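(* Let $p>2$ be a prime and $m\ge1$. If $G$ is a finite group with $\mathcal{C}^{(p)}_m\le G\le GL(p^m,\mathbb{C})$, then there exists a root of unity $\zeta$ such that $G=\langle\mathcal{C}^{(p)}_m,\zeta I_{p^m}\rangle$.
   Context: Let $(v_x)_{x\in\mathbb{Z}/p\mathbb{Z}}$ be a basis of $\mathbb{C}^p$ and let $E_p(1)\le U(p,\mathbb{C})$ be the group generated by $X:v_x\mapsto v_{x+1}$ and $Z:v_x\mapsto e^{2\pi ix/p}v_x$. Let $E_p(m)\le U(p^m,\mathbb{C})$ be the $m$-th tensor power of $E_p(1)$, i.e. the group of all $A_1\otimes\cdots\otimes A_m$ with $A_i\in E_p(1)$ (an extraspecial group $p^{1+2m}_+$). Let $a=\gcd(p+1,4)$ and $\zeta_{ap}=e^{2\pi i/(ap)}$. The Clifford group $\mathcal{C}^{(p)}_m$ is the normalizer of $E_p(m)$ in $U(p^m,\mathbb{Q}[\zeta_{ap}])$, the group of unitary $p^m\times p^m$ matrices with entries in $\mathbb{Q}(\zeta_{ap})$.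
   Formalization: The Clifford group is taken to be the elements of finite order in the stated normalizer: the literal normalizer contains all scalars of absolute value 1 in the field, so it is infinite and no finite G could contain it. *)

theory Defs
  imports
    "HOL-Algebra.Group_Action"
    "HOL-Algebra.Generated_Groups"
    "HOL-Computational_Algebra.Primes"
    "Jordan_Normal_Form.Schur_Decomposition"
begin

abbreviation GL :: "nat \<Rightarrow> complex mat monoid" where
  "GL n \<equiv> units_of (ring_mat TYPE(complex) n ())"

text \<open>Index \<open>(i, j)\<close> of the left factor and \<open>(k, l)\<close> of the right factor give the index
  \<open>(i * dim_row B + k, j * dim_col B + l)\<close> of the tensor product.\<close>

definition kronecker :: "complex mat \<Rightarrow> complex mat \<Rightarrow> complex mat" where
  "kronecker A B = mat (dim_row A * dim_row B) (dim_col A * dim_col B)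
     (\<lambda>(i, j). A $$ (i div dim_row B, j div dim_col B) * B $$ (i mod dim_row B, j mod dim_col B))"

text \<open>Matrices act on column vectors, so column \<open>x\<close> holds the image of the basis vector
  \<open>v\<^sub>x\<close>, with \<open>x\<close> represented in \<open>{0..<p}\<close>.\<close>

definition X_mat :: "nat \<Rightarrow> complex mat" where
  "X_mat p = mat p p (\<lambda>(i, x). if i = (x + 1) mod p then 1 else 0)"

definition Z_mat :: "nat \<Rightarrow> complex mat" where
  "Z_mat p = mat p p (\<lambda>(i, x). if i = x then cis (2 * pi * real x / real p) else 0)"

definition E1_group :: "nat \<Rightarrow> complex mat set" where
  "E1_group p = generate (GL p) {X_mat p, Z_mat p}"

definition E_group :: "nat \<Rightarrow> nat \<Rightarrow> complex mat set" where
  "E_group p m = {foldr kronecker As (1\<^sub>m 1) |As. length As = m \<and> set As \<subseteq> E1_group p}"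

text \<open>\<open>\<rat>[\<zeta>]\<close> for \<open>\<zeta> = exp (2 \<pi> \<i> / n)\<close>, as the image of \<open>\<rat>[x]\<close>; it is a field because \<open>\<zeta>\<close> is algebraic.\<close>

definition cyclotomic_field :: "nat \<Rightarrow> complex set" where
  "cyclotomic_field n = range (\<lambda>q :: rat poly. poly (map_poly of_rat q) (cis (2 * pi / real n)))"

definition unitary_group :: "nat \<Rightarrow> complex set \<Rightarrow> complex mat set" where
  "unitary_group n K = {A \<in> carrier_mat n n. elements_mat A \<subseteq> K \<and> A * mat_adjoint A = 1\<^sub>m n}"

text \<open>The normalizer of \<open>E\<^sub>p(m)\<close> in \<open>U(p\<^sup>m, \<rat>[\<zeta>\<^bsub>ap\<^esub>])\<close>, \<open>a = gcd (p + 1) 4\<close>,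
  with all its scalar matrices; see \<open>clifford_group\<close> below for the Clifford group itself.\<close>

definition clifford_normalizer :: "nat \<Rightarrow> nat \<Rightarrow> complex mat set" where
  "clifford_normalizer p m =
     unitary_group (p ^ m) (cyclotomic_field (gcd (p + 1) 4 * p)) \<inter>
     normalizer (GL (p ^ m)) (E_group p m)"

lemma kronecker_carrier:
  assumes "A \<in> carrier_mat n n" "B \<in> carrier_mat k k"
  shows "kronecker A B \<in> carrier_mat (n * k) (n * k)"
  using assms by (auto simp: kronecker_def)

lemma kronecker_mult:
  assumes A: "A \<in> carrier_mat n n" and B: "B \<in> carrier_mat k k"
    and C: "C \<in> carrier_mat n n" and D: "D \<in> carrier_mat k k"
  shows "kronecker A B * kronecker C D = kronecker (A * C) (B * D)"
proof (rule eq_matI)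
  show "dim_row (kronecker A B * kronecker C D) = dim_row (kronecker (A * C) (B * D))"
    and "dim_col (kronecker A B * kronecker C D) = dim_col (kronecker (A * C) (B * D))"
    using assms by (auto simp: kronecker_def)
  fix i j assume "i < dim_row (kronecker (A * C) (B * D))" "j < dim_col (kronecker (A * C) (B * D))"
  then have i: "i < n * k" and j: "j < n * k"
    using assms by (auto simp: kronecker_def)
  then have k: "k > 0" by (cases k) auto
  have ib: "i div k < n" "i mod k < k" "j div k < n" "j mod k < k"
    using i j k by (auto simp: less_mult_imp_div_less)
  have "(kronecker A B * kronecker C D) $$ (i, j) =
      (\<Sum>t<n * k. A $$ (i div k, t div k) * B $$ (i mod k, t mod k) *
        (C $$ (t div k, j div k) * D $$ (t mod k, j mod k)))"
    using assms i j by (simp add: kronecker_def scalar_prod_def lessThan_atLeast0)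
  also have "\<dots> = (\<Sum>(s, r)\<in>{..<n} \<times> {..<k}. A $$ (i div k, s) * B $$ (i mod k, r) *
        (C $$ (s, j div k) * D $$ (r, j mod k)))"
  proof (rule sum.reindex_bij_witness[where i = "\<lambda>(s, r). s * k + r" and j = "\<lambda>t. (t div k, t mod k)"])
    fix x :: "nat \<times> nat" assume "x \<in> {..<n} \<times> {..<k}"
    then obtain s r where x: "x = (s, r)" "s < n" "r < k" by auto
    have "s * k + r < (s + 1) * k" using x by simp
    also have "\<dots> \<le> n * k" using x by (intro mult_right_mono) auto
    finally show "(case x of (s, r) \<Rightarrow> s * k + r) \<in> {..<n * k}" using x by simp
  qed (use k in \<open>auto simp: less_mult_imp_div_less\<close>)
  also have "\<dots> = (\<Sum>s<n. A $$ (i div k, s) * C $$ (s, j div k)) *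
      (\<Sum>r<k. B $$ (i mod k, r) * D $$ (r, j mod k))"
    by (simp add: sum_product sum.cartesian_product mult_ac)
  also have "\<dots> = kronecker (A * C) (B * D) $$ (i, j)"
    using assms i j ib by (simp add: kronecker_def scalar_prod_def lessThan_atLeast0)
  finally show "(kronecker A B * kronecker C D) $$ (i, j) = kronecker (A * C) (B * D) $$ (i, j)" .
qed

lemma kronecker_one: "kronecker (1\<^sub>m n) (1\<^sub>m k) = 1\<^sub>m (n * k)"
proof (rule eq_matI)
  fix i j assume "i < dim_row (1\<^sub>m (n * k) :: complex mat)" "j < dim_col (1\<^sub>m (n * k) :: complex mat)"
  then have i: "i < n * k" and j: "j < n * k" by auto
  then have k: "k > 0" by (cases k) auto
  have ib: "i div k < n" "i mod k < k" "j div k < n" "j mod k < k"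
    using i j k by (auto simp: less_mult_imp_div_less)
  have "i = j \<longleftrightarrow> i div k = j div k \<and> i mod k = j mod k"
    by (metis div_mult_mod_eq)
  then show "kronecker (1\<^sub>m n) (1\<^sub>m k) $$ (i, j) = 1\<^sub>m (n * k) $$ (i, j)"
    using i j ib by (auto simp: kronecker_def)
qed (auto simp: kronecker_def)

lemma GL_iff: "A \<in> carrier (GL n) \<longleftrightarrow>
    A \<in> carrier_mat n n \<and> (\<exists>B \<in> carrier_mat n n. A * B = 1\<^sub>m n \<and> B * A = 1\<^sub>m n)"
  by (auto simp: units_of_def Units_def ring_mat_def)

lemma GL_simps: "Group.monoid.mult (GL n) = (*)" "one (GL n) = 1\<^sub>m n"
  by (auto simp: units_of_def ring_mat_def)

lemma group_GL: "group (GL n)"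
proof -
  interpret ring "ring_mat TYPE(complex) n ()" by (rule ring_mat)
  show ?thesis by (rule units_group)
qed

lemma kronecker_GL:
  assumes "A \<in> carrier (GL n)" "B \<in> carrier (GL k)"
  shows "kronecker A B \<in> carrier (GL (n * k))"
proof -
  obtain C D where "C \<in> carrier_mat n n" "A * C = 1\<^sub>m n" "C * A = 1\<^sub>m n"
      "D \<in> carrier_mat k k" "B * D = 1\<^sub>m k" "D * B = 1\<^sub>m k"
    using assms by (auto simp: GL_iff)
  then show ?thesis using assms
    by (auto simp: GL_iff kronecker_carrier kronecker_mult kronecker_one
        intro!: bexI[of _ "kronecker C D"])
qed

lemma X_mat_GL: assumes "p > 0" shows "X_mat p \<in> carrier (GL p)"
proof -
  define Y :: "complex mat" where "Y = mat p p (\<lambda>(i, x). if x = (i + 1) mod p then 1 else 0)"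
  have inj: "i = j" if "Suc i mod p = Suc j mod p" "i < p" "j < p" for i j
  proof -
    show "i = j" using that by (auto simp: mod_Suc split: if_splits)
  qed
  have YX: "Y * X_mat p = 1\<^sub>m p"
  proof (rule eq_matI)
    fix i j assume "i < dim_row (1\<^sub>m p :: complex mat)" "j < dim_col (1\<^sub>m p :: complex mat)"
    then have ij: "i < p" "j < p" by auto
    have "(Y * X_mat p) $$ (i, j) = (\<Sum>t<p. (if t = Suc i mod p then 1 else 0) * (if t = Suc j mod p then 1 else 0))"
      using ij by (simp add: Y_def X_mat_def scalar_prod_def lessThan_atLeast0)
    also have "\<dots> = (\<Sum>t<p. if t = Suc i mod p then (if Suc i mod p = Suc j mod p then 1 else 0) else 0)"
      by (intro sum.cong) auto
    also have "\<dots> = 1\<^sub>m p $$ (i, j)" using ij assms by (auto dest: inj)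
    finally show "(Y * X_mat p) $$ (i, j) = 1\<^sub>m p $$ (i, j)" .
  qed (auto simp: Y_def X_mat_def)
  have "Y \<in> carrier_mat p p" "X_mat p \<in> carrier_mat p p" by (auto simp: Y_def X_mat_def)
  then show ?thesis using YX mat_mult_left_right_inverse[OF _ _ YX] unfolding GL_iff by blast
qed

lemma Z_mat_GL: "Z_mat p \<in> carrier (GL p)"
proof -
  define Y where "Y = mat p p (\<lambda>(i, x). if i = x then cis (- (2 * pi * real x / real p)) else 0)"
  have YZ: "Y * Z_mat p = 1\<^sub>m p"
  proof (rule eq_matI)
    fix i j assume "i < dim_row (1\<^sub>m p :: complex mat)" "j < dim_col (1\<^sub>m p :: complex mat)"
    then have ij: "i < p" "j < p" by auto
    have "(Y * Z_mat p) $$ (i, j) =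
        (\<Sum>t<p. (if i = t then cis (- (2 * pi * real t / real p)) else 0) *
          (if t = j then cis (2 * pi * real j / real p) else 0))"
      using ij by (simp add: Y_def Z_mat_def scalar_prod_def lessThan_atLeast0)
    also have "\<dots> = (\<Sum>t<p. if t = i then (if i = j then 1 else 0) else 0)"
      by (intro sum.cong) (auto simp: cis_mult)
    also have "\<dots> = 1\<^sub>m p $$ (i, j)" using ij by auto
    finally show "(Y * Z_mat p) $$ (i, j) = 1\<^sub>m p $$ (i, j)" .
  qed (auto simp: Y_def Z_mat_def)
  have "Y \<in> carrier_mat p p" "Z_mat p \<in> carrier_mat p p" by (auto simp: Y_def Z_mat_def)
  then show ?thesis using YZ mat_mult_left_right_inverse[OF _ _ YZ] unfolding GL_iff by blast
qed

lemma E_group_GL: assumes "p > 0" shows "E_group p m \<subseteq> carrier (GL (p ^ m))"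
proof -
  interpret group "GL p" by (rule group_GL)
  have E1: "E1_group p \<subseteq> carrier (GL p)"
    unfolding E1_group_def by (rule generate_incl) (use assms X_mat_GL Z_mat_GL in auto)
  have "foldr kronecker As (1\<^sub>m 1) \<in> carrier (GL (p ^ length As))" if "set As \<subseteq> E1_group p" for As
    using that
  proof (induction As)
    case Nil
    then show ?case by (auto simp: GL_iff)
  next
    case (Cons A As)
    then show ?case using E1 kronecker_GL[of A p "foldr kronecker As (1\<^sub>m 1)" "p ^ length As"] by auto
  qed
  then show ?thesis by (auto simp: E_group_def)
qed

lemma scalar_mem_clifford_normalizer:
  assumes "p > 0" and z: "z * cnj z = 1" "z \<in> cyclotomic_field (gcd (p + 1) 4 * p)"
  shows "z \<cdot>\<^sub>m 1\<^sub>m (p ^ m) \<in> clifford_normalizer p m"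
proof -
  let ?n = "p ^ m" and ?E = "E_group p m" and ?z = "z \<cdot>\<^sub>m 1\<^sub>m (p ^ m)"
  interpret group "GL ?n" by (rule group_GL)
  have E: "?E \<subseteq> carrier (GL ?n)" by (rule E_group_GL[OF assms(1)])
  have adj: "mat_adjoint ?z = cnj z \<cdot>\<^sub>m 1\<^sub>m ?n"
    by (rule eq_matI) (auto simp: mat_adjoint_def mat_of_rows_def)
  have zz: "?z * (cnj z \<cdot>\<^sub>m 1\<^sub>m ?n) = 1\<^sub>m ?n"
  proof -
    have "?z * (cnj z \<cdot>\<^sub>m 1\<^sub>m ?n) = cnj z \<cdot>\<^sub>m ?z"
      by (simp add: mult_smult_distrib[where nr = ?n and n = ?n and nc = ?n])
    also have "\<dots> = 1\<^sub>m ?n"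
      using z by (intro eq_matI) (auto simp: mult.commute)
    finally show ?thesis .
  qed
  have zGL: "?z \<in> carrier (GL ?n)"
    unfolding GL_iff
  proof (intro conjI bexI[of _ "cnj z \<cdot>\<^sub>m 1\<^sub>m ?n"])
    show "cnj z \<cdot>\<^sub>m 1\<^sub>m ?n * ?z = 1\<^sub>m ?n"
      by (rule mat_mult_left_right_inverse[OF _ _ zz]) auto
  qed (use zz in auto)
  have conj: "?z \<otimes>\<^bsub>GL ?n\<^esub> h \<otimes>\<^bsub>GL ?n\<^esub> inv\<^bsub>GL ?n\<^esub> ?z = h" if "h \<in> ?E" for h
  proof -
    have h: "h \<in> carrier (GL ?n)" using that E by auto
    then have hm: "h \<in> carrier_mat ?n ?n" by (simp add: GL_iff)
    have "?z * h = h * ?z" using hm by (simp add: mult_smult_assoc_mat[where nr = ?n and n = ?n and nc = ?n]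
          mult_smult_distrib[where nr = ?n and n = ?n and nc = ?n])
    then have "?z \<otimes>\<^bsub>GL ?n\<^esub> h = h \<otimes>\<^bsub>GL ?n\<^esub> ?z" by (simp add: GL_simps)
    then show ?thesis using h zGL by (metis inv_solve_right m_closed)
  qed
  have "?z <#\<^bsub>GL ?n\<^esub> ?E #>\<^bsub>GL ?n\<^esub> inv\<^bsub>GL ?n\<^esub> ?z = ?E"
  proof -
    have "?z <#\<^bsub>GL ?n\<^esub> ?E #>\<^bsub>GL ?n\<^esub> inv\<^bsub>GL ?n\<^esub> ?z =
        (\<lambda>h. ?z \<otimes>\<^bsub>GL ?n\<^esub> h \<otimes>\<^bsub>GL ?n\<^esub> inv\<^bsub>GL ?n\<^esub> ?z) ` ?E"
      unfolding l_coset_def r_coset_def by blast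
    also have "\<dots> = ?E" using conj by (simp cong: image_cong)
    finally show ?thesis .
  qed
  then have "?z \<in> normalizer (GL ?n) ?E"
    using E zGL by (simp add: normalizer_def stabilizer_def)
  moreover have "elements_mat ?z \<subseteq> cyclotomic_field (gcd (p + 1) 4 * p)"
  proof -
    have "0 \<in> cyclotomic_field (gcd (p + 1) 4 * p)"
      unfolding cyclotomic_field_def by (rule image_eqI[of _ _ 0]) auto
    then show ?thesis using z by (auto simp: elements_mat_def)
  qed
  ultimately show ?thesis
    using zz adj by (simp add: clifford_normalizer_def unitary_group_def)
qed

lemma cyclotomic_field_closed:
  shows "u \<in> cyclotomic_field n \<Longrightarrow> v \<in> cyclotomic_field n \<Longrightarrow> u + v \<in> cyclotomic_field n"
    and "u \<in> cyclotomic_field n \<Longrightarrow> v \<in> cyclotomic_field n \<Longrightarrow> u * v \<in> cyclotomic_field n"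
    and "of_rat r \<in> cyclotomic_field n"
    and "cis (2 * pi / real n) \<in> cyclotomic_field n"
proof -
  let ?ev = "\<lambda>q :: rat poly. poly (map_poly of_rat q) (cis (2 * pi / real n))"
  show "u + v \<in> cyclotomic_field n" if uv: "u \<in> cyclotomic_field n" "v \<in> cyclotomic_field n"
  proof -
    obtain f g where "u = ?ev f" "v = ?ev g" using uv by (auto simp: cyclotomic_field_def)
    then have "u + v = ?ev (f + g)" by (simp add: of_rat_hom.map_poly_hom_add)
    then show ?thesis unfolding cyclotomic_field_def by (rule range_eqI)
  qed
  show "u * v \<in> cyclotomic_field n" if uv: "u \<in> cyclotomic_field n" "v \<in> cyclotomic_field n"
  proof -
    obtain f g where fg: "u = ?ev f" "v = ?ev g" using uv by (auto simp: cyclotomic_field_def)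
    interpret map_poly_comm_ring_hom "of_rat :: rat \<Rightarrow> complex" ..
    have "u * v = ?ev (f * g)" by (simp add: fg hom_mult)
    then show ?thesis unfolding cyclotomic_field_def by (rule range_eqI)
  qed
  have "of_rat r = ?ev [:r:]" by (simp add: of_rat_hom.map_poly_pCons_hom)
  then show "of_rat r \<in> cyclotomic_field n" unfolding cyclotomic_field_def by (rule range_eqI)
  have "cis (2 * pi / real n) = ?ev [:0, 1:]" by (simp add: of_rat_hom.map_poly_pCons_hom)
  then show "cis (2 * pi / real n) \<in> cyclotomic_field n" unfolding cyclotomic_field_def by (rule range_eqI)
qed

lemma infinite_clifford_normalizer:
  assumes "prime p" "p > 2"
  shows "infinite (clifford_normalizer p m)"
proof
  assume fin: "finite (clifford_normalizer p m)"
  define a where "a = gcd (p + 1) 4"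
  define w where "w = cis (2 * pi / real p)"
  let ?K = "cyclotomic_field (a * p)"
  have a: "a > 0" by (simp add: a_def)
  have odd: "odd p" using assms prime_odd_nat by auto
  note cl = cyclotomic_field_closed[where n = "a * p"]
  have pow: "u ^ k \<in> ?K" if "u \<in> ?K" for u k
  proof (induction k)
    case 0
    show ?case using cl(3)[of 1] by simp
  next
    case (Suc k)
    then show ?case using cl(2) that by simp
  qed
  have su: "(\<Sum>i<(k::nat). f i) \<in> ?K" if "\<And>i. f i \<in> ?K" for f k
  proof (induction k)
    case 0
    show ?case using cl(3)[of 0] by simp
  next
    case (Suc k)
    then show ?case using cl(1) that by simp
  qed
  have nat: "of_nat k \<in> ?K" for k using cl(3)[of "of_nat k"] by simp
  have "w = cis (2 * pi / real (a * p)) ^ a"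
    using a by (simp add: w_def DeMoivre)
  then have w: "w \<in> ?K" using pow[OF cl(4)] by simp
  have wp: "w ^ p = 1" using assms by (simp add: w_def DeMoivre)
  have ww: "w * cnj w = 1" by (simp add: w_def cis_cnj cis_mult)
  have cw: "cnj w = w ^ (p - 1)"
  proof -
    have "w * w ^ (p - 1) = w * cnj w" using wp ww assms by (cases p) auto
    moreover have "w \<noteq> 0" by (simp add: w_def)
    ultimately show ?thesis by simp
  qed
  have cwK: "cnj w \<in> ?K" unfolding cw by (rule pow[OF w])
  have im: "Im w > 0"
    unfolding w_def cis.sel by (rule sin_gt_zero) (use assms in \<open>auto simp: field_simps\<close>)
  define d where "d k = complex_of_real (real k) + w" for k :: nat
  have d0: "d k \<noteq> 0" for k
  proof
    assume "d k = 0"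
    then have "Im (d k) = 0" by simp
    then show False using im by (simp add: d_def)
  qed
  have invK: "inverse (cnj (d k)) \<in> ?K" for k
  proof -
    let ?x = "cnj w" and ?k = "of_nat k :: complex"
    let ?S = "\<Sum>i<p. (- ?x) ^ (p - Suc i) * ?k ^ i"
    have xp: "?x ^ p = 1" using wp by (metis complex_cnj_one complex_cnj_power)
    have "?k ^ p + 1 = ?k ^ p - (- ?x) ^ p" using odd xp by simp
    also have "\<dots> = (?k - (- ?x)) * ?S" by (rule power_diff_sumr2)
    also have "\<dots> = cnj (d k) * ?S" by (simp add: d_def)
    finally have eq: "?k ^ p + 1 = cnj (d k) * ?S" .
    have nz: "?k ^ p + 1 \<noteq> 0"
      by (metis of_nat_Suc of_nat_power add.commute of_nat_neq_0)
    have "inverse (cnj (d k)) = of_rat (1 / (of_nat k ^ p + 1)) * ?S"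
      using eq nz d0[of k] by (simp add: of_rat_divide of_rat_add of_rat_power field_simps)
    moreover have "- ?x \<in> ?K" using cl(2)[OF cl(3)[of "-1"] cwK] by (simp add: of_rat_minus)
    then have "?S \<in> ?K" by (intro su cl(2) pow nat)
    ultimately show ?thesis using cl(2)[OF cl(3)] by metis
  qed
  define z where "z k = d k * inverse (cnj (d k))" for k
  have zK: "z k \<in> ?K" for k
    unfolding z_def by (rule cl(2)[OF _ invK]) (use cl(1)[OF nat w] in \<open>simp add: d_def\<close>)
  have zz: "z k * cnj (z k) = 1" for k using d0[of k] by (simp add: z_def field_simps)
  have mem: "z k \<cdot>\<^sub>m 1\<^sub>m (p ^ m) \<in> clifford_normalizer p m" for k
    using scalar_mem_clifford_normalizer zz zK assms by (simp add: a_def)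
  have "inj (\<lambda>k. z k \<cdot>\<^sub>m 1\<^sub>m (p ^ m))"
  proof (rule injI)
    fix k l assume "z k \<cdot>\<^sub>m 1\<^sub>m (p ^ m) = z l \<cdot>\<^sub>m 1\<^sub>m (p ^ m)"
    then have "(z k \<cdot>\<^sub>m 1\<^sub>m (p ^ m)) $$ (0, 0) = (z l \<cdot>\<^sub>m 1\<^sub>m (p ^ m)) $$ (0, 0)" by simp
    then have "z k = z l" using assms by simp
    then have "d k * cnj (d l) = d l * cnj (d k)"
      using d0[of k] d0[of l] by (simp add: z_def field_simps)
    then have "(of_nat k - of_nat l) * (w - cnj w) = 0"
      by (simp add: d_def algebra_simps)
    moreover have "w - cnj w \<noteq> 0" using im by (auto simp: complex_eq_iff)
    ultimately show "k = l" by simp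
  qed
  then have "infinite (range (\<lambda>k. z k \<cdot>\<^sub>m 1\<^sub>m (p ^ m)))" by (rule range_inj_infinite)
  then show False using fin mem by (meson finite_subset image_subsetI)
qed

text \<open>The full normalizer of \<open>E\<^sub>p(m)\<close> in \<open>U(p\<^sup>m, \<rat>[\<zeta>\<^bsub>ap\<^esub>])\<close> is infinite
  (\<open>infinite_clifford_normalizer\<close>): it contains \<open>z I\<close> for every \<open>z\<close> of absolute value 1 in the field,
  not only for roots of unity, so no finite group contains it. The Clifford group is customarily
  described as that normalizer, but the group meant is the finite group \<open>Z\<^sub>a \<times> p\<^bsup>1+2m\<^esup>.Sp(2m, p)\<close>, whose scalars are the roots of unity in the field.
  It consists of the elements of finite order of the normalizer: modulo scalars the two groups agree,
  and a scalar multiple \<open>z g\<close> of an element \<open>g\<close> of finite order has finite order iff \<open>z\<close> is a root of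
  unity.\<close>

definition clifford_group :: "nat \<Rightarrow> nat \<Rightarrow> complex mat set" where
  "clifford_group p m = {A \<in> clifford_normalizer p m. \<exists>k>0. A ^\<^sub>m k = 1\<^sub>m (p ^ m)}"

end

theory Submission
  imports Defs "HOL-Number_Theory.Number_Theory"
begin

text \<open>Let \<open>G\<close> be finite and contain the Clifford group. Conjugating an element \<open>e\<close> of the extraspecial
  group \<open>E\<close> by the chirps of \<open>E\<close> shows that traces against \<open>(e - 1)\<^sup>2\<close> vanish modulo the primes above \<open>p\<close>
  in a cyclotomic ring containing the character values of \<open>G\<close>. On the group generated by the conjugates of
  the parity involution, a lift of the Frobenius acts on character values as complex conjugation; feeding
  in rank one idempotents built from Clifford elements improves this to the vanishing of the traces
  against \<open>e - 1\<close> itself. Hence the conjugates of \<open>E\<close> under \<open>G\<close> generate a group whose iterated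
  commutators become trivial, and chirp conjugation forces these conjugates into scalar multiples of
  \<open>E\<close>. So \<open>G\<close> normalizes \<open>E\<close> up to scalars. A matrix normalizing \<open>E\<close> is a scalar times a Clifford element, since the only
  irrationality in its normalization is a Gauss sum, and the scalars in \<open>G\<close> form a finite cyclic group.\<close>

section \<open>Cyclotomic integers\<close>

text \<open>The obstacle is the square. A chirp is a quadratic phase in the exponent
  \<open>i\<close> of an eigenvalue of \<open>e\<close>; over the integers localised at
  \<open>p\<close>, such phases span \<open>(zeta p ^ i - 1) ^ 2 / (1 - zeta p)\<close> but not the
  quotient with a single factor, since all of them are 1 modulo \<open>1 - zeta p\<close>. To reach
  \<open>e - 1\<close>, let \<open>z\<close> be the trace of a rank one idempotent \<epsilon>
  against \<open>(e - 1) * x\<close>. The Frobenius lift makes \<open>z ^ p\<close> congruent to a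
  combination of conjugated traces, where each group element is replaced by its inverse. So
  inversion must turn the combination of group elements giving \<epsilon> into a conjugate of
  \<epsilon>; dilations qualify, as the Fourier matrix inverts them. By rank one, the product of
  both traces is one trace with two factors of type \<open>e - 1\<close>, known to vanish. Hence
  \<open>z ^ (p + 1)\<close> vanishes, and so does \<open>z\<close>, the residue ring being reduced.
  The parity involution supplies the action of the Frobenius lift: traces of its conjugates against
  \<open>E\<close> are roots of unity of \<open>p\<close>-power order, by Parseval, the inequality
  of the means and Kronecker's theorem on integers with bounded conjugates.\<close>

definition zeta :: "nat \<Rightarrow> complex" where "zeta N = cis (2 * pi / real N)"

abbreviation ipol :: "int poly \<Rightarrow> complex \<Rightarrow> complex" where
  "ipol q z \<equiv> poly (map_poly of_int q) z"

definition zint :: "nat \<Rightarrow> complex set" where "zint N = range (\<lambda>q. ipol q (zeta N))"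

text \<open>Congruences modulo \<open>u\<close> are expressed as membership of a difference in this
  principal ideal.\<close>

definition zideal :: "nat \<Rightarrow> complex \<Rightarrow> complex set" where "zideal N u = (\<lambda>z. u * z) ` zint N"

lemma ipol_simps:
  "ipol (p + q) z = ipol p z + ipol q z" "ipol (p * q) z = ipol p z * ipol q z"
  "ipol (- q) z = - ipol q z" "ipol (pCons a q) z = of_int a + z * ipol q z"
  "ipol 0 z = 0" "ipol 1 z = 1"
proof -
  have add: "ipol (p + q) z = ipol p z + ipol q z" for p q by (simp add: of_int_hom.map_poly_hom_add)
  show "ipol (- q) z = - ipol q z" using add[of q "- q"] by (simp add: add_eq_0_iff)
  show "ipol (p * q) z = ipol p z * ipol q z" by (simp add: of_int_poly_hom.hom_mult)
  show "ipol (p + q) z = ipol p z + ipol q z" by (rule add)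
  show "ipol (pCons a q) z = of_int a + z * ipol q z"
    "ipol 0 z = 0" "ipol 1 z = 1"
    by (simp_all add: of_int_hom.map_poly_pCons_hom)
qed

lemma sum_powers_root_of_unity:
  assumes "z ^ n = 1" "z \<noteq> (1::complex)"
  shows "(\<Sum>k<n. z ^ k) = 0"
  using assms by (simp add: geometric_sum)

lemma bij_betw_add_mod:
  assumes "N > 0"
  shows "bij_betw (\<lambda>i. (i + a) mod N) {..<N} {..<N::nat}"
proof -
  have "inj_on (\<lambda>i. (i + a) mod N) {..<N}"
  proof (rule inj_onI)
    fix i j assume ij: "i \<in> {..<N}" "j \<in> {..<N}" "(i + a) mod N = (j + a) mod N"
    then have "[i + a = j + a] (mod N)" by (simp add: cong_def)
    then have "[i = j] (mod N)" by (simp add: cong_add_rcancel_nat)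
    then show "i = j" using ij by (simp add: cong_less_modulus_unique_nat)
  qed
  moreover have "(\<lambda>i. (i + a) mod N) ` {..<N} \<subseteq> {..<N}" using assms by auto
  ultimately show ?thesis
    by (metis bij_betw_def card_image card_subset_eq finite_lessThan)
qed

locale cyclotomic_integers =
  fixes N :: nat
  assumes N_pos: "N > 0"
begin

abbreviation \<zeta> where "\<zeta> \<equiv> zeta N"
abbreviation \<O> where "\<O> \<equiv> zint N"

lemma zeta_N: "\<zeta> ^ N = 1"
  using N_pos by (simp add: zeta_def DeMoivre)

lemma zeta_nz: "\<zeta> \<noteq> 0" by (simp add: zeta_def)

lemma zeta_power_mod: "\<zeta> ^ (k mod N) = \<zeta> ^ k"
proof -
  have "\<zeta> ^ k = \<zeta> ^ (N * (k div N) + k mod N)" by simp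
  also have "\<dots> = \<zeta> ^ (k mod N)" by (simp only: power_add power_mult zeta_N) simp
  finally show ?thesis by simp
qed

lemma zeta_power_cong: "[j = k] (mod N) \<Longrightarrow> \<zeta> ^ j = \<zeta> ^ k"
  by (metis cong_def zeta_power_mod)

lemma root_of_unity_eq: assumes "z ^ N = 1" obtains k where "k < N" "z = \<zeta> ^ k"
proof -
  have "z \<in> (\<lambda>k. cis (2 * pi * real k / real N)) ` {..<N}"
    using bij_betw_roots_unity[OF N_pos] assms unfolding bij_betw_def by auto
  then obtain k where "k < N" "z = cis (2 * pi * real k / real N)" by auto
  then show ?thesis using that[of k] by (simp add: zeta_def DeMoivre field_simps)
qed

lemma zeta_power_eq_1_iff: "\<zeta> ^ k = 1 \<longleftrightarrow> N dvd k"
proof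
  assume h: "\<zeta> ^ k = 1"
  have inj: "inj_on (\<lambda>k. cis (2 * pi * real k / real N)) {..<N}"
    using bij_betw_roots_unity[OF N_pos] unfolding bij_betw_def by auto
  have "\<zeta> ^ (k mod N) = \<zeta> ^ 0" using h zeta_power_mod by simp
  then have "cis (2 * pi * real (k mod N) / real N) = cis (2 * pi * real 0 / real N)"
    by (simp add: zeta_def DeMoivre field_simps)
  then have "k mod N = 0" by (rule inj_onD[OF inj]) (use N_pos in auto)
  then show "N dvd k" by auto
next
  assume "N dvd k"
  then show "\<zeta> ^ k = 1" by (metis dvd_def power_mult zeta_N power_one)
qed

lemma cnj_zeta: "cnj \<zeta> = \<zeta> ^ (N - 1)"
proof -
  have "\<zeta> * cnj \<zeta> = 1" by (simp add: zeta_def cis_cnj cis_mult)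
  also have "1 = \<zeta> * \<zeta> ^ (N - 1)" using zeta_N N_pos by (cases N) auto
  finally show ?thesis using zeta_nz by simp
qed

lemma zint_ipol: "ipol q \<zeta> \<in> \<O>" by (simp add: zint_def)

lemma zint_intros [intro, simp]:
  "0 \<in> \<O>" "1 \<in> \<O>" "of_int a \<in> \<O>" "of_nat n \<in> \<O>" "numeral w \<in> \<O>" "\<zeta> \<in> \<O>"
proof -
  have i: "of_int a \<in> \<O>" for a using zint_ipol[of "[:a:]"] by (simp add: ipol_simps)
  show "0 \<in> \<O>" "1 \<in> \<O>" "of_int a \<in> \<O>" "of_nat n \<in> \<O>" "numeral w \<in> \<O>"
    using i[of 0] i[of 1] i[of a] i[of "int n"] i[of "numeral w"] by simp_all
  show "\<zeta> \<in> \<O>" using zint_ipol[of "[:0, 1:]"] by (simp add: ipol_simps)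
qed

lemma zint_closed [intro]:
  "x \<in> \<O> \<Longrightarrow> y \<in> \<O> \<Longrightarrow> x + y \<in> \<O>"
  "x \<in> \<O> \<Longrightarrow> y \<in> \<O> \<Longrightarrow> x * y \<in> \<O>"
  "x \<in> \<O> \<Longrightarrow> - x \<in> \<O>"
  "x \<in> \<O> \<Longrightarrow> y \<in> \<O> \<Longrightarrow> x - y \<in> \<O>"
proof -
  have *: "x + y \<in> \<O>" "x * y \<in> \<O>" "- x \<in> \<O>" if "x \<in> \<O>" "y \<in> \<O>" for x y
    using that unfolding zint_def by (auto simp flip: ipol_simps)
  show "x \<in> \<O> \<Longrightarrow> y \<in> \<O> \<Longrightarrow> x + y \<in> \<O>"
    "x \<in> \<O> \<Longrightarrow> y \<in> \<O> \<Longrightarrow> x * y \<in> \<O>" "x \<in> \<O> \<Longrightarrow> - x \<in> \<O>"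
    using * by auto
  show "x \<in> \<O> \<Longrightarrow> y \<in> \<O> \<Longrightarrow> x - y \<in> \<O>"
    using *[of x "- y"] *[of y y] by simp
qed

lemma zint_power [intro]: "x \<in> \<O> \<Longrightarrow> x ^ k \<in> \<O>"
  by (induction k) auto

lemma zint_sum [intro]: "(\<And>i. i \<in> A \<Longrightarrow> f i \<in> \<O>) \<Longrightarrow> sum f A \<in> \<O>"
  by (induction A rule: infinite_finite_induct) auto

lemma zint_prod [intro]: "(\<And>i. i \<in> A \<Longrightarrow> f i \<in> \<O>) \<Longrightarrow> prod f A \<in> \<O>"
  by (induction A rule: infinite_finite_induct) auto

lemma zint_root_of_unity: "z ^ N = 1 \<Longrightarrow> z \<in> \<O>"
  by (metis root_of_unity_eq zint_power zint_intros(6))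

lemma zint_poly: "z \<in> \<O> \<Longrightarrow> ipol q z \<in> \<O>"
  by (induction q) (auto simp: ipol_simps)

lemma zint_cnj [intro]: "z \<in> \<O> \<Longrightarrow> cnj z \<in> \<O>"
proof -
  assume "z \<in> \<O>"
  then obtain q where q: "z = ipol q \<zeta>" by (auto simp: zint_def)
  have "cnj (ipol q x) = ipol q (cnj x)" for x
    by (induction q) (auto simp: ipol_simps)
  then show ?thesis using q by (auto simp: cnj_zeta intro: zint_poly)
qed

text \<open>Multiplying by \<open>\<zeta>\<close> shifts a coefficient vector cyclically, as
  \<open>\<zeta> ^ N = 1\<close>. Exponents are reduced modulo \<open>N\<close> only, not modulo the
  cyclotomic polynomial, so the coefficients are in general not unique.\<close>

lemma zint_coeffs: assumes "z \<in> \<O>" obtains c :: "nat \<Rightarrow> int" where "z = (\<Sum>i<N. of_int (c i) * \<zeta> ^ i)"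
proof -
  obtain q where q: "z = ipol q \<zeta>" using assms by (auto simp: zint_def)
  have "\<exists>c :: nat \<Rightarrow> int. ipol q \<zeta> = (\<Sum>i<N. of_int (c i) * \<zeta> ^ i)"
  proof (induction q)
    case 0
    show ?case by (rule exI[of _ "\<lambda>_. 0"]) (simp add: ipol_simps)
  next
    case (pCons a q)
    then obtain c :: "nat \<Rightarrow> int" where c: "ipol q \<zeta> = (\<Sum>i<N. of_int (c i) * \<zeta> ^ i)" by auto
    \<comment> \<open>Adding \<open>N - 1\<close> modulo \<open>N\<close> subtracts 1 without
      leaving the natural numbers.\<close>
    define c' where "c' i = c ((i + (N - 1)) mod N)" for i
    have shift: "((i + 1) mod N + (N - 1)) mod N = i" if "i < N" for i
    proof -
      have "((i + 1) mod N + (N - 1)) mod N = (i + 1 + (N - 1)) mod N" by (simp add: mod_add_left_eq)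
      also have "\<dots> = i" using that by simp
      finally show ?thesis .
    qed
    have "\<zeta> * ipol q \<zeta> = (\<Sum>i<N. of_int (c i) * \<zeta> ^ (i + 1))"
      by (simp add: c sum_distrib_left mult_ac)
    also have "\<dots> = (\<Sum>i<N. of_int (c' ((i + 1) mod N)) * \<zeta> ^ ((i + 1) mod N))"
    proof (rule sum.cong)
      fix i assume "i \<in> {..<N}"
      then have "i < N" by simp
      then have e: "c' ((i + 1) mod N) = c i" by (simp only: c'_def shift)
      show "of_int (c i) * \<zeta> ^ (i + 1) = of_int (c' ((i + 1) mod N)) * \<zeta> ^ ((i + 1) mod N)"
        unfolding zeta_power_mod e by (rule refl)
    qed (rule refl)
    also have "\<dots> = (\<Sum>i<N. of_int (c' i) * \<zeta> ^ i)"
      using sum.reindex_bij_betw[OF bij_betw_add_mod[OF N_pos, of 1], of "\<lambda>i. of_int (c' i) * \<zeta> ^ i"] .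
    finally have e: "\<zeta> * ipol q \<zeta> = (\<Sum>i<N. of_int (c' i) * \<zeta> ^ i)" .
    have "of_int a = (\<Sum>i<N. if i = 0 then of_int a else 0 :: complex)"
      using N_pos by (simp add: sum.delta)
    then have "ipol (pCons a q) \<zeta> = (\<Sum>i<N. (if i = 0 then of_int a else 0)) + (\<Sum>i<N. of_int (c' i) * \<zeta> ^ i)"
      unfolding ipol_simps e by simp
    also have "\<dots> = (\<Sum>i<N. (if i = 0 then of_int a else 0) + of_int (c' i) * \<zeta> ^ i)"
      by (rule sum.distrib[symmetric])
    also have "\<dots> = (\<Sum>i<N. of_int (c' i + (if i = 0 then a else 0)) * \<zeta> ^ i)"
      by (rule sum.cong) auto
    finally have "ipol (pCons a q) \<zeta> = (\<Sum>i<N. of_int (c' i + (if i = 0 then a else 0)) * \<zeta> ^ i)" .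
    then show ?case by (rule exI[of _ "\<lambda>i. c' i + (if i = 0 then a else 0)"])
  qed
  then show ?thesis using that q by auto
qed

text \<open>Multiplication by \<open>z\<close> acts on the vector of powers of
  \<open>\<zeta>\<close> through an integer matrix, so \<open>z\<close> is a root of its monic
  characteristic polynomial.\<close>

lemma zint_algebraic_int:
  assumes "z \<in> \<O>"
  shows "algebraic_int z"
proof -
  obtain c :: "nat \<Rightarrow> int" where c: "z = (\<Sum>i<N. of_int (c i) * \<zeta> ^ i)"
    using zint_coeffs[OF assms] .
  define M :: "int mat" where
    "M = mat N N (\<lambda>(j, k). \<Sum>i<N. if (i + j) mod N = k then c i else 0)"
  define v where "v = vec N (\<lambda>k. \<zeta> ^ k)"
  let ?M = "map_mat of_int M :: complex mat"
  have M: "M \<in> carrier_mat N N" by (simp add: M_def)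
  have "?M *\<^sub>v v = z \<cdot>\<^sub>v v"
  proof (rule eq_vecI)
    show "dim_vec (?M *\<^sub>v v) = dim_vec (z \<cdot>\<^sub>v v)" by (simp add: M_def v_def)
    fix j assume "j < dim_vec (z \<cdot>\<^sub>v v)"
    then have j: "j < N" by (simp add: v_def)
    have "(?M *\<^sub>v v) $ j = (\<Sum>k<N. (\<Sum>i<N. if (i + j) mod N = k then of_int (c i) else 0) * \<zeta> ^ k)"
      using j by (simp add: M_def v_def scalar_prod_def lessThan_atLeast0 if_distrib cong: if_cong)
    also have "\<dots> = (\<Sum>k<N. \<Sum>i<N. if (i + j) mod N = k then of_int (c i) * \<zeta> ^ k else 0)"
      by (intro sum.cong) (auto simp: sum_distrib_right intro!: sum.cong)
    also have "\<dots> = (\<Sum>i<N. \<Sum>k<N. if (i + j) mod N = k then of_int (c i) * \<zeta> ^ k else 0)"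
      by (rule sum.swap)
    also have "\<dots> = (\<Sum>i<N. of_int (c i) * \<zeta> ^ ((i + j) mod N))"
      using N_pos by (intro sum.cong) (auto simp: sum.delta')
    also have "\<dots> = z * \<zeta> ^ j"
      by (simp add: zeta_power_mod c sum_distrib_left power_add mult_ac)
    finally show "(?M *\<^sub>v v) $ j = (z \<cdot>\<^sub>v v) $ j" using j by (simp add: v_def)
  qed
  moreover have "v \<noteq> 0\<^sub>v N"
  proof
    assume "v = 0\<^sub>v N"
    then have "v $ 0 = 0" using N_pos by simp
    then show False using N_pos by (simp add: v_def)
  qed
  ultimately have "eigenvector ?M v z" using M by (simp add: eigenvector_def v_def)
  then have "eigenvalue ?M z" by (auto simp: eigenvalue_def)
  then have "poly (char_poly ?M) z = 0" using M by (simp add: eigenvalue_root_char_poly[where n = N])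
  moreover have "char_poly ?M = map_poly of_int (char_poly M)" by (rule of_int_hom.char_poly_hom[OF M])
  ultimately have "ipol (char_poly M) z = 0" by simp
  moreover have "lead_coeff (char_poly M) = 1" using degree_monic_char_poly[OF M] by simp
  ultimately show ?thesis by (auto simp: algebraic_int_altdef_ipoly)
qed

text \<open>The quotient \<open>z\<close> is rational and an algebraic integer, hence an integer.
  This brings divisibilities in \<open>\<O>\<close> back to the integers.\<close>

lemma zint_multiple_int:
  assumes "z \<in> \<O>" "of_int b = of_int a * z" "a \<noteq> 0"
  shows "a dvd b"
proof -
  have "z = of_int b / of_int a" using assms by (simp add: field_simps)
  then have "z \<in> \<rat>" by simp
  with zint_algebraic_int[OF assms(1)] have "z \<in> \<int>" by (rule rational_algebraic_int_is_int)
  then obtain c where "z = of_int c" by (auto elim: Ints_cases)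
  then have "of_int b = (of_int (a * c) :: complex)" using assms by simp
  then have "b = a * c" by (simp only: of_int_eq_iff)
  then show ?thesis by simp
qed

text \<open>In an integer polynomial vanishing at \<open>z\<close>, the lowest nonzero coefficient
  is a multiple of \<open>z\<close>; the induction strips the zero coefficients before it.\<close>

lemma nonzero_divides_int:
  assumes "z \<in> \<O>" "z \<noteq> 0"
  obtains b where "b \<noteq> 0" "of_int b \<in> zideal N z"
proof -
  obtain q where q: "q \<noteq> 0" "ipol q z = 0"
    using zint_algebraic_int[OF assms(1)]
    unfolding algebraic_int_altdef_ipoly by (metis leading_coeff_0_iff one_neq_zero)
  have "\<exists>b. b \<noteq> 0 \<and> of_int b \<in> zideal N z" using q
  proof (induction q)
    case 0
    then show ?case by simp
  next
    case (pCons a q)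
    show ?case
    proof (cases "a = 0")
      case True
      then show ?thesis using pCons assms by (auto simp: ipol_simps)
    next
      case False
      have "of_int a = z * (- ipol q z)" using pCons.prems(2) by (simp add: ipol_simps add_eq_0_iff)
      moreover have "- ipol q z \<in> \<O>" using zint_poly[OF assms(1)] by auto
      ultimately have "of_int a \<in> zideal N z" unfolding zideal_def by (rule image_eqI)
      then show ?thesis using False by blast
    qed
  qed
  then show ?thesis using that by blast
qed

lemma zideal_closed:
  "0 \<in> zideal N u"
  "x \<in> zideal N u \<Longrightarrow> y \<in> zideal N u \<Longrightarrow> x + y \<in> zideal N u"
  "x \<in> zideal N u \<Longrightarrow> y \<in> zideal N u \<Longrightarrow> x - y \<in> zideal N u"
  "x \<in> zideal N u \<Longrightarrow> - x \<in> zideal N u"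
  "x \<in> zideal N u \<Longrightarrow> y \<in> \<O> \<Longrightarrow> x * y \<in> zideal N u"
  "x \<in> zideal N u \<Longrightarrow> y \<in> \<O> \<Longrightarrow> y * x \<in> zideal N u"
  "y \<in> \<O> \<Longrightarrow> u * y \<in> zideal N u"
proof -
  show "0 \<in> zideal N u" by (auto simp: zideal_def intro!: image_eqI[of _ _ 0])
  show "x \<in> zideal N u \<Longrightarrow> y \<in> zideal N u \<Longrightarrow> x + y \<in> zideal N u"
    by (auto simp: zideal_def simp flip: distrib_left)
  show "x \<in> zideal N u \<Longrightarrow> y \<in> zideal N u \<Longrightarrow> x - y \<in> zideal N u"
    by (auto simp: zideal_def simp flip: right_diff_distrib)
  show "x \<in> zideal N u \<Longrightarrow> - x \<in> zideal N u"
    by (auto simp: zideal_def simp flip: mult_minus_right)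
  show 1: "x \<in> zideal N u \<Longrightarrow> y \<in> \<O> \<Longrightarrow> x * y \<in> zideal N u"
    by (auto simp: zideal_def mult.assoc)
  show "x \<in> zideal N u \<Longrightarrow> y \<in> \<O> \<Longrightarrow> y * x \<in> zideal N u"
    using 1 by (simp add: mult.commute)
  show "y \<in> \<O> \<Longrightarrow> u * y \<in> zideal N u" by (auto simp: zideal_def)
qed

lemma zideal_sum: "(\<And>i. i \<in> A \<Longrightarrow> f i \<in> zideal N u) \<Longrightarrow> sum f A \<in> zideal N u"
  by (induction A rule: infinite_finite_induct) (auto intro: zideal_closed)

lemma zideal_mono: "v \<in> zideal N u \<Longrightarrow> zideal N v \<subseteq> zideal N u"
  using zideal_closed(5) by (auto simp: zideal_def mult.assoc)

lemma zideal_mult: "x \<in> zideal N u \<Longrightarrow> y \<in> zideal N v \<Longrightarrow> x * y \<in> zideal N (u * v)"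
proof -
  assume "x \<in> zideal N u" "y \<in> zideal N v"
  then obtain a b where "x = u * a" "y = v * b" "a \<in> \<O>" "b \<in> \<O>" by (auto simp: zideal_def)
  then have "x * y = u * v * (a * b)" "a * b \<in> \<O>" by auto
  then show ?thesis by (auto simp: zideal_def)
qed

lemma freshman:
  assumes "prime l" "x \<in> \<O>" "y \<in> \<O>"
  shows "(x + y) ^ l - (x ^ l + y ^ l) \<in> zideal N (of_nat l)"
proof -
  have l: "l > 0" using assms(1) by (simp add: prime_gt_0_nat)
  have "(x + y) ^ l = (\<Sum>k\<le>l. of_nat (l choose k) * x ^ k * y ^ (l - k))" by (rule binomial_ring)
  also have "{..l} = insert 0 (insert l {1..<l})" using l by auto
  also have "(\<Sum>k\<in>\<dots>. of_nat (l choose k) * x ^ k * y ^ (l - k)) =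
      y ^ l + (x ^ l + (\<Sum>k\<in>{1..<l}. of_nat (l choose k) * x ^ k * y ^ (l - k)))"
    using l by (subst sum.insert; simp)+
  finally have "(x + y) ^ l - (x ^ l + y ^ l) = (\<Sum>k\<in>{1..<l}. of_nat (l choose k) * x ^ k * y ^ (l - k))"
    by simp
  also have "\<dots> \<in> zideal N (of_nat l)"
  proof (rule zideal_sum)
    fix k assume k: "k \<in> {1..<l}"
    then have "l dvd (l choose k)" using assms(1) by (intro dvd_choose_prime) auto
    then obtain d where "(l choose k) = l * d" by (rule dvdE)
    then have "of_nat (l choose k) * x ^ k * y ^ (l - k) = of_nat l * (of_nat d * x ^ k * y ^ (l - k))"
      by simp
    moreover have "of_nat d * x ^ k * y ^ (l - k) \<in> \<O>" using assms by (intro zint_closed zint_power) auto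
    ultimately show "of_nat (l choose k) * x ^ k * y ^ (l - k) \<in> zideal N (of_nat l)"
      unfolding zideal_def by (rule image_eqI)
  qed
  finally show ?thesis .
qed

lemma fermat_int:
  assumes "prime l"
  shows "(of_int a :: complex) ^ l - of_int a \<in> zideal N (of_nat l)"
proof -
  have "[a ^ l = a] (mod int l)"
  proof (cases "int l dvd a")
    case True
    moreover have "int l dvd a ^ l" using True assms by (simp add: dvd_power prime_gt_0_nat dvd_trans)
    ultimately show ?thesis by (simp add: cong_iff_dvd_diff)
  next
    case False
    have cop: "coprime a (int l)" using False assms
      by (metis coprime_commute prime_imp_coprime prime_nat_int_transfer)
    have "[nat (a mod int l) ^ (l - 1) = 1] (mod l)"
    proof (rule fermat_theorem[OF assms])
      show "\<not> l dvd nat (a mod int l)"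
        using False assms by (simp add: prime_gt_0_nat nat_dvd_iff dvd_mod_iff flip: int_dvd_int_iff)
    qed
    then have "[int (nat (a mod int l) ^ (l - 1)) = int 1] (mod int l)" by (simp only: cong_int_iff)
    then have "[(a mod int l) ^ (l - 1) = 1] (mod int l)" using assms by (simp add: prime_gt_0_nat)
    then have "[a ^ (l - 1) = 1] (mod int l)" by (simp add: cong_def power_mod)
    then have "[a ^ (l - 1) * a = 1 * a] (mod int l)" by (rule cong_scalar_right)
    moreover have "a ^ (l - 1) * a = a ^ l" using assms
      by (metis mult.commute power_eq_if prime_gt_0_nat less_numeral_extra(3))
    ultimately show ?thesis by simp
  qed
  then obtain d where "a ^ l - a = int l * d" by (auto simp: cong_iff_dvd_diff elim: dvdE)
  then have "(of_int (a ^ l - a) :: complex) = of_int (int l * d)" by (rule arg_cong)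
  then show ?thesis by (auto simp: zideal_def)
qed

lemma ideal_power_diff:
  assumes "x \<in> \<O>" "y \<in> \<O>" "x - y \<in> zideal N u"
  shows "x ^ k - y ^ k \<in> zideal N u"
proof -
  have "x ^ k - y ^ k = (x - y) * (\<Sum>i<k. y ^ (k - Suc i) * x ^ i)" by (rule power_diff_sumr2)
  moreover have "(\<Sum>i<k. y ^ (k - Suc i) * x ^ i) \<in> \<O>"
    using assms by (intro zint_sum zint_closed zint_power) auto
  ultimately show ?thesis using zideal_closed(5)[OF assms(3)] by simp
qed

text \<open>Modulo \<open>l\<close> the power \<open>l\<close> is additive and fixes the integer
  coefficients, so it acts on the argument only.\<close>

lemma frobenius_ipol:
  assumes "prime l" "w \<in> \<O>"
  shows "ipol q w ^ l - ipol q (w ^ l) \<in> zideal N (of_nat l)"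
proof (induction q)
  case 0
  then show ?case using assms by (simp add: ipol_simps prime_gt_0_nat zero_power zideal_closed)
next
  case (pCons a q)
  have q: "ipol q w \<in> \<O>" using assms(2) by (rule zint_poly)
  have 1: "(of_int a + w * ipol q w) ^ l - (of_int a ^ l + (w * ipol q w) ^ l) \<in> zideal N (of_nat l)"
    by (rule freshman) (use assms q in auto)
  have 2: "(of_int a :: complex) ^ l - of_int a \<in> zideal N (of_nat l)" by (rule fermat_int) fact
  have 3: "w ^ l * (ipol q w ^ l - ipol q (w ^ l)) \<in> zideal N (of_nat l)"
    using pCons.IH assms by (intro zideal_closed(6)) auto
  have "ipol (pCons a q) w ^ l - ipol (pCons a q) (w ^ l) =
     ((of_int a + w * ipol q w) ^ l - (of_int a ^ l + (w * ipol q w) ^ l)) +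
     ((of_int a) ^ l - of_int a) + w ^ l * (ipol q w ^ l - ipol q (w ^ l))"
    by (simp add: ipol_simps algebra_simps power_mult_distrib)
  then show ?case using zideal_closed(2)[OF zideal_closed(2)[OF 1 2] 3] by (simp only:)
qed

text \<open>Add to \<open>k\<close> the multiple of \<open>N\<close> by the product of the primes up
  to \<open>A\<close> that do not divide \<open>k\<close>: every prime up to \<open>A\<close> then
  divides exactly one of the two summands.\<close>

lemma coprime_representative:
  assumes "coprime k N"
  obtains k' where "k' > 0" "[k' = k] (mod N)" "\<And>l. prime l \<Longrightarrow> l dvd k' \<Longrightarrow> l > A"
proof -
  define Q where "Q = {q. prime q \<and> q \<le> A \<and> \<not> q dvd k}"
  have fin: "finite Q" by (rule finite_subset[of _ "{..A}"]) (auto simp: Q_def)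
  define k' where "k' = k + N * \<Prod>Q"
  have pQ: "\<Prod>Q > 0" by (rule prod_pos) (auto simp: Q_def prime_gt_0_nat)
  have "l > A" if l: "prime l" "l dvd k'" for l
  proof (rule ccontr)
    assume "\<not> l > A"
    show False
    proof (cases "l dvd k")
      case True
      then have "l dvd N * \<Prod>Q" using l by (simp add: k'_def dvd_add_right_iff)
      then have "l dvd N \<or> l dvd \<Prod>Q" using l by (simp add: prime_dvd_mult_iff)
      moreover have "\<not> l dvd N" using True assms l by (meson coprime_common_divisor not_prime_unit)
      moreover have "\<not> l dvd \<Prod>Q"
      proof
        assume "l dvd \<Prod>Q"
        then obtain q where "q \<in> Q" "l dvd q" using l fin by (auto simp: prime_dvd_prod_iff)
        then have "l = q" using l by (auto simp: Q_def primes_dvd_imp_eq)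
        then show False using True \<open>q \<in> Q\<close> by (simp add: Q_def)
      qed
      ultimately show False by blast
    next
      case False
      then have "l \<in> Q" using l \<open>\<not> l > A\<close> by (auto simp: Q_def)
      then have "l dvd \<Prod>Q" using dvd_prodI[OF fin, of l "\<lambda>x. x"] by simp
      then show False using l False by (simp add: k'_def dvd_add_left_iff)
    qed
  qed
  moreover have "k' > 0" using N_pos pQ by (simp add: k'_def)
  moreover have "[k' = k] (mod N)" by (simp add: k'_def cong_def)
  ultimately show ?thesis using that by blast
qed

text \<open>Landau's argument for the irreducibility of the cyclotomic polynomial: only finitely many
  values \<open>q(\<zeta>\<^sup>j)\<close> occur, and a nonzero one is divisible by finitely many primes, whereas
  \<open>q(\<zeta>\<^sup>j) = 0\<close> makes \<open>q(\<zeta>\<^sup>j\<^sup>l)\<close> divisible by the prime \<open>l\<close>; so large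
  primes preserve the zeros of \<open>q\<close>, and every residue class prime to \<open>N\<close> is represented by a
  product of large primes.\<close>

lemma ipol_conjugate_zero:
  assumes "ipol q \<zeta> = 0" "coprime k N"
  shows "ipol q (\<zeta> ^ k) = 0"
proof -
  define b where "b j = (SOME b. b \<noteq> 0 \<and> of_int b \<in> zideal N (ipol q (\<zeta> ^ j)))" for j
  have b: "b j \<noteq> 0" "of_int (b j) \<in> zideal N (ipol q (\<zeta> ^ j))" if "ipol q (\<zeta> ^ j) \<noteq> 0" for j
  proof -
    have "\<exists>b. b \<noteq> 0 \<and> of_int b \<in> zideal N (ipol q (\<zeta> ^ j))"
      by (rule nonzero_divides_int[OF zint_poly that]) auto
    from someI_ex[OF this] show "b j \<noteq> 0" "of_int (b j) \<in> zideal N (ipol q (\<zeta> ^ j))"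
      by (auto simp: b_def)
  qed
  \<comment> \<open>A prime above \<open>A\<close> divides none of the nonzero integers
    \<open>b j\<close>.\<close>
  define A where "A = (\<Sum>j<N. nat \<bar>b j\<bar>)"
  obtain k' where k': "k' > 0" "[k' = k] (mod N)" "\<And>l. prime l \<Longrightarrow> l dvd k' \<Longrightarrow> l > A"
    using coprime_representative[OF assms(2)] by blast
  have "ipol q (\<zeta> ^ k') = 0" using k'(1,3)
  proof (induction k' rule: prime_divisors_induct)
    case zero
    then show ?case by simp
  next
    case (unit x)
    then show ?case using assms by simp
  next
    case (factor l x)
    then have IH: "ipol q (\<zeta> ^ x) = 0" by auto
    have l: "l > A" using factor by auto
    have lp: "l > 0" using factor(1) by (rule prime_gt_0_nat)
    define j where "j = (l * x) mod N"
    have j: "j < N" using N_pos by (simp add: j_def)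
    have e: "(\<zeta> ^ x) ^ l = \<zeta> ^ j"
      by (simp add: j_def zeta_power_mod flip: power_mult) (simp add: mult.commute)
    have "ipol q (\<zeta> ^ x) ^ l - ipol q ((\<zeta> ^ x) ^ l) \<in> zideal N (of_nat l)"
      using factor by (intro frobenius_ipol) auto
    then have "- ipol q (\<zeta> ^ j) \<in> zideal N (of_nat l)"
      using IH lp by (simp add: e zero_power)
    then have d: "ipol q (\<zeta> ^ j) \<in> zideal N (of_nat l)" using zideal_closed(4) by fastforce
    have "ipol q (\<zeta> ^ j) = 0"
    proof (rule ccontr)
      assume nz: "ipol q (\<zeta> ^ j) \<noteq> 0"
      have "of_int (b j) \<in> zideal N (of_nat l)" using zideal_mono[OF d] b(2)[OF nz] by blast
      then obtain z where "z \<in> \<O>" "of_int (b j) = of_int (int l) * z" by (auto simp: zideal_def)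
      then have "int l dvd b j" using lp by (intro zint_multiple_int) auto
      then have "int l \<le> \<bar>b j\<bar>" using b(1)[OF nz] by (simp add: zdvd_imp_le)
      then have "l \<le> nat \<bar>b j\<bar>" by simp
      also have "\<dots> \<le> A" unfolding A_def using j by (intro member_le_sum) auto
      finally show False using l by simp
    qed
    moreover have "\<zeta> ^ (l * x) = \<zeta> ^ j" by (simp add: j_def zeta_power_mod)
    ultimately show ?case by simp
  qed
  moreover have "\<zeta> ^ k' = \<zeta> ^ k" using k'(2) by (rule zeta_power_cong)
  ultimately show ?thesis by simp
qed

text \<open>The automorphism sending \<open>\<zeta>\<close> to its \<open>k\<close>-th power,
  evaluated on an arbitrary polynomial representing \<open>z\<close>. The choice is immaterial for
  \<open>z\<close> in \<open>\<O>\<close> and \<open>k\<close> coprime to \<open>N\<close>, by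
  \<open>ipol_conjugate_zero\<close>.\<close>

definition \<sigma> :: "nat \<Rightarrow> complex \<Rightarrow> complex" where
  "\<sigma> k z = ipol (SOME q. ipol q \<zeta> = z) (\<zeta> ^ k)"

context
  fixes k assumes k: "coprime k N"
begin

lemma sigma_ipol: "\<sigma> k (ipol q \<zeta>) = ipol q (\<zeta> ^ k)"
proof -
  define r where "r = (SOME r. ipol r \<zeta> = ipol q \<zeta>)"
  have "ipol r \<zeta> = ipol q \<zeta>" unfolding r_def by (rule someI) simp
  then have "ipol (r + - q) \<zeta> = 0" unfolding ipol_simps by simp
  then have "ipol (r + - q) (\<zeta> ^ k) = 0" using k by (rule ipol_conjugate_zero)
  then show ?thesis unfolding ipol_simps by (simp add: \<sigma>_def r_def)
qed

lemma sigma_add: "x \<in> \<O> \<Longrightarrow> y \<in> \<O> \<Longrightarrow> \<sigma> k (x + y) = \<sigma> k x + \<sigma> k y"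
  unfolding zint_def by (elim rangeE) (simp only: sigma_ipol ipol_simps(1)[symmetric])

lemma sigma_mult: "x \<in> \<O> \<Longrightarrow> y \<in> \<O> \<Longrightarrow> \<sigma> k (x * y) = \<sigma> k x * \<sigma> k y"
  unfolding zint_def by (elim rangeE) (simp only: sigma_ipol ipol_simps(2)[symmetric])

lemma sigma_of_int [simp]: "\<sigma> k (of_int a) = of_int a"
  using sigma_ipol[of "[:a:]"] by (simp add: ipol_simps)

lemma sigma_simps [simp]: "\<sigma> k 0 = 0" "\<sigma> k 1 = 1" "\<sigma> k (of_nat n) = of_nat n"
  using sigma_of_int[of 0] sigma_of_int[of 1] sigma_of_int[of "int n"] by simp_all

lemma sigma_minus: "x \<in> \<O> \<Longrightarrow> \<sigma> k (- x) = - \<sigma> k x"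
  using sigma_add[of x "- x"] by (simp add: zint_closed add_eq_0_iff)

lemma sigma_diff: "x \<in> \<O> \<Longrightarrow> y \<in> \<O> \<Longrightarrow> \<sigma> k (x - y) = \<sigma> k x - \<sigma> k y"
  using sigma_add[of x "- y"] sigma_minus[of y] by auto

lemma sigma_zeta: "\<sigma> k \<zeta> = \<zeta> ^ k"
  using sigma_ipol[of "[:0, 1:]"] by (simp add: ipol_simps)

lemma sigma_power: "x \<in> \<O> \<Longrightarrow> \<sigma> k (x ^ i) = \<sigma> k x ^ i"
  by (induction i) (simp_all add: sigma_mult zint_power)

lemma sigma_sum: "(\<And>i. i \<in> A \<Longrightarrow> f i \<in> \<O>) \<Longrightarrow> \<sigma> k (sum f A) = (\<Sum>i\<in>A. \<sigma> k (f i))"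
  by (induction A rule: infinite_finite_induct) (auto simp: sigma_add zint_sum)

lemma sigma_prod: "(\<And>i. i \<in> A \<Longrightarrow> f i \<in> \<O>) \<Longrightarrow> \<sigma> k (prod f A) = (\<Prod>i\<in>A. \<sigma> k (f i))"
  by (induction A rule: infinite_finite_induct) (auto simp: sigma_mult zint_prod)

lemma sigma_root_of_unity: "z ^ N = 1 \<Longrightarrow> \<sigma> k z = z ^ k"
  by (elim root_of_unity_eq) (simp add: sigma_power sigma_zeta flip: power_mult; simp add: mult.commute)

text \<open>On roots of unity both maps are powers, so they commute. This lets an identity for
  \<open>z * cnj z\<close> pass to all conjugates of \<open>z\<close>.\<close>

lemma sigma_cnj: assumes "z \<in> \<O>" shows "\<sigma> k (cnj z) = cnj (\<sigma> k z)"
proof -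
  obtain c :: "nat \<Rightarrow> int" where c: "z = (\<Sum>i<N. of_int (c i) * \<zeta> ^ i)" using zint_coeffs[OF assms] .
  have cz: "cnj z = (\<Sum>i<N. of_int (c i) * cnj \<zeta> ^ i)" by (simp add: c)
  have r: "cnj \<zeta> ^ i \<in> \<O>" for i by auto
  have "\<sigma> k (cnj \<zeta> ^ i) = cnj (\<sigma> k (\<zeta> ^ i))" for i
  proof -
    have "cnj \<zeta> ^ N = 1" using zeta_N by (metis complex_cnj_one complex_cnj_power)
    then show ?thesis
      by (simp add: sigma_power sigma_root_of_unity zeta_N zint_cnj)
  qed
  then have "\<sigma> k (cnj z) = (\<Sum>i<N. of_int (c i) * cnj (\<sigma> k (\<zeta> ^ i)))"
    unfolding cz by (subst sigma_sum) (auto simp: sigma_mult r)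
  also have "\<dots> = cnj (\<Sum>i<N. \<sigma> k (of_int (c i) * \<zeta> ^ i))"
    by (simp add: sigma_mult zint_power)
  also have "(\<Sum>i<N. \<sigma> k (of_int (c i) * \<zeta> ^ i)) = \<sigma> k z"
    unfolding c by (rule sigma_sum[symmetric]) auto
  finally show ?thesis .
qed

end

lemma sigma_sigma:
  assumes "coprime j N" "coprime k N" "z \<in> \<O>"
  shows "\<sigma> j (\<sigma> k z) = \<sigma> (k * j) z"
proof -
  obtain c :: "nat \<Rightarrow> int" where c: "z = (\<Sum>i<N. of_int (c i) * \<zeta> ^ i)" using zint_coeffs[OF assms(3)] .
  have cop: "coprime (k * j) N" using assms by simp
  have z: "\<sigma> a z = (\<Sum>i<N. of_int (c i) * (\<zeta> ^ a) ^ i)" if "coprime a N" for a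
    unfolding c using that
    by (subst sigma_sum) (auto simp: sigma_mult zint_power sigma_power sigma_zeta)
  have p: "((\<zeta> ^ k) ^ i :: complex) \<in> \<O>" for i by auto
  have "\<sigma> j ((\<zeta> ^ k) ^ i) = (\<zeta> ^ (k * j)) ^ i" for i
    using assms(1) by (simp add: sigma_power sigma_zeta zint_power power_mult) (simp add: mult.commute flip: power_mult)
  then show ?thesis unfolding z[OF assms(2)] z[OF cop] using assms(1)
    by (subst sigma_sum) (auto simp: sigma_mult p)
qed

lemma sigma_cong: "[j = k] (mod N) \<Longrightarrow> \<sigma> j z = \<sigma> k z"
  by (simp add: \<sigma>_def zeta_power_cong)

lemma sigma_1: "[k = 1] (mod N) \<Longrightarrow> z \<in> \<O> \<Longrightarrow> \<sigma> k z = z"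
proof -
  assume "[k = 1] (mod N)" and z: "z \<in> \<O>"
  then have "\<sigma> k z = \<sigma> 1 z" by (intro sigma_cong)
  also have "\<dots> = z" using z by (auto simp: zint_def sigma_ipol)
  finally show ?thesis .
qed

text \<open>An inverse \<open>j\<close> of \<open>k\<close> modulo \<open>N\<close> gives the
  inverse automorphism \<open>\<sigma> j\<close>.\<close>

lemma sigma_nonzero:
  assumes "coprime k N" "z \<in> \<O>" "z \<noteq> 0"
  shows "\<sigma> k z \<noteq> 0"
proof
  assume z: "\<sigma> k z = 0"
  obtain j where j: "[k * j = 1] (mod N)" using assms(1) using cong_solve_coprime_nat by auto
  then have "coprime (k * j) N" by (metis cong_imp_coprime cong_sym coprime_1_left)
  then have cj: "coprime j N" by simp
  have "z = \<sigma> (k * j) z" using j assms by (simp add: sigma_1)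
  also have "\<dots> = \<sigma> j (\<sigma> k z)" using assms cj by (simp add: sigma_sigma)
  also have "\<dots> = 0" using z cj by simp
  finally show False using assms by simp
qed

end

section \<open>Galois traces and Kronecker's theorem on integers with bounded conjugates\<close>

context cyclotomic_integers begin

lemma sum_totatives_split:
  fixes f :: "nat \<Rightarrow> complex"
  assumes "M > 0"
  shows "(\<Sum>k<M. f k) = (\<Sum>d | d dvd M. \<Sum>k | k < M div d \<and> coprime k (M div d). f (d * k))"
proof -
  have fin: "finite {d. d dvd M}" using assms by simp
  have "(\<Sum>k<M. f k) = (\<Sum>d | d dvd M. \<Sum>k | k \<in> {..<M} \<and> gcd k M = d. f k)"
    by (rule sum.group[symmetric]) (use fin in auto)
  also have "\<dots> = (\<Sum>d | d dvd M. \<Sum>k | k < M div d \<and> coprime k (M div d). f (d * k))"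
  proof (rule sum.cong)
    fix d assume "d \<in> {d. d dvd M}"
    then obtain e where e: "M = d * e" by (auto elim: dvdE)
    then have pos: "d > 0" "e > 0" using assms by auto
    show "(\<Sum>k | k \<in> {..<M} \<and> gcd k M = d. f k) = (\<Sum>k | k < M div d \<and> coprime k (M div d). f (d * k))"
    proof (rule sum.reindex_bij_witness[where j = "\<lambda>k. k div d" and i = "\<lambda>k. d * k"])
      fix k assume k: "k \<in> {k. k \<in> {..<M} \<and> gcd k M = d}"
      then have "d dvd k" by auto
      then obtain c where c: "k = d * c" by (auto elim: dvdE)
      have "d * gcd c e = d * 1" using k gcd_mult_distrib_nat[of d c e] unfolding c e by (simp only: mem_Collect_eq mult_1_right)
      then have "gcd c e = 1" using pos mult_left_cancel[of d] by blast
      then have "coprime c e" by (simp only: coprime_iff_gcd_eq_1)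
      moreover have "c < e"
      proof -
        have "d * c < d * e" using k c e by (simp only: mem_Collect_eq lessThan_iff)
        then show ?thesis by simp
      qed
      moreover have "k div d = c" "M div d = e" using c e pos by simp_all
      ultimately show "k div d \<in> {k. k < M div d \<and> coprime k (M div d)}" "d * (k div d) = k"
        "f (d * (k div d)) = f k" by (simp_all add: c)
    next
      fix k assume k: "k \<in> {k. k < M div d \<and> coprime k (M div d)}"
      moreover have "M div d = e" using e pos by simp
      ultimately show "d * k div d = k" "d * k \<in> {k. k \<in> {..<M} \<and> gcd k M = d}"
        using pos gcd_mult_distrib_nat[of d k e] by (auto simp: e)
    qed
  qed simp
  finally show ?thesis .
qed

text \<open>Grouping the exponents below \<open>M\<close> by their gcd with \<open>M\<close>
  exhibits this sum as the full geometric sum, which is 0 or \<open>M\<close>, minus the same sums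
  for the proper divisors of \<open>M\<close>. Allowing any \<open>M\<close>-th root of unity
  \<open>w\<close> keeps the induction going.\<close>

lemma ramanujan_sum_int:
  "M > 0 \<Longrightarrow> w ^ M = 1 \<Longrightarrow> (\<Sum>k | k < M \<and> coprime k M. w ^ k) \<in> (\<int> :: complex set)"
proof (induction M arbitrary: w rule: less_induct)
  case (less M)
  have "(\<Sum>k<M. w ^ k) = (\<Sum>d | d dvd M. \<Sum>k | k < M div d \<and> coprime k (M div d). w ^ (d * k))"
    using less.prems by (rule_tac sum_totatives_split)
  also have "{d. d dvd M} = insert 1 ({d. d dvd M} - {1})" by auto
  also have "(\<Sum>d \<in> \<dots>. \<Sum>k | k < M div d \<and> coprime k (M div d). w ^ (d * k)) =
     (\<Sum>k | k < M \<and> coprime k M. w ^ k) +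
     (\<Sum>d \<in> {d. d dvd M} - {1}. \<Sum>k | k < M div d \<and> coprime k (M div d). (w ^ d) ^ k)"
    using less.prems by (subst sum.insert) (auto simp: power_mult)
  finally have "(\<Sum>k | k < M \<and> coprime k M. w ^ k) = (\<Sum>k<M. w ^ k) -
     (\<Sum>d \<in> {d. d dvd M} - {1}. \<Sum>k | k < M div d \<and> coprime k (M div d). (w ^ d) ^ k)" by simp
  also have "\<dots> \<in> \<int>"
  proof (rule Ints_diff, goal_cases)
    case 1
    show "(\<Sum>k<M. w ^ k) \<in> \<int>"
      using sum_powers_root_of_unity[of w M] less.prems by (cases "w = 1") auto
  next
    case 2
    show ?case
    proof (rule Ints_sum)
    fix d assume d: "d \<in> {d. d dvd M} - {1}"
    then obtain e where e: "M = d * e" by (auto elim: dvdE)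
    then have "e > 0" "d > 1" using less.prems d by (auto intro: Nat.gr0I simp: Suc_lessI)
    then have "M div d < M" "M div d > 0" "(w ^ d) ^ (M div d) = 1"
      using less.prems e by (auto simp flip: power_mult)
    then show "(\<Sum>k | k < M div d \<and> coprime k (M div d). (w ^ d) ^ k) \<in> \<int>" by (intro less.IH)
    qed
  qed
  finally show ?case .
qed

lemma trace_int:
  assumes "z \<in> \<O>"
  shows "(\<Sum>k | k < N \<and> coprime k N. \<sigma> k z) \<in> \<int>"
proof -
  obtain c :: "nat \<Rightarrow> int" where c: "z = (\<Sum>i<N. of_int (c i) * \<zeta> ^ i)" using zint_coeffs[OF assms] .
  have "(\<Sum>k | k < N \<and> coprime k N. \<sigma> k z) = (\<Sum>k | k < N \<and> coprime k N. \<Sum>i<N. of_int (c i) * (\<zeta> ^ i) ^ k)"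
  proof (rule sum.cong)
    fix k assume "k \<in> {k. k < N \<and> coprime k N}"
    then have "coprime k N" by simp
    moreover have "\<sigma> k (\<zeta> ^ i) = (\<zeta> ^ i) ^ k" for i
      using calculation by (simp add: sigma_power sigma_zeta flip: power_mult) (simp add: mult.commute)
    ultimately show "\<sigma> k z = (\<Sum>i<N. of_int (c i) * (\<zeta> ^ i) ^ k)" unfolding c
      by (subst sigma_sum) (auto simp: sigma_mult zint_power)
  qed simp
  also have "\<dots> = (\<Sum>i<N. of_int (c i) * (\<Sum>k | k < N \<and> coprime k N. (\<zeta> ^ i) ^ k))"
    by (subst sum.swap) (simp add: sum_distrib_left)
  also have "\<dots> \<in> \<int>"
  proof (rule Ints_sum)
    fix i
    have "(\<zeta> ^ i) ^ N = 1" by (metis power_mult mult.commute zeta_N power_one)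
    then show "of_int (c i) * (\<Sum>k | k < N \<and> coprime k N. (\<zeta> ^ i) ^ k) \<in> \<int>"
      by (intro Ints_mult Ints_of_int ramanujan_sum_int[OF N_pos])
  qed
  finally show ?thesis .
qed

text \<open>The traces of \<open>z\<close> times negative powers of \<open>\<zeta>\<close> are
  rational integers of absolute value at most \<open>N\<close>, and they determine \<open>z\<close>
  by Fourier inversion over the exponents. So \<open>z\<close> is one of the finitely many
  \<open>?f t\<close>.\<close>

lemma finite_bounded_conjugates:
  "finite {z \<in> \<O>. \<forall>k. coprime k N \<longrightarrow> cmod (\<sigma> k z) \<le> 1}"
proof -
  let ?T = "{..<N} \<rightarrow>\<^sub>E {- int N..int N}"
  let ?f = "\<lambda>t :: nat \<Rightarrow> int. (\<Sum>j<N. of_int (t j) * \<zeta> ^ j) / of_nat N"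
  have "z \<in> ?f ` ?T" if z: "z \<in> \<O>" and b: "\<And>k. coprime k N \<Longrightarrow> cmod (\<sigma> k z) \<le> 1" for z
  proof -
    \<comment> \<open>\<open>(N - 1) * j\<close> stands for the exponent \<open>- j\<close>.\<close>
    define y where "y j = (\<Sum>k | k < N \<and> coprime k N. \<sigma> k (z * \<zeta> ^ ((N - 1) * j)))" for j
    define t where "t = (\<lambda>j. if j \<in> {..<N} then \<lfloor>Re (y j)\<rfloor> else undefined)"
    have "y j \<in> \<int>" for j unfolding y_def using z by (intro trace_int) auto
    then have ty: "of_int \<lfloor>Re (y j)\<rfloor> = y j" for j
    proof -
      obtain a where "y j = of_int a" using \<open>\<And>j. y j \<in> \<int>\<close>[of j] by (rule Ints_cases)
      then show ?thesis by simp
    qed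
    have sk: "\<sigma> k (z * \<zeta> ^ ((N - 1) * j)) = \<sigma> k z * \<zeta> ^ ((N - 1) * j * k)" if "coprime k N" for k j
      using that z by (simp add: sigma_mult zint_power sigma_power sigma_zeta flip: power_mult) (simp add: mult_ac)
    have "cmod (y j) \<le> (\<Sum>k | k < N \<and> coprime k N. 1)" for j
      unfolding y_def
    proof (rule sum_norm_le)
      fix k assume "k \<in> {k. k < N \<and> coprime k N}"
      then have k: "coprime k N" by simp
      show "cmod (\<sigma> k (z * \<zeta> ^ ((N - 1) * j))) \<le> 1"
        unfolding sk[OF k] using b[OF k] by (simp add: norm_mult norm_power) (simp add: zeta_def)
    qed
    also have "(\<Sum>k | k < N \<and> coprime k N. 1 :: real) \<le> real N"
    proof -
      have "card {k. k < N \<and> coprime k N} \<le> card {..<N}" by (rule card_mono) auto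
      then show ?thesis by simp
    qed
    finally have yN: "cmod (y j) \<le> real N" for j .
    have "cmod (of_int \<lfloor>Re (y j)\<rfloor>) \<le> real N" for j using yN[of j] by (simp only: ty)
    then have "\<bar>real_of_int \<lfloor>Re (y j)\<rfloor>\<bar> \<le> real N" for j by (simp only: norm_of_int)
    then have le: "- int N \<le> \<lfloor>Re (y j)\<rfloor>" "\<lfloor>Re (y j)\<rfloor> \<le> int N" for j
      by (simp_all only: abs_le_iff flip: of_int_le_iff[where 'a = real]) (simp_all add: abs_le_iff minus_le_iff)
    have "t \<in> ?T" by (rule PiE_I) (use le in \<open>auto simp: t_def\<close>)
    moreover have "z = ?f t"
    proof -
      have "(\<Sum>j<N. of_int (t j) * \<zeta> ^ j) = (\<Sum>j<N. y j * \<zeta> ^ j)"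
        by (intro sum.cong) (auto simp: t_def ty)
      also have "\<dots> = (\<Sum>k | k < N \<and> coprime k N. \<sigma> k z * (\<Sum>j<N. (\<zeta> ^ ((N - 1) * k + 1)) ^ j))"
      proof -
        have "\<sigma> k (z * \<zeta> ^ ((N - 1) * j)) * \<zeta> ^ j = \<sigma> k z * (\<zeta> ^ ((N - 1) * k + 1)) ^ j"
          if "coprime k N" for k j
        proof -
          have "\<zeta> ^ ((N - 1) * j * k) * \<zeta> ^ j = (\<zeta> ^ ((N - 1) * k + 1)) ^ j"
            unfolding power_mult[symmetric] power_add[symmetric]
            by (rule arg_cong[of _ _ "\<lambda>i. \<zeta> ^ i"]) (simp add: algebra_simps)
          then show ?thesis by (simp only: sk[OF that] mult.assoc)
        qed
        then have "(\<Sum>j<N. y j * \<zeta> ^ j) =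
            (\<Sum>j<N. \<Sum>k | k < N \<and> coprime k N. \<sigma> k z * (\<zeta> ^ ((N - 1) * k + 1)) ^ j)"
          unfolding y_def sum_distrib_right by (intro sum.cong) auto
        also have "\<dots> = (\<Sum>k | k < N \<and> coprime k N. \<Sum>j<N. \<sigma> k z * (\<zeta> ^ ((N - 1) * k + 1)) ^ j)"
          by (rule sum.swap)
        finally show ?thesis by (simp only: sum_distrib_left)
      qed
      \<comment> \<open>The inner sum vanishes unless \<open>k\<close> is 1 modulo \<open>N\<close>,
        so only the identity automorphism contributes. Writing \<open>1 mod N\<close> covers
        \<open>N = 1\<close>, where the sole index is 0.\<close>
      also have "\<dots> = (\<Sum>k | k < N \<and> coprime k N. if k = 1 mod N then of_nat N * z else 0)"
      proof (rule sum.cong)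
        fix k assume "k \<in> {k. k < N \<and> coprime k N}"
        then have k: "k < N" "coprime k N" by auto
        have eq: "N dvd (N - 1) * k + 1 \<longleftrightarrow> k = 1 mod N"
        proof -
          have "N dvd (N - 1) * k + 1 \<longleftrightarrow> [(N - 1) * k + 1 + k = 0 + k] (mod N)"
            by (simp only: cong_add_rcancel_nat cong_0_iff)
          also have "(N - 1) * k + 1 + k = N * k + 1" using N_pos by (cases N) auto
          also have "[N * k + 1 = 0 + k] (mod N) \<longleftrightarrow> (1 + N * k) mod N = k mod N"
            by (simp only: cong_def add_0 add.commute)
          also have "(1 + N * k) mod N = 1 mod N" by (rule mod_mult_self2)
          also have "1 mod N = k mod N \<longleftrightarrow> k = 1 mod N" using k(1) by (simp only: mod_less) blast
          finally show ?thesis .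
        qed
        show "\<sigma> k z * (\<Sum>j<N. (\<zeta> ^ ((N - 1) * k + 1)) ^ j) = (if k = 1 mod N then of_nat N * z else 0)"
        proof (cases "k = 1 mod N")
          case True
          then have "\<zeta> ^ ((N - 1) * k + 1) = 1" using eq zeta_power_eq_1_iff by blast
          moreover have "\<sigma> k z = z" using True z by (intro sigma_1) (auto simp: cong_def)
          ultimately show ?thesis using True by simp
        next
          case False
          then have "\<zeta> ^ ((N - 1) * k + 1) \<noteq> 1" using eq zeta_power_eq_1_iff by blast
          moreover have "(\<zeta> ^ ((N - 1) * k + 1)) ^ N = 1" by (metis power_mult mult.commute zeta_N power_one)
          ultimately show ?thesis using False sum_powers_root_of_unity by simp
        qed
      qed simp
      also have "\<dots> = of_nat N * z"
      proof -
        have "finite {k. k < N \<and> coprime k N}" by simp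
        moreover have "1 mod N \<in> {k. k < N \<and> coprime k N}"
          using N_pos by (cases "N = 1") auto
        ultimately show ?thesis by (subst sum.delta) auto
      qed
      finally show ?thesis using N_pos by simp
    qed
    ultimately show ?thesis by blast
  qed
  then have "{z \<in> \<O>. \<forall>k. coprime k N \<longrightarrow> cmod (\<sigma> k z) \<le> 1} \<subseteq> ?f ` ?T" by blast
  moreover have "finite (?f ` ?T)" by (intro finite_imageI finite_PiE) auto
  ultimately show ?thesis by (rule finite_subset)
qed

text \<open>All powers of \<open>z\<close> satisfy the bound as well, so by finiteness two of them
  coincide.\<close>

lemma kronecker_theorem:
  assumes "z \<in> \<O>" "z \<noteq> 0" "\<And>k. coprime k N \<Longrightarrow> cmod (\<sigma> k z) \<le> 1"
  obtains r where "r > 0" "z ^ r = 1"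
proof -
  have "range (\<lambda>i. z ^ i) \<subseteq> {z \<in> \<O>. \<forall>k. coprime k N \<longrightarrow> cmod (\<sigma> k z) \<le> 1}"
    using assms by (auto simp: sigma_power norm_power power_le_one)
  then have "finite (range (\<lambda>i. z ^ i))" using finite_bounded_conjugates by (rule finite_subset)
  then have "\<not> inj (\<lambda>i. z ^ i)" using finite_imageD infinite_UNIV_nat by blast
  then obtain i j where "i \<noteq> j" "z ^ i = z ^ j" by (auto simp: inj_def)
  then obtain i j where ij: "i < j" "z ^ i = z ^ j" by (metis nat_neq_iff)
  have "z ^ i * z ^ (j - i) = z ^ j" using ij(1) by (simp flip: power_add)
  then have "z ^ i * z ^ (j - i) = z ^ i * 1" using ij(2) by simp
  then have "z ^ (j - i) = 1" using assms by simp
  then show ?thesis using that[of "j - i"] ij by simp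
qed

text \<open>Otherwise \<open>z\<close> would be a root of unity, of absolute value 1. This is how
  divisibility by a large integer will force a trace to vanish.\<close>

lemma zint_small_conjugates_zero:
  assumes "z \<in> \<O>" "\<And>k. coprime k N \<Longrightarrow> cmod (\<sigma> k z) < 1"
  shows "z = 0"
proof (rule ccontr)
  assume "z \<noteq> 0"
  then obtain r where r: "r > 0" "z ^ r = 1"
    using kronecker_theorem[OF assms(1)] assms(2) less_imp_le by blast
  have "cmod z < 1" using assms(2)[of 1] sigma_1[OF _ assms(1), of 1] by simp
  then have "cmod z ^ r < 1" using r by (simp add: power_less_one_iff)
  moreover have "cmod z ^ r = 1" using r by (metis norm_one norm_power)
  ultimately show False by simp
qed

end

section \<open>The primes above \<open>p\<close>\<close>

locale cyclotomic_prime = cyclotomic_integers +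
  fixes p s n' :: nat
  assumes p: "prime p" and s: "s \<ge> 1" and N_eq: "N = p ^ s * n'" and n': "coprime p n'"
begin

abbreviation P where "P \<equiv> p ^ s"

text \<open>\<open>\<zeta> ^ n'\<close> is a primitive \<open>P\<close>-th root of unity, so
  \<open>\<pi>\<close> generates the product of the primes of \<open>\<O>\<close> above
  \<open>p\<close>: congruences modulo \<open>\<pi>\<close> treat all these primes at once.\<close>

definition \<pi> where "\<pi> = 1 - \<zeta> ^ n'"

lemma p_pos: "p > 0" using p by (rule prime_gt_0_nat)

lemma n'_pos: "n' > 0" using N_pos N_eq by (cases n') auto

lemma pi_in [intro, simp]: "\<pi> \<in> \<O>" by (auto simp: \<pi>_def)

lemma frobenius_power: "x \<in> \<O> \<Longrightarrow> y \<in> \<O> \<Longrightarrow> (x + y) ^ (p ^ k) - (x ^ (p ^ k) + y ^ (p ^ k)) \<in> zideal N (of_nat p)"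
proof (induction k)
  case 0
  then show ?case by (simp add: zideal_closed)
next
  case (Suc k)
  let ?a = "(x + y) ^ (p ^ k)" and ?b = "x ^ (p ^ k)" and ?c = "y ^ (p ^ k)"
  have 1: "?a ^ p - (?b + ?c) ^ p \<in> zideal N (of_nat p)"
    by (rule ideal_power_diff) (use Suc in auto)
  have 2: "(?b + ?c) ^ p - (?b ^ p + ?c ^ p) \<in> zideal N (of_nat p)"
    by (rule freshman[OF p]) (use Suc in auto)
  have "z ^ p ^ Suc k = (z ^ p ^ k) ^ p" for z :: complex
    by (simp add: mult.commute flip: power_mult)
  moreover have "?a ^ p - (?b ^ p + ?c ^ p) = ?a ^ p - (?b + ?c) ^ p + ((?b + ?c) ^ p - (?b ^ p + ?c ^ p))"
    by simp
  ultimately show ?case using zideal_closed(2)[OF 1 2] by (simp only:)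
qed

text \<open>Modulo \<open>p\<close> the power \<open>P\<close> is additive, which leaves
  \<open>1 + (- 1) ^ P\<close>: this is 0 for odd \<open>P\<close> and 2 = \<open>p\<close> for even
  \<open>P\<close>.\<close>

lemma pi_power_P: "\<pi> ^ (P + P) \<in> zideal N (of_nat p)"
proof -
  have z: "(\<zeta> ^ n') ^ P = 1" using zeta_N by (simp add: N_eq mult.commute flip: power_mult)
  have "((1::complex) + - (\<zeta> ^ n')) ^ P - (1 ^ P + (- (\<zeta> ^ n')) ^ P) \<in> zideal N (of_nat p)"
    by (rule frobenius_power) auto
  then have *: "\<pi> ^ P - (1 + (- 1) ^ P * (\<zeta> ^ n') ^ P) \<in> zideal N (of_nat p)"
    by (simp add: \<pi>_def power_minus[of "\<zeta> ^ n'"])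
  have "1 + (- 1) ^ P * (\<zeta> ^ n') ^ P \<in> zideal N (of_nat p)"
  proof (cases "even P")
    case False
    then show ?thesis using z by (simp add: zideal_closed)
  next
    case True
    then have "even p" using even_power by blast
    then have "p = 2" using p primes_dvd_imp_eq two_is_prime_nat by blast
    moreover have "1 + (- 1) ^ P * (\<zeta> ^ n') ^ P = of_nat 2 * 1" using True z by simp
    ultimately show ?thesis using zideal_closed(7)[of 1 "of_nat p"] by simp
  qed
  then have "\<pi> ^ P \<in> zideal N (of_nat p)" using zideal_closed(2)[OF *] by force
  then show ?thesis unfolding power_add by (rule zideal_closed) auto
qed

lemma root_of_unity_cong: assumes "y ^ P = 1" shows "y \<in> \<O>" "1 - y \<in> zideal N \<pi>"
proof -
  have "y ^ N = 1" using assms by (simp add: N_eq power_mult)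
  then show y: "y \<in> \<O>" by (rule zint_root_of_unity)
  obtain k where k: "y = \<zeta> ^ k" using root_of_unity_eq[OF \<open>y ^ N = 1\<close>] by metis
  then have "N dvd k * P" using assms zeta_power_eq_1_iff[of "k * P"] by (simp add: power_mult)
  then have "n' dvd k" using p_pos by (simp add: N_eq)
  then obtain j where "k = n' * j" by (rule dvdE)
  then have "1 - y = 1 ^ j - (\<zeta> ^ n') ^ j" by (simp add: k power_mult)
  also have "\<dots> \<in> zideal N \<pi>"
  proof (rule ideal_power_diff)
    show "1 - \<zeta> ^ n' \<in> zideal N \<pi>" using zideal_closed(7)[of 1 \<pi>] by (simp add: \<pi>_def)
  qed auto
  finally show "1 - y \<in> zideal N \<pi>" .
qed

lemma ideal_1_minus_trans: "x ^ P = 1 \<Longrightarrow> y \<in> \<O> \<Longrightarrow> y - y * x \<in> zideal N \<pi>"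
  using zideal_closed(6)[OF root_of_unity_cong(2), of x y] by (simp add: algebra_simps)

text \<open>\<open>p\<close> is the sum of \<open>1 - z ^ k\<close> over the \<open>p\<close>-th
  roots of unity \<open>z ^ k\<close>, because those sum to zero.\<close>

lemma of_p_in_pi: "of_nat p \<in> zideal N \<pi>"
proof -
  define z where "z = \<zeta> ^ (N div p)"
  have pN: "p dvd N" using s by (simp add: N_eq)
  have zp: "z ^ p = 1" using pN zeta_N by (simp add: z_def flip: power_mult)
  have "z \<noteq> 1"
  proof
    assume "z = 1"
    then have "N dvd N div p" using zeta_power_eq_1_iff by (simp add: z_def)
    moreover have "N div p < N" using N_pos p prime_gt_1_nat by auto
    moreover have "N div p > 0" using pN N_pos by (metis dvd_mult_div_cancel mult_0_right not_gr_zero)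
    ultimately show False using dvd_imp_le by fastforce
  qed
  then have 0: "(\<Sum>k<p. z ^ k) = 0" using zp by (rule sum_powers_root_of_unity[rotated])
  have zP: "(z ^ k) ^ P = 1" for k
  proof -
    have "P = p * p ^ (s - 1)" using s by (cases s) auto
    then have "(z ^ k) ^ P = (z ^ p) ^ (k * p ^ (s - 1))"
      by (simp only: power_mult[symmetric] mult_ac)
    then show ?thesis using zp by simp
  qed
  have "of_nat p = (\<Sum>k<p. 1 - z ^ k)" using 0 by (simp add: sum_subtractf)
  also have "\<dots> \<in> zideal N \<pi>" by (intro zideal_sum root_of_unity_cong zP)
  finally show ?thesis .
qed

lemma p_ideal_in_pi: "x \<in> zideal N (of_nat p) \<Longrightarrow> x \<in> zideal N \<pi>"
  using zideal_mono[OF of_p_in_pi] by blast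

lemma zideal_power: "x \<in> zideal N u \<Longrightarrow> x ^ k \<in> zideal N (u ^ k)"
proof -
  assume "x \<in> zideal N u"
  then obtain y where "x = u * y" "y \<in> \<O>" by (auto simp: zideal_def)
  then have "x ^ k = u ^ k * y ^ k" "y ^ k \<in> \<O>" by (auto simp: power_mult_distrib)
  then show ?thesis by (auto simp: zideal_def)
qed

text \<open>Raising to the power \<open>P + P\<close> replaces divisibility by \<open>\<pi>\<close>
  with divisibility by \<open>p\<close>, which descends to the integers.\<close>

lemma int_in_pi_iff: "of_int a \<in> zideal N \<pi> \<longleftrightarrow> int p dvd a"
proof
  assume "of_int a \<in> zideal N \<pi>"
  then have "of_int a ^ (P + P) \<in> zideal N (\<pi> ^ (P + P))" by (rule zideal_power)
  then have "of_int a ^ (P + P) \<in> zideal N (of_nat p)" using zideal_mono[OF pi_power_P] by blast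
  then obtain z where "z \<in> \<O>" "of_int (a ^ (P + P)) = of_int (int p) * z" by (auto simp: zideal_def)
  then have "int p dvd a ^ (P + P)" using p_pos by (intro zint_multiple_int) auto
  moreover have "prime (int p)" using p by simp
  ultimately show "int p dvd a" using prime_dvd_power by metis
next
  assume "int p dvd a"
  then obtain b where "a = int p * b" by (rule dvdE)
  then have "of_int a = of_nat p * (of_int b :: complex)" by simp
  then show "of_int a \<in> zideal N \<pi>" using zideal_closed(5)[OF of_p_in_pi] by simp
qed

lemma nat_in_pi_iff: "of_nat a \<in> zideal N \<pi> \<longleftrightarrow> p dvd a"
  using int_in_pi_iff[of "int a"] by simp

lemma cancel_coprime:
  assumes "coprime d p" "z \<in> \<O>" "of_nat d * z \<in> zideal N \<pi>"
  shows "z \<in> zideal N \<pi>"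
proof -
  have "gcd (int d) (int p) = 1" using assms(1) by simp
  then obtain x y where xy: "x * int d + y * int p = 1"
    using bezout_int[of "int d" "int p"] by metis
  have "z = of_int (x * int d + y * int p) * z" using xy by simp
  also have "\<dots> = of_int x * (of_nat d * z) + of_int y * z * of_nat p"
    by (simp add: algebra_simps)
  also have "\<dots> \<in> zideal N \<pi>"
    by (intro zideal_closed(2) zideal_closed(6)[OF assms(3)] zideal_closed(6)[OF of_p_in_pi]
        zint_closed zint_intros assms(2))
  finally show ?thesis .
qed

lemma cancel_coprime_power:
  assumes "coprime d p" "z \<in> \<O>" "of_nat d * z \<in> zideal N (of_nat p ^ k)"
  shows "z \<in> zideal N (of_nat p ^ k)"
proof -
  have "coprime d (p ^ k)" using assms(1) by simp
  then have "gcd (int d) (int (p ^ k)) = 1" by (metis coprime_iff_gcd_eq_1 coprime_int_iff)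
  then obtain x y where xy: "x * int d + y * int (p ^ k) = 1"
    using bezout_int[of "int d" "int (p ^ k)"] by metis
  have "z = of_int (x * int d + y * int (p ^ k)) * z" using xy by simp
  also have "\<dots> = of_int x * (of_nat d * z) + of_nat p ^ k * (of_int y * z)"
    by (simp add: algebra_simps)
  also have "\<dots> \<in> zideal N (of_nat p ^ k)"
    using assms by (intro zideal_closed(2)[OF zideal_closed(6) zideal_closed(7)]) auto
  finally show ?thesis .
qed

text \<open>Roots of unity of \<open>p\<close>-power order are 1 modulo \<open>\<pi>\<close>, so
  only the residue of \<open>k\<close> modulo \<open>n'\<close> matters here. Its residue modulo
  \<open>P\<close> stays free, and \<open>tw\<close> below exploits this freedom.\<close>

lemma frobenius_sigma:
  assumes "coprime k N" "[k = p ^ j] (mod n')" "z \<in> \<O>"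
  shows "z ^ (p ^ j) - \<sigma> k z \<in> zideal N \<pi>"
proof -
  obtain c :: "nat \<Rightarrow> int" where c: "z = (\<Sum>i<N. of_int (c i) * \<zeta> ^ i)" using zint_coeffs[OF assms(3)] .
  have 1: "(\<Sum>i\<in>A. of_int (c i) * \<zeta> ^ i) ^ (p ^ j) - (\<Sum>i\<in>A. (of_int (c i) * \<zeta> ^ i) ^ (p ^ j)) \<in> zideal N \<pi>"
    if "finite A" for A using that
  proof induction
    case empty
    then show ?case using p_pos by (simp add: zero_power zideal_closed)
  next
    case (insert x A)
    let ?s = "\<Sum>i\<in>A. of_int (c i) * \<zeta> ^ i" and ?a = "of_int (c x) * \<zeta> ^ x"
    have "(?a + ?s) ^ (p ^ j) - (?a ^ (p ^ j) + ?s ^ (p ^ j)) \<in> zideal N \<pi>"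
      by (intro p_ideal_in_pi frobenius_power) auto
    from zideal_closed(2)[OF this insert.IH] insert.hyps show ?case
      by (simp add: algebra_simps)
  qed
  have int: "of_int a ^ (p ^ j) - (of_int a :: complex) \<in> zideal N \<pi>" for a
  proof (induction j)
    case 0
    then show ?case by (simp add: zideal_closed)
  next
    case (Suc j)
    have "(of_int a ^ (p ^ j)) ^ p - (of_int a :: complex) ^ p \<in> zideal N \<pi>"
      by (rule ideal_power_diff[OF _ _ Suc]) auto
    moreover have "of_int a ^ p - (of_int a :: complex) \<in> zideal N \<pi>"
      by (intro p_ideal_in_pi fermat_int p)
    ultimately have "(of_int a ^ (p ^ j)) ^ p - (of_int a :: complex) \<in> zideal N \<pi>"
      using zideal_closed(2) by fastforce
    then show ?case by (simp add: mult.commute flip: power_mult)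
  qed
  have zk: "(\<zeta> ^ i) ^ (p ^ j) - (\<zeta> ^ k) ^ i \<in> zideal N \<pi>" for i
  proof -
    \<comment> \<open>Adding a multiple of \<open>n'\<close> makes the difference with
      \<open>p ^ j\<close> a natural number.\<close>
    define l where "l = k + n' * p ^ j"
    have "n' dvd l - p ^ j"
    proof -
      have "[l = p ^ j] (mod n')" using assms(2) by (simp add: l_def cong_def)
      moreover have "p ^ j \<le> l" using n'_pos by (simp add: l_def trans_le_add2)
      ultimately show ?thesis by (simp add: cong_altdef_nat)
    qed
    then obtain r where "l - p ^ j = n' * r" by (rule dvdE)
    moreover have "p ^ j \<le> l" using n'_pos by (simp add: l_def trans_le_add2)
    ultimately have r: "k + n' * p ^ j = p ^ j + n' * r" by (simp add: l_def)
    define u where "u = \<zeta> ^ n'"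
    have uP: "(u ^ a) ^ P = 1" for a
    proof -
      have "(u ^ a) ^ P = (\<zeta> ^ N) ^ a" by (simp add: u_def N_eq mult_ac flip: power_mult)
      then show ?thesis by (simp add: zeta_N)
    qed
    have "\<zeta> ^ k * u ^ (p ^ j) = \<zeta> ^ (p ^ j) * u ^ r"
      unfolding u_def power_mult[symmetric] power_add[symmetric] r ..
    then have "(\<zeta> ^ k * u ^ (p ^ j)) ^ i = (\<zeta> ^ (p ^ j) * u ^ r) ^ i" by simp
    then have e: "(\<zeta> ^ k) ^ i * u ^ (p ^ j * i) = (\<zeta> ^ i) ^ (p ^ j) * u ^ (r * i)"
      by (simp add: power_mult_distrib mult.commute flip: power_mult)
    have "(\<zeta> ^ k) ^ i - (\<zeta> ^ k) ^ i * u ^ (p ^ j * i) \<in> zideal N \<pi>"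
      "(\<zeta> ^ i) ^ (p ^ j) - (\<zeta> ^ i) ^ (p ^ j) * u ^ (r * i) \<in> zideal N \<pi>"
      by (intro ideal_1_minus_trans uP; auto)+
    from zideal_closed(3)[OF this(2) this(1)] show ?thesis by (simp add: e)
  qed
  have summand: "(of_int (c i) * \<zeta> ^ i) ^ (p ^ j) - of_int (c i) * (\<zeta> ^ k) ^ i \<in> zideal N \<pi>" for i
  proof -
    have "(of_int (c i) * \<zeta> ^ i) ^ (p ^ j) - of_int (c i) * (\<zeta> ^ k) ^ i =
      (of_int (c i) ^ (p ^ j) - of_int (c i)) * (\<zeta> ^ i) ^ (p ^ j) +
      of_int (c i) * ((\<zeta> ^ i) ^ (p ^ j) - (\<zeta> ^ k) ^ i)"
      by (simp add: algebra_simps power_mult_distrib)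
    also have "\<dots> \<in> zideal N \<pi>"
      using int[of "c i"] zk[of i] by (intro zideal_closed(2)[OF zideal_closed(5) zideal_closed(6)]) auto
    finally show ?thesis .
  qed
  have "\<sigma> k z = (\<Sum>i<N. of_int (c i) * (\<zeta> ^ k) ^ i)"
    unfolding c using assms(1)
    by (subst sigma_sum) (auto simp: sigma_mult zint_power sigma_power sigma_zeta)
  then have "z ^ (p ^ j) - \<sigma> k z = (z ^ (p ^ j) - (\<Sum>i<N. (of_int (c i) * \<zeta> ^ i) ^ (p ^ j))) +
      (\<Sum>i<N. (of_int (c i) * \<zeta> ^ i) ^ (p ^ j) - of_int (c i) * (\<zeta> ^ k) ^ i)"
    by (simp add: sum_subtractf)
  also have "\<dots> \<in> zideal N \<pi>"
    using 1[of "{..<N}"] by (intro zideal_closed(2) zideal_sum summand) (simp add: c)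
  finally show ?thesis .
qed

text \<open>The ring \<open>\<O> / \<pi>\<close> is reduced because a power of the Frobenius map is the identity on it.\<close>

lemma pi_radical:
  assumes "z \<in> \<O>" "z ^ k \<in> zideal N \<pi>"
  shows "z \<in> zideal N \<pi>"
proof -
  \<comment> \<open>\<open>p ^ f\<close> is 1 modulo \<open>n'\<close>, so the
    \<open>f * k\<close>-fold Frobenius is the identity modulo \<open>\<pi>\<close>, and its
    exponent \<open>p ^ (f * k)\<close> is at least \<open>k\<close>.\<close>
  define f where "f = totient n'"
  have f: "f > 0" using n'_pos by (simp add: f_def)
  have "[p ^ f = 1] (mod n')" unfolding f_def by (rule euler_theorem) (use n' in auto)
  then have "[(p ^ f) ^ k = 1 ^ k] (mod n')" by (rule cong_pow)
  then have "[1 = p ^ (f * k)] (mod n')" by (simp add: power_mult cong_sym_eq)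
  then have "z ^ (p ^ (f * k)) - \<sigma> 1 z \<in> zideal N \<pi>" using assms by (intro frobenius_sigma) auto
  then have *: "z ^ (p ^ (f * k)) - z \<in> zideal N \<pi>" using assms by (simp add: sigma_1)
  have "k \<le> p ^ (f * k)"
  proof -
    have "k < 2 ^ k" by (rule less_exp)
    also have "(2::nat) ^ k \<le> p ^ k" using prime_ge_2_nat[OF p] by (intro power_mono) auto
    also have "p ^ k \<le> p ^ (f * k)" using f p_pos by (intro power_increasing) auto
    finally show ?thesis by simp
  qed
  then have "z ^ (p ^ (f * k)) = z ^ k * z ^ (p ^ (f * k) - k)" by (simp flip: power_add)
  then have "z ^ (p ^ (f * k)) \<in> zideal N \<pi>" using assms by (auto intro: zideal_closed)
  from zideal_closed(3)[OF this *] show ?thesis by simp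
qed

text \<open>A root of unity \<open>u\<close> in \<open>\<O>\<close> is an \<open>N\<close>-th root of unity as soon as its order is a power
  of a prime dividing \<open>N\<close>: the automorphism \<open>\<zeta> \<mapsto> \<zeta>\<^sup>1\<^sup>+\<^sup>N\<close> of a larger cyclotomic
  ring fixes \<open>\<zeta>\<close>, hence \<open>u\<close>.\<close>

lemma p_power_root_of_unity:
  assumes u: "u \<in> \<O>" and a: "u ^ (p ^ a) = 1"
  shows "u ^ P = 1"
proof -
  interpret M: cyclotomic_integers "N * p ^ a" by unfold_locales (use N_pos p_pos in simp)
  obtain q where q: "u = ipol q \<zeta>" using u by (auto simp: zint_def)
  have zz: "\<zeta> = zeta (N * p ^ a) ^ (p ^ a)"
    using p_pos N_pos by (simp add: zeta_def DeMoivre field_simps)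
  have cop: "coprime (N + 1) (N * p ^ a)"
  proof -
    have "coprime (N + 1) N" by simp
    moreover have "p dvd N" using s by (simp add: N_eq)
    ultimately have "coprime (N + 1) p" by (meson coprime_divisors dvd_refl)
    moreover have "coprime (N + 1) N" by simp
    ultimately show ?thesis by simp
  qed
  have "u ^ (N * p ^ a) = (u ^ (p ^ a)) ^ N" by (simp add: mult.commute flip: power_mult)
  then have "u ^ (N * p ^ a) = 1" using a by simp
  then have 1: "M.\<sigma> (N + 1) u = u ^ (N + 1)" by (rule M.sigma_root_of_unity[OF cop])
  have zO: "\<zeta> \<in> zint (N * p ^ a)" unfolding zz by auto
  have "\<zeta> ^ (N * p ^ a) = 1" by (simp add: power_mult zeta_N)
  then have "M.\<sigma> (N + 1) \<zeta> = \<zeta> ^ (N + 1)" by (rule M.sigma_root_of_unity[OF cop])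
  then have zs: "M.\<sigma> (N + 1) \<zeta> = \<zeta>" by (simp add: zeta_N)
  have "M.\<sigma> (N + 1) (ipol r \<zeta>) = ipol r \<zeta>" for r
  proof (induction r)
    case 0
    show ?case using M.sigma_simps(1)[OF cop] by (simp add: ipol_simps)
  next
    case (pCons b r)
    then show ?case using M.zint_poly[OF zO, of r] zO cop zs
      by (simp add: ipol_simps M.sigma_add M.sigma_mult M.zint_closed)
  qed
  then have "u ^ (N + 1) = u" using 1 q by simp
  moreover have "u \<noteq> 0" using a p_pos by (auto simp: zero_power)
  ultimately have uN: "u ^ N = 1" by simp
  have "u ^ gcd N (p ^ a) = 1"
  proof -
    obtain x y where xy: "N * x = p ^ a * y + gcd N (p ^ a)"
      using bezout_nat[of N "p ^ a"] N_pos by auto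
    have "u ^ (N * x) = u ^ (p ^ a * y) * u ^ gcd N (p ^ a)" unfolding xy by (rule power_add)
    then show ?thesis using uN a by (simp add: power_mult)
  qed
  moreover have "gcd N (p ^ a) dvd P"
  proof -
    have "coprime (gcd N (p ^ a)) n'"
      using n' by (meson coprime_divisors coprime_power_left_iff dvd_refl gcd_dvd2)
    moreover have "gcd N (p ^ a) dvd P * n'" by (simp add: N_eq)
    ultimately show ?thesis by (simp add: coprime_dvd_mult_left_iff)
  qed
  ultimately show ?thesis by (metis dvd_def power_mult power_one)
qed

text \<open>Split off the \<open>p\<close>-part of the order. What remains is a \<open>v\<close>
  with \<open>v ^ r' = 1\<close>, where \<open>r'\<close> is prime to \<open>p\<close>, and
  \<open>v\<close> is 1 modulo \<open>\<pi>\<close>. If \<open>v\<close> were not 1, its powers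
  would sum to zero, while modulo \<open>\<pi>\<close> they sum to \<open>r'\<close>.\<close>

lemma root_of_unity_cong_1:
  assumes u: "u \<in> \<O>" and r: "r > 0" "u ^ r = 1" and c: "u - 1 \<in> zideal N \<pi>"
  shows "u ^ P = 1"
proof -
  define a where "a = multiplicity p r"
  obtain r' where r': "r = p ^ a * r'" "\<not> p dvd r'"
    using multiplicity_decompose'[of r p] r p not_prime_unit unfolding a_def by blast
  define v where "v = u ^ (p ^ a)"
  have v1: "v - 1 \<in> zideal N \<pi>" using ideal_power_diff[OF u _ c, of "p ^ a"] by (simp add: v_def)
  have vO: "v \<in> \<O>" using u by (auto simp: v_def)
  have vr: "v ^ r' = 1" using r r' by (simp add: v_def flip: power_mult)
  have "v = 1"
  proof (rule ccontr)
    assume "v \<noteq> 1"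
    then have 0: "(\<Sum>k<r'. v ^ k) = 0" using vr by (rule sum_powers_root_of_unity[rotated])
    have "v ^ k - 1 \<in> zideal N \<pi>" for k using ideal_power_diff[OF vO _ v1, of k] by simp
    then have "(\<Sum>k<r'. v ^ k - 1) \<in> zideal N \<pi>" by (intro zideal_sum)
    then have "- of_nat r' \<in> zideal N \<pi>" using 0 by (simp add: sum_subtractf)
    then have "of_nat r' \<in> zideal N \<pi>" using zideal_closed(4) by fastforce
    then show False using r' nat_in_pi_iff by simp
  qed
  then show ?thesis using p_power_root_of_unity[OF u] by (simp add: v_def)
qed

end

section \<open>Matrices of finite support\<close>

text \<open>All matrices live in one (non-unital) ring, the finitely supported complex matrices indexed by
  the natural numbers; \<open>n \<times> n\<close> matrices form the corner cut out by \<open>un n\<close>.  This keeps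
  size conditions out of the ring laws.\<close>

typedef cmat = "{A :: nat \<Rightarrow> nat \<Rightarrow> complex. \<exists>n. \<forall>i j. n \<le> i \<or> n \<le> j \<longrightarrow> A i j = 0}"
  morphisms ent Cmat
  by (rule exI[of _ "\<lambda>_ _. 0"]) auto

setup_lifting type_definition_cmat

definition supp :: "nat \<Rightarrow> cmat \<Rightarrow> bool" where
  "supp n A \<longleftrightarrow> (\<forall>i j. n \<le> i \<or> n \<le> j \<longrightarrow> ent A i j = 0)"

lemma supp_exists: "\<exists>n. supp n A"
  using ent[of A] by (auto simp: supp_def)

lemma supp_mono: "supp n A \<Longrightarrow> n \<le> n' \<Longrightarrow> supp n' A"
  by (auto simp: supp_def)

lemma supp_exists2: obtains n where "supp n A" "supp n B"
  using supp_exists[of A] supp_exists[of B] supp_mono max.cobounded1 max.cobounded2 by metis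

lemma cmat_eqI: "(\<And>i j. ent A i j = ent B i j) \<Longrightarrow> A = B"
  by (metis ent_inverse ext)

instantiation cmat :: ab_group_add
begin
lift_definition zero_cmat :: cmat is "\<lambda>_ _. 0" by auto
lift_definition plus_cmat :: "cmat \<Rightarrow> cmat \<Rightarrow> cmat" is "\<lambda>A B i j. A i j + B i j"
  by (metis (no_types, opaque_lifting) add.right_neutral max.cobounded1 max.cobounded2 order_trans)
lift_definition uminus_cmat :: "cmat \<Rightarrow> cmat" is "\<lambda>A i j. - A i j"
  by (metis neg_0_equal_iff_equal)
definition minus_cmat :: "cmat \<Rightarrow> cmat \<Rightarrow> cmat" where "minus_cmat A B = A + - B"
instance
  by standard (transfer; auto simp: minus_cmat_def algebra_simps)+
end

lemma ent_simps [simp]: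
  "ent 0 i j = 0" "ent (A + B) i j = ent A i j + ent B i j" "ent (- A) i j = - ent A i j"
  "ent (A - B) i j = ent A i j - ent B i j"
proof -
  show "ent 0 i j = 0" "ent (A + B) i j = ent A i j + ent B i j" "ent (- A) i j = - ent A i j"
    by (transfer; simp)+
  then show "ent (A - B) i j = ent A i j - ent B i j"
    unfolding minus_cmat_def plus_cmat.rep_eq uminus_cmat.rep_eq by simp
qed

lemma ent_sum [simp]: "ent (sum f S) i j = (\<Sum>x\<in>S. ent (f x) i j)"
  by (induction S rule: infinite_finite_induct) auto

text \<open>The sum over the nonzero entries of a row is finite by the support condition and
  mentions no size; \<open>tms_eq\<close> gives the usual form.\<close>

definition tms :: "cmat \<Rightarrow> cmat \<Rightarrow> nat \<Rightarrow> nat \<Rightarrow> complex" where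
  "tms A B i j = (\<Sum>k | ent A i k \<noteq> 0. ent A i k * ent B k j)"

lemma tms_eq: assumes "supp n A" shows "tms A B i j = (\<Sum>k<n. ent A i k * ent B k j)"
  unfolding tms_def by (rule sum.mono_neutral_left) (use assms in \<open>auto simp: supp_def not_le[symmetric]\<close>)

instantiation cmat :: times
begin
definition times_cmat :: "cmat \<Rightarrow> cmat \<Rightarrow> cmat" where "A * B = Cmat (tms A B)"
instance ..
end

lemma ent_times_raw: "ent (A * B) i j = tms A B i j"
proof -
  obtain n where n: "supp n A" "supp n B" by (rule supp_exists2)
  have "tms A B \<in> {A. \<exists>n. \<forall>i j. n \<le> i \<or> n \<le> j \<longrightarrow> A i j = 0}"
    using n by (auto simp: tms_eq[OF n(1)] supp_def intro!: exI[of _ n])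
  then show ?thesis by (simp add: times_cmat_def Cmat_inverse)
qed

lemma ent_times: "supp n A \<Longrightarrow> ent (A * B) i j = (\<Sum>k<n. ent A i k * ent B k j)"
  by (simp add: ent_times_raw tms_eq)

lemma supp_times [intro]: "supp n A \<Longrightarrow> supp n B \<Longrightarrow> supp n (A * B)"
  unfolding supp_def[of n "A * B"] by (auto simp: ent_times) (auto simp: supp_def)

instance cmat :: ring
proof
  fix A B C :: cmat
  obtain n where n: "supp n A" "supp n B" by (rule supp_exists2)
  then have n': "supp n (A * B)" "supp n (A + B)" by (auto simp: supp_def[of n "A + B"]) (auto simp: supp_def)
  show "A * B * C = A * (B * C)"
  proof (rule cmat_eqI)
    fix i j
    have "ent (A * B * C) i j = (\<Sum>k<n. \<Sum>l<n. ent A i l * ent B l k * ent C k j)"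
      by (simp add: ent_times[OF n'(1)] ent_times[OF n(1)] sum_distrib_right)
    also have "\<dots> = (\<Sum>l<n. \<Sum>k<n. ent A i l * ent B l k * ent C k j)" by (rule sum.swap)
    also have "\<dots> = ent (A * (B * C)) i j"
      by (simp add: ent_times[OF n(1)] ent_times[OF n(2)] sum_distrib_left mult.assoc)
    finally show "ent (A * B * C) i j = ent (A * (B * C)) i j" .
  qed
  show "(A + B) * C = A * C + B * C"
    by (rule cmat_eqI) (simp add: ent_times[OF n(1)] ent_times[OF n(2)] ent_times[OF n'(2)] sum.distrib ring_distribs)
  show "A * (B + C) = A * B + A * C"
    by (rule cmat_eqI) (simp add: ent_times[OF n(1)] sum.distrib ring_distribs)
qed

lift_definition sc :: "complex \<Rightarrow> cmat \<Rightarrow> cmat" is "\<lambda>c A i j. c * A i j"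
  by (metis mult_zero_right)

lift_definition un :: "nat \<Rightarrow> cmat" is "\<lambda>n i j. if i = j \<and> i < n then 1 else 0"
  using leD by metis

lift_definition adj :: "cmat \<Rightarrow> cmat" is "\<lambda>A i j. cnj (A j i)"
  by (metis complex_cnj_zero)

definition tr :: "cmat \<Rightarrow> complex" where "tr A = (\<Sum>i | ent A i i \<noteq> 0. ent A i i)"

lemma ent_sc [simp]: "ent (sc c A) i j = c * ent A i j" by transfer simp
lemma ent_un [simp]: "ent (un n) i j = (if i = j \<and> i < n then 1 else 0)" by transfer simp
lemma ent_adj [simp]: "ent (adj A) i j = cnj (ent A j i)" by transfer simp

lemma supp_intros [intro, simp]:
  "supp n 0" "supp n (un n)" "supp n A \<Longrightarrow> supp n (sc c A)" "supp n A \<Longrightarrow> supp n (adj A)"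
  "supp n A \<Longrightarrow> supp n B \<Longrightarrow> supp n (A + B)" "supp n A \<Longrightarrow> supp n B \<Longrightarrow> supp n (A - B)"
  "supp n A \<Longrightarrow> supp n (- A)"
  by (auto simp: supp_def)

lemma supp_sum [intro]: "(\<And>x. x \<in> S \<Longrightarrow> supp n (f x)) \<Longrightarrow> supp n (sum f S)"
  by (auto simp: supp_def)

lemma tr_eq: "supp n A \<Longrightarrow> tr A = (\<Sum>i<n. ent A i i)"
  unfolding tr_def by (rule sum.mono_neutral_left) (auto simp: supp_def not_le[symmetric])

lemma un_times [simp]: "supp n A \<Longrightarrow> un n * A = A" "supp n A \<Longrightarrow> A * un n = A"
proof -
  assume A: "supp n A"
  have un: "supp n (un n)" by (auto simp: supp_def)
  show "un n * A = A"
  proof (rule cmat_eqI)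
    fix i j
    have "ent (un n * A) i j = (\<Sum>k<n. if k = i then ent A i j else 0)"
      unfolding ent_times[OF un] by (intro sum.cong) auto
    then show "ent (un n * A) i j = ent A i j" using A by (auto simp: supp_def)
  qed
  show "A * un n = A"
  proof (rule cmat_eqI)
    fix i j
    have "ent (A * un n) i j = (\<Sum>k<n. if k = j then ent A i j else 0)"
      unfolding ent_times[OF A] by (intro sum.cong) auto
    then show "ent (A * un n) i j = ent A i j" using A by (auto simp: supp_def)
  qed
qed

lemma sc_simps [simp]:
  "sc c A * B = sc c (A * B)" "A * sc c B = sc c (A * B)" "sc c (sc d A) = sc (c * d) A"
  "sc 1 A = A" "sc 0 A = 0" "sc c 0 = 0" "sc (- 1) A = - A"
proof -
  obtain n where n: "supp n A" "supp n (sc c A)" by (rule supp_exists2)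
  show "sc c A * B = sc c (A * B)" "A * sc c B = sc c (A * B)"
    by (rule cmat_eqI, simp add: ent_times[OF n(1)] ent_times[OF n(2)] sum_distrib_left mult_ac)+
qed (rule cmat_eqI, simp)+

lemma sc_add: "sc c (A + B) = sc c A + sc c B" "sc (c + d) A = sc c A + sc d A"
  "sc c (A - B) = sc c A - sc c B" "sc (c - d) A = sc c A - sc d A" "sc c (- A) = - sc c A" "sc (- c) A = - sc c A"
  by (rule cmat_eqI, simp add: algebra_simps)+

lemma sc_sum: "sc c (sum f S) = (\<Sum>x\<in>S. sc c (f x))" "sc (sum g S) A = (\<Sum>x\<in>S. sc (g x) A)"
  by (rule cmat_eqI, simp add: sum_distrib_left sum_distrib_right)+

lemma sc_eq_0_iff: "sc c A = 0 \<longleftrightarrow> c = 0 \<or> A = 0"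
proof
  assume h: "sc c A = 0"
  show "c = 0 \<or> A = 0"
  proof (cases "c = 0")
    case False
    have "A = sc (inverse c) (sc c A)" using False by (simp only: sc_simps) simp
    then show ?thesis using h by simp
  qed simp
qed auto

lemma sc_cancel: "sc c A = sc c B \<Longrightarrow> c \<noteq> 0 \<Longrightarrow> A = B"
  using sc_eq_0_iff[of c "A - B"] by (simp add: sc_add)

lemma tr_simps [simp]:
  "tr 0 = 0" "tr (A + B) = tr A + tr B" "tr (A - B) = tr A - tr B" "tr (- A) = - tr A"
  "tr (sc c A) = c * tr A" "tr (un n) = of_nat n"
proof -
  obtain n where n: "supp n A" "supp n B" by (rule supp_exists2)
  show "tr (A + B) = tr A + tr B" "tr (A - B) = tr A - tr B" "tr (- A) = - tr A"
    "tr (sc c A) = c * tr A"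
    using n by (simp_all add: tr_eq[of n] sum.distrib sum_subtractf sum_negf sum_distrib_left)
qed (simp_all add: tr_eq[of 0] tr_eq[of n "un n"])

lemma tr_sum [simp]: "tr (sum f S) = (\<Sum>x\<in>S. tr (f x))"
  by (induction S rule: infinite_finite_induct) auto

lemma tr_comm: "tr (A * B) = tr (B * A)"
proof -
  obtain n where n: "supp n A" "supp n B" by (rule supp_exists2)
  have "tr (A * B) = (\<Sum>i<n. \<Sum>k<n. ent A i k * ent B k i)"
    using n by (subst tr_eq[of n]) (auto simp: ent_times[of n])
  also have "\<dots> = (\<Sum>k<n. \<Sum>i<n. ent B k i * ent A i k)"
    by (subst sum.swap) (simp add: mult.commute)
  also have "\<dots> = tr (B * A)" using n by (subst tr_eq[of n]) (auto simp: ent_times[of n])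
  finally show ?thesis .
qed

lemma adj_simps [simp]:
  "adj (A * B) = adj B * adj A" "adj (adj A) = A" "adj (A + B) = adj A + adj B"
  "adj (sc c A) = sc (cnj c) (adj A)" "adj (un n) = un n" "adj 0 = 0"
proof -
  obtain n where n: "supp n A" "supp n B" by (rule supp_exists2)
  show "adj (A * B) = adj B * adj A"
    by (rule cmat_eqI) (use n in \<open>simp add: ent_times[of n] mult.commute\<close>)
qed (rule cmat_eqI, simp)+

text \<open>The size \<open>n\<close> only selects the identity \<open>un n\<close> that serves as
  zeroth power.\<close>

primrec mpow :: "nat \<Rightarrow> cmat \<Rightarrow> nat \<Rightarrow> cmat" where
  "mpow n A 0 = un n"
| "mpow n A (Suc k) = A * mpow n A k"

lemma supp_mpow [intro, simp]: "supp n A \<Longrightarrow> supp n (mpow n A k)"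
  by (induction k) auto

lemma mpow_add: "supp n A \<Longrightarrow> mpow n A (j + k) = mpow n A j * mpow n A k"
  by (induction j) (auto simp: mult.assoc)

lemma mpow_Suc_right: "supp n A \<Longrightarrow> mpow n A (Suc k) = mpow n A k * A"
  using mpow_add[of n A k 1] by simp

lemma mpow_un [simp]: "mpow n (un n) k = un n"
  by (induction k) auto

lemma mpow_mult: "supp n A \<Longrightarrow> mpow n A (j * k) = mpow n (mpow n A j) k"
  by (induction k) (simp_all add: mpow_add)

lemma mpow_sc: "supp n A \<Longrightarrow> mpow n (sc c A) k = sc (c ^ k) (mpow n A k)"
  by (induction k) (auto simp: mult.commute)

lemma mpow_conj:
  assumes "supp n A" "supp n X" "supp n Y" "Y * X = un n" "X * Y = un n"
  shows "mpow n (X * A * Y) k = X * mpow n A k * Y"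
proof (induction k)
  case (Suc k)
  have "mpow n (X * A * Y) (Suc k) = X * A * (Y * X * mpow n A k) * Y"
    unfolding mpow.simps(2) Suc by (simp only: mult.assoc)
  then show ?case using assms by (simp add: mult.assoc)
qed (use assms in simp)

text \<open>Rank at most one: the zero matrix qualifies too, and a trace equal to 1 excludes it in
  \<open>good\<close> and \<open>idem\<close>.\<close>

definition rank1 :: "cmat \<Rightarrow> bool" where "rank1 A \<longleftrightarrow> (\<exists>a b. \<forall>i j. ent A i j = a i * b j)"

text \<open>Between two copies of \<open>A\<close> any \<open>X\<close> collapses to a scalar. This
  fuses a product of two traces into one, and conversely splits the trace of a path that returns to
  the same idempotent.\<close>

lemma rank1_sandwich: assumes "rank1 A" shows "A * X * A = sc (tr (A * X)) A"
proof -
  obtain a b where ab: "\<And>i j. ent A i j = a i * b j" using assms by (auto simp: rank1_def)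
  obtain n where n: "supp n A" "supp n X" by (rule supp_exists2)
  show ?thesis
  proof (rule cmat_eqI)
    fix i j
    have AX: "supp n (A * X)" using n by auto
    have "ent (A * X * A) i j = (\<Sum>k<n. (\<Sum>l<n. a i * b l * ent X l k) * (a k * b j))"
      by (simp add: ent_times[OF AX] ent_times[OF n(1)] ab)
    also have "\<dots> = (\<Sum>k<n. \<Sum>l<n. a k * b l * ent X l k) * (a i * b j)"
      by (simp add: sum_distrib_left sum_distrib_right mult_ac)
    also have "(\<Sum>k<n. \<Sum>l<n. a k * b l * ent X l k) = tr (A * X)"
      by (simp add: tr_eq[OF AX] ent_times[OF n(1)] ab)
    finally show "ent (A * X * A) i j = ent (sc (tr (A * X)) A) i j" by (simp add: ab)
  qed
qed

subsection \<open>Kronecker products\<close>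

text \<open>\<open>kr k A B\<close> uses \<open>k\<close> as the size of the right factor.\<close>

definition kr :: "nat \<Rightarrow> cmat \<Rightarrow> cmat \<Rightarrow> cmat" where
  "kr k A B = Cmat (\<lambda>i j. ent A (i div k) (j div k) * ent B (i mod k) (j mod k))"

lemma ent_kr: assumes "k > 0" shows "ent (kr k A B) i j = ent A (i div k) (j div k) * ent B (i mod k) (j mod k)"
proof -
  obtain n where n: "supp n A" using supp_exists by auto
  have "n \<le> i div k" if "n * k \<le> i" for i using that assms by (metis div_le_mono div_mult_self_is_m)
  then have "(\<lambda>i j. ent A (i div k) (j div k) * ent B (i mod k) (j mod k)) \<in>
    {A. \<exists>n. \<forall>i j. n \<le> i \<or> n \<le> j \<longrightarrow> A i j = 0}"
    using n by (auto simp: supp_def intro!: exI[of _ "n * k"])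
  then show ?thesis by (simp add: kr_def Cmat_inverse)
qed

lemma supp_kr: assumes "k > 0" "supp n A" "supp k B" shows "supp (n * k) (kr k A B)"
proof -
  have "n \<le> i div k" if "n * k \<le> i" for i using that assms(1) by (metis div_le_mono div_mult_self_is_m)
  then show ?thesis using assms unfolding supp_def[of "n * k"] by (auto simp: ent_kr supp_def)
qed

lemma sum_div_mod:
  fixes k n :: nat and f :: "nat \<Rightarrow> nat \<Rightarrow> complex"
  shows "k > 0 \<Longrightarrow> (\<Sum>t<n * k. f (t div k) (t mod k)) = (\<Sum>s<n. \<Sum>r<k. f s r)"
proof -
  assume k: "k > 0"
  have "(\<Sum>t<n * k. f (t div k) (t mod k)) = (\<Sum>(s, r)\<in>{..<n} \<times> {..<k}. f s r)"
  proof (rule sum.reindex_bij_witness[where i = "\<lambda>(s, r). s * k + r" and j = "\<lambda>t. (t div k, t mod k)"])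
    fix x assume "x \<in> {..<n} \<times> {..<k}"
    then obtain s r where x: "x = (s, r)" "s < n" "r < k" by auto
    have "s * k + r < (s + 1) * k" using x by simp
    also have "\<dots> \<le> n * k" using x by (intro mult_right_mono) auto
    finally show "(case x of (s, r) \<Rightarrow> s * k + r) \<in> {..<n * k}" using x by simp
  qed (use k in \<open>auto simp: less_mult_imp_div_less\<close>)
  then show ?thesis by (simp add: sum.cartesian_product)
qed

lemma kr_mult:
  assumes "k > 0" "supp k B"
  shows "kr k A B * kr k C D = kr k (A * C) (B * D)"
proof (rule cmat_eqI)
  fix i j
  obtain n where n: "supp n A" using supp_exists by auto
  have "ent (kr k A B * kr k C D) i j = (\<Sum>t<n * k. (ent A (i div k) (t div k) * ent B (i mod k) (t mod k)) *
      (ent C (t div k) (j div k) * ent D (t mod k) (j mod k)))"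
    unfolding ent_times[OF supp_kr[OF assms(1) n assms(2)]] using assms(1) by (simp only: ent_kr)
  also have "\<dots> = (\<Sum>s<n. \<Sum>r<k. (ent A (i div k) s * ent B (i mod k) r) * (ent C s (j div k) * ent D r (j mod k)))"
    using assms(1) by (rule sum_div_mod)
  also have "\<dots> = (\<Sum>s<n. ent A (i div k) s * ent C s (j div k)) * (\<Sum>r<k. ent B (i mod k) r * ent D r (j mod k))"
    by (simp add: sum_product mult_ac)
  also have "\<dots> = ent (kr k (A * C) (B * D)) i j"
    using assms n by (simp add: ent_kr ent_times)
  finally show "ent (kr k A B * kr k C D) i j = ent (kr k (A * C) (B * D)) i j" .
qed

lemma tr_kr: "k > 0 \<Longrightarrow> supp k B \<Longrightarrow> tr (kr k A B) = tr A * tr B"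
proof -
  assume k: "k > 0" and B: "supp k B"
  obtain n where n: "supp n A" using supp_exists by auto
  show ?thesis using k
    by (simp add: tr_eq[OF supp_kr[OF k n B]] tr_eq[OF n] tr_eq[OF B] ent_kr sum_product
      sum_div_mod[OF k, where n = n and f = "\<lambda>s r. ent A s s * ent B r r"])
qed

lemma kr_un: "k > 0 \<Longrightarrow> kr k (un n) (un k) = un (n * k)"
proof (rule cmat_eqI)
  fix i j assume k: "k > 0"
  have "i = j \<longleftrightarrow> i div k = j div k \<and> i mod k = j mod k" by (metis div_mult_mod_eq)
  moreover have "i div k < n \<longleftrightarrow> i < n * k" using k by (simp add: div_less_iff_less_mult)
  ultimately show "ent (kr k (un n) (un k)) i j = ent (un (n * k)) i j" using k by (auto simp: ent_kr)
qed

lemma kr_simps: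
  assumes "k > 0"
  shows "kr k (A + A') B = kr k A B + kr k A' B" "kr k A (B + B') = kr k A B + kr k A B'"
    "kr k (sc c A) B = sc c (kr k A B)" "kr k A (sc c B) = sc c (kr k A B)"
    "adj (kr k A B) = kr k (adj A) (adj B)" "kr k 0 B = 0" "kr k A 0 = 0"
  using assms by (intro cmat_eqI; simp add: ent_kr algebra_simps)+

lemma kr_sum:
  assumes "k > 0"
  shows "kr k (sum f S) B = (\<Sum>x\<in>S. kr k (f x) B)" "kr k A (sum f S) = (\<Sum>x\<in>S. kr k A (f x))"
  using assms by (intro cmat_eqI; simp add: ent_kr sum_distrib_left sum_distrib_right)+

lemma rank1_kr: assumes "k > 0" "rank1 A" "rank1 B" shows "rank1 (kr k A B)"
proof -
  obtain a b where ab: "\<And>i j. ent A i j = a i * b j" using assms by (auto simp: rank1_def)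
  obtain a' b' where ab': "\<And>i j. ent B i j = a' i * b' j" using assms by (auto simp: rank1_def)
  show ?thesis unfolding rank1_def using assms(1)
    by (intro exI[of _ "\<lambda>i. a (i div k) * a' (i mod k)"] exI[of _ "\<lambda>j. b (j div k) * b' (j mod k)"])
      (simp add: ent_kr ab ab')
qed

lemma mpow_kr: "k > 0 \<Longrightarrow> supp n A \<Longrightarrow> supp k B \<Longrightarrow> mpow (n * k) (kr k A B) r = kr k (mpow n A r) (mpow k B r)"
  by (induction r) (auto simp: kr_un kr_mult)

subsection \<open>Comparison with matrices of fixed size\<close>

definition emb :: "complex mat \<Rightarrow> cmat" where
  "emb M = Cmat (\<lambda>i j. if i < dim_row M \<and> j < dim_col M then M $$ (i, j) else 0)"

lemma ent_emb: "ent (emb M) i j = (if i < dim_row M \<and> j < dim_col M then M $$ (i, j) else 0)"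
proof -
  have "(\<lambda>i j. if i < dim_row M \<and> j < dim_col M then M $$ (i, j) else 0) \<in>
    {A. \<exists>n. \<forall>i j. n \<le> i \<or> n \<le> j \<longrightarrow> A i j = 0}"
    by (auto intro!: exI[of _ "max (dim_row M) (dim_col M)"])
  then show ?thesis by (simp add: emb_def Cmat_inverse)
qed

lemma supp_emb: "M \<in> carrier_mat n n \<Longrightarrow> supp n (emb M)"
  by (auto simp: supp_def ent_emb)

lemma emb_inj: "M \<in> carrier_mat n n \<Longrightarrow> M' \<in> carrier_mat n n \<Longrightarrow> emb M = emb M' \<Longrightarrow> M = M'"
proof (rule eq_matI)
  fix i j assume h: "M \<in> carrier_mat n n" "M' \<in> carrier_mat n n" "emb M = emb M'" "i < dim_row M'" "j < dim_col M'"
  have "ent (emb M) i j = ent (emb M') i j" using h by (simp only:)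
  then show "M $$ (i, j) = M' $$ (i, j)" using h(1,2,4,5) unfolding ent_emb by auto
qed auto

lemma emb_surj: assumes "supp n A" obtains M where "M \<in> carrier_mat n n" "emb M = A"
proof
  show "mat n n (\<lambda>(i, j). ent A i j) \<in> carrier_mat n n" by simp
  show "emb (mat n n (\<lambda>(i, j). ent A i j)) = A"
    by (rule cmat_eqI) (use assms in \<open>auto simp: ent_emb supp_def\<close>)
qed

lemma emb_mult: "M \<in> carrier_mat n n \<Longrightarrow> M' \<in> carrier_mat n n \<Longrightarrow> emb (M * M') = emb M * emb M'"
  by (rule cmat_eqI)
    (auto simp: ent_times[OF supp_emb] ent_emb scalar_prod_def lessThan_atLeast0 intro!: sum.cong)

lemma emb_one: "emb (1\<^sub>m n) = un n" by (rule cmat_eqI) (auto simp: ent_emb)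

lemma emb_smult: "emb (c \<cdot>\<^sub>m M) = sc c (emb M)" by (rule cmat_eqI) (auto simp: ent_emb)

lemma emb_pow: "M \<in> carrier_mat n n \<Longrightarrow> emb (M ^\<^sub>m k) = mpow n (emb M) k"
proof (induction k)
  case 0
  then show ?case by (simp add: emb_one)
next
  case (Suc k)
  then show ?case by (simp add: emb_mult[of _ n] mpow_Suc_right[OF supp_emb] del: mpow.simps(2))
qed

lemma emb_adjoint: "M \<in> carrier_mat n n \<Longrightarrow> emb (mat_adjoint M) = adj (emb M)"
  by (rule cmat_eqI) (auto simp: ent_emb mat_adjoint_def mat_of_rows_def)

lemma emb_kronecker:
  assumes "A \<in> carrier_mat n n" "B \<in> carrier_mat k k" "k > 0"
  shows "emb (kronecker A B) = kr k (emb A) (emb B)"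
  by (rule cmat_eqI) (use assms in \<open>auto simp: ent_emb ent_kr kronecker_def div_less_iff_less_mult\<close>)

section \<open>Traces of the powers of a matrix of finite order\<close>

lemma upper_triangular_mult:
  assumes "A \<in> carrier_mat n n" "B \<in> carrier_mat n n" "upper_triangular A" "upper_triangular B"
  shows "upper_triangular (A * B)" "i < n \<Longrightarrow> (A * B) $$ (i, i) = A $$ (i, i) * (B $$ (i, i) :: complex)"
proof -
  have z: "A $$ (i, k) * B $$ (k, j) = 0" if "i < n" "j < n" "k < n" "j < i \<or> (i = j \<and> k \<noteq> i)" for i j k
  proof (cases "k < i")
    case True
    then show ?thesis using assms that by (auto simp: upper_triangular_def)
  next
    case False
    then have "j < k" using that by auto
    then show ?thesis using assms that by (auto simp: upper_triangular_def)
  qed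
  show "upper_triangular (A * B)"
    unfolding upper_triangular_def using assms
    by (auto simp: scalar_prod_def intro!: sum.neutral z)
  show "(A * B) $$ (i, i) = A $$ (i, i) * B $$ (i, i)" if i: "i < n"
  proof -
    have "(A * B) $$ (i, i) = (\<Sum>k<n. A $$ (i, k) * B $$ (k, i))"
      using assms i by (simp add: scalar_prod_def lessThan_atLeast0)
    also have "\<dots> = (\<Sum>k<n. if k = i then A $$ (i, i) * B $$ (i, i) else 0)"
      using i by (intro sum.cong) (auto simp: z)
    finally show ?thesis using i by simp
  qed
qed

text \<open>Schur triangularisation turns the traces of all powers into power sums of one list of
  diagonal entries; these are \<open>N\<close>-th roots of unity because the \<open>N\<close>-th
  power of the triangular factor is the identity.\<close>

lemma finite_order_traces:
  assumes A: "supp n A" and N: "mpow n A N = un n"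
  obtains \<theta> :: "nat \<Rightarrow> complex" where "\<And>i. i < n \<Longrightarrow> \<theta> i ^ N = 1" "\<And>k. tr (mpow n A k) = (\<Sum>i<n. \<theta> i ^ k)"
proof -
  obtain M where M: "M \<in> carrier_mat n n" "emb M = A" using emb_surj[OF A] .
  obtain es where es: "char_poly M = (\<Prod>a\<leftarrow>es. [:- a, 1:])" using char_poly_factorized[OF M(1)] by blast
  obtain B P Q where BPQ: "schur_decomposition M es = (B, P, Q)" by (cases "schur_decomposition M es")
  have sim: "similar_mat_wit M B P Q" and ut: "upper_triangular B"
    using schur_decomposition[OF M(1) es BPQ] by auto
  have B: "B \<in> carrier_mat n n" and P: "P \<in> carrier_mat n n" and Q: "Q \<in> carrier_mat n n"
    and PQ: "P * Q = 1\<^sub>m n" "Q * P = 1\<^sub>m n"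
    using similar_mat_witD2[OF M(1) sim] by auto
  have Bk: "upper_triangular (B ^\<^sub>m k) \<and> (\<forall>i<n. (B ^\<^sub>m k) $$ (i, i) = (B $$ (i, i)) ^ k)" for k
  proof (induction k)
    case 0
    then show ?case using B by auto
  next
    case (Suc k)
    then show ?case using B ut upper_triangular_mult[of "B ^\<^sub>m k" n B] by (auto simp: mult.commute)
  qed
  have Mk: "M ^\<^sub>m k = P * (B ^\<^sub>m k) * Q" for k
    using similar_mat_wit_pow[OF sim, of k] by (auto simp: similar_mat_wit_def Let_def)
  have eQP: "emb Q * emb P = un n" using PQ emb_mult[OF Q P] by (simp add: emb_one)
  have tr_k: "tr (mpow n A k) = (\<Sum>i<n. (B $$ (i, i)) ^ k)" for k
  proof -
    have Bkc: "B ^\<^sub>m k \<in> carrier_mat n n" using B by simp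
    have "mpow n A k = emb P * emb (B ^\<^sub>m k) * emb Q"
    proof -
      have "mpow n A k = emb (P * (B ^\<^sub>m k) * Q)" using emb_pow[OF M(1), of k] by (simp only: M(2) Mk)
      then show ?thesis using P Q Bkc by (simp add: emb_mult[of _ n] mult.assoc)
    qed
    then have "tr (mpow n A k) = tr (emb P * (emb (B ^\<^sub>m k) * emb Q))" by (simp add: mult.assoc)
    also have "\<dots> = tr (emb (B ^\<^sub>m k) * (emb Q * emb P))" by (subst tr_comm) (simp add: mult.assoc)
    also have "\<dots> = tr (emb (B ^\<^sub>m k))" using supp_emb[OF Bkc] by (simp add: eQP)
    also have "\<dots> = (\<Sum>i<n. (B $$ (i, i)) ^ k)"
      using Bk[of k] B by (simp add: tr_eq[OF supp_emb[OF Bkc]] ent_emb)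
    finally show ?thesis .
  qed
  have Bc: "B ^\<^sub>m N \<in> carrier_mat n n" using B by simp
  have "un n = emb (M ^\<^sub>m N)" using M N by (simp add: emb_pow)
  also have "\<dots> = emb P * emb (B ^\<^sub>m N) * emb Q"
    unfolding Mk using P Q Bc by (simp add: emb_mult[of _ n] mult.assoc)
  finally have PB: "emb P * emb (B ^\<^sub>m N) * emb Q = un n" by simp
  have "emb (B ^\<^sub>m N) = un n * emb (B ^\<^sub>m N) * un n" using supp_emb[OF Bc] by simp
  also have "\<dots> = emb Q * (emb P * emb (B ^\<^sub>m N) * emb Q) * emb P"
    unfolding eQP[symmetric] by (simp only: mult.assoc)
  also have "\<dots> = emb (1\<^sub>m n)" unfolding PB using supp_emb[OF Q] by (simp add: eQP emb_one)
  finally have "B ^\<^sub>m N = 1\<^sub>m n" using Bc by (intro emb_inj[of _ n]) auto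
  then have "B $$ (i, i) ^ N = 1" if "i < n" for i using Bk[of N] that by (metis index_one_mat(1))
  from that[of "\<lambda>i. B $$ (i, i)", OF this tr_k] show ?thesis .
qed

section \<open>Quadratic phase functions modulo \<open>p\<close>\<close>

text \<open>\<open>quadf p\<close> is the localised span of the functions \<open>\<zeta>\<^sup>j\<^sup>C\<^sup>(\<^sup>i\<^sup>,\<^sup>2\<^sup>)\<^sup>+\<^sup>k\<^sup>i\<close> on \<open>{..<p}\<close>.
  Modulo \<open>q = 1 - \<zeta>\<close> it is graded: \<open>gradf p a\<close> consists of the combinations of \<open>q\<^sup>r f\<close> with
  \<open>r \<ge> a\<close> and \<open>f\<close> polynomial of degree at most \<open>2 r\<close>, and the two coincide for
  \<open>a = 1\<close> up to constants.\<close>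

inductive quadf :: "nat \<Rightarrow> (nat \<Rightarrow> complex) \<Rightarrow> bool" for p where
  quadf_gen: "quadf p (\<lambda>i. zeta p ^ (j * (i choose 2) + k * i))"
| quadf_add: "quadf p f \<Longrightarrow> quadf p g \<Longrightarrow> quadf p (\<lambda>i. f i + g i)"
| quadf_scale: "quadf p f \<Longrightarrow> c \<in> zint p \<Longrightarrow> quadf p (\<lambda>i. c * f i)"
| quadf_div: "quadf p (\<lambda>i. of_nat d * f i) \<Longrightarrow> coprime d p \<Longrightarrow> quadf p f"
| quadf_eq: "quadf p f \<Longrightarrow> (\<And>i. i < p \<Longrightarrow> f i = g i) \<Longrightarrow> quadf p g"

text \<open>The localisation at the integers prime to \<open>p\<close>: differences of distinct
  numbers below \<open>p\<close>, and factorials of numbers below \<open>p\<close>, are invertible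
  in it.\<close>

definition zloc :: "nat \<Rightarrow> complex set" where
  "zloc p = {z. \<exists>d. coprime d p \<and> of_nat d * z \<in> zint p}"

inductive gradf :: "nat \<Rightarrow> nat \<Rightarrow> (nat \<Rightarrow> complex) \<Rightarrow> bool" for p a where
  gradf_gen: "a \<le> r \<Longrightarrow> degree Q \<le> 2 * r \<Longrightarrow> (\<And>i. poly.coeff Q i \<in> zloc p) \<Longrightarrow>
     gradf p a (\<lambda>i. (1 - zeta p) ^ r * poly Q (of_nat i))"
| gradf_add: "gradf p a f \<Longrightarrow> gradf p a g \<Longrightarrow> gradf p a (\<lambda>i. f i + g i)"
| gradf_eq: "gradf p a f \<Longrightarrow> (\<And>i. i < p \<Longrightarrow> f i = g i) \<Longrightarrow> gradf p a g"

locale odd_prime =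
  fixes p :: nat
  assumes p_prime: "prime p" and p_gt_2: "p > 2"

sublocale odd_prime \<subseteq> cyclotomic_prime p p 1 1
  using p_prime p_gt_2 by unfold_locales auto

context odd_prime
begin

abbreviation q where "q \<equiv> 1 - zeta p"

lemma q_in: "q \<in> zint p" by auto

lemma pi_q': "\<pi> = q" unfolding \<pi>_def by simp

lemmas pi_q = pi_q' pi_q'[unfolded One_nat_def]

lemma zint_zloc: "z \<in> zint p \<Longrightarrow> z \<in> zloc p"
  by (auto simp: zloc_def intro!: exI[of _ 1])

lemma zloc_closed:
  "x \<in> zloc p \<Longrightarrow> y \<in> zloc p \<Longrightarrow> x + y \<in> zloc p"
  "x \<in> zloc p \<Longrightarrow> y \<in> zloc p \<Longrightarrow> x * y \<in> zloc p"
  "coprime d p \<Longrightarrow> inverse (of_nat d) \<in> zloc p"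
  "x \<in> zloc p \<Longrightarrow> - x \<in> zloc p"
proof -
  assume "x \<in> zloc p" "y \<in> zloc p"
  then obtain d e where d: "coprime d p" "of_nat d * x \<in> zint p" and e: "coprime e p" "of_nat e * y \<in> zint p"
    by (auto simp: zloc_def)
  have "of_nat (d * e) * (x + y) = of_nat e * (of_nat d * x) + of_nat d * (of_nat e * y)"
    by (simp add: algebra_simps)
  also have "\<dots> \<in> zint p" using d e by auto
  finally show "x + y \<in> zloc p" using d e by (auto simp: zloc_def intro!: exI[of _ "d * e"])
  have "of_nat (d * e) * (x * y) = (of_nat d * x) * (of_nat e * y)" by simp
  also have "\<dots> \<in> zint p" using d e by auto
  finally show "x * y \<in> zloc p" using d e by (auto simp: zloc_def intro!: exI[of _ "d * e"])
next
  assume d: "coprime d p"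
  then have "d \<noteq> 0" using p_gt_2 by (cases d) auto
  then have "of_nat d * inverse (of_nat d) = (1 :: complex)" by simp
  then show "inverse (of_nat d) \<in> zloc p" using d by (auto simp: zloc_def intro!: exI[of _ d])
next
  assume "x \<in> zloc p"
  then obtain d where d: "coprime d p" "of_nat d * x \<in> zint p" by (auto simp: zloc_def)
  then have "of_nat d * (- x) \<in> zint p" using zint_closed(3)[OF d(2)] by simp
  then show "- x \<in> zloc p" using d by (auto simp: zloc_def)
qed

lemma zloc_sum: "(\<And>i. i \<in> A \<Longrightarrow> f i \<in> zloc p) \<Longrightarrow> sum f A \<in> zloc p"
  by (induction A rule: infinite_finite_induct) (auto intro: zloc_closed zint_zloc)

definition lpol :: "complex poly \<Rightarrow> bool" where "lpol Q \<longleftrightarrow> (\<forall>i. poly.coeff Q i \<in> zloc p)"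

lemma lpol_intros:
  "lpol 0" "lpol 1" "lpol Q \<Longrightarrow> lpol R \<Longrightarrow> lpol (Q + R)" "lpol Q \<Longrightarrow> lpol R \<Longrightarrow> lpol (Q * R)"
  "c \<in> zloc p \<Longrightarrow> lpol Q \<Longrightarrow> lpol (smult c Q)" "c \<in> zloc p \<Longrightarrow> lpol Q \<Longrightarrow> lpol (pCons c Q)"
proof -
  have [simp]: "0 \<in> zloc p" "1 \<in> zloc p" by (auto intro: zint_zloc)
  show "lpol 0" by (simp add: lpol_def)
  show "lpol 1" by (simp add: lpol_def coeff_1)
  show "lpol Q \<Longrightarrow> lpol R \<Longrightarrow> lpol (Q + R)" by (simp add: lpol_def zloc_closed)
  show "lpol Q \<Longrightarrow> lpol R \<Longrightarrow> lpol (Q * R)"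
    by (auto simp: lpol_def coeff_mult intro!: zloc_sum zloc_closed(2))
  show "c \<in> zloc p \<Longrightarrow> lpol Q \<Longrightarrow> lpol (smult c Q)" by (auto simp: lpol_def intro: zloc_closed)
  show "c \<in> zloc p \<Longrightarrow> lpol Q \<Longrightarrow> lpol (pCons c Q)" by (auto simp: lpol_def coeff_pCons split: nat.split)
qed

lemma lpol_prod: "(\<And>i. i \<in> A \<Longrightarrow> lpol (f i)) \<Longrightarrow> lpol (prod f A)"
  by (induction A rule: infinite_finite_induct) (auto intro: lpol_intros)

lemma lpol_sum: "(\<And>i. i \<in> A \<Longrightarrow> lpol (f i)) \<Longrightarrow> lpol (sum f A)"
  by (induction A rule: infinite_finite_induct) (auto intro: lpol_intros)

lemma gradfI: "a \<le> r \<Longrightarrow> degree Q \<le> 2 * r \<Longrightarrow> lpol Q \<Longrightarrow> (\<And>i. i < p \<Longrightarrow> f i = q ^ r * poly Q (of_nat i)) \<Longrightarrow> gradf p a f"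
  by (rule gradf_eq[OF gradf_gen[of a r Q]]) (auto simp: lpol_def)

lemma gradf_mono: "gradf p a f \<Longrightarrow> b \<le> a \<Longrightarrow> gradf p b f"
proof (induction rule: gradf.induct)
  case (gradf_gen r Q)
  then show ?case by (intro gradf.gradf_gen) auto
next
  case (gradf_add f g)
  then show ?case by (intro gradf.gradf_add) auto
next
  case (gradf_eq f g)
  then show ?case by (intro gradf.gradf_eq[of p b f g]) auto
qed

lemma gradf_mult: "gradf p a f \<Longrightarrow> gradf p b g \<Longrightarrow> gradf p (a + b) (\<lambda>i. f i * g i)"
proof (induction rule: gradf.induct)
  case (gradf_gen r Q)
  then have Q: "lpol Q" by (simp add: lpol_def)
  show ?case using gradf_gen(4)
  proof (induction rule: gradf.induct)
    case (gradf_gen r' Q')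
    then have Q': "lpol Q'" by (simp add: lpol_def)
    have "degree (Q * Q') \<le> 2 * r + 2 * r'"
      by (rule order_trans[OF degree_mult_le add_mono]) fact+
    then have "degree (Q * Q') \<le> 2 * (r + r')" by (simp only: distrib_left)
    then show ?case using \<open>a \<le> r\<close> \<open>b \<le> r'\<close>
      by (intro gradfI[of "a + b" "r + r'" "Q * Q'"] lpol_intros Q Q') (auto simp: power_add)
  next
    case (gradf_add f g)
    from gradf.gradf_add[OF gradf_add.IH] show ?case by (simp add: distrib_left)
  next
    case (gradf_eq f g)
    then show ?case by (intro gradf.gradf_eq[OF gradf_eq.IH]) auto
  qed
next
  case (gradf_add f f')
  from gradf.gradf_add[OF gradf_add.IH(1)[OF gradf_add.prems] gradf_add.IH(2)[OF gradf_add.prems]]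
  show ?case by (simp add: distrib_right)
next
  case (gradf_eq f f')
  then show ?case by (intro gradf.gradf_eq[OF gradf_eq.IH[OF gradf_eq.prems]]) auto
qed

lemma gradf_0: "gradf p a (\<lambda>_. 0)"
  by (rule gradfI[of a a 0]) (auto intro: lpol_intros)

lemma gradf_scale: "gradf p a f \<Longrightarrow> c \<in> zloc p \<Longrightarrow> gradf p a (\<lambda>i. c * f i)"
  using gradf_mult[of 0 "\<lambda>_. c" a f] gradfI[of 0 0 "[:c:]" "\<lambda>_. c"]
  by (auto intro: lpol_intros)

lemma gradf_sum: "(\<And>x. x \<in> A \<Longrightarrow> gradf p a (f x)) \<Longrightarrow> gradf p a (\<lambda>i. \<Sum>x\<in>A. f x i)"
  by (induction A rule: infinite_finite_induct) (auto intro: gradf_0 gradf_add)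

lemma coprime_less_p: "0 < d \<Longrightarrow> d < p \<Longrightarrow> coprime d p"
  using p_prime by (metis coprime_commute nat_dvd_not_less prime_imp_coprime)

lemma inverse_diff_zloc:
  assumes "i < p" "j < p" "i \<noteq> j"
  shows "inverse (of_nat i - of_nat j) \<in> zloc p"
proof (cases "j < i")
  case True
  then have "inverse (of_nat (i - j)) \<in> zloc p" using assms by (intro zloc_closed coprime_less_p) auto
  then show ?thesis using True by (simp add: of_nat_diff)
next
  case False
  then have "- inverse (of_nat (j - i)) \<in> zloc p" using assms by (intro zloc_closed coprime_less_p) auto
  moreover have "- inverse (of_nat (j - i)) = inverse (of_nat i - of_nat j :: complex)"
    using False by (simp add: of_nat_diff flip: inverse_minus_eq)
  ultimately show ?thesis by simp
qed

text \<open>Lagrange interpolation: its denominators are differences of distinct numbers below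
  \<open>p\<close>.\<close>

lemma interpolation:
  assumes "\<And>i. i < p \<Longrightarrow> f i \<in> zloc p"
  obtains Q where "lpol Q" "degree Q \<le> p - 1" "\<And>i. i < p \<Longrightarrow> poly Q (of_nat i) = f i"
proof -
  define L :: "nat \<Rightarrow> complex poly" where
    "L i0 = (\<Prod>j\<in>{..<p} - {i0}. smult (inverse (of_nat i0 - of_nat j)) [:- of_nat j, 1:])" for i0
  have L: "lpol (L i0)" if "i0 < p" for i0 unfolding L_def
    using that by (intro lpol_prod lpol_intros inverse_diff_zloc) (auto intro: zint_zloc)
  have dL: "degree (L i0) \<le> p - 1" if "i0 < p" for i0
  proof -
    have "degree (L i0) \<le> (\<Sum>j\<in>{..<p} - {i0}. degree (smult (inverse (of_nat i0 - of_nat j :: complex)) [:- of_nat j, 1:]))"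
      unfolding L_def by (rule degree_prod_sum_le[unfolded comp_def]) auto
    also have "\<dots> \<le> (\<Sum>j\<in>{..<p} - {i0}. 1)" by (intro sum_mono) auto
    also have "\<dots> = p - 1" using that by simp
    finally show ?thesis .
  qed
  have pL: "poly (L i0) (of_nat i) = (if i = i0 then 1 else 0)" if "i < p" "i0 < p" for i i0
  proof -
    have 1: "poly (smult c [:- a, 1:]) x = c * (x - a)" for a c x :: complex by (simp add: algebra_simps)
    show ?thesis
    proof (cases "i = i0")
      case True
      have "poly (L i0) (of_nat i) = 1" unfolding L_def poly_prod 1 True
      proof (intro prod.neutral ballI)
        fix j assume "j \<in> {..<p} - {i0}"
        then have "of_nat i0 - of_nat j \<noteq> (0 :: complex)" by auto
        then show "inverse (of_nat i0 - of_nat j) * (of_nat i0 - of_nat j) = (1 :: complex)" by (rule left_inverse)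
      qed
      then show ?thesis using True by simp
    next
      case False
      have "poly (L i0) (of_nat i) = 0" unfolding L_def poly_prod 1
        by (rule prod_zero) (use that False in \<open>auto intro!: bexI[of _ i]\<close>)
      then show ?thesis using False by simp
    qed
  qed
  define Q where "Q = (\<Sum>i0<p. smult (f i0) (L i0))"
  show ?thesis
  proof
    show "lpol Q" unfolding Q_def using assms L by (intro lpol_sum lpol_intros) auto
    show "degree Q \<le> p - 1" unfolding Q_def
      by (rule degree_sum_le) (auto intro: dL[unfolded One_nat_def])
    show "poly Q (of_nat i) = f i" if "i < p" for i
    proof -
      have "poly Q (of_nat i) = (\<Sum>i0<p. if i = i0 then f i0 else 0)"
        unfolding Q_def poly_sum poly_smult using that by (intro sum.cong) (auto simp: pL)
      also have "\<dots> = f i" using that by simp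
      finally show ?thesis .
    qed
  qed
qed

lemma inverse_fact_zloc: "r < p \<Longrightarrow> inverse (fact r) \<in> zloc p"
  using zloc_closed(3)[of "fact r"] p_prime
  by (metis coprime_commute not_le of_nat_fact prime_dvd_fact_iff prime_imp_coprime)

text \<open>For \<open>r < p\<close> the factorial of \<open>r\<close> is invertible, so the
  binomial coefficient is a polynomial of degree at most \<open>d * r\<close>. For larger
  \<open>r\<close> interpolation on \<open>{..<p}\<close> gives degree at most \<open>p - 1\<close>,
  which is still below \<open>2 * r\<close>.\<close>

lemma binomial_gradf:
  assumes t: "\<And>i. of_nat (t i) = poly Q (of_nat i)" and Q: "lpol Q" "degree Q \<le> d" and d: "d \<le> 2"
  shows "\<exists>R. lpol R \<and> degree R \<le> max (d * r) (if r < p then 0 else p - 1) \<and> (\<forall>i<p. of_nat (t i choose r) = poly R (of_nat i))"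
proof (cases "r < p")
  case True
  define R where "R = smult (inverse (fact r)) (\<Prod>j<r. Q + [:- of_nat j:])"
  have "lpol R" unfolding R_def
    using Q True by (intro lpol_intros lpol_prod inverse_fact_zloc) (auto intro: zint_zloc)
  moreover have "degree R \<le> d * r"
  proof -
    have "degree (\<Prod>j<r. Q + [:- of_nat j:]) \<le> (\<Sum>j<r. degree (Q + [:- of_nat j :: complex:]))"
      by (rule degree_prod_sum_le[unfolded comp_def]) auto
    also have "\<dots> \<le> (\<Sum>j<r. d)" using Q by (intro sum_mono degree_add_le) auto
    finally show ?thesis unfolding R_def by (simp add: mult.commute order.trans[OF degree_smult_le])
  qed
  moreover have "of_nat (t i choose r) = poly R (of_nat i)" for i
  proof -
    have "of_nat (t i choose r) = ((of_nat (t i)) gchoose r :: complex)" by (rule binomial_gbinomial)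
    also have "\<dots> = (\<Prod>j<r. of_nat (t i) - of_nat j) / fact r"
      by (simp add: gbinomial_prod_rev lessThan_atLeast0)
    also have "\<dots> = poly R (of_nat i)" by (simp add: R_def poly_prod t field_simps)
    finally show ?thesis .
  qed
  ultimately show ?thesis using True by (intro exI[of _ R]) auto
next
  case False
  obtain R where "lpol R" "degree R \<le> p - 1" "\<And>i. i < p \<Longrightarrow> poly R (of_nat i) = of_nat (t i choose r)"
    by (rule interpolation[of "\<lambda>i. of_nat (t i choose r)"]) (auto intro: zint_zloc)
  then show ?thesis using False by (intro exI[of _ R]) auto
qed

lemma zeta_power_expand: assumes "T \<ge> t" shows "zeta p ^ t = (\<Sum>r\<le>T. of_nat (t choose r) * (- q) ^ r)"
proof -
  have "zeta p ^ t = ((- q) + 1) ^ t" by simp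
  also have "\<dots> = (\<Sum>r\<le>t. of_nat (t choose r) * (- q) ^ r)" by (subst binomial_ring) simp
  also have "\<dots> = (\<Sum>r\<le>T. of_nat (t choose r) * (- q) ^ r)"
    using assms by (intro sum.mono_neutral_left) (auto simp: not_le)
  finally show ?thesis .
qed

lemma minus_1_zloc: "(- 1) ^ r \<in> zloc p" by (rule zint_zloc) auto

text \<open>Expand the powers of \<open>zeta p = 1 - q\<close> binomially. The \<open>r\<close>-th
  term carries \<open>q ^ r\<close> and a polynomial of degree at most \<open>2 * r\<close>; the
  terms with \<open>r < 2\<close> are \<open>1 - q * t i\<close>.\<close>

lemma gradf_phase:
  assumes t: "\<And>i. of_nat (t i) = poly Q (of_nat i)" and Q: "lpol Q" "degree Q \<le> 2"
  shows "gradf p 2 (\<lambda>i. zeta p ^ t i - 1 + q * of_nat (t i))"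
proof -
  define T where "T = (\<Sum>i<p. t i) + 2"
  have tT: "t i \<le> T" if "i < p" for i
    using member_le_sum[of i "{..<p}" t] that by (simp add: T_def)
  have "gradf p 2 (\<lambda>i. (- q) ^ r * of_nat (t i choose r))" if "r \<in> {2..T}" for r
  proof -
    obtain R where R: "lpol R" "degree R \<le> max (2 * r) (if r < p then 0 else p - 1)"
        "\<forall>i<p. of_nat (t i choose r) = poly R (of_nat i)"
      using binomial_gradf[OF t Q] by blast
    have "degree R \<le> 2 * r" using R(2) by (auto split: if_splits)
    then have "gradf p 2 (\<lambda>i. q ^ r * of_nat (t i choose r))"
      using R that by (intro gradfI[of 2 r R]) auto
    from gradf_scale[OF this minus_1_zloc[of r]] show ?thesis
      by (simp only: power_minus[of q] mult.assoc)
  qed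
  then have "gradf p 2 (\<lambda>i. \<Sum>r\<in>{2..T}. (- q) ^ r * of_nat (t i choose r))" by (rule gradf_sum)
  then show ?thesis
  proof (rule gradf_eq)
    fix i assume i: "i < p"
    have "{..T} = {0, 1} \<union> {2..T}" by (auto simp: T_def)
    then have "zeta p ^ t i = (\<Sum>r\<in>{0, 1}. of_nat (t i choose r) * (- q) ^ r) +
      (\<Sum>r\<in>{2..T}. of_nat (t i choose r) * (- q) ^ r)"
      unfolding zeta_power_expand[OF tT[OF i]] by (subst sum.union_disjoint[symmetric]) auto
    then show "(\<Sum>r\<in>{2..T}. (- q) ^ r * of_nat (t i choose r)) = zeta p ^ t i - 1 + q * of_nat (t i)"
      by (simp add: mult.commute algebra_simps)
  qed
qed

text \<open>Fourier inversion on the residues modulo \<open>p\<close>: a delta function times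
  \<open>p\<close> is a sum of linear phases.\<close>

lemma quadf_zint: "(\<And>i. i < p \<Longrightarrow> f i \<in> zint p) \<Longrightarrow> quadf p (\<lambda>i. of_nat p * f i)"
proof -
  assume f: "\<And>i. i < p \<Longrightarrow> f i \<in> zint p"
  have sum: "quadf p (\<lambda>i. \<Sum>x\<in>A. h x i)" if "finite A" "\<And>x. x \<in> A \<Longrightarrow> quadf p (h x)" for A :: "'b set" and h
    using that
  proof (induction A)
    case empty
    show ?case using quadf_scale[OF quadf_gen[of p 0 0], of 0] by simp
  next
    case (insert x A)
    then show ?case by (simp add: quadf_add)
  qed
  have "quadf p (\<lambda>i. \<Sum>i0<p. \<Sum>k<p. f i0 * zeta p ^ ((p - 1) * k * i0) * zeta p ^ (0 * (i choose 2) + k * i))"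
    using f by (intro sum quadf_scale quadf_gen) auto
  then show ?thesis
  proof (rule quadf_eq)
    fix i assume i: "i < p"
    have "(\<Sum>k<p. f i0 * zeta p ^ ((p - 1) * k * i0) * zeta p ^ (0 * (i choose 2) + k * i)) =
        (if i0 = i then of_nat p * f i else 0)" if i0: "i0 < p" for i0
    proof -
      define x where "x = zeta p ^ ((p - 1) * i0 + i)"
      have "(\<Sum>k<p. f i0 * zeta p ^ ((p - 1) * k * i0) * zeta p ^ (0 * (i choose 2) + k * i)) = f i0 * (\<Sum>k<p. x ^ k)"
        unfolding sum_distrib_left x_def
        by (intro sum.cong) (simp_all add: power_add[symmetric] power_mult[symmetric] mult.assoc algebra_simps)
      also have "(\<Sum>k<p. x ^ k) = (if i0 = i then of_nat p else 0)"
      proof -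
        have "[(p - 1) * i0 + i + i0 = i + p * i0] (mod p)"
        proof -
          have "(p - 1) * i0 + i0 = p * i0" using p_gt_2 by (cases p) auto
          then have "(p - 1) * i0 + i + i0 = i + p * i0" by linarith
          then show ?thesis by (simp only: cong_refl)
        qed
        then have s: "((p - 1) * i0 + i + i0) mod p = (i + p * i0) mod p" by (simp only: cong_def)
        have "p dvd (p - 1) * i0 + i \<longleftrightarrow> [(p - 1) * i0 + i + i0 = 0 + i0] (mod p)"
          unfolding cong_add_rcancel_nat cong_0_iff ..
        also have "\<dots> \<longleftrightarrow> [0 + i0 = i + p * i0] (mod p)" unfolding cong_def s by (rule eq_commute)
        also have "\<dots> \<longleftrightarrow> i0 = i" using i i0 by (auto simp: cong_def)
        finally have x1: "x = 1 \<longleftrightarrow> i0 = i" by (simp add: x_def zeta_power_eq_1_iff)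
        have "x ^ p = 1" unfolding x_def by (metis power_mult mult.commute zeta_N power_one)
        then show ?thesis using x1 sum_powers_root_of_unity[of x p] by auto
      qed
      finally show ?thesis by simp
    qed
    then have "(\<Sum>i0<p. \<Sum>k<p. f i0 * zeta p ^ ((p - 1) * k * i0) * zeta p ^ (0 * (i choose 2) + k * i)) =
      (\<Sum>i0<p. if i0 = i then of_nat p * f i else 0)" by (intro sum.cong) auto
    then show "(\<Sum>i0<p. \<Sum>k<p. f i0 * zeta p ^ ((p - 1) * k * i0) * zeta p ^ (0 * (i choose 2) + k * i)) = of_nat p * f i"
      using i by simp
  qed
qed

lemma quadf_mult: "quadf p f \<Longrightarrow> quadf p g \<Longrightarrow> quadf p (\<lambda>i. f i * g i)"
proof (induction rule: quadf.induct)
  case (quadf_gen j k)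
  from this show ?case
  proof (induction rule: quadf.induct)
    case (quadf_gen j' k')
    show ?case by (rule quadf_eq[OF quadf.quadf_gen[of p "j + j'" "k + k'"]])
       (simp add: power_add[symmetric] algebra_simps)
  next
    case (quadf_add f g)
    from quadf.quadf_add[OF quadf_add.IH] show ?case by (simp add: distrib_left)
  next
    case (quadf_scale f c)
    from quadf.quadf_scale[OF quadf_scale.IH quadf_scale.hyps(2)] show ?case by (simp add: mult_ac)
  next
    case (quadf_div d f)
    show ?case by (rule quadf.quadf_div[OF _ quadf_div.hyps(2)]) (use quadf_div.IH in \<open>simp add: mult_ac\<close>)
  next
    case (quadf_eq f g)
    then show ?case by (intro quadf.quadf_eq[OF quadf_eq.IH]) auto
  qed
next
  case (quadf_add f f')
  from quadf.quadf_add[OF quadf_add.IH(1)[OF quadf_add.prems] quadf_add.IH(2)[OF quadf_add.prems]]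
  show ?case by (simp add: distrib_right)
next
  case (quadf_scale f c)
  from quadf.quadf_scale[OF quadf_scale.IH[OF quadf_scale.prems] quadf_scale.hyps(2)] show ?case by (simp add: mult_ac)
next
  case (quadf_div d f)
  show ?case by (rule quadf.quadf_div[OF _ quadf_div.hyps(2)]) (use quadf_div.IH[OF quadf_div.prems] in \<open>simp add: mult_ac\<close>)
next
  case (quadf_eq f f')
  then show ?case by (intro quadf.quadf_eq[OF quadf_eq.IH[OF quadf_eq.prems]]) auto
qed

lemma quadf_const: "c \<in> zint p \<Longrightarrow> quadf p (\<lambda>_. c)"
  using quadf_scale[OF quadf_gen[of p 0 0], of c] by simp

lemma quadf_power: "quadf p f \<Longrightarrow> quadf p (\<lambda>i. f i ^ k)"
  by (induction k) (auto intro: quadf_mult quadf_const)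

lemma quadf_zloc: assumes "quadf p f" "c \<in> zloc p" shows "quadf p (\<lambda>i. c * f i)"
proof -
  obtain d where d: "coprime d p" "of_nat d * c \<in> zint p" using assms(2) by (auto simp: zloc_def)
  show ?thesis by (rule quadf_div[OF _ d(1)]) (use quadf_scale[OF assms(1) d(2)] in \<open>simp add: mult.assoc\<close>)
qed

lemma gradf_power_diff:
  assumes "gradf p 1 f" "gradf p 1 g" "gradf p 2 (\<lambda>i. f i - g i)"
  shows "gradf p (k + 1) (\<lambda>i. f i ^ k - g i ^ k)" "gradf p k (\<lambda>i. g i ^ k)"
proof -
  show g: "gradf p k (\<lambda>i. g i ^ k)" for k
  proof (induction k)
    case 0
    show ?case by (rule gradfI[of 0 0 1]) (auto intro: lpol_intros)
  next
    case (Suc k)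
    from gradf_mult[OF assms(2) Suc] show ?case by simp
  qed
  show "gradf p (k + 1) (\<lambda>i. f i ^ k - g i ^ k)"
  proof (induction k)
    case 0
    show ?case by (simp add: gradf_0)
  next
    case (Suc k)
    from gradf_add[OF gradf_mult[OF assms(1) Suc, folded add_Suc_right] gradf_mult[OF assms(3) g[of k], THEN gradf_mono[where b = "1 + (k + 1)"]]]
    show ?case by (simp add: algebra_simps)
  qed
qed

text \<open>Descending induction on \<open>r\<close>. From \<open>2 * p\<close> on,
  \<open>q ^ r\<close> is a multiple of \<open>p\<close> and \<open>quadf_zint\<close> applies.
  Below, the monomial is the leading term of a product of phases, and the error lies in higher
  grade, where the induction hypothesis applies.\<close>

lemma monomial_quadf:
  "s \<le> 2 * r \<Longrightarrow> quadf p (\<lambda>i. q ^ r * of_nat i ^ s)"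
proof (induction "2 * p - r" arbitrary: r s rule: less_induct)
  case less
  show ?case
  proof (cases "2 * p \<le> r")
    case True
    have "q ^ (p + p) \<in> zideal p (of_nat p)" using pi_power_P by (simp add: pi_q)
    then obtain z where z: "z \<in> zint p" "q ^ (p + p) = of_nat p * z" by (auto simp: zideal_def)
    have "q ^ r = q ^ (p + p) * q ^ (r - (p + p))" using True by (simp flip: power_add)
    then have qr: "q ^ r = of_nat p * (z * q ^ (r - (p + p)))" by (simp only: z mult.assoc)
    have "quadf p (\<lambda>i. of_nat p * (z * q ^ (r - (p + p)) * of_nat i ^ s))"
      by (rule quadf_zint, intro zint_closed zint_power q_in z zint_intros)
    then show ?thesis unfolding qr by (simp only: mult.assoc)
  next
    case False
    have gq: "quadf p f" if "gradf p (Suc r) f" for f using that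
    proof (induction rule: gradf.induct)
      case (gradf_gen r' Q)
      have "quadf p (\<lambda>i. \<Sum>s\<in>A. poly.coeff Q s * (q ^ r' * of_nat i ^ s))" if "finite A" "A \<subseteq> {..degree Q}" for A
        using that
      proof (induction A)
        case empty
        then show ?case using quadf_const[of 0] by simp
      next
        case (insert x A)
        have "quadf p (\<lambda>i. poly.coeff Q x * (q ^ r' * of_nat i ^ x))"
          using insert.prems gradf_gen False
          by (intro quadf_zloc less.hyps) auto
        then show ?case using insert by (simp add: quadf_add)
      qed
      from this[of "{..degree Q}"] have "quadf p (\<lambda>i. \<Sum>s\<le>degree Q. poly.coeff Q s * (q ^ r' * of_nat i ^ s))" by simp
      then show ?case
        by (rule quadf_eq) (simp add: poly_altdef sum_distrib_left mult_ac)
    next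
      case (gradf_add f g)
      then show ?case by (intro quadf_add)
    next
      case (gradf_eq f g)
      then show ?case by (intro quadf_eq[OF gradf_eq.IH])
    qed
    \<comment> \<open>With \<open>s = 2 * k + l\<close> and \<open>l < 2\<close>, taking
      \<open>k\<close> quadratic and \<open>l\<close> linear factors uses
      \<open>k + l \<le> r\<close> powers of \<open>q\<close>.\<close>
    define k l where "k = s div 2" and "l = s mod 2"
    have s: "s = 2 * k + l" by (simp add: k_def l_def)
    have kl: "k + l \<le> r" using less.prems by (simp add: k_def l_def) presburger
    have half: "inverse 2 \<in> zloc p" using zloc_closed(3)[of 2] coprime_less_p[of 2] p_gt_2 by simp
    have c2: "of_nat (i choose 2) = poly [:0, - inverse 2, inverse 2:] (of_nat i :: complex)" for i
    proof -
      have "i * (i - 1) = 2 * (i choose 2)" unfolding choose_two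
        by (rule dvd_mult_div_cancel[symmetric]) (cases i; auto)
      then have "of_nat (i * (i - 1)) = (2 * of_nat (i choose 2) :: complex)" by (metis of_nat_mult of_nat_numeral)
      then show ?thesis by (cases i) (auto simp: field_simps)
    qed
    have lp: "lpol [:0, - inverse 2, inverse 2:]" "lpol [:0, 1:]"
      using half by (intro lpol_intros zloc_closed(4); auto intro: zint_zloc)+
    have gu: "gradf p 2 (\<lambda>i. zeta p ^ (i choose 2) - 1 + q * of_nat (i choose 2))"
      by (rule gradf_phase[OF c2 lp(1)]) simp
    have gv: "gradf p 2 (\<lambda>i. zeta p ^ i - 1 + q * of_nat i)"
      by (rule gradf_phase[OF _ lp(2)]) auto
    \<comment> \<open>Since \<open>2 * (i choose 2) + i = i ^ 2\<close>, the leading terms of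
      \<open>U\<close> and \<open>V\<close> are exactly \<open>q * i ^ 2\<close> and
      \<open>q * i\<close>.\<close>
    define U where "U = (\<lambda>i. - (2 * (zeta p ^ (i choose 2) - 1) + (zeta p ^ i - 1)))"
    define V where "V = (\<lambda>i. - (zeta p ^ i - 1))"
    define U0 V0 where "U0 = (\<lambda>i::nat. q * of_nat i ^ 2)" and "V0 = (\<lambda>i::nat. q * of_nat i :: complex)"
    have m1: "- 1 \<in> zloc p" "- 2 \<in> zloc p" by (auto intro!: zint_zloc)
    have U2: "gradf p 2 (\<lambda>i. U i - U0 i)"
    proof (rule gradf_eq[OF gradf_add[OF gradf_scale[OF gu m1(2)] gradf_scale[OF gv m1(1)]]])
      fix i
      have "2 * of_nat (i choose 2) = (of_nat i ^ 2 - of_nat i :: complex)"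
        unfolding c2 by (simp add: field_simps power2_eq_square)
      then have "q * (2 * of_nat (i choose 2)) = q * (of_nat i ^ 2 - of_nat i)" by simp
      then show "- 2 * (zeta p ^ (i choose 2) - 1 + q * of_nat (i choose 2)) + - 1 * (zeta p ^ i - 1 + q * of_nat i) = U i - U0 i"
        unfolding U_def U0_def by (simp add: algebra_simps)
    qed
    have V2: "gradf p 2 (\<lambda>i. V i - V0 i)"
      by (rule gradf_eq[OF gradf_scale[OF gv m1(1)]]) (simp add: V_def V0_def)
    have U0: "gradf p 1 U0" and V0: "gradf p 1 V0" unfolding U0_def V0_def
      by (rule gradfI[of 1 1 "[:0, 0, 1:]"] gradfI[of 1 1 "[:0, 1:]"]; auto intro!: lpol_intros zint_zloc simp: power2_eq_square)+
    have U1: "gradf p 1 U" using gradf_add[OF gradf_mono[OF U2] U0] by simp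
    have V1: "gradf p 1 V" using gradf_add[OF gradf_mono[OF V2] V0] by simp
    have "gradf p (k + l + 1) (\<lambda>i. U i ^ k * V i ^ l - U0 i ^ k * V0 i ^ l)"
    proof -
      have 1: "gradf p (k + 1 + l) (\<lambda>i. (U i ^ k - U0 i ^ k) * V0 i ^ l)"
        by (rule gradf_mult[OF gradf_power_diff(1)[OF U1 U0 U2] gradf_power_diff(2)[OF V1 V0 V2]])
      have Uk: "gradf p k (\<lambda>i. U i ^ k)"
        using gradf_power_diff(2)[OF U1 U1, of k] by (simp add: gradf_0)
      have 2: "gradf p (k + (l + 1)) (\<lambda>i. U i ^ k * (V i ^ l - V0 i ^ l))"
        by (rule gradf_mult[OF Uk gradf_power_diff(1)[OF V1 V0 V2]])
      from gradf_add[OF 1 2[THEN gradf_mono[where b = "k + 1 + l"]]] show ?thesis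
        by (simp add: algebra_simps)
    qed
    moreover have "gradf p (r - (k + l)) (\<lambda>_. q ^ (r - (k + l)))"
      by (rule gradfI[of _ "r - (k + l)" 1]) (auto intro: lpol_intros)
    ultimately have "gradf p (r - (k + l) + (k + l + 1)) (\<lambda>i. q ^ (r - (k + l)) * (U i ^ k * V i ^ l - U0 i ^ k * V0 i ^ l))"
      by (intro gradf_mult)
    then have "gradf p (Suc r) (\<lambda>i. q ^ (r - (k + l)) * (U i ^ k * V i ^ l - U0 i ^ k * V0 i ^ l))"
      using kl by simp
    then have 3: "quadf p (\<lambda>i. q ^ (r - (k + l)) * (U i ^ k * V i ^ l - U0 i ^ k * V0 i ^ l))" by (rule gq)
    have quv: "quadf p (\<lambda>i. zeta p ^ (i choose 2))" "quadf p (\<lambda>i. zeta p ^ i)"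
      using quadf_gen[of p 1 0] quadf_gen[of p 0 1] by simp_all
    have m: "- 1 \<in> zint p" "- 2 \<in> zint p" by auto
    have "quadf p V"
      using quadf_add[OF quadf_const[of 1] quadf_scale[OF quv(2) m(1)]] by (simp add: V_def)
    moreover have "quadf p U"
      using quadf_add[OF quadf_add[OF quadf_const[of 3] quadf_scale[OF quv(1) m(2)]] quadf_scale[OF quv(2) m(1)]]
      by (simp add: U_def algebra_simps)
    ultimately have 4: "quadf p (\<lambda>i. q ^ (r - (k + l)) * (U i ^ k * V i ^ l))"
      by (intro quadf_scale quadf_mult quadf_power zint_power q_in)
    have "quadf p (\<lambda>i. q ^ (r - (k + l)) * (U i ^ k * V i ^ l) + - 1 * (q ^ (r - (k + l)) * (U i ^ k * V i ^ l - U0 i ^ k * V0 i ^ l)))"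
      by (intro quadf_add quadf_scale 3 4) auto
    then show ?thesis
    proof (rule quadf_eq)
      fix i
      have e: "c * a + - 1 * (c * (a - b)) = c * b" for a b c :: complex by (simp add: algebra_simps)
      have qr: "q ^ r = q ^ (r - (k + l)) * (q ^ k * q ^ l)" using kl by (simp add: power_add[symmetric])
      show "q ^ (r - (k + l)) * (U i ^ k * V i ^ l) + - 1 * (q ^ (r - (k + l)) * (U i ^ k * V i ^ l - U0 i ^ k * V0 i ^ l)) = q ^ r * of_nat i ^ s"
        unfolding e qr s U0_def V0_def power_mult_distrib power_add power_mult by (simp only: mult_ac)
    qed
  qed
qed

text \<open>In the product of two binomial expansions the term \<open>(r, r')\<close> keeps
  \<open>q ^ (r + r' - 1)\<close> after division by \<open>q\<close>, and its degree
  \<open>r + r'\<close> is at most \<open>2 * (r + r' - 1)\<close>. A single factor fails at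
  \<open>r = 1\<close>, with degree 1 and no power of \<open>q\<close> left; hence the
  square.\<close>

theorem square_divisible_quadf:
  obtains g where "quadf p g" "\<And>i. i < p \<Longrightarrow> (zeta p ^ i - 1) ^ 2 = q * g i"
proof -
  define g where "g i = (\<Sum>r\<in>{1..<p}. \<Sum>r'\<in>{1..<p}. (- 1) ^ (r + r') * (q ^ (r + r' - 1) * (of_nat (i choose r) * of_nat (i choose r'))))" for i
  have "gradf p 1 g" unfolding g_def
  proof (intro gradf_sum)
    fix r r' assume r: "r \<in> {1..<p}" "r' \<in> {1..<p}"
    have b: "\<exists>R. lpol R \<and> degree R \<le> r \<and> (\<forall>i<p. of_nat (i choose r) = poly R (of_nat i))" if "r < p" for r
      using binomial_gradf[of "\<lambda>i. i" "[:0, 1:]" 1 r] that by (auto intro!: lpol_intros zint_zloc)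
    obtain R R' where R: "lpol R" "degree R \<le> r" "\<forall>i<p. of_nat (i choose r) = poly R (of_nat i)"
      "lpol R'" "degree R' \<le> r'" "\<forall>i<p. of_nat (i choose r') = poly R' (of_nat i)"
      using b[of r] b[of r'] r by auto
    have "degree (R * R') \<le> r + r'" by (rule order_trans[OF degree_mult_le add_mono[OF R(2,5)]])
    also have "\<dots> \<le> 2 * (r + r' - 1)" using r by auto
    finally have "degree (R * R') \<le> 2 * (r + r' - 1)" .
    then have "gradf p 1 (\<lambda>i. q ^ (r + r' - 1) * (of_nat (i choose r) * of_nat (i choose r')))"
      using R r by (intro gradfI[of 1 "r + r' - 1" "R * R'"] lpol_intros) auto
    then show "gradf p 1 (\<lambda>i. (- 1) ^ (r + r') * (q ^ (r + r' - 1) * (of_nat (i choose r) * of_nat (i choose r'))))"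
      by (rule gradf_scale[OF _ minus_1_zloc])
  qed
  then have "quadf p g"
  proof (induction rule: gradf.induct)
    case (gradf_gen r Q)
    have "quadf p (\<lambda>i. \<Sum>s\<in>A. poly.coeff Q s * (q ^ r * of_nat i ^ s))" if "finite A" "A \<subseteq> {..degree Q}" for A
      using that
    proof (induction A)
      case empty
      then show ?case using quadf_const[of 0] by simp
    next
      case (insert x A)
      have "quadf p (\<lambda>i. poly.coeff Q x * (q ^ r * of_nat i ^ x))"
        using insert.prems gradf_gen by (intro quadf_zloc monomial_quadf) auto
      then show ?case using insert by (simp add: quadf_add)
    qed
    from this[of "{..degree Q}"] have "quadf p (\<lambda>i. \<Sum>s\<le>degree Q. poly.coeff Q s * (q ^ r * of_nat i ^ s))" by simp
    then show ?case
      by (rule quadf_eq) (simp add: poly_altdef sum_distrib_left mult_ac)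
  next
    case (gradf_add f g)
    then show ?case by (intro quadf_add)
  next
    case (gradf_eq f g)
    then show ?case by (intro quadf_eq[OF gradf_eq.IH])
  qed
  moreover have "(zeta p ^ i - 1) ^ 2 = q * g i" if "i < p" for i
  proof -
    have "{..p - 1} = insert 0 {1..<p}" using p_gt_2 by auto
    then have v: "zeta p ^ i - 1 = (\<Sum>r\<in>{1..<p}. of_nat (i choose r) * (- q) ^ r)"
      using zeta_power_expand[of i "p - 1"] that by simp
    have "(zeta p ^ i - 1) ^ 2 = (\<Sum>r\<in>{1..<p}. \<Sum>r'\<in>{1..<p}. of_nat (i choose r) * (- q) ^ r * (of_nat (i choose r') * (- q) ^ r'))"
      unfolding v power2_eq_square sum_product ..
    also have "\<dots> = q * g i" unfolding g_def sum_distrib_left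
    proof (intro sum.cong refl)
      fix r r' assume r: "r \<in> {1..<p}" "r' \<in> {1..<p}"
      have e: "Suc (r + r' - 1) = r + r'" using r by simp
      have "(- q) ^ r * (- q) ^ r' = (- 1) ^ (r + r') * q ^ Suc (r + r' - 1)"
        unfolding e power_add power_minus[of q r] power_minus[of q r'] by (simp only: mult_ac)
      then have "of_nat (i choose r) * of_nat (i choose r') * ((- q) ^ r * (- q) ^ r') =
        of_nat (i choose r) * of_nat (i choose r') * ((- 1) ^ (r + r') * q ^ Suc (r + r' - 1))" by (simp only:)
      then show "of_nat (i choose r) * (- q) ^ r * (of_nat (i choose r') * (- q) ^ r') =
        q * ((- 1) ^ (r + r') * (q ^ (r + r' - 1) * (of_nat (i choose r) * of_nat (i choose r'))))"
        unfolding power_Suc by (simp only: mult_ac)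
    qed
    finally show ?thesis .
  qed
  ultimately show ?thesis using that by blast
qed

end

section \<open>Gauss sums and elements of absolute value a power of \<open>p\<close>\<close>

context odd_prime
begin

lemma zeta_cnj: "zeta p * cnj (zeta p) = 1"
  by (simp add: zeta_def cis_cnj cis_mult)

definition gauss :: complex where "gauss = (\<Sum>x<p. zeta p ^ (x ^ 2))"

lemma gauss_in: "gauss \<in> zint p" unfolding gauss_def by auto

lemma sum_zeta_multiples: "(\<Sum>y<p. zeta p ^ (a * y)) = (if p dvd a then of_nat p else 0)"
proof (cases "p dvd a")
  case True
  then have "zeta p ^ (a * y) = 1" for y by (simp add: zeta_power_eq_1_iff)
  then show ?thesis using True by simp
next
  case False
  then have "zeta p ^ a \<noteq> 1" by (simp add: zeta_power_eq_1_iff)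
  moreover have "(zeta p ^ a) ^ p = 1" by (metis power_mult mult.commute zeta_N power_one)
  ultimately show ?thesis using False sum_powers_root_of_unity[of "zeta p ^ a" p] by (simp add: power_mult)
qed

text \<open>Substituting \<open>x = d + y\<close> makes the difference of squares in the exponent
  linear in \<open>y\<close>, so the inner sum vanishes unless \<open>d = 0\<close>, as
  \<open>p\<close> is odd.\<close>

lemma gauss_norm: "gauss * cnj gauss = of_nat p"
proof -
  have shift: "(\<Sum>x<p. zeta p ^ (x ^ 2)) = (\<Sum>d<p. zeta p ^ ((d + y) ^ 2))" for y
  proof -
    have "(\<Sum>x<p. zeta p ^ (x ^ 2)) = (\<Sum>d<p. zeta p ^ (((d + y) mod p) ^ 2))"
      using sum.reindex_bij_betw[OF bij_betw_add_mod[OF p_pos, of y], of "\<lambda>x. zeta p ^ (x ^ 2)"] by simp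
    also have "\<dots> = (\<Sum>d<p. zeta p ^ ((d + y) ^ 2))"
      by (intro sum.cong zeta_power_cong) (auto simp: cong_def power_mod)
    finally show ?thesis .
  qed
  have cz: "zeta p ^ k * cnj (zeta p) ^ k = 1" for k
    using zeta_cnj by (simp flip: power_mult_distrib)
  have "gauss * cnj gauss = (\<Sum>y<p. (\<Sum>x<p. zeta p ^ (x ^ 2)) * cnj (zeta p) ^ (y ^ 2))"
    by (simp add: gauss_def sum_distrib_left)
  also have "\<dots> = (\<Sum>y<p. \<Sum>d<p. zeta p ^ (d ^ 2) * zeta p ^ (2 * d * y))"
  proof (intro sum.cong refl)
    fix y
    have "(\<Sum>x<p. zeta p ^ (x ^ 2)) * cnj (zeta p) ^ (y ^ 2) = (\<Sum>d<p. zeta p ^ ((d + y) ^ 2) * cnj (zeta p) ^ (y ^ 2))"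
      by (simp only: shift[of y] sum_distrib_right)
    also have "\<dots> = (\<Sum>d<p. zeta p ^ (d ^ 2) * zeta p ^ (2 * d * y))"
    proof (intro sum.cong refl)
      fix d
      have e: "(d + y) ^ 2 = (d ^ 2 + 2 * d * y) + y ^ 2" by (simp add: power2_eq_square algebra_simps)
      have "zeta p ^ ((d + y) ^ 2) * cnj (zeta p) ^ (y ^ 2) =
        zeta p ^ (d ^ 2) * zeta p ^ (2 * d * y) * (zeta p ^ (y ^ 2) * cnj (zeta p) ^ (y ^ 2))"
        unfolding e power_add by (simp only: mult_ac)
      then show "zeta p ^ ((d + y) ^ 2) * cnj (zeta p) ^ (y ^ 2) = zeta p ^ (d ^ 2) * zeta p ^ (2 * d * y)"
        by (simp add: cz)
    qed
    finally show "(\<Sum>x<p. zeta p ^ (x ^ 2)) * cnj (zeta p) ^ (y ^ 2) = (\<Sum>d<p. zeta p ^ (d ^ 2) * zeta p ^ (2 * d * y))" .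
  qed
  also have "\<dots> = (\<Sum>d<p. zeta p ^ (d ^ 2) * (\<Sum>y<p. zeta p ^ (2 * d * y)))"
    by (subst sum.swap) (simp add: sum_distrib_left)
  also have "\<dots> = (\<Sum>d<p. if d = 0 then of_nat p else 0)"
  proof (intro sum.cong refl)
    fix d assume d: "d \<in> {..<p}"
    have "p dvd 2 * d \<longleftrightarrow> d = 0"
    proof
      assume "p dvd 2 * d"
      then have "p dvd 2 \<or> p dvd d" using p_prime by (simp add: prime_dvd_mult_iff)
      then show "d = 0" using d p_gt_2 by (auto dest: dvd_imp_le)
    qed simp
    then show "zeta p ^ (d ^ 2) * (\<Sum>y<p. zeta p ^ (2 * d * y)) = (if d = 0 then of_nat p else 0)"
      by (simp add: sum_zeta_multiples)
  qed
  also have "\<dots> = of_nat p" using p_pos by simp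
  finally show ?thesis .
qed

text \<open>\<open>zeta p\<close> is 1 modulo \<open>q\<close>, so every residue class contains a
  rational integer.\<close>

lemma zint_mod_q: assumes "z \<in> zint p" obtains a where "z - of_int a \<in> zideal p q"
proof -
  obtain c :: "nat \<Rightarrow> int" where c: "z = (\<Sum>i<p. of_int (c i) * zeta p ^ i)" using zint_coeffs[OF assms] .
  have "zeta p ^ i - 1 \<in> zideal p q" for i
    using zideal_closed(4)[OF root_of_unity_cong(2)[of "zeta p ^ i"]] zeta_N
    by (simp add: pi_q) (metis power_mult mult.commute power_one)
  then have "(\<Sum>i<p. of_int (c i) * (zeta p ^ i - 1)) \<in> zideal p q"
    by (intro zideal_sum zideal_closed(6)) auto
  then have "z - of_int (\<Sum>i<p. c i) \<in> zideal p q"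
    by (simp add: c algebra_simps sum_subtractf)
  then show ?thesis using that by blast
qed

lemma cnj_q: "cnj q = - (zeta p ^ (p - 1)) * q"
proof -
  have "zeta p ^ (p - 1) * zeta p = 1" using zeta_N p_gt_2 by (cases p) (auto simp: mult.commute)
  then show ?thesis by (simp add: cnj_zeta algebra_simps)
qed

lemma not_divisible_all_powers:
  assumes "\<And>j. of_nat p ^ R \<in> zideal p (q ^ j)"
  shows False
proof -
  have "(q ^ (p + p)) ^ (R + 1) \<in> zideal p (of_nat p ^ (R + 1))"
    by (rule zideal_power) (use pi_power_P in \<open>simp add: pi_q\<close>)
  then have "of_nat p ^ R \<in> zideal p (of_nat p ^ (R + 1))"
    using zideal_mono assms[of "(p + p) * (R + 1)"] unfolding power_mult by blast
  then obtain z where z: "z \<in> zint p" "of_nat p ^ R = of_nat p ^ (R + 1) * z" unfolding zideal_def by blast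
  then have "of_int 1 = of_int (int p) * z" using p_pos by simp
  then have "int p dvd 1" using z p_pos by (intro zint_multiple_int[of z]) auto
  then show False using p_gt_2 by simp
qed

text \<open>Since \<open>q\<close> generates the only prime above \<open>p\<close> and is stable under conjugation, an
  element whose norm is a power of \<open>p\<close> is associated to its conjugate.\<close>

lemma associated_cnj:
  assumes z: "z \<in> zint p" and R: "z * cnj z = of_nat p ^ R"
  obtains b where "b \<in> zint p" "z = b * cnj z"
proof -
  \<comment> \<open>The exact power of \<open>q\<close> dividing \<open>z\<close> exists because
    \<open>p ^ R\<close>, a multiple of \<open>z\<close>, is not divisible by all powers of
    \<open>q\<close>.\<close>
  have "\<exists>j. z \<in> zideal p (q ^ j) \<and> z \<notin> zideal p (q ^ Suc j)"
  proof (rule ccontr)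
    assume "\<not> ?thesis"
    then have step: "z \<in> zideal p (q ^ j) \<Longrightarrow> z \<in> zideal p (q ^ Suc j)" for j by blast
    have "z \<in> zideal p (q ^ j)" for j
    proof (induction j)
      case 0
      then show ?case using z by (auto simp: zideal_def)
    qed (rule step)
    then have "of_nat p ^ R \<in> zideal p (q ^ j)" for j
      using z by (simp only: R[symmetric]) (intro zideal_closed(5); auto)
    then show False by (rule not_divisible_all_powers)
  qed
  then obtain j z1 where z1: "z1 \<in> zint p" "z = q ^ j * z1" and nd: "z \<notin> zideal p (q ^ Suc j)"
    by (auto simp: zideal_def)
  have z1q: "z1 \<notin> zideal p q"
  proof
    assume "z1 \<in> zideal p q"
    then have "q ^ j * z1 \<in> zideal p (q ^ j * q)"
      using zideal_mult[OF zideal_closed(7)[of 1 "q ^ j"]] by simp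
    then show False using nd z1 by (simp add: mult.commute)
  qed
  obtain a where a: "z1 - of_int a \<in> zideal p q" using zint_mod_q[OF z1(1)] .
  have "cnj (z1 - of_int a) \<in> zideal p q"
  proof -
    obtain y where y: "y \<in> zint p" "z1 - of_int a = q * y" using a by (auto simp: zideal_def)
    have "cnj (z1 - of_int a) = cnj q * cnj y" by (simp only: y(2) complex_cnj_mult)
    also have "\<dots> = q * (- (zeta p ^ (p - 1)) * cnj y)" unfolding cnj_q by (simp only: mult_ac)
    also have "\<dots> \<in> zideal p q"
      by (intro zideal_closed(7) zint_closed(2,3) zint_power zint_cnj y(1) zint_intros)
    finally show ?thesis .
  qed
  then have a': "cnj z1 - of_int a \<in> zideal p q" by simp
  define D where "D = z1 * cnj z1"
  have D: "D \<in> zint p" using z1 by (auto simp: D_def)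
  have Da: "D - of_int (a * a) \<in> zideal p q"
  proof -
    have "D - of_int (a * a) = (z1 - of_int a) * cnj z1 + of_int a * (cnj z1 - of_int a)"
      by (simp add: D_def algebra_simps)
    then show ?thesis using zideal_closed(2)[OF zideal_closed(5)[OF a] zideal_closed(6)[OF a']] z1 by auto
  qed
  have "\<not> int p dvd a"
  proof
    assume "int p dvd a"
    then have "of_int a \<in> zideal p q" using int_in_pi_iff by (simp add: pi_q)
    from zideal_closed(2)[OF a this] show False using z1q by simp
  qed
  then have "coprime (a * a) (int p)"
    using p_prime by (metis coprime_commute coprime_mult_left_iff prime_imp_coprime prime_nat_int_transfer)
  then have "gcd (a * a) (int p) = 1" by simp
  then obtain x y where xy: "x * (a * a) + y * int p = 1" using bezout_int[of "a * a" "int p"] by metis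
  have "of_int x * (D - of_int (a * a)) - of_int y * of_nat p \<in> zideal p q"
    by (rule zideal_closed(3)[OF zideal_closed(6)[OF Da] zideal_closed(6)[OF of_p_in_pi[unfolded pi_q']]]) auto
  moreover have "of_int x * (D - of_int (a * a)) - of_int y * of_nat p = of_int x * D - of_int (x * (a * a) + y * int p)"
    by (simp add: algebra_simps)
  ultimately have "of_int x * D - 1 \<in> zideal p q" unfolding xy by simp
  then obtain t where t: "t \<in> zint p" "of_int x * D - 1 = q * t" by (auto simp: zideal_def)
  \<comment> \<open>\<open>D\<close> divides \<open>p ^ R\<close> and hence \<open>q ^ M\<close>; it
    also divides \<open>1 + q * t\<close>. So \<open>(q * t) ^ M\<close> is both 0 and
    \<open>(- 1) ^ M\<close> modulo \<open>D\<close>, which makes \<open>D\<close> a unit.\<close>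
  define M where "M = (p + p) * R"
  have Dz: "D * (q * cnj q) ^ j = of_nat p ^ R"
    using R unfolding z1(2) D_def by (simp add: power_mult_distrib mult_ac)
  have pD: "of_nat p ^ R \<in> zideal p D"
  proof -
    have "(q * cnj q) ^ j \<in> zint p" by (intro zint_power zint_closed(2) zint_cnj q_in)
    then show ?thesis unfolding Dz[symmetric] by (rule zideal_closed)
  qed
  have "(q ^ (p + p)) ^ R \<in> zideal p (of_nat p ^ R)"
    by (rule zideal_power) (use pi_power_P in \<open>simp add: pi_q\<close>)
  then have qD: "q ^ M \<in> zideal p D" using zideal_mono[OF pD] by (auto simp: M_def power_mult)
  have "(q * t) ^ M \<in> zideal p D" using qD t by (simp add: power_mult_distrib zideal_closed zint_power)
  moreover have "(q * t) ^ M - (- 1) ^ M \<in> zideal p D"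
  proof (rule ideal_power_diff)
    show "q * t - - 1 \<in> zideal p D" unfolding t(2)[symmetric] using zideal_closed(6)[OF zideal_closed(7)[of 1 D]] by simp
  qed (use t in auto)
  ultimately have "(q * t) ^ M - ((q * t) ^ M - (- 1) ^ M) \<in> zideal p D" by (rule zideal_closed(3))
  then have "(- 1) ^ M * (- 1) ^ M \<in> zideal p D" using zideal_closed(5)[of "(- 1) ^ M" D "(- 1) ^ M"] by auto
  then have "1 \<in> zideal p D" by (simp flip: power_mult_distrib)
  then have "1 \<in> (\<lambda>z. D * z) ` zint p" by (simp only: zideal_def)
  then obtain D' where D'_in: "D' \<in> zint p" and "1 = D * D'" by (elim imageE)
  then have D': "D' \<in> zint p" "D * D' = 1" by simp_all
  \<comment> \<open>This is \<open>z / cnj z\<close>: the quotient of \<open>q\<close> by its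
    conjugate is \<open>- zeta p\<close>, and \<open>D'\<close> inverts
    \<open>z1 * cnj z1\<close>.\<close>
  define b where "b = (- zeta p) ^ j * z1 ^ 2 * D'"
  have zz: "- zeta p * - (zeta p ^ (p - 1)) = 1" using zeta_N p_gt_2 by (cases p) auto
  have cz: "cnj z = (- (zeta p ^ (p - 1))) ^ j * q ^ j * cnj z1"
    by (simp only: z1(2) complex_cnj_mult complex_cnj_power cnj_q power_mult_distrib)
  have "b * cnj z = (- zeta p * - (zeta p ^ (p - 1))) ^ j * q ^ j * z1 * (z1 * cnj z1 * D')"
    unfolding b_def cz power2_eq_square power_mult_distrib[of "- zeta p"] by (simp only: mult_ac)
  also have "\<dots> = z" using D' zz by (simp add: z1(2) D_def[symmetric])
  finally have "z = b * cnj z" by simp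
  moreover have "b \<in> zint p" unfolding b_def
    by (intro zint_closed(2) zint_power zint_closed(3) zint_intros(6) z1(1) D'(1))
  ultimately show ?thesis using that by blast
qed

text \<open>The quotient of \<open>z\<close> by its conjugate has absolute value 1 under every
  automorphism, because these commute with conjugation; Kronecker's theorem applies.\<close>

lemma associated_cnj_root:
  assumes z: "z \<in> zint p" and R: "z * cnj z = of_nat p ^ R"
  obtains b r where "r > 0" "b ^ r = 1" "z = b * cnj z"
proof -
  obtain b where b: "b \<in> zint p" "z = b * cnj z" using associated_cnj[OF assms] .
  have z0: "z \<noteq> 0" using R p_pos by auto
  then have b0: "b \<noteq> 0" using b(2) by auto
  have "cmod (\<sigma> k b) \<le> 1" if k: "coprime k p" for k
  proof -
    have "\<sigma> k z = \<sigma> k (b * cnj z)" by (rule arg_cong[OF b(2)])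
    also have "\<dots> = \<sigma> k b * cnj (\<sigma> k z)"
      by (simp only: sigma_mult[OF k b(1) zint_cnj[OF z]] sigma_cnj[OF k z])
    finally have "\<sigma> k z = \<sigma> k b * cnj (\<sigma> k z)" .
    then have "cmod (\<sigma> k z) = cmod (\<sigma> k b) * cmod (\<sigma> k z)" by (metis complex_mod_cnj norm_mult)
    moreover have "\<sigma> k z \<noteq> 0" using k z z0 by (rule sigma_nonzero)
    ultimately show ?thesis by simp
  qed
  then obtain r where "r > 0" "b ^ r = 1" using kronecker_theorem[OF b(1) b0] by blast
  then show ?thesis using that b by blast
qed

end

section \<open>Irreducible groups with central commutators\<close>

lemma sc_un_eq_iff: "n > 0 \<Longrightarrow> sc c (un n) = sc d (un n) \<longleftrightarrow> c = d"
  by (metis ent_sc ent_un mult.right_neutral)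

lemma un_neq_0: "n > 0 \<Longrightarrow> un n \<noteq> 0"
  by (metis ent_un ent_simps(1) zero_neq_one)

text \<open>The properties of the extraspecial group used below, in a form that passes to Kronecker
  products (\<open>heis_kr\<close>). Irreducibility is stated as triviality of the commutant, and
  adjoints serve as inverses. Integrality of the entries feeds the arithmetic of
  \<open>normz_rescale\<close>.\<close>

locale heis = odd_prime +
  fixes n m :: nat and E :: "cmat set"
  assumes n_eq: "n = p ^ m"
    and E_supp [simp, intro]: "e \<in> E \<Longrightarrow> supp n e"
    and E_un [simp, intro]: "un n \<in> E"
    and E_mult [intro]: "e \<in> E \<Longrightarrow> f \<in> E \<Longrightarrow> e * f \<in> E"
    and E_adj [intro]: "e \<in> E \<Longrightarrow> adj e \<in> E"
    and E_unitary [simp]: "e \<in> E \<Longrightarrow> e * adj e = un n"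
    and E_unitary' [simp]: "e \<in> E \<Longrightarrow> adj e * e = un n"
    and E_fin: "finite E"
    and E_pow: "e \<in> E \<Longrightarrow> mpow n e p = un n"
    and E_comm: "e \<in> E \<Longrightarrow> f \<in> E \<Longrightarrow> \<exists>c. c ^ p = 1 \<and> e * f = sc c (f * e)"
    and E_scal: "c ^ p = 1 \<Longrightarrow> sc c (un n) \<in> E"
    and E_irr: "supp n M \<Longrightarrow> (\<And>e. e \<in> E \<Longrightarrow> M * e = e * M) \<Longrightarrow> \<exists>c. M = sc c (un n)"
    and E_int: "e \<in> E \<Longrightarrow> ent e i j \<in> zint p"
begin

lemma n_pos: "n > 0" using n_eq p_pos by simp

lemma card_pos: "card E > 0" using E_fin E_un by (auto simp: card_gt_0_iff)

lemma sum_E_left: "f \<in> E \<Longrightarrow> (\<Sum>e\<in>E. g (f * e)) = (\<Sum>e\<in>E. g e)"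
  by (rule sum.reindex_bij_witness[where i = "\<lambda>e. adj f * e" and j = "\<lambda>e. f * e"])
    (auto simp flip: mult.assoc)

lemma schur:
  assumes M: "supp n M"
  shows "(\<Sum>e\<in>E. e * M * adj e) = sc (of_nat (card E) / of_nat n * tr M) (un n)"
proof -
  define S where "S = (\<Sum>e\<in>E. e * M * adj e)"
  have sS: "supp n S" unfolding S_def using M by auto
  have "S * f = f * S" if f: "f \<in> E" for f
  proof -
    have "S = (\<Sum>e\<in>E. (f * e) * M * adj (f * e))"
      unfolding S_def using sum_E_left[OF f, of "\<lambda>e. e * M * adj e"] by simp
    also have "\<dots> = f * S * adj f" unfolding S_def by (simp add: sum_distrib_left sum_distrib_right mult.assoc)
    finally have "S * f = f * S * (adj f * f)" by (metis mult.assoc)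
    then show ?thesis using f supp_times[OF E_supp[OF f] sS] by simp
  qed
  then obtain c where c: "S = sc c (un n)" using E_irr[OF sS] by blast
  have "tr S = (\<Sum>e\<in>E. tr M)"
    unfolding S_def tr_sum
  proof (rule sum.cong)
    fix e assume e: "e \<in> E"
    have "tr (e * M * adj e) = tr ((adj e * e) * M)" by (subst tr_comm) (simp only: mult.assoc)
    then show "tr (e * M * adj e) = tr M" using e M by simp
  qed simp
  then have "c = of_nat (card E) / of_nat n * tr M" using n_pos by (simp add: c field_simps)
  then show ?thesis using c S_def by simp
qed

text \<open>Average the matrix unit \<open>J\<close> at position \<open>(j, l)\<close> with
  \<open>schur\<close> and read off the entry \<open>(i, k)\<close>.\<close>

lemma orthogonality:
  assumes "i < n" "j < n" "k < n" "l < n"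
  shows "(\<Sum>e\<in>E. ent e i j * cnj (ent e k l)) = (if i = k \<and> j = l then of_nat (card E) / of_nat n else 0)"
proof -
  define J where "J = Cmat (\<lambda>a b. if a = j \<and> b = l then 1 else 0)"
  have "(\<lambda>a b. if a = j \<and> b = l then 1 else 0) \<in> {A. \<exists>n. \<forall>i j. n \<le> i \<or> n \<le> j \<longrightarrow> A i j = (0 :: complex)}"
    using assms by (auto intro!: exI[of _ n])
  then have J: "ent J a b = (if a = j \<and> b = l then 1 else 0)" for a b by (simp add: J_def Cmat_inverse)
  have sJ: "supp n J" using assms by (auto simp: supp_def J)
  have e1: "ent (e * J) a b = (if b = l then ent e a j else 0)" if e: "e \<in> E" for e a b
  proof -
    have "ent (e * J) a b = (\<Sum>c<n. if c = j then (if b = l then ent e a j else 0) else 0)"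
      unfolding ent_times[OF E_supp[OF e]] by (intro sum.cong) (auto simp: J)
    then show ?thesis using assms by simp
  qed
  have "ent (e * J * adj e) i k = ent e i j * cnj (ent e k l)" if e: "e \<in> E" for e
  proof -
    have s: "supp n (e * J)" using e sJ by auto
    have "ent (e * J * adj e) i k = (\<Sum>b<n. if b = l then ent e i j * cnj (ent e k l) else 0)"
      unfolding ent_times[OF s] by (intro sum.cong) (auto simp: e1[OF e])
    then show ?thesis using assms by simp
  qed
  then have "(\<Sum>e\<in>E. ent e i j * cnj (ent e k l)) = ent (\<Sum>e\<in>E. e * J * adj e) i k" by simp
  also have "\<dots> = (if i = k then of_nat (card E) / of_nat n * tr J else 0)"
    using assms by (simp add: schur[OF sJ])
  also have "tr J = (if j = l then 1 else 0)"
  proof -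
    have "tr J = (\<Sum>a<n. if a = j then (if j = l then 1 else 0) else 0)"
      unfolding tr_eq[OF sJ] by (intro sum.cong) (auto simp: J)
    then show ?thesis using assms by simp
  qed
  finally show ?thesis by auto
qed

text \<open>\<open>E\<close> spans all matrices of size \<open>n\<close>. Every class modulo scalars
  is counted \<open>p\<close> times, which makes the factor
  \<open>card E / n = p * n\<close>.\<close>

lemma fourier:
  assumes X: "supp n X"
  shows "(\<Sum>e\<in>E. sc (tr (X * adj e)) e) = sc (of_nat (card E) / of_nat n) X"
proof (rule cmat_eqI)
  fix i j
  show "ent (\<Sum>e\<in>E. sc (tr (X * adj e)) e) i j = ent (sc (of_nat (card E) / of_nat n) X) i j"
  proof (cases "i < n \<and> j < n")
    case False
    then have "ent e i j = 0" if "e \<in> E" for e using E_supp[OF that] by (auto simp: supp_def)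
    moreover have "ent X i j = 0" using False X by (auto simp: supp_def)
    ultimately show ?thesis by simp
  next
    case True
    have t: "tr (X * adj e) = (\<Sum>k<n. \<Sum>l<n. ent X k l * cnj (ent e k l))" if "e \<in> E" for e
      using that X by (subst tr_eq[of n]) (auto simp: ent_times[OF X])
    have "ent (\<Sum>e\<in>E. sc (tr (X * adj e)) e) i j =
        (\<Sum>e\<in>E. \<Sum>k<n. \<Sum>l<n. ent X k l * (ent e i j * cnj (ent e k l)))"
      by (simp add: t sum_distrib_left sum_distrib_right mult_ac)
    also have "\<dots> = (\<Sum>k<n. \<Sum>e\<in>E. \<Sum>l<n. ent X k l * (ent e i j * cnj (ent e k l)))" by (rule sum.swap)
    also have "\<dots> = (\<Sum>k<n. \<Sum>l<n. \<Sum>e\<in>E. ent X k l * (ent e i j * cnj (ent e k l)))"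
      by (intro sum.cong refl sum.swap)
    also have "\<dots> = (\<Sum>k<n. \<Sum>l<n. ent X k l * (if i = k \<and> j = l then of_nat (card E) / of_nat n else 0))"
      using True by (intro sum.cong refl) (simp add: orthogonality flip: sum_distrib_left)
    also have "\<dots> = (\<Sum>k<n. if k = i then ent X i j * (of_nat (card E) / of_nat n) else 0)"
    proof (intro sum.cong refl)
      fix k assume "k \<in> {..<n}"
      have "(\<Sum>l<n. ent X k l * (if i = k \<and> j = l then of_nat (card E) / of_nat n else 0)) =
        (\<Sum>l<n. if l = j then (if k = i then ent X i j * (of_nat (card E) / of_nat n) else 0) else 0)"
        by (intro sum.cong) auto
      then show "(\<Sum>l<n. ent X k l * (if i = k \<and> j = l then of_nat (card E) / of_nat n else 0)) =
        (if k = i then ent X i j * (of_nat (card E) / of_nat n) else 0)" using True by simp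
    qed
    also have "\<dots> = ent (sc (of_nat (card E) / of_nat n) X) i j" using True by simp
    finally show ?thesis .
  qed
qed

lemma parseval:
  assumes X: "supp n X"
  shows "(\<Sum>e\<in>E. tr (X * adj e) * tr (e * Y)) = of_nat (card E) / of_nat n * tr (X * Y)"
proof -
  have "tr ((\<Sum>e\<in>E. sc (tr (X * adj e)) e) * Y) = tr (sc (of_nat (card E) / of_nat n) X * Y)"
    by (simp only: fourier[OF X])
  then show ?thesis by (simp add: sum_distrib_right)
qed

definition scalar :: "cmat \<Rightarrow> bool" where "scalar x \<longleftrightarrow> (\<exists>c. x = sc c (un n))"

lemma tr_nonscalar: assumes e: "e \<in> E" "\<not> scalar e" shows "tr e = 0"
proof -
  obtain f where f: "f \<in> E" "e * f \<noteq> f * e" using E_irr[OF E_supp[OF e(1)]] e by (auto simp: scalar_def)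
  obtain c where c: "f * e = sc c (e * f)" using E_comm[OF f(1) e(1)] by blast
  have "c \<noteq> 1" using c f by auto
  have "tr (f * e * adj f) = tr (sc c (e * f) * adj f)" by (simp only: c)
  also have "\<dots> = c * tr e" using f e by (simp add: mult.assoc)
  finally have "tr (f * e * adj f) = c * tr e" .
  moreover have "tr (f * e * adj f) = tr ((adj f * f) * e)" by (subst tr_comm) (simp only: mult.assoc)
  ultimately show ?thesis using f e \<open>c \<noteq> 1\<close> by simp
qed

lemma scalar_E: "e \<in> E \<Longrightarrow> e = sc c (un n) \<Longrightarrow> c ^ p = 1"
  using E_pow[of e] n_pos sc_un_eq_iff[of n "c ^ p" 1] by (simp add: mpow_sc)

lemma sum_scalars: "(\<Sum>e | e \<in> E \<and> scalar e. g e) = (\<Sum>c | c ^ p = 1. g (sc c (un n)))"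
proof (rule sum.reindex_bij_betw[symmetric])
  show "bij_betw (\<lambda>c. sc c (un n)) {c. c ^ p = 1} {e. e \<in> E \<and> scalar e}"
    unfolding bij_betw_def using sc_un_eq_iff[OF n_pos] E_scal scalar_E
    by (auto simp: scalar_def inj_on_def)
qed

text \<open>Parseval for the identity: only the \<open>p\<close> scalars of \<open>E\<close> have
  nonzero trace, and each contributes \<open>n ^ 2\<close>.\<close>

lemma card_E: "card E = p * n ^ 2"
proof -
  have "(\<Sum>e\<in>E. tr (un n * adj e) * tr (e * un n)) = of_nat (card E)"
    using parseval[of "un n" "un n"] n_pos by simp
  moreover have "(\<Sum>e\<in>E. tr (un n * adj e) * tr (e * un n)) = (\<Sum>e | e \<in> E \<and> scalar e. tr (adj e) * tr e)"
    using E_fin by (intro sum.mono_neutral_cong_right) (auto simp: tr_nonscalar)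
  moreover have "\<dots> = (\<Sum>c | c ^ p = 1. of_nat n * of_nat n * (c * cnj c))"
    unfolding sum_scalars by (intro sum.cong) auto
  moreover have "\<dots> = (\<Sum>c :: complex | c ^ p = 1. of_nat n * of_nat n)"
  proof (rule sum.cong)
    fix c :: complex assume "c \<in> {c. c ^ p = 1}"
    then have "cmod c = 1" using power_eq_1_iff[of c p] p_pos by auto
    then have "c * cnj c = 1" by (simp add: complex_norm_square[symmetric])
    then show "of_nat n * of_nat n * (c * cnj c) = (of_nat n * of_nat n :: complex)" by simp
  qed simp
  ultimately have "of_nat (card E) = (\<Sum>c :: complex | c ^ p = 1. of_nat n * of_nat n :: complex)" by simp
  also have "\<dots> = of_nat (p * n ^ 2)"
    using card_roots_unity_eq[of p] p_pos by (simp add: power2_eq_square)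
  finally show ?thesis by (simp only: of_nat_eq_iff)
qed

end

section \<open>The normalizer modulo scalars\<close>

context heis
begin

text \<open>The normalizer of \<open>E\<close> in the full linear group, with the inverse as second
  argument. Unitarity and finite order come only after rescaling.\<close>

definition normz :: "cmat \<Rightarrow> cmat \<Rightarrow> bool" where
  "normz x x' \<longleftrightarrow> supp n x \<and> supp n x' \<and> x * x' = un n \<and> x' * x = un n \<and> (\<forall>e\<in>E. x * e * x' \<in> E)"

lemma normzD:
  assumes "normz x x'"
  shows "supp n x" "supp n x'" "x * x' = un n" "x' * x = un n" "e \<in> E \<Longrightarrow> x * e * x' \<in> E"
  using assms by (auto simp: normz_def)

lemma conj_cancel: "x' * x = un n \<Longrightarrow> supp n e \<Longrightarrow> x' * (x * e * x') * x = e"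
proof -
  assume h: "x' * x = un n" and e: "supp n e"
  have "x' * (x * e * x') * x = (x' * x) * e * (x' * x)" by (simp only: mult.assoc)
  then show ?thesis using h e by simp
qed

lemma normz_sym: assumes h: "normz x x'" shows "normz x' x"
proof -
  note d = normzD[OF h]
  have "inj_on (\<lambda>e. x * e * x') E"
    using conj_cancel[OF d(4)] by (intro inj_onI) (metis E_supp)
  then have im: "(\<lambda>e. x * e * x') ` E = E" using d(5) E_fin by (intro endo_inj_surj) auto
  have "x' * e * x \<in> E" if "e \<in> E" for e
  proof -
    have "e \<in> (\<lambda>e. x * e * x') ` E" using that unfolding im .
    then obtain f where f: "f \<in> E" "e = x * f * x'" by (elim imageE)
    then show ?thesis using conj_cancel[OF d(4), of f] by simp
  qed
  then show ?thesis using d by (simp add: normz_def)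
qed

lemma normz_mult: assumes "normz x x'" "normz y y'" shows "normz (x * y) (y' * x')"
proof -
  note d = normzD[OF assms(1)] and d' = normzD[OF assms(2)]
  have "x * y * (y' * x') = x * (y * y') * x'" "y' * x' * (x * y) = y' * (x' * x) * y"
    by (simp_all only: mult.assoc)
  moreover have "x * y * e * (y' * x') = x * (y * e * y') * x'" for e by (simp only: mult.assoc)
  ultimately show ?thesis using d d' by (auto simp: normz_def)
qed

lemma normz_E: "e \<in> E \<Longrightarrow> normz e (adj e)"
  by (auto simp: normz_def)

lemma normz_sc: "c \<noteq> 0 \<Longrightarrow> normz x x' \<Longrightarrow> normz (sc c x) (sc (inverse c) x')"
  by (auto simp: normz_def)

lemma normz_mpow: "normz x x' \<Longrightarrow> normz (mpow n x k) (mpow n x' k)"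
proof (induction k)
  case 0
  show ?case using normz_E[OF E_un] by simp
next
  case (Suc k)
  have "mpow n x' (Suc k) = mpow n x' k * x'" using Suc.prems by (intro mpow_Suc_right) (auto simp: normz_def)
  then show ?case using normz_mult[OF Suc.prems Suc.IH[OF Suc.prems]] by simp
qed

text \<open>The powers of \<open>x\<close> act on the finite set \<open>E\<close> by conjugation, so
  two of these actions agree and their quotient centralizes \<open>E\<close>.\<close>

lemma normz_power_scalar:
  assumes h: "normz x x'"
  obtains k where "k > 0" "scalar (mpow n x k)"
proof -
  define \<phi> where "\<phi> k = restrict (\<lambda>e. mpow n x k * e * mpow n x' k) E" for k
  have "range \<phi> \<subseteq> E \<rightarrow>\<^sub>E E" using normzD(5)[OF normz_mpow[OF h]] by (auto simp: \<phi>_def)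
  then have "finite (range \<phi>)" using E_fin by (meson finite_PiE finite_subset)
  then have "\<not> inj \<phi>" using finite_imageD infinite_UNIV_nat by blast
  then obtain i j where "\<phi> i = \<phi> j" "i < j" unfolding inj_def by (metis nat_neq_iff)
  define d where "d = j - i"
  have s: "supp n x" "supp n x'" using h by (auto simp: normz_def)
  have j1: "mpow n x j = mpow n x i * mpow n x d" and j2: "mpow n x' j = mpow n x' d * mpow n x' i"
    using mpow_add[OF s(1), of i d] mpow_add[OF s(2), of d i] \<open>i < j\<close> by (auto simp: d_def)
  note di = normzD[OF normz_mpow[OF h, of i]] and dd = normzD[OF normz_mpow[OF h, of d]]
  have "mpow n x d * e = e * mpow n x d" if e: "e \<in> E" for e
  proof -
    have "mpow n x i * e * mpow n x' i = mpow n x j * e * mpow n x' j"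
      using fun_cong[OF \<open>\<phi> i = \<phi> j\<close>, of e] e by (simp add: \<phi>_def)
    also have "\<dots> = mpow n x i * (mpow n x d * e * mpow n x' d) * mpow n x' i"
      unfolding j1 j2 by (simp only: mult.assoc)
    finally have eq: "mpow n x i * e * mpow n x' i = mpow n x i * (mpow n x d * e * mpow n x' d) * mpow n x' i" .
    have "e = mpow n x' i * (mpow n x i * e * mpow n x' i) * mpow n x i"
      by (rule conj_cancel[OF di(4) E_supp[OF e], symmetric])
    also have "\<dots> = mpow n x d * e * mpow n x' d"
      unfolding eq by (rule conj_cancel[OF di(4) E_supp[OF dd(5)[OF e]]])
    finally have "e = mpow n x d * e * mpow n x' d" .
    then have "e * mpow n x d = mpow n x d * e * (mpow n x' d * mpow n x d)" by (metis mult.assoc)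
    then show ?thesis using dd e by (simp add: supp_times)
  qed
  then have "scalar (mpow n x d)" using E_irr[of "mpow n x d"] s by (auto simp: scalar_def)
  then show ?thesis using that[of d] \<open>i < j\<close> by (simp add: d_def)
qed

text \<open>\<open>x * adj x\<close> commutes with \<open>E\<close>, because \<open>x\<close>
  normalizes \<open>E\<close> and \<open>E\<close> is unitary.\<close>

lemma normz_adj:
  assumes h: "normz x x'"
  obtains \<rho> where "x * adj x = sc \<rho> (un n)"
proof -
  note d = normzD[OF h]
  have "x * adj x * e = e * (x * adj x)" if e: "e \<in> E" for e
  proof -
    define f where "f = x' * e * x"
    have f: "f \<in> E" using normzD(5)[OF normz_sym[OF h] e] by (simp add: f_def)
    have ef: "e = x * f * x'" unfolding f_def using conj_cancel[OF d(3), of e] e by simp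
    have xf: "e * x = x * f" unfolding ef using f d by (simp add: mult.assoc)
    have "x * adj x = e * (x * adj x) * adj e"
    proof -
      have "e * (x * adj x) * adj e = (e * x) * adj (e * x)" by (simp add: mult.assoc)
      also have "\<dots> = x * (f * adj f) * adj x" unfolding xf by (simp add: mult.assoc)
      also have "\<dots> = x * adj x" using f d by simp
      finally show ?thesis by simp
    qed
    then have "x * adj x * e = e * (x * adj x) * (adj e * e)" by (metis mult.assoc)
    then show ?thesis using e d by (simp add: supp_times)
  qed
  then show ?thesis using that E_irr[of "x * adj x"] d by (metis supp_intros(4) supp_times)
qed

text \<open>The centralizer of \<open>w\<close> is a subgroup of \<open>E\<close>, whose order is
  \<open>p ^ (2 * m + 1)\<close>.\<close>

lemma stabilizer_card:
  "supp n w \<Longrightarrow> \<exists>b. card {f \<in> E. f * w = w * f} = p ^ b"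
proof -
  assume w: "supp n w"
  define G where "G = \<lparr>carrier = E, monoid.mult = (*), one = un n\<rparr>"
  have G: "group G"
  proof (rule groupI)
    fix x assume "x \<in> carrier G"
    then show "\<exists>y\<in>carrier G. y \<otimes>\<^bsub>G\<^esub> x = \<one>\<^bsub>G\<^esub>" by (auto simp: G_def intro!: bexI[of _ "adj x"])
  qed (auto simp: G_def mult.assoc)
    have "subgroup {f \<in> E. f * w = w * f} G"
    proof (rule group.subgroupI[OF G])
      fix a assume a: "a \<in> {f \<in> E. f * w = w * f}"
      then have aE: "a \<in> E" by simp
      have "inv\<^bsub>G\<^esub> a = adj a"
        using aE by (intro group.inv_equality[OF G]) (auto simp: G_def)
      moreover have "adj a * w = w * adj a"
      proof -
        have "adj a * w = adj a * (w * a) * adj a" using aE w by (simp add: mult.assoc)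
        also have "\<dots> = adj a * (a * w) * adj a" using a by simp
        also have "\<dots> = (adj a * a) * w * adj a" by (simp only: mult.assoc)
        finally show ?thesis using aE w by simp
      qed
      ultimately show "inv\<^bsub>G\<^esub> a \<in> {f \<in> E. f * w = w * f}" using aE by auto
    next
      fix a b assume "a \<in> {f \<in> E. f * w = w * f}" "b \<in> {f \<in> E. f * w = w * f}"
      then have h: "a \<in> E" "b \<in> E" "a * w = w * a" "b * w = w * b" by auto
      have "a * b * w = w * (a * b)" using h(3,4) by (metis mult.assoc)
      then show "a \<otimes>\<^bsub>G\<^esub> b \<in> {f \<in> E. f * w = w * f}" using h by (auto simp: G_def)
    qed (use w in \<open>auto simp: G_def intro!: exI[of _ "un n"]\<close>)
    from group.lagrange[OF G this] have "card {f \<in> E. f * w = w * f} dvd Coset.order G"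
      by (rule dvdI[OF trans[OF sym mult.commute]])
    then have "card {f \<in> E. f * w = w * f} dvd card E" by (simp add: Coset.order_def G_def)
    then have "card {f \<in> E. f * w = w * f} dvd p ^ (2 * m + 1)"
      by (simp add: card_E n_eq power_mult[symmetric] mult.commute)
    then show ?thesis using divides_primepow_nat[OF p_prime] by blast
qed

lemma mpow_unitary: "y * adj y = un n \<Longrightarrow> supp n y \<Longrightarrow> mpow n y k * adj (mpow n y k) = un n"
proof (induction k)
  case (Suc k)
  have "mpow n y (Suc k) * adj (mpow n y (Suc k)) = y * (mpow n y k * adj (mpow n y k)) * adj y"
    by (simp add: mult.assoc)
  then show ?case using Suc by simp
qed simp

lemma zint_mpow: "(\<And>i j. ent y i j \<in> zint p) \<Longrightarrow> supp n y \<Longrightarrow> ent (mpow n y k) i j \<in> zint p"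
  by (induction k arbitrary: i j) (auto simp: ent_times intro!: zint_sum zint_closed)

text \<open>The multiples \<open>y\<close> of \<open>x\<close> with entries in the ring of cyclotomic integers obtained
  by averaging satisfy \<open>y * adj y = p\<^sup>R\<close>, so dividing by a Gauss sum makes them
  unitary; the scalar powers of the result are of finite order by \<open>associated_cnj_root\<close>.\<close>

theorem normz_rescale:
  assumes h: "normz x x'"
  obtains \<mu> r d where "\<mu> \<noteq> 0" "sc \<mu> x * adj (sc \<mu> x) = un n" "r > 0" "mpow n (sc \<mu> x) r = un n"
    "d > 0" "\<And>i j. of_nat d * ent (sc \<mu> x) i j \<in> zint p"
proof -
  note d = normzD[OF h]
  \<comment> \<open>The average below has the trace of \<open>x' * e\<close> as a factor, so
    \<open>e\<close> must make it nonzero.\<close>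
  have "\<exists>e\<in>E. tr (x' * e) \<noteq> 0"
  proof (rule ccontr)
    assume "\<not> ?thesis"
    then have "tr (x' * adj e) = 0" if "e \<in> E" for e using that by blast
    then have "sc (of_nat (card E) / of_nat n) x' = 0"
      using fourier[OF d(2)] by simp
    then have "x' = 0" using card_pos n_pos by (simp add: sc_eq_0_iff)
    then show False using d(3) un_neq_0[OF n_pos] by simp
  qed
  then obtain e where e: "e \<in> E" "tr (x' * e) \<noteq> 0" by blast
  define w w' where "w = x' * e" and "w' = adj e * x"
  have nw: "normz w w'" unfolding w_def w'_def
    using normz_mult[OF normz_sym[OF h] normz_E[OF e(1)]] .
  note dw = normzD[OF nw]
  define \<kappa> where "\<kappa> = of_nat (card E) / of_nat n * tr w"
  have \<kappa>: "\<kappa> \<noteq> 0" using e(2) card_pos n_pos by (simp add: \<kappa>_def w_def)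
  define y0 where "y0 = sc \<kappa> x"
  \<comment> \<open>Averaging \<open>w\<close> over \<open>E\<close> gives the scalar \<kappa>.
    After multiplication by \<open>x\<close> each summand starts with \<open>x * f * x'\<close>, an
    element of \<open>E\<close>, so \<open>y0\<close> has integral entries although \<open>x\<close>
    need not.\<close>
  have "x * (\<Sum>f\<in>E. f * w * adj f) = y0"
    using d(1) by (simp add: schur[OF dw(1)] y0_def \<kappa>_def)
  then have y0: "y0 = (\<Sum>f\<in>E. x * f * x' * e * adj f)"
    by (simp add: sum_distrib_left w_def mult.assoc)
  have ent_y0: "ent y0 i j \<in> zint p" for i j
    unfolding y0 ent_sum using d(5) e by (intro zint_sum E_int) blast
  have s0: "supp n y0" using d by (simp add: y0_def)
  define F where "F = {f \<in> E. f * w = w * f}"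
  obtain b where b: "card F = p ^ b" using stabilizer_card[OF dw(1)] unfolding F_def by blast
  obtain \<rho> where \<rho>: "x * adj x = sc \<rho> (un n)" using normz_adj[OF h] .
  \<comment> \<open>A second moment: \<open>f * w * adj f * w'\<close> lies in \<open>E\<close>, so
    its trace vanishes unless it is scalar; comparing traces with \<open>w\<close> then shows that
    the scalar is 1, that is, that \<open>f\<close> commutes with \<open>w\<close>.\<close>
  have trw: "tr w * tr w' * of_nat (card E) = of_nat n ^ 2 * of_nat (card F)"
  proof -
    have "(\<Sum>f\<in>E. tr (f * w * adj f * w')) = tr ((\<Sum>f\<in>E. f * w * adj f) * w')"
      by (simp add: sum_distrib_right)
    also have "\<dots> = of_nat (card E) / of_nat n * tr w * tr w'"
      using dw by (simp add: schur[OF dw(1)])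
    also have "(\<Sum>f\<in>E. tr (f * w * adj f * w')) = (\<Sum>f\<in>E. if f \<in> F then of_nat n else 0)"
    proof (intro sum.cong refl)
      fix f assume f: "f \<in> E"
      define g where "g = f * w * adj f * w'"
      have gE: "g \<in> E" using dw(5)[of "adj f"] f by (auto simp: g_def mult.assoc)
      have gw: "g * w * f = f * w"
      proof -
        have "g * w * f = f * w * adj f * (w' * w) * f" by (simp add: g_def mult.assoc)
        also have "\<dots> = f * w * (adj f * f)" using f dw by (simp add: mult.assoc)
        finally show ?thesis using f dw by (simp add: supp_times)
      qed
      show "tr (f * w * adj f * w') = (if f \<in> F then of_nat n else 0)"
      proof (cases "scalar g")
        case False
        have "f \<notin> F"
        proof
          assume "f \<in> F"
          then have "g = w * (f * adj f) * w'" by (simp add: g_def F_def mult.assoc)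
          then have "g = sc 1 (un n)" using f dw by simp
          then have "scalar g" unfolding scalar_def by blast
          then show False using False by simp
        qed
        then show ?thesis using tr_nonscalar[OF gE False] by (simp add: g_def)
      next
        case True
        then obtain c where c: "g = sc c (un n)" by (auto simp: scalar_def)
        have fw: "f * w = sc c (w * f)" using gw f dw by (simp add: c supp_times)
        have "tr (f * w * adj f) = tr ((adj f * f) * w)" by (subst tr_comm) (simp only: mult.assoc)
        then have "tr (f * w * adj f) = tr w" using f dw by simp
        moreover have "tr (f * w * adj f) = c * tr w" using f dw by (simp add: fw mult.assoc)
        ultimately have "c = 1" using e(2) by (simp add: w_def)
        then have "f \<in> F" "g = un n" using fw f c by (auto simp: F_def)
        then show ?thesis by (simp add: g_def)
      qed
    qed
    also have "\<dots> = of_nat n * of_nat (card F)"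
    proof -
      have "E \<inter> {f. f \<in> F} = F" by (auto simp: F_def)
      then show ?thesis using E_fin by (simp flip: sum.inter_restrict)
    qed
    finally show ?thesis using n_pos by (simp add: field_simps power2_eq_square)
  qed
  have adjx: "adj x = sc \<rho> x'"
  proof -
    have "x' * (x * adj x) = sc \<rho> x'" using d by (simp add: \<rho>)
    moreover have "x' * (x * adj x) = adj x" using d by (simp flip: mult.assoc)
    ultimately show ?thesis by simp
  qed
  have cw: "cnj (tr w') = \<rho> * tr w"
  proof -
    have tr_adj: "tr (adj A) = cnj (tr A)" if "supp n A" for A
      using that by (simp add: tr_eq[of n])
    have "cnj (tr w') = tr (adj x * e)" using tr_adj[OF dw(2)] by (simp add: w'_def)
    then show ?thesis by (simp add: adjx w_def)
  qed
  \<comment> \<open>The exponent of \<open>p\<close> in \<open>card E * card F\<close>.\<close>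
  define R where "R = 2 * m + 1 + b"
  have \<rho>_real: "cnj \<rho> = \<rho>"
  proof -
    have "adj (x * adj x) = x * adj x" by simp
    then show ?thesis unfolding \<rho> using sc_un_eq_iff[OF n_pos] by simp
  qed
  have norm: "\<kappa> * cnj \<kappa> * \<rho> = of_nat p ^ R"
  proof -
    have "cnj (tr w) * \<rho> = tr w'" using arg_cong[OF cw, of cnj] \<rho>_real by simp
    then have "\<kappa> * cnj \<kappa> * \<rho> = (of_nat (card E) / of_nat n) ^ 2 * (tr w * tr w')"
      by (simp add: \<kappa>_def power2_eq_square)
    also have "\<dots> = of_nat (card E) * (tr w * tr w' * of_nat (card E)) / of_nat n ^ 2"
      by (simp add: power2_eq_square)
    also have "\<dots> = of_nat (card E * card F)" unfolding trw using n_pos by simp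
    also have "card E * card F = p ^ R"
      by (simp add: card_E n_eq b R_def power_add power_mult power_mult_distrib[symmetric] power_commutes)
        (simp add: power_mult[symmetric] mult.commute)
    finally show ?thesis by simp
  qed
  \<comment> \<open>An element of \<open>zint p\<close> whose absolute value is the square root of
    \<open>p ^ R\<close>: for odd \<open>R\<close> the Gauss sum replaces the square root of
    \<open>p\<close>, which may lie outside the field of \<open>p\<close>-th roots of unity.\<close>
  define s where "s = of_nat p ^ (R div 2) * gauss ^ (R mod 2)"
  have s_in: "s \<in> zint p" using gauss_in by (auto simp: s_def)
  have s_norm: "s * cnj s = of_nat p ^ R"
  proof -
    have "s * cnj s = of_nat p ^ (R div 2 + R div 2) * (gauss * cnj gauss) ^ (R mod 2)"
      by (simp add: s_def power_add power_mult_distrib mult_ac)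
    also have "\<dots> = of_nat p ^ (R div 2 + R div 2 + R mod 2)" unfolding gauss_norm power_add ..
    also have "R div 2 + R div 2 + R mod 2 = R" by presburger
    finally show ?thesis .
  qed
  have s_neq: "s \<noteq> 0" using s_norm p_pos by auto
  define \<mu> where "\<mu> = \<kappa> / s"
  have \<mu>: "\<mu> \<noteq> 0" using \<kappa> s_neq by (simp add: \<mu>_def)
  have \<mu>x: "sc \<mu> x = sc (1 / s) y0" by (simp add: y0_def \<mu>_def)
  have U: "sc \<mu> x * adj (sc \<mu> x) = un n"
  proof -
    have "sc \<mu> x * adj (sc \<mu> x) = sc (\<mu> * cnj \<mu> * \<rho>) (un n)" by (simp add: \<rho> mult_ac)
    also have "\<mu> * cnj \<mu> * \<rho> = (\<kappa> * cnj \<kappa> * \<rho>) / (s * cnj s)" by (simp add: \<mu>_def)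
    also have "\<dots> = 1" unfolding norm s_norm using p_pos by simp
    finally show ?thesis by simp
  qed
  have ent: "of_nat (p ^ R) * ent (sc \<mu> x) i j \<in> zint p" for i j
  proof -
    have "of_nat (p ^ R) * ent (sc \<mu> x) i j = cnj s * ent y0 i j"
      unfolding \<mu>x using s_neq by (simp flip: s_norm)
    then show ?thesis using s_in ent_y0 by auto
  qed
  obtain k where k: "k > 0" "scalar (mpow n (sc \<mu> x) k)"
    using normz_power_scalar[OF normz_sc[OF \<mu> h]] .
  then obtain c where c: "mpow n (sc \<mu> x) k = sc c (un n)" by (auto simp: scalar_def)
  have "sc (c * cnj c) (un n) = sc 1 (un n)" using mpow_unitary[OF U, of k] d(1) by (simp add: c mult.commute)
  then have c1: "c * cnj c = 1" by (simp only: sc_un_eq_iff[OF n_pos])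
  \<comment> \<open>\<open>z\<close> is in \<open>zint p\<close> and \<open>z * cnj z\<close> is a
    power of \<open>p\<close>, as for \<open>s\<close>. As \<open>c\<close> has absolute value 1,
    \<open>c ^ 2\<close> is the quotient of \<open>z / cnj z\<close> by
    \<open>(s / cnj s) ^ k\<close>, and both are roots of unity.\<close>
  define z where "z = c * s ^ k"
  have "mpow n y0 k = sc z (un n)"
  proof -
    have "y0 = sc s (sc \<mu> x)" using s_neq by (simp add: \<mu>x)
    then have "mpow n y0 k = sc (s ^ k) (mpow n (sc \<mu> x) k)" using d(1) by (simp only: mpow_sc supp_intros)
    then show ?thesis by (simp add: c z_def mult.commute)
  qed
  then have z_in: "z \<in> zint p" using zint_mpow[OF ent_y0 s0, of k 0 0] n_pos by simp
  have z_norm: "z * cnj z = of_nat p ^ (R * k)"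
  proof -
    have "z * cnj z = (c * cnj c) * (s * cnj s) ^ k" by (simp add: z_def power_mult_distrib)
    then show ?thesis by (simp only: c1 s_norm power_mult mult_1_left)
  qed
  obtain b1 r1 where b1: "r1 > 0" "b1 ^ r1 = 1" "z = b1 * cnj z" using associated_cnj_root[OF z_in z_norm] .
  obtain b2 r2 where b2: "r2 > 0" "b2 ^ r2 = 1" "s = b2 * cnj s" using associated_cnj_root[OF s_in s_norm] .
  have cc: "c ^ 2 * b2 ^ k = b1"
  proof -
    have zn: "cnj z \<noteq> 0" using z_norm p_pos by auto
    have "c ^ 2 * b2 ^ k * cnj z = c * (c * cnj c) * (b2 * cnj s) ^ k"
      by (simp add: z_def power2_eq_square power_mult_distrib mult_ac)
    also have "\<dots> = z" unfolding c1 b2(3)[symmetric] by (simp add: z_def)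
    also have "\<dots> = b1 * cnj z" by (rule b1)
    finally show ?thesis using zn by simp
  qed
  have "(c ^ 2) ^ (r1 * r2) = 1"
  proof -
    have "(c ^ 2) ^ (r1 * r2) * (b2 ^ k) ^ (r1 * r2) = b1 ^ (r1 * r2)"
      unfolding cc[symmetric] by (rule power_mult_distrib[symmetric])
    moreover have "(b2 ^ k) ^ (r1 * r2) = (b2 ^ r2) ^ (k * r1)" by (simp only: power_mult[symmetric] mult_ac)
    moreover have "b1 ^ (r1 * r2) = (b1 ^ r1) ^ r2" by (simp only: power_mult)
    ultimately show ?thesis by (simp add: b1 b2)
  qed
  then have "mpow n (sc \<mu> x) (k * (2 * (r1 * r2))) = un n"
    using d(1) by (simp add: mpow_mult c mpow_sc power_mult)
  then show ?thesis
    using that[of \<mu> "k * (2 * (r1 * r2))" "p ^ R"] \<mu> U ent k b1 b2 p_pos by simp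
qed

end

section \<open>Spectral calculus\<close>

lemma choose_two_add: "(a + b) choose 2 = (a choose 2) + a * b + (b choose 2)"
  by (induction b) (auto simp: numeral_2_eq_2)

lemma (in odd_prime) zeta_power_inj:
  assumes "zeta p ^ i = zeta p ^ j" "i < p" "j < p"
  shows "i = j"
proof -
  have *: "a = b" if h: "zeta p ^ a = zeta p ^ b" "a \<le> b" "b < p" for a b
  proof -
    have "zeta p ^ (a + (b - a)) = zeta p ^ a * zeta p ^ (b - a)" by (rule power_add)
    then have "zeta p ^ a * 1 = zeta p ^ a * zeta p ^ (b - a)" using h by simp
    then have "zeta p ^ (b - a) = 1" using zeta_nz by (metis mult_cancel_left power_not_zero)
    then show "a = b" using h by (auto simp: zeta_power_eq_1_iff dest: dvd_imp_le)
  qed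
  show ?thesis using *[of i j] *[of j i] assms by (cases "i \<le> j") auto
qed

context heis
begin

lemma E_mpow: "e \<in> E \<Longrightarrow> mpow n e k \<in> E"
  by (induction k) auto

lemma E_sc: "c ^ p = 1 \<Longrightarrow> e \<in> E \<Longrightarrow> sc c e \<in> E"
  using E_mult[OF E_scal[of c], of e] by simp

text \<open>\<open>spec e i\<close> projects onto the eigenspace of \<open>e\<close> for
  \<open>zeta p ^ i\<close>, and \<open>fc e f\<close> below acts there as \<open>f i\<close>: a
  functional calculus in the exponent.\<close>

definition spec :: "cmat \<Rightarrow> nat \<Rightarrow> cmat" where
  "spec e i = sc (inverse (of_nat p)) (\<Sum>k<p. sc (cnj (zeta p) ^ (i * k)) (mpow n e k))"

definition fc :: "cmat \<Rightarrow> (nat \<Rightarrow> complex) \<Rightarrow> cmat" where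
  "fc e f = (\<Sum>i<p. sc (f i) (spec e i))"

lemma spec_supp [simp]: "e \<in> E \<Longrightarrow> supp n (spec e i)"
  unfolding spec_def by (intro supp_intros supp_sum supp_mpow E_supp)

lemma fc_supp [simp]: "e \<in> E \<Longrightarrow> supp n (fc e f)"
  unfolding fc_def by auto

lemma cnj_zeta_p: "cnj (zeta p) ^ p = 1"
  using arg_cong[OF zeta_N, of cnj] by simp

lemma zeta_cnj_power: "zeta p ^ k * cnj (zeta p) ^ k = 1"
  using zeta_cnj by (simp flip: power_mult_distrib)

lemma spec_mod: "spec e (i mod p) = spec e i"
proof -
  have "cnj (zeta p) ^ (i mod p * k) = cnj (zeta p) ^ (i * k)" for k
  proof -
    have "cnj (zeta p ^ (i mod p * k)) = cnj (zeta p ^ (i * k))"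
      by (intro arg_cong[of _ _ cnj] zeta_power_cong) (simp add: cong_def mod_mult_left_eq)
    then show ?thesis by simp
  qed
  then show ?thesis by (simp add: spec_def)
qed

lemma spec_eigen: assumes e: "e \<in> E" shows "e * spec e i = sc (zeta p ^ i) (spec e i)"
proof -
  define g where "g k = sc (cnj (zeta p) ^ (i * k)) (mpow n e k)" for k
  have g: "e * g k = sc (zeta p ^ i) (g (Suc k))" for k
  proof -
    have "zeta p ^ i * cnj (zeta p) ^ (i * Suc k) = (zeta p ^ i * cnj (zeta p) ^ i) * cnj (zeta p) ^ (i * k)"
      by (simp add: power_add)
    then show ?thesis by (simp add: g_def zeta_cnj_power)
  qed
  have "g p = g 0"
  proof -
    have "cnj (zeta p) ^ (i * p) = 1" by (metis cnj_zeta_p mult.commute power_mult power_one)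
    then show ?thesis using E_pow[OF e] by (simp add: g_def)
  qed
  have "(\<Sum>k<p. g (Suc k)) = (\<Sum>k<p. g k)"
    using sum.lessThan_Suc_shift[of g p] sum.lessThan_Suc[of g p] \<open>g p = g 0\<close> by simp
  have "e * (\<Sum>k<p. g k) = (\<Sum>k<p. sc (zeta p ^ i) (g (Suc k)))" by (simp add: sum_distrib_left g)
  also have "\<dots> = sc (zeta p ^ i) (\<Sum>k<p. g (Suc k))" by (simp add: sc_sum)
  finally have "e * (\<Sum>k<p. g k) = sc (zeta p ^ i) (\<Sum>k<p. g k)"
    unfolding \<open>(\<Sum>k<p. g (Suc k)) = (\<Sum>k<p. g k)\<close> .
  then show ?thesis by (simp add: spec_def g_def mult.commute)
qed

lemma spec_eigen_power: assumes e: "e \<in> E" shows "mpow n e k * spec e i = sc (zeta p ^ (i * k)) (spec e i)"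
proof (induction k)
  case (Suc k)
  have "mpow n e (Suc k) * spec e i = e * (mpow n e k * spec e i)" by (simp add: mult.assoc)
  also have "\<dots> = sc (zeta p ^ (i * k) * zeta p ^ i) (spec e i)" unfolding Suc using spec_eigen[OF e] by simp
  finally show ?case by (simp add: power_add mult.commute)
qed (use e in simp)

lemma sum_cnj_zeta: "(\<Sum>k<p. cnj (zeta p) ^ (a * k)) = (if p dvd a then of_nat p else 0)"
  using arg_cong[OF sum_zeta_multiples[of a], of cnj] by simp

lemma spec_mult: assumes e: "e \<in> E" and ij: "i < p" "j < p"
  shows "spec e j * spec e i = (if i = j then spec e i else 0)"
proof -
  define x where "x = zeta p ^ i * cnj (zeta p) ^ j"
  have xk: "x ^ k = cnj (zeta p) ^ (j * k) * zeta p ^ (i * k)" for k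
    by (simp add: x_def power_mult_distrib power_mult)
  have "spec e j * spec e i = sc (inverse (of_nat p)) (\<Sum>k<p. sc (cnj (zeta p) ^ (j * k)) (mpow n e k * spec e i))"
    unfolding spec_def[of e j] by (simp add: sum_distrib_right)
  also have "\<dots> = sc (inverse (of_nat p)) (\<Sum>k<p. sc (x ^ k) (spec e i))"
    by (simp only: spec_eigen_power[OF e] sc_simps xk)
  also have "\<dots> = sc (inverse (of_nat p) * (\<Sum>k<p. x ^ k)) (spec e i)" by (simp add: sc_sum(2)[symmetric])
  also have "(\<Sum>k<p. x ^ k) = (if i = j then of_nat p else 0)"
  proof (cases "i = j")
    case True
    then have "x = 1" by (simp add: x_def zeta_cnj_power)
    then show ?thesis using True by simp
  next
    case False
    have "x ^ p = 1" unfolding xk by (metis cnj_zeta_p mult.commute mult_1 power_mult power_one zeta_N)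
    moreover have "x \<noteq> 1"
    proof
      assume "x = 1"
      then have "zeta p ^ i * (zeta p ^ j * cnj (zeta p) ^ j) = zeta p ^ j" by (simp add: x_def mult_ac)
      then have "zeta p ^ i = zeta p ^ j" by (simp add: zeta_cnj_power)
      then show False using False ij zeta_power_inj by blast
    qed
    ultimately show ?thesis using False sum_powers_root_of_unity by simp
  qed
  finally show ?thesis using p_pos by auto
qed

lemma spec_sum: assumes e: "e \<in> E" shows "(\<Sum>i<p. spec e i) = un n"
proof -
  have "(\<Sum>i<p. spec e i) = sc (inverse (of_nat p)) (\<Sum>i<p. \<Sum>k<p. sc (cnj (zeta p) ^ (k * i)) (mpow n e k))"
    by (simp add: spec_def sc_sum mult.commute)
  also have "\<dots> = sc (inverse (of_nat p)) (\<Sum>k<p. \<Sum>i<p. sc (cnj (zeta p) ^ (k * i)) (mpow n e k))"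
    by (subst sum.swap) rule
  also have "\<dots> = sc (inverse (of_nat p)) (\<Sum>k<p. sc (\<Sum>i<p. cnj (zeta p) ^ (k * i)) (mpow n e k))"
    by (simp only: sc_sum(2))
  also have "(\<Sum>k<p. sc (\<Sum>i<p. cnj (zeta p) ^ (k * i)) (mpow n e k)) = (\<Sum>k<p. if k = 0 then sc (of_nat p) (un n) else 0)"
    by (intro sum.cong refl) (auto simp: sum_cnj_zeta dest: dvd_imp_le)
  also have "\<dots> = sc (of_nat p) (un n)" using p_pos by simp
  finally show ?thesis using p_pos by simp
qed

lemma fc_cong: "(\<And>i. i < p \<Longrightarrow> f i = g i) \<Longrightarrow> fc e f = fc e g"
  unfolding fc_def by (intro sum.cong) auto

lemma fc_add: "fc e (\<lambda>i. f i + g i) = fc e f + fc e g"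
  unfolding fc_def by (simp add: sc_add sum.distrib)

lemma fc_scale: "fc e (\<lambda>i. c * f i) = sc c (fc e f)"
  unfolding fc_def by (simp add: sc_sum)

lemma fc_power: assumes e: "e \<in> E" shows "fc e (\<lambda>i. zeta p ^ (k * i)) = mpow n e k"
proof -
  have "mpow n e k = mpow n e k * (\<Sum>i<p. spec e i)" unfolding spec_sum[OF e] using e by simp
  also have "\<dots> = fc e (\<lambda>i. zeta p ^ (k * i))"
    by (simp add: fc_def sum_distrib_left spec_eigen_power[OF e] mult.commute)
  finally show ?thesis by simp
qed

lemma fc_const: "e \<in> E \<Longrightarrow> fc e (\<lambda>_. c) = sc c (un n)"
  using fc_power[of e 0] fc_scale[of e c "\<lambda>_. 1"] by simp

lemma fc_mult: assumes e: "e \<in> E" shows "fc e f * fc e g = fc e (\<lambda>i. f i * g i)"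
proof -
  have "fc e f * fc e g = (\<Sum>j<p. \<Sum>i<p. sc (f j * g i) (spec e j * spec e i))"
    by (simp add: fc_def sum_product mult.commute[of "g _"])
  also have "\<dots> = (\<Sum>j<p. \<Sum>i<p. if i = j then sc (f j * g j) (spec e j) else 0)"
    by (intro sum.cong refl) (auto simp: spec_mult[OF e])
  also have "\<dots> = fc e (\<lambda>i. f i * g i)" by (simp add: fc_def)
  finally show ?thesis .
qed

lemma mpow_fc: assumes e: "e \<in> E" shows "mpow n (fc e f) k = fc e (\<lambda>i. f i ^ k)"
  by (induction k) (simp_all add: fc_const[OF e] fc_mult[OF e])

lemma commutator_power:
  assumes "e \<in> E" "h \<in> E"
  obtains r where "r < p" "h * e = sc (zeta p ^ r) (e * h)"
proof -
  obtain c where c: "c ^ p = 1" "h * e = sc c (e * h)" using E_comm[OF assms(2,1)] by blast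
  obtain r where "r < p" "c = zeta p ^ r" using root_of_unity_eq[OF c(1)] .
  then show ?thesis using that c by blast
qed

lemma spec_shift:
  assumes e: "e \<in> E" and h: "h \<in> E" and r: "h * e = sc (zeta p ^ r) (e * h)"
  shows "h * spec e (i + r) = spec e i * h"
proof -
  have hk: "h * mpow n e k = sc (zeta p ^ (r * k)) (mpow n e k * h)" for k
  proof (induction k)
    case (Suc k)
    have "h * mpow n e (Suc k) = (h * e) * mpow n e k" by (simp add: mult.assoc)
    also have "\<dots> = sc (zeta p ^ r) (e * (h * mpow n e k))" unfolding r by (simp add: mult.assoc)
    also have "\<dots> = sc (zeta p ^ r * zeta p ^ (r * k)) (e * (mpow n e k * h))" unfolding Suc by simp
    finally show ?case by (simp add: power_add mult.assoc)
  qed (use h in simp)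
  have "cnj (zeta p) ^ ((i + r) * k) * zeta p ^ (r * k) = cnj (zeta p) ^ (i * k)" for k
  proof -
    have "cnj (zeta p) ^ ((i + r) * k) * zeta p ^ (r * k) = cnj (zeta p) ^ (i * k) * (zeta p ^ (r * k) * cnj (zeta p) ^ (r * k))"
      by (simp only: distrib_right distrib_left power_add mult_ac)
    then show ?thesis by (simp only: zeta_cnj_power mult_1_right)
  qed
  then show ?thesis
    by (simp add: spec_def sum_distrib_left sum_distrib_right hk)
qed

lemma fc_shift:
  assumes e: "e \<in> E" and h: "h \<in> E" and r: "h * e = sc (zeta p ^ r) (e * h)"
    and g: "\<And>i. g (i mod p) = g i"
  shows "h * fc e g = fc e (\<lambda>i. g (i + r)) * h"
proof -
  have "fc e g = (\<Sum>i<p. sc (g ((i + r) mod p)) (spec e ((i + r) mod p)))"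
    unfolding fc_def
    using sum.reindex_bij_betw[OF bij_betw_add_mod[OF p_pos, of r], of "\<lambda>i. sc (g i) (spec e i)"] by simp
  then have "h * fc e g = (\<Sum>i<p. sc (g (i + r)) (h * spec e (i + r)))"
    by (simp add: sum_distrib_left g spec_mod)
  then show ?thesis
    unfolding spec_shift[OF e h r] fc_def by (simp add: sum_distrib_right)
qed

text \<open>The chirp, a quadratic phase; it has period \<open>p\<close> because \<open>p\<close> is
  odd (\<open>chi_mod\<close>).\<close>

definition chi :: "nat \<Rightarrow> complex" where "chi i = zeta p ^ (i choose 2)"

lemma chi_add: "chi (i + r) = chi i * zeta p ^ (r * i) * chi r"
  by (simp add: chi_def choose_two_add power_add mult_ac)

lemma chi_p: "chi p = 1"
proof -
  have "2 * (p choose 2) = p * (p - 1)" unfolding choose_two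
    by (rule dvd_mult_div_cancel) (cases p; auto)
  then have "p dvd 2 * (p choose 2)" by simp
  moreover have "coprime p 2" using coprime_less_p[of 2] p_gt_2 by (simp add: coprime_commute)
  ultimately have "p dvd (p choose 2)" by (simp add: coprime_dvd_mult_right_iff)
  then show ?thesis by (simp add: chi_def zeta_power_eq_1_iff)
qed

lemma chi_mod: "chi (i mod p) = chi i"
proof -
  have "chi (i + p * k) = chi i" for i k
  proof (induction k)
    case (Suc k)
    have "chi (i + p * Suc k) = chi ((i + p * k) + p)" by (simp add: add_ac)
    also have "\<dots> = chi (i + p * k)" unfolding chi_add chi_p by (simp add: power_mult zeta_N)
    finally show ?case using Suc by simp
  qed simp
  from this[of "i mod p" "i div p"] show ?thesis by simp
qed

lemma chi_cnj: "chi i * cnj (chi i) = 1"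
  using zeta_cnj_power by (simp add: chi_def)

lemma chi_pow: "chi i ^ p = 1" "cnj (chi i) ^ p = 1"
proof -
  show 1: "chi i ^ p = 1" unfolding chi_def by (metis mult.commute power_mult power_one zeta_N)
  show "cnj (chi i) ^ p = 1" using arg_cong[OF 1, of cnj] by simp
qed

text \<open>Moving \<open>h\<close> past the chirp shifts the phase by \<open>r\<close>. The
  quotient of a quadratic phase by its shift is a linear phase, which the functional calculus turns
  into a power of \<open>e\<close>.\<close>

lemma chirp_conj:
  assumes e: "e \<in> E" and h: "h \<in> E" and r: "h * e = sc (zeta p ^ r) (e * h)"
  shows "fc e chi * h * fc e (\<lambda>i. cnj (chi i)) = sc (cnj (chi r)) (mpow n e ((p - 1) * r)) * h"
proof -
  have "chi i * cnj (chi (i + r)) = cnj (chi r) * zeta p ^ ((p - 1) * r * i)" for i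
  proof -
    have "cnj (zeta p) ^ (r * i) = zeta p ^ ((p - 1) * r * i)" unfolding cnj_zeta by (simp only: power_mult[symmetric] mult.assoc)
    then show ?thesis using chi_cnj[of i] by (simp add: chi_add mult_ac)
  qed
  then have "fc e chi * fc e (\<lambda>i. cnj (chi (i + r))) = sc (cnj (chi r)) (mpow n e ((p - 1) * r))"
    by (simp only: fc_mult[OF e] fc_scale fc_power[OF e])
  moreover have "h * fc e (\<lambda>i. cnj (chi i)) = fc e (\<lambda>i. cnj (chi (i + r))) * h"
    by (rule fc_shift[OF e h r]) (simp add: chi_mod)
  ultimately show ?thesis by (metis mult.assoc)
qed

lemma normz_chirp: assumes e: "e \<in> E" shows "normz (fc e chi) (fc e (\<lambda>i. cnj (chi i)))"
  unfolding normz_def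
proof (intro conjI ballI)
  show "fc e chi * fc e (\<lambda>i. cnj (chi i)) = un n" "fc e (\<lambda>i. cnj (chi i)) * fc e chi = un n"
    by (simp_all add: fc_mult[OF e] chi_cnj fc_const[OF e] mult.commute[of "cnj _"])
next
  fix h assume h: "h \<in> E"
  obtain r where r: "r < p" "h * e = sc (zeta p ^ r) (e * h)" using commutator_power[OF e h] .
  have "sc (cnj (chi r)) (mpow n e ((p - 1) * r)) * h \<in> E"
    using e h by (intro E_mult E_sc E_mpow chi_pow)
  then show "fc e chi * h * fc e (\<lambda>i. cnj (chi i)) \<in> E" unfolding chirp_conj[OF e h r(2)] .
qed (use e in auto)

lemma chirp_power: "e \<in> E \<Longrightarrow> mpow n (fc e chi) p = un n"
  by (simp add: mpow_fc chi_pow fc_const)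

end

section \<open>Groups containing the finite-order normalizer\<close>

text \<open>The exponent \<open>4 * p * (p - 1)\<close> covers the normalizing elements that occur:
  chirps have order dividing \<open>p\<close>, dilations \<open>p - 1\<close>, the Fourier matrix
  and its products with dilations 4. The same divisibility puts \<open>zeta p\<close>, the
  \<open>(p - 1)\<close>-th roots of unity and \<i> into \<open>zint N\<close>.\<close>

locale heis_group = heis p n m E + big: cyclotomic_prime N p s n'
  for p n m E N s n' +
  fixes \<G> :: "cmat set" and t :: cmat
  assumes N_dvd: "4 * p * (p - 1) dvd N"
    and G_supp [simp, intro]: "x \<in> \<G> \<Longrightarrow> supp n x"
    and G_mult [intro]: "x \<in> \<G> \<Longrightarrow> y \<in> \<G> \<Longrightarrow> x * y \<in> \<G>"
    and G_E [intro]: "e \<in> E \<Longrightarrow> e \<in> \<G>"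
    and G_pow: "x \<in> \<G> \<Longrightarrow> mpow n x N = un n"
    and G_normz: "normz a a' \<Longrightarrow> mpow n a (4 * p * (p - 1)) = un n \<Longrightarrow> a \<in> \<G>"
    and t_G: "t \<in> \<G>" and t_t: "t * t = un n" and tr_t: "tr t = 1"
    and t_E: "e \<in> E \<Longrightarrow> \<exists>c. c ^ p = 1 \<and> t * e * t = sc c (adj e)"
begin

abbreviation ON where "ON \<equiv> zint N"
abbreviation PN where "PN \<equiv> zideal N big.\<pi>"

lemma p_dvd_N: "p dvd N" using N_dvd by (metis dvd_mult_left dvd_mult_right mult.commute)

lemma zeta_p_N: "zeta p ^ N = 1" using p_dvd_N by (simp add: zeta_power_eq_1_iff)

lemma zeta_p_P: "zeta p ^ big.P = 1"
  using big.s by (simp add: zeta_power_eq_1_iff)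

lemma root_p: "(c :: complex) ^ p = 1 \<Longrightarrow> c ^ big.P = 1"
proof -
  have "p dvd p ^ s" using big.s by simp
  then obtain k where "p ^ s = p * k" by (elim dvdE)
  then show "c ^ p = 1 \<Longrightarrow> c ^ big.P = 1" by (simp add: power_mult)
qed

lemma zint_p_subset: "z \<in> zint p \<Longrightarrow> z \<in> ON"
proof -
  assume "z \<in> zint p"
  then obtain c :: "nat \<Rightarrow> int" where c: "z = (\<Sum>i<p. of_int (c i) * zeta p ^ i)" using zint_coeffs by blast
  have "zeta p \<in> ON" by (rule big.zint_root_of_unity[OF zeta_p_N])
  then show "z \<in> ON" unfolding c by auto
qed

lemma un_G [simp, intro]: "un n \<in> \<G>" by (rule G_E) simp

lemma G_mpow [intro]: "x \<in> \<G> \<Longrightarrow> mpow n x k \<in> \<G>"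
  by (induction k) auto

definition iv :: "cmat \<Rightarrow> cmat" where "iv x = mpow n x (N - 1)"

lemma iv_G [simp, intro]: "x \<in> \<G> \<Longrightarrow> iv x \<in> \<G>" unfolding iv_def by auto

lemma iv_simps [simp]: assumes "x \<in> \<G>" shows "x * iv x = un n" "iv x * x = un n"
proof -
  have "Suc (N - 1) = N" using big.N_pos by simp
  then show "x * iv x = un n" "iv x * x = un n"
    using G_pow[OF assms] mpow.simps(2)[of n x "N - 1"] mpow_Suc_right[OF G_supp[OF assms], of "N - 1"]
    by (simp_all add: iv_def)
qed

lemma iv_unique: assumes "x \<in> \<G>" "supp n y" "x * y = un n" shows "y = iv x"
proof -
  have "y = iv x * x * y" using assms by simp
  also have "\<dots> = iv x * (x * y)" by (simp only: mult.assoc)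
  finally show ?thesis using assms by simp
qed

lemma iv_mult: assumes x: "x \<in> \<G>" and y: "y \<in> \<G>" shows "iv (x * y) = iv y * iv x"
proof (rule iv_unique[symmetric])
  have "x * y * (iv y * iv x) = x * (y * iv y) * iv x" by (simp only: mult.assoc)
  then show "x * y * (iv y * iv x) = un n" using x y by simp
qed (use x y in auto)

lemma iv_iv: "x \<in> \<G> \<Longrightarrow> iv (iv x) = x"
  by (rule iv_unique[symmetric]) auto

lemma iv_E: "e \<in> E \<Longrightarrow> iv e = adj e"
  by (rule iv_unique[symmetric]) auto

lemma iv_cancel [simp]: assumes "x \<in> \<G>" "supp n y"
  shows "x * (iv x * y) = y" "iv x * (x * y) = y"
  using assms by (simp_all flip: mult.assoc)

lemma tr_conj: "x \<in> \<G> \<Longrightarrow> supp n y \<Longrightarrow> tr (x * y * iv x) = tr y"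
  by (subst tr_comm) (simp flip: mult.assoc)

lemma traces:
  assumes x: "x \<in> \<G>"
  shows tr_in: "tr x \<in> ON" and tr_iv: "tr (iv x) = cnj (tr x)"
    and sigma_tr_bound: "coprime k N \<Longrightarrow> cmod (big.\<sigma> k (tr x)) \<le> of_nat n"
proof -
  obtain \<theta> :: "nat \<Rightarrow> complex" where \<theta>: "\<And>i. i < n \<Longrightarrow> \<theta> i ^ N = 1" "\<And>k. tr (mpow n x k) = (\<Sum>i<n. \<theta> i ^ k)"
    using finite_order_traces[OF G_supp[OF x] G_pow[OF x]] by blast
  have \<theta>O: "\<theta> i \<in> ON" if "i < n" for i using big.zint_root_of_unity \<theta>(1)[OF that] by blast
  have trx: "tr x = (\<Sum>i<n. \<theta> i)" using \<theta>(2)[of 1] x by simp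
  show "tr x \<in> ON" unfolding trx using \<theta>O by auto
  have "\<theta> i ^ (N - 1) = cnj (\<theta> i)" if i: "i < n" for i
  proof -
    have "cmod (\<theta> i) = 1" using power_eq_1_iff[OF \<theta>(1)[OF i]] big.N_pos by simp
    then have "\<theta> i * cnj (\<theta> i) = 1" by (simp add: complex_norm_square[symmetric])
    moreover have "\<theta> i * \<theta> i ^ (N - 1) = 1" using \<theta>(1)[OF i] big.N_pos by (cases N) auto
    ultimately show ?thesis by (metis mult_cancel_left mult_zero_left zero_neq_one)
  qed
  then show "tr (iv x) = cnj (tr x)" unfolding iv_def \<theta>(2) trx by simp
  assume k: "coprime k N"
  have "big.\<sigma> k (tr x) = (\<Sum>i<n. big.\<sigma> k (\<theta> i))"
    unfolding trx by (rule big.sigma_sum[OF k]) (use \<theta>O in auto)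
  also have "\<dots> = (\<Sum>i<n. \<theta> i ^ k)"
    by (intro sum.cong refl) (simp add: big.sigma_root_of_unity[OF k] \<theta>(1))
  also have "cmod \<dots> \<le> (\<Sum>i<n. cmod (\<theta> i ^ k))" by (rule norm_sum)
  also have "\<dots> = (\<Sum>i<n. 1)"
  proof (intro sum.cong refl)
    fix i assume "i \<in> {..<n}"
    then have "cmod (\<theta> i) = 1" using power_eq_1_iff[OF \<theta>(1)] big.N_pos by auto
    then show "cmod (\<theta> i ^ k) = 1" by (simp add: norm_power)
  qed
  finally show "cmod (big.\<sigma> k (tr x)) \<le> of_nat n" by simp
qed

lemma chirp_G: "e \<in> E \<Longrightarrow> fc e chi \<in> \<G>"
proof (rule G_normz[OF normz_chirp])
  assume e: "e \<in> E"
  have "4 * p * (p - 1) = p * (4 * (p - 1))" by simp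
  then show "mpow n (fc e chi) (4 * p * (p - 1)) = un n"
    using e by (simp only: mpow_mult[OF fc_supp[OF e]] chirp_power[OF e] mpow_un)
qed

text \<open>For a generator of \<open>quadf\<close> the matrix \<open>fc e f\<close> is a chirp
  power times a power of \<open>e\<close>, hence in \<G>, where traces are integral. The other rules
  preserve integrality at \<open>p\<close>.\<close>

lemma quadf_trace:
  assumes e: "e \<in> E" and y: "y \<in> \<G>"
  shows "quadf p f \<Longrightarrow> \<exists>d. coprime d p \<and> of_nat d * tr (y * fc e f) \<in> ON"
proof (induction rule: quadf.induct)
  case (quadf_gen j k)
  have "fc e (\<lambda>i. zeta p ^ (j * (i choose 2) + k * i)) = fc e (\<lambda>i. chi i ^ j * zeta p ^ (k * i))"
    by (intro fc_cong) (simp add: chi_def power_add power_mult[symmetric] mult.commute)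
  also have "\<dots> = mpow n (fc e chi) j * mpow n e k"
    by (simp only: mpow_fc[OF e] fc_power[OF e, symmetric] fc_mult[OF e])
  also have "y * \<dots> \<in> \<G>" using chirp_G[OF e] e y by auto
  finally show ?case using tr_in by (intro exI[of _ 1]) auto
next
  case (quadf_add f g)
  then obtain d d' where d: "coprime d p" "of_nat d * tr (y * fc e f) \<in> ON" and
    d': "coprime d' p" "of_nat d' * tr (y * fc e g) \<in> ON" by blast
  have "of_nat (d * d') * tr (y * fc e (\<lambda>i. f i + g i)) =
    of_nat d' * (of_nat d * tr (y * fc e f)) + of_nat d * (of_nat d' * tr (y * fc e g))"
    by (simp add: fc_add algebra_simps)
  also have "\<dots> \<in> ON" by (rule big.zint_closed(1)[OF big.zint_closed(2)[OF big.zint_intros(4) d(2)] big.zint_closed(2)[OF big.zint_intros(4) d'(2)]])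
  finally show ?case using d d' by (intro exI[of _ "d * d'"]) simp
next
  case (quadf_scale f c)
  then obtain d where d: "coprime d p" "of_nat d * tr (y * fc e f) \<in> ON" by blast
  have "of_nat d * tr (y * fc e (\<lambda>i. c * f i)) = c * (of_nat d * tr (y * fc e f))"
    by (simp add: fc_scale)
  also have "\<dots> \<in> ON" by (rule big.zint_closed(2)[OF zint_p_subset[OF quadf_scale.hyps(2)] d(2)])
  finally show ?case using d by blast
next
  case (quadf_div d' f)
  then obtain d where d: "coprime d p" "of_nat d * tr (y * fc e (\<lambda>i. of_nat d' * f i)) \<in> ON" by blast
  then have "of_nat (d * d') * tr (y * fc e f) \<in> ON" by (simp add: fc_scale mult.assoc)
  then show ?case using d quadf_div.hyps(2) by (intro exI[of _ "d * d'"]) simp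
next
  case (quadf_eq f g)
  then show ?case using fc_cong[of f g e] by simp
qed

text \<open>\<open>(e - 1) ^ 2\<close> is \<open>q\<close> times a matrix whose trace against
  \<open>y\<close> is integral at \<open>p\<close>, and \<open>q\<close> lies in
  \<open>PN\<close>.\<close>

lemma square_trace:
  assumes e: "e \<in> E" and y: "y \<in> \<G>"
  shows "tr (y * e * e) - 2 * tr (y * e) + tr y \<in> PN"
proof -
  obtain g where g: "quadf p g" "\<And>i. i < p \<Longrightarrow> (zeta p ^ i - 1) ^ 2 = q * g i"
    using square_divisible_quadf by blast
  obtain d where d: "coprime d p" "of_nat d * tr (y * fc e g) \<in> ON" using quadf_trace[OF e y g(1)] by blast
  have "sc q (fc e g) = fc e (\<lambda>i. (zeta p ^ i - 1) ^ 2)"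
    unfolding fc_scale[symmetric] using g(2) by (intro fc_cong) simp
  also have "\<dots> = fc e (\<lambda>i. zeta p ^ (2 * i) + (- 2 * zeta p ^ (1 * i) + 1))"
  proof (intro fc_cong)
    fix i
    have "zeta p ^ (2 * i) = zeta p ^ i * zeta p ^ i" by (simp add: mult_2 power_add)
    then show "(zeta p ^ i - 1) ^ 2 = zeta p ^ (2 * i) + (- 2 * zeta p ^ (1 * i) + 1)"
      by (simp add: power2_eq_square left_diff_distrib right_diff_distrib)
  qed
  also have "\<dots> = mpow n e 2 + (sc (- 2) (mpow n e 1) + un n)"
    unfolding fc_add fc_scale fc_power[OF e] fc_const[OF e] by simp
  finally have *: "sc q (fc e g) = e * e + (sc (- 2) e + un n)" using e by (simp add: numeral_2_eq_2)
  have "q * tr (y * fc e g) = tr (y * sc q (fc e g))" by simp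
  also have "\<dots> = tr (y * e * e) - 2 * tr (y * e) + tr y"
    unfolding * using y by (simp add: distrib_left mult.assoc)
  finally have q: "q * tr (y * fc e g) = tr (y * e * e) - 2 * tr (y * e) + tr y" .
  have "1 - zeta p \<in> PN" by (rule big.root_of_unity_cong(2)[OF zeta_p_P])
  then have "q * (of_nat d * tr (y * fc e g)) \<in> PN" using d(2) by (rule big.zideal_closed(5))
  then have "of_nat d * (tr (y * e * e) - 2 * tr (y * e) + tr y) \<in> PN"
    unfolding q[symmetric] by (simp only: mult_ac)
  moreover have "y * e \<in> \<G>" "y * e * e \<in> \<G>" using e y by (simp_all add: G_mult G_E)
  then have "tr (y * e * e) - 2 * tr (y * e) + tr y \<in> ON"
    by (intro big.zint_closed(1,2,4) tr_in big.zint_intros y)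
  ultimately show ?thesis using big.cancel_coprime[OF d(1)] by blast
qed

text \<open>Polarization of \<open>square_trace\<close>, giving the trace against
  \<open>(e - 1) * (f - 1)\<close>. Reordering \<open>e\<close> and \<open>f\<close> costs a
  \<open>p\<close>-th root of unity, which is 1 modulo \<open>big.\<pi>\<close>.\<close>

lemma product_trace:
  assumes e: "e \<in> E" and f: "f \<in> E" and y: "y \<in> \<G>"
  shows "tr (y * e * f) - tr (y * e) - tr (y * f) + tr y \<in> PN"
proof -
  obtain c where c: "c ^ p = 1" "e * f = sc c (f * e)" using E_comm[OF e f] by blast
  have sc: "c ^ big.P = 1" using root_p[OF c(1)] .
  have 1: "tr (y * (e * f) * (e * f)) - 2 * tr (y * (e * f)) + tr y \<in> PN"
    using square_trace[of "e * f" y] e f y by auto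
  have 2: "tr (y * (e * e * f * f)) - 2 * tr (y * (e * f * f)) + tr (y * (f * f)) \<in> PN"
  proof -
    have "tr (f * f * y * e * e) - 2 * tr (f * f * y * e) + tr (f * f * y) \<in> PN"
      using square_trace[of e "f * f * y"] e f y by auto
    moreover have "tr (f * f * y * e * e) = tr (y * (e * e * f * f))"
      using tr_comm[of "f * f" "y * e * e"] by (simp add: mult.assoc)
    moreover have "tr (f * f * y * e) = tr (y * (e * f * f))"
      using tr_comm[of "f * f" "y * e"] by (simp add: mult.assoc)
    moreover have "tr (f * f * y) = tr (y * (f * f))"
      using tr_comm[of "f * f" y] by (simp add: mult.assoc)
    ultimately show ?thesis by simp
  qed
  have 3: "tr (y * e * f * f) - 2 * tr (y * e * f) + tr (y * e) \<in> PN"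
    using square_trace[of f "y * e"] e f y by auto
  have 4: "tr (y * f * f) - 2 * tr (y * f) + tr y \<in> PN"
    using square_trace[of f y] e f y by auto
  have 5: "tr (y * (e * e * f * f)) - tr (y * (e * f * e * f)) \<in> PN"
  proof -
    have "e * e * f * f = sc c (e * f * e * f)"
      using arg_cong[OF c(2), of "\<lambda>z. e * z * f"] by (simp add: mult.assoc)
    then have "tr (y * (e * e * f * f)) = tr (y * (e * f * e * f)) * c" by (simp add: mult.commute)
    moreover have "tr (y * (e * f * e * f)) \<in> ON" using e f y by (intro tr_in) (simp add: G_mult G_E)
    ultimately show ?thesis
      using big.zideal_closed(4)[OF big.ideal_1_minus_trans[OF sc, of "tr (y * (e * f * e * f))"]] by simp
  qed
  \<comment> \<open>For commuting \<open>e\<close> and \<open>f\<close> this is \<open>2 (e - 1) (f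
    - 1) = (e f - 1)^2 - (e - 1)^2 f^2 - 2 e (f - 1)^2 + (f - 1)^2\<close>; the second line on the
    right corrects the commutation.\<close>
  have "2 * (tr (y * e * f) - tr (y * e) - tr (y * f) + tr y) =
    (tr (y * (e * f) * (e * f)) - 2 * tr (y * (e * f)) + tr y)
    + (tr (y * (e * e * f * f)) - tr (y * (e * f * e * f)))
    - (tr (y * (e * e * f * f)) - 2 * tr (y * (e * f * f)) + tr (y * (f * f)))
    - 2 * (tr (y * e * f * f) - 2 * tr (y * e * f) + tr (y * e))
    + (tr (y * f * f) - 2 * tr (y * f) + tr y)"
    by (simp add: mult.assoc)
  also have "\<dots> \<in> PN"
    by (intro big.zideal_closed(2,3) 1 2 4 5 big.zideal_closed(6)[OF 3]) auto
  finally have "of_nat 2 * (tr (y * e * f) - tr (y * e) - tr (y * f) + tr y) \<in> PN" by simp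
  moreover have "y * e \<in> \<G>" "y * f \<in> \<G>" "y * e * f \<in> \<G>" using e f y by (simp_all add: G_mult G_E)
  then have "tr (y * e * f) - tr (y * e) - tr (y * f) + tr y \<in> ON"
    by (intro big.zint_closed(1,4) tr_in y)
  moreover have "coprime 2 p" using coprime_less_p[of 2] p_gt_2 by simp
  ultimately show ?thesis using big.cancel_coprime[of 2] by blast
qed

end

section \<open>Conjugates of the parity involution\<close>

declare supp_times [simp]
declare (in heis) E_mult [simp] E_adj [simp]
declare (in heis_group) G_mult [simp] G_E [simp]

text \<open>The inequality of arithmetic and geometric means with its case of equality, from
  \<open>ln x \<le> x - 1\<close>.\<close>

lemma prod_le_1_of_sum:
  fixes a :: "'a \<Rightarrow> real"
  assumes fin: "finite A" and pos: "\<And>x. x \<in> A \<Longrightarrow> a x > 0" and sum: "(\<Sum>x\<in>A. a x) = of_nat (card A)"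
  shows "prod a A \<le> 1" and "prod a A = 1 \<Longrightarrow> x \<in> A \<Longrightarrow> a x = 1"
proof -
  have nz: "a x \<noteq> 0" if "x \<in> A" for x using pos[OF that] by simp
  have ln: "ln (prod a A) = (\<Sum>x\<in>A. ln (a x))" by (rule ln_prod) (use fin pos nz in auto)
  have pp: "prod a A > 0" using pos by (intro prod_pos) auto
  have d: "a x - 1 - ln (a x) \<ge> 0" if "x \<in> A" for x using ln_le_minus_one[OF pos[OF that]] by simp
  have s: "(\<Sum>x\<in>A. a x - 1 - ln (a x)) = - ln (prod a A)"
    unfolding ln by (simp add: sum_subtractf sum)
  have "0 \<le> (\<Sum>x\<in>A. a x - 1 - ln (a x))" by (rule sum_nonneg) (rule d)
  then have "ln (prod a A) \<le> 0" using s by simp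
  then show "prod a A \<le> 1" using pp by (simp add: ln_le_zero_iff)
  assume p1: "prod a A = 1" and x: "x \<in> A"
  have "(\<Sum>x\<in>A. a x - 1 - ln (a x)) = 0" using s p1 by simp
  then have "a x - 1 - ln (a x) = 0" using sum_nonneg_eq_0_iff[OF fin d] x by auto
  then show "a x = 1" using ln_eq_minus_one[OF pos[OF x]] by simp
qed

context heis_group
begin

text \<open>By Parseval the squared absolute values of the \<open>z e\<close> have mean 1 over
  \<open>E\<close>, also under every automorphism. No \<open>z e\<close> vanishes, since its sum
  with its conjugate is 2 modulo \<open>big.\<pi>\<close>. So their product has all conjugates of
  absolute value at most 1 and is a root of unity. Equality of the means then gives every
  \<open>z e\<close> absolute value 1 under all automorphisms, and Kronecker's theorem applies once
  more.\<close>

lemma parity_conj: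
  assumes x: "x \<in> \<G>" and e: "e \<in> E"
  shows "tr (x * t * iv x * e) ^ big.P = 1"
proof -
  define u where "u = x * t * iv x"
  define z where "z e = tr (u * e)" for e
  have uG: "u \<in> \<G>" using x t_G by (auto simp: u_def)
  have uu: "u * u = un n"
  proof -
    have "u * u = x * (t * (iv x * x) * t) * iv x" by (simp only: u_def mult.assoc)
    then show ?thesis using x t_G t_t by simp
  qed
  have iu: "iv u = u" using uG uu by (intro iv_unique[symmetric]) auto
  have tru: "tr u = 1" unfolding u_def using tr_conj[OF x, of t] t_G tr_t by simp
  have z_in: "z e \<in> ON" if "e \<in> E" for e using that uG by (auto simp: z_def intro!: tr_in)
  have z_adj: "z (adj e) = cnj (z e)" if e: "e \<in> E" for e
  proof -
    have "cnj (z e) = tr (iv (u * e))" using tr_iv[of "u * e"] uG e by (simp add: z_def)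
    also have "\<dots> = tr (adj e * u)" using uG e by (simp add: iv_mult G_E iu iv_E)
    also have "\<dots> = z (adj e)" unfolding z_def by (rule tr_comm)
    finally show ?thesis by simp
  qed
  \<comment> \<open>Applying \<open>square_trace\<close> to \<open>u * adj e\<close> makes its outer
    terms \<open>z e\<close> and the conjugate of \<open>z e\<close>.\<close>
  have z2: "z e + cnj (z e) - 2 \<in> PN" if e: "e \<in> E" for e
  proof -
    have eq: "u * adj e * e = u" using e uG by (simp add: mult.assoc)
    have "tr (u * adj e * e * e) - 2 * tr (u * adj e * e) + tr (u * adj e) \<in> PN"
      using square_trace[OF e, of "u * adj e"] uG e by simp
    then have "tr (u * e) - 2 * tr u + tr (u * adj e) \<in> PN" unfolding eq .
    then show ?thesis using z_adj[OF e] tru by (simp add: z_def algebra_simps)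
  qed
  have z0: "z e \<noteq> 0" if e: "e \<in> E" for e
  proof
    assume "z e = 0"
    then have "of_nat 2 \<in> PN" using z2[OF e] big.zideal_closed(4)[of "-2"] by simp
    then have "p dvd 2" unfolding big.nat_in_pi_iff .
    then show False using p_gt_2 by (auto dest: dvd_imp_le)
  qed
  have pars: "(\<Sum>e\<in>E. cnj (z e) * z e) = of_nat (card E)"
  proof -
    have "(\<Sum>e\<in>E. tr (u * adj e) * tr (e * u)) = of_nat (card E) / of_nat n * tr (u * u)"
      using uG by (intro parseval) auto
    also have "(\<Sum>e\<in>E. tr (u * adj e) * tr (e * u)) = (\<Sum>e\<in>E. cnj (z e) * z e)"
    proof (intro sum.cong refl)
      fix e assume "e \<in> E"
      then show "tr (u * adj e) * tr (e * u) = cnj (z e) * z e"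
        using z_adj[of e] tr_comm[of e u] by (simp add: z_def)
    qed
    finally show ?thesis using n_pos uu by simp
  qed
  have sum1: "(\<Sum>e\<in>E. (cmod (big.\<sigma> k (z e)))\<^sup>2) = of_nat (card E)" if k: "coprime k N" for k
  proof -
    have "(\<Sum>e\<in>E. cnj (big.\<sigma> k (z e)) * big.\<sigma> k (z e)) = big.\<sigma> k (\<Sum>e\<in>E. cnj (z e) * z e)"
      using z_in by (simp add: big.sigma_sum[OF k] big.sigma_mult[OF k] big.sigma_cnj[OF k] big.zint_cnj big.zint_closed)
    also have "\<dots> = of_nat (card E)" unfolding pars using k by simp
    also have "(\<Sum>e\<in>E. cnj (big.\<sigma> k (z e)) * big.\<sigma> k (z e)) = of_real (\<Sum>e\<in>E. (cmod (big.\<sigma> k (z e)))\<^sup>2)"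
      unfolding of_real_sum by (intro sum.cong refl) (simp only: complex_norm_square mult.commute)
    finally show ?thesis by (metis of_real_eq_iff of_real_of_nat_eq)
  qed
  have pos: "(cmod (big.\<sigma> k (z e)))\<^sup>2 > 0" if "coprime k N" "e \<in> E" for k e
    using big.sigma_nonzero[OF that(1) z_in[OF that(2)] z0[OF that(2)]] by simp
  define \<Lambda> where "\<Lambda> = (\<Prod>e\<in>E. z e)"
  have \<Lambda>_in: "\<Lambda> \<in> ON" unfolding \<Lambda>_def using z_in by auto
  have norm\<Lambda>: "(cmod (big.\<sigma> k \<Lambda>))\<^sup>2 = (\<Prod>e\<in>E. (cmod (big.\<sigma> k (z e)))\<^sup>2)" if k: "coprime k N" for k
    unfolding \<Lambda>_def using z_in by (simp add: big.sigma_prod[OF k] prod_norm[symmetric] prod_power_distrib)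
  have "cmod (big.\<sigma> k \<Lambda>) \<le> 1" if k: "coprime k N" for k
    using prod_le_1_of_sum(1)[OF E_fin pos[OF k] sum1[OF k]] unfolding norm\<Lambda>[OF k, symmetric]
    by (simp add: abs_square_le_1)
  moreover have "\<Lambda> \<noteq> 0" unfolding \<Lambda>_def using z0 E_fin by simp
  ultimately obtain r where r: "r > 0" "\<Lambda> ^ r = 1" using big.kronecker_theorem[OF \<Lambda>_in] by blast
  have unit: "cmod (big.\<sigma> k (z e)) = 1" if k: "coprime k N" and e: "e \<in> E" for k e
  proof -
    have "big.\<sigma> k \<Lambda> ^ r = 1" using r k by (simp flip: big.sigma_power[OF k \<Lambda>_in])
    then have "cmod (big.\<sigma> k \<Lambda>) = 1" using power_eq_1_iff r by blast
    then have p1: "(\<Prod>e\<in>E. (cmod (big.\<sigma> k (z e)))\<^sup>2) = 1" unfolding norm\<Lambda>[OF k, symmetric] by simp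
    have "(cmod (big.\<sigma> k (z e)))\<^sup>2 = 1"
      using prod_le_1_of_sum(2)[of E "\<lambda>e. (cmod (big.\<sigma> k (z e)))\<^sup>2" e, OF E_fin pos[OF k] sum1[OF k] p1 e] by simp
    then show ?thesis using norm_ge_zero[of "big.\<sigma> k (z e)"] by (simp add: power2_eq_1_iff)
  qed
  have "\<And>k. coprime k N \<Longrightarrow> cmod (big.\<sigma> k (z e)) \<le> 1" using unit[OF _ e] by simp
  then obtain r' where r': "r' > 0" "z e ^ r' = 1"
    using big.kronecker_theorem[OF z_in[OF e] z0[OF e]] by blast
  have "cmod (z e) = 1" using power_eq_1_iff[OF r'(2)] r'(1) by simp
  then have zc: "z e * cnj (z e) = 1" by (simp add: complex_norm_square[symmetric])
  \<comment> \<open>The residue ring is reduced, so this makes \<open>z e\<close> congruent to 1,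
    and a root of unity congruent to 1 has \<open>p\<close>-power order.\<close>
  have "(z e - 1) ^ 2 = z e * (z e + cnj (z e) - 2)"
    using zc by (simp add: power2_eq_square algebra_simps)
  then have "(z e - 1) ^ 2 \<in> PN" using big.zideal_closed(6)[OF z2[OF e] z_in[OF e]] by simp
  then have "z e - 1 \<in> PN" using z_in[OF e] by (intro big.pi_radical[of "z e - 1" 2]) auto
  then have "z e ^ big.P = 1" by (rule big.root_of_unity_cong_1[OF z_in[OF e] r'])
  then show ?thesis by (simp add: z_def u_def)
qed

text \<open>The automorphism \<open>\<sigma>\<^sub>k\<close> with \<open>k = tw\<close> lifts the Frobenius and
  inverts the \<open>p\<close>-power roots of unity.\<close>

definition tw :: nat where "tw = (SOME k. [k = big.P - 1] (mod big.P) \<and> [k = p] (mod n'))"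

lemma tw: "[tw = big.P - 1] (mod big.P)" "[tw = p] (mod n')"
proof -
  have "coprime big.P n'" using big.n' by simp
  then have "\<exists>k. [k = big.P - 1] (mod big.P) \<and> [k = p] (mod n')" by (rule binary_chinese_remainder_nat)
  from someI_ex[OF this] show "[tw = big.P - 1] (mod big.P)" "[tw = p] (mod n')" by (auto simp: tw_def)
qed

lemma tw_coprime: "coprime tw N"
proof -
  have "coprime (big.P - 1) big.P" using big.p_pos by (intro coprime_diff_one_left_nat) simp
  then have 1: "coprime tw big.P" using tw(1) cong_imp_coprime cong_sym by metis
  have 2: "coprime tw n'" using tw(2) big.n' cong_imp_coprime cong_sym by metis
  show ?thesis using 1 2 unfolding big.N_eq by (simp only: coprime_mult_right_iff)
qed

text \<open>On this subring the \<open>p\<close>-th power is congruent to complex conjugation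
  (\<open>RR_frob\<close>).\<close>

definition RR :: "complex set" where "RR = {z \<in> ON. big.\<sigma> tw z = cnj z}"

lemma RR_ON: "z \<in> RR \<Longrightarrow> z \<in> ON" by (simp add: RR_def)

lemma RR_closed:
  "0 \<in> RR" "of_nat k \<in> RR" "x \<in> RR \<Longrightarrow> y \<in> RR \<Longrightarrow> x + y \<in> RR" "x \<in> RR \<Longrightarrow> y \<in> RR \<Longrightarrow> x * y \<in> RR"
  "x \<in> RR \<Longrightarrow> y \<in> RR \<Longrightarrow> x - y \<in> RR" "x \<in> RR \<Longrightarrow> cnj x \<in> RR" "of_int a \<in> RR"
  using tw_coprime
  by (auto simp: RR_def big.sigma_add big.sigma_mult big.sigma_diff big.sigma_cnj)

lemma RR_sum: "(\<And>i. i \<in> A \<Longrightarrow> f i \<in> RR) \<Longrightarrow> sum f A \<in> RR"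
  by (induction A rule: infinite_finite_induct) (auto intro: RR_closed)

lemma RR_power: "x \<in> RR \<Longrightarrow> x ^ k \<in> RR"
  using RR_closed(2)[of 1] by (induction k) (auto intro: RR_closed)

lemma RR_root: assumes u: "u ^ big.P = 1" shows "u \<in> RR"
proof -
  have uN: "u ^ N = 1" using u by (simp add: big.N_eq power_mult)
  have "[tw + 1 = big.P - 1 + 1] (mod big.P)" using tw(1) cong_add_rcancel_nat by blast
  then have "big.P dvd tw + 1" using big.p_pos by (simp add: cong_0_iff[symmetric] cong_def)
  then obtain k where "tw + 1 = big.P * k" by (elim dvdE)
  then have "u ^ (tw + 1) = 1" using u by (simp only: power_mult power_one)
  moreover have "u * cnj u = 1"
  proof -
    have "cmod u = 1" using power_eq_1_iff[OF uN] big.N_pos by simp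
    then show ?thesis by (simp add: complex_norm_square[symmetric])
  qed
  ultimately have "u ^ tw = cnj u" by (metis add.commute mult_cancel_left mult_zero_left plus_1_eq_Suc power_Suc zero_neq_one)
  then show ?thesis using uN tw_coprime by (simp add: RR_def big.sigma_root_of_unity big.zint_root_of_unity)
qed

lemma RR_zint: assumes "z \<in> zint p" shows "z \<in> RR"
proof -
  obtain c :: "nat \<Rightarrow> int" where c: "z = (\<Sum>i<p. of_int (c i) * zeta p ^ i)" using zint_coeffs[OF assms] .
  show ?thesis unfolding c by (intro RR_sum RR_closed RR_power RR_root[OF zeta_p_P])
qed

lemma RR_cancel: "of_nat k * z \<in> RR \<Longrightarrow> k > 0 \<Longrightarrow> z \<in> ON \<Longrightarrow> z \<in> RR"
  using tw_coprime by (auto simp: RR_def big.sigma_mult)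

lemma RR_frob: "z \<in> RR \<Longrightarrow> z ^ p - cnj z \<in> PN"
  using big.frobenius_sigma[OF tw_coprime, of 1 z] tw(2) by (auto simp: RR_def)

text \<open>The condition is on all Fourier coefficients over \<open>E\<close>, not only on the
  trace, so that Parseval makes it stable under products.\<close>

definition G1 :: "cmat set" where "G1 = {x \<in> \<G>. \<forall>e\<in>E. tr (x * e) \<in> RR}"

lemma G1_G: "x \<in> G1 \<Longrightarrow> x \<in> \<G>" by (simp add: G1_def)

lemma G1_E: "e \<in> E \<Longrightarrow> e \<in> G1"
proof -
  have "tr f \<in> RR" if "f \<in> E" for f
    using E_int[OF that] E_supp[OF that] by (auto simp: tr_eq intro!: RR_sum RR_zint)
  then show "e \<in> E \<Longrightarrow> e \<in> G1" by (auto simp: G1_def)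
qed

lemma tr_RR: "x \<in> G1 \<Longrightarrow> tr x \<in> RR"
  using E_un unfolding G1_def by (metis (no_types, lifting) G_supp mem_Collect_eq un_times(2))

lemma card_E_div: "of_nat (card E) / of_nat n = (of_nat (p * n) :: complex)"
  using n_pos by (simp add: card_E power2_eq_square)

lemma G1_mult: assumes x: "x \<in> G1" and y: "y \<in> G1" shows "x * y \<in> G1"
proof -
  have xy: "x \<in> \<G>" "y \<in> \<G>" using x y by (auto simp: G1_G)
  have "tr (x * y * e) \<in> RR" if e: "e \<in> E" for e
  proof -
    have "of_nat (p * n) * tr (x * y * e) = (\<Sum>f\<in>E. tr (x * adj f) * tr (f * (y * e)))"
      using parseval[of x "y * e"] xy by (simp add: card_E_div mult.assoc)
    also have "\<dots> \<in> RR"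
    proof (intro RR_sum RR_closed(4))
      fix f assume f: "f \<in> E"
      show "tr (x * adj f) \<in> RR" using x f by (auto simp: G1_def)
      have "tr (f * (y * e)) = tr (y * (e * f))" by (subst tr_comm) (simp only: mult.assoc)
      then show "tr (f * (y * e)) \<in> RR" using y e f by (auto simp: G1_def)
    qed
    finally show ?thesis
    proof (rule RR_cancel)
      show "p * n > 0" using n_pos p_pos by simp
      show "tr (x * y * e) \<in> ON" using xy e by (intro tr_in) simp
    qed
  qed
  then show ?thesis using xy by (auto simp: G1_def)
qed

lemma G1_iv: assumes x: "x \<in> G1" shows "iv x \<in> G1"
proof -
  have xG: "x \<in> \<G>" using x by (rule G1_G)
  have "tr (iv x * e) \<in> RR" if e: "e \<in> E" for e
  proof -
    have "iv (adj e * x) = iv x * e"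
      using xG e by (simp add: iv_mult G_E E_adj iv_E)
    then have "tr (iv x * e) = cnj (tr (adj e * x))" using tr_iv[of "adj e * x"] xG e by auto
    also have "tr (adj e * x) = tr (x * adj e)" by (rule tr_comm)
    finally show ?thesis using x e by (auto simp: G1_def intro!: RR_closed)
  qed
  then show ?thesis using xG by (auto simp: G1_def)
qed

lemma parity_conj_G1: "x \<in> \<G> \<Longrightarrow> x * t * iv x \<in> G1"
  using parity_conj t_G by (auto simp: G1_def intro!: RR_root)

text \<open>\<open>p\<close> is odd, so squaring permutes the powers of \<open>e\<close>.\<close>

lemma E_root:
  assumes e: "e \<in> E"
  obtains f where "f \<in> E" "adj f * adj f = e"
proof -
  define k where "k = (p - 1) div 2"
  have "odd p" using p_prime p_gt_2 prime_odd_nat by blast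
  then have k: "Suc (k + k) = p" using p_pos unfolding k_def by (auto elim!: oddE)
  define f where "f = mpow n e k"
  have f: "f \<in> E" using e by (simp add: f_def E_mpow)
  have "e * (f * f) = un n" using E_pow[OF e] mpow_add[OF E_supp[OF e], of k k] by (simp add: f_def flip: k)
  then have "e * (f * f) * (adj f * adj f) = adj f * adj f" using f by auto
  moreover have "e * (f * f) * (adj f * adj f) = e * (f * (f * adj f) * adj f)" by (simp only: mult.assoc)
  ultimately have "adj f * adj f = e" using f e by simp
  then show ?thesis using that f by blast
qed

text \<open>Since \<open>t\<close> inverts \<open>f\<close> up to a scalar, the product of the
  conjugates of \<open>t\<close> under \<open>x\<close> and \<open>x * f\<close> is a scalar times
  the conjugate of \<open>adj f * adj f\<close> under \<open>x\<close>; \<open>E_root\<close>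
  chooses \<open>f\<close>.\<close>

lemma G1_E_conj: assumes x: "x \<in> \<G>" and e: "e \<in> E" shows "x * e * iv x \<in> G1"
proof -
  obtain f where f: "f \<in> E" "adj f * adj f = e" using E_root[OF e] .
  obtain c where c: "c ^ p = 1" "t * f * t = sc c (adj f)" using t_E[OF f(1)] by blast
  have fG: "f \<in> \<G>" "adj f \<in> \<G>" using f by auto
  have i: "iv (x * f) = adj f * iv x" using x f by (simp add: iv_mult iv_E)
  have "(x * t * iv x) * (x * f * t * iv (x * f)) = x * (t * (iv x * x) * f * t * adj f) * iv x"
    unfolding i by (simp only: mult.assoc)
  also have "t * (iv x * x) * f * t * adj f = t * f * t * adj f" using x t_G by simp
  also have "\<dots> = sc c e" by (simp add: c f)
  finally have "(x * t * iv x) * (x * f * t * iv (x * f)) = sc c (x * e * iv x)" by simp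
  moreover have "(x * t * iv x) * (x * f * t * iv (x * f)) \<in> G1"
    by (rule G1_mult[OF parity_conj_G1[OF x] parity_conj_G1[OF G_mult[OF x fG(1)]]])
  ultimately have *: "sc c (x * e * iv x) \<in> G1" by simp
  have c0: "c \<noteq> 0" using c(1) p_pos by (auto simp: power_0_left)
  have "inverse c ^ p = 1" using c(1) by (simp add: power_inverse)
  then have "sc (inverse c) (un n) \<in> G1" by (intro G1_E E_scal)
  from G1_mult[OF this *] show ?thesis using x e c0 by (simp add: supp_times G_E)
qed

text \<open>By cyclicity of the trace the conjugation moves to \<open>e\<close>, and
  \<open>G1_E_conj\<close> puts \<open>iv x * e * x\<close> into \<open>G1\<close>.\<close>

lemma G1_conj: assumes x: "x \<in> \<G>" and y: "y \<in> G1" shows "x * y * iv x \<in> G1"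
proof -
  have yG: "y \<in> \<G>" using y by (rule G1_G)
  have "tr (x * y * iv x * e) \<in> RR" if e: "e \<in> E" for e
  proof -
    define g where "g = iv x * e * x"
    have g: "g \<in> G1" using G1_E_conj[of "iv x" e] x e by (simp add: g_def iv_iv)
    have "tr (x * y * iv x * e) = tr (y * g)"
      unfolding g_def using tr_comm[of x "y * iv x * e"] by (simp add: mult.assoc)
    then show ?thesis using tr_RR[OF G1_mult[OF y g]] by simp
  qed
  then show ?thesis using x yG by (auto simp: G1_def)
qed

end

section \<open>Traces on the twisted real form\<close>

text \<open>\<open>Y\<close> will pair a matrix with its inverse.\<close>

inductive combo :: "(complex \<Rightarrow> bool) \<Rightarrow> (cmat \<Rightarrow> cmat \<Rightarrow> bool) \<Rightarrow> cmat \<Rightarrow> cmat \<Rightarrow> bool" for B Y where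
  combo_0: "combo B Y 0 0"
| combo_add: "combo B Y U V \<Longrightarrow> B b \<Longrightarrow> Y y y' \<Longrightarrow> combo B Y (U + sc b y) (V + sc b y')"

context heis_group
begin

text \<open>The Frobenius leaves such coefficients unchanged, so it conjugates a combination of
  traces from \<open>RR\<close> term by term.\<close>

definition frob_fixed :: "complex \<Rightarrow> bool" where "frob_fixed b \<longleftrightarrow> b \<in> ON \<and> b ^ p - b \<in> PN"

definition real_norm :: "cmat \<Rightarrow> cmat \<Rightarrow> bool" where
  "real_norm y y' \<longleftrightarrow> y \<in> G1 \<and> y' = iv y \<and> normz y y'"

text \<open>Replacing each group element in a combination for \<epsilon> by its inverse must give a
  conjugate of \<epsilon> under an element normalizing \<open>E\<close>. The integer
  \<open>d\<close> clears the denominators.\<close>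

definition good :: "nat \<Rightarrow> cmat \<Rightarrow> bool" where
  "good d \<epsilon> \<longleftrightarrow> supp n \<epsilon> \<and> rank1 \<epsilon> \<and> tr \<epsilon> = 1 \<and>
    (\<exists>h\<in>\<G>. normz h (iv h) \<and> combo frob_fixed real_norm (sc (of_nat d) \<epsilon>) (sc (of_nat d) (h * \<epsilon> * iv h)))"

text \<open>\<open>k\<close> normalizes \<open>E\<close>, so moving \<open>adj e\<close> across it
  gives another element of \<open>E\<close>, and \<open>product_trace\<close> applies.\<close>

lemma sandwich_trace:
  assumes y: "y \<in> \<G>" and k: "k \<in> \<G>" "normz k (iv k)" and e: "e \<in> E"
  shows "tr (y * adj e * k * e) - tr (y * adj e * k) - tr (y * k * e) + tr (y * k) \<in> PN"
proof -
  define f where "f = iv k * adj e * k"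
  have f: "f \<in> E" using normzD(5)[OF normz_sym[OF k(2)], of "adj e"] e by (auto simp: f_def)
  have kf: "adj e * k = k * f" using k e by (simp add: f_def mult.assoc)
  have "tr (y * k * f * e) - tr (y * k * f) - tr (y * k * e) + tr (y * k) \<in> PN"
    using product_trace[OF f e, of "y * k"] y k by auto
  moreover have "y * k * f = y * adj e * k" by (simp only: mult.assoc kf)
  ultimately show ?thesis by simp
qed

text \<open>Term by term the Frobenius fixes the coefficient and conjugates the trace, and the
  conjugate of a trace is the trace of the inverse.\<close>

lemma combo_frob:
  assumes "combo frob_fixed real_norm U V" and x: "x \<in> G1" and e: "e \<in> E"
  defines "L \<equiv> \<lambda>U. tr (U * e * x) - tr (U * x)"
  shows "L U \<in> ON \<and> L U ^ p - (tr (iv x * adj e * V) - tr (iv x * V)) \<in> PN"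
  using assms(1)
proof (induction rule: combo.induct)
  case combo_0
  then show ?case using p_pos big.zideal_closed(1) by (simp add: L_def zero_power)
next
  case (combo_add U V b y y')
  have xG: "x \<in> \<G>" using x by (rule G1_G)
  have b: "b \<in> ON" "b ^ p - b \<in> PN" using combo_add.hyps by (auto simp: frob_fixed_def)
  have y: "y \<in> G1" "y' = iv y" using combo_add.hyps by (auto simp: real_norm_def)
  have yG: "y \<in> \<G>" using y by (simp add: G1_G)
  define l where "l = tr (y * e * x) - tr (y * x)"
  have lR: "l \<in> RR" unfolding l_def
    by (intro RR_closed tr_RR G1_mult y x G1_E[OF e])
  have cl: "cnj l = tr (iv x * adj e * y') - tr (iv x * y')"
  proof -
    have "cnj (tr (y * e * x)) = tr (iv (y * e * x))" using yG xG e by (subst tr_iv) auto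
    also have "\<dots> = tr (iv x * adj e * y')" using yG xG e y by (simp add: iv_mult G_mult G_E iv_E mult.assoc)
    moreover have "cnj (tr (y * x)) = tr (iv x * y')" using yG xG y tr_iv[of "y * x"] by (simp add: iv_mult G_mult)
    ultimately show ?thesis by (simp add: l_def)
  qed
  have LU: "L (U + sc b y) = L U + b * l" by (simp add: L_def l_def distrib_right algebra_simps)
  have IH: "L U \<in> ON" "L U ^ p - (tr (iv x * adj e * V) - tr (iv x * V)) \<in> PN" using combo_add.IH by auto
  have lO: "l \<in> ON" using lR by (rule RR_ON)
  have "(L U + b * l) ^ p - (L U ^ p + (b * l) ^ p) \<in> PN"
    using IH b lO p_prime by (intro big.p_ideal_in_pi big.freshman) auto
  moreover have "(b ^ p - b) * l ^ p \<in> PN" by (rule big.zideal_closed(5)[OF b(2) big.zint_power[OF lO]])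
  moreover have "b * (l ^ p - cnj l) \<in> PN" using b RR_frob[OF lR] by (intro big.zideal_closed(6))
  ultimately have "((L U + b * l) ^ p - (L U ^ p + (b * l) ^ p)) + (b ^ p - b) * l ^ p + b * (l ^ p - cnj l)
    + (L U ^ p - (tr (iv x * adj e * V) - tr (iv x * V))) \<in> PN"
    using IH(2) by (intro big.zideal_closed(2))
  moreover have "((L U + b * l) ^ p - (L U ^ p + (b * l) ^ p)) + (b ^ p - b) * l ^ p + b * (l ^ p - cnj l)
    + (L U ^ p - (tr (iv x * adj e * V) - tr (iv x * V))) =
    L (U + sc b y) ^ p - (tr (iv x * adj e * (V + sc b y')) - tr (iv x * (V + sc b y')))"
    unfolding LU by (simp add: cl distrib_left power_mult_distrib algebra_simps)
  ultimately show ?case using IH b lO by (auto simp: LU)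
qed

text \<open>\<open>sandwich_trace\<close> extended linearly in both places. The second place is the
  one where the terms must normalize \<open>E\<close>.\<close>

lemma combo_sandwich:
  assumes U: "combo frob_fixed real_norm U V" and U': "combo frob_fixed real_norm U' V'"
    and x: "x \<in> \<G>" and h: "h \<in> \<G>" "normz h (iv h)" and e: "e \<in> E"
  defines "\<Phi> \<equiv> \<lambda>A k. tr (x * A * iv h * iv x * adj e * h * k * e) - tr (x * A * iv h * iv x * adj e * h * k)
    - tr (x * A * iv h * iv x * h * k * e) + tr (x * A * iv h * iv x * h * k)"
  shows "\<Phi> U U' \<in> PN"
proof -
  have 1: "\<Phi> g U' \<in> PN" if g: "g \<in> \<G>" for g
    using U'
  proof (induction rule: combo.induct)
    case combo_0
    then show ?case using big.zideal_closed(1) by (simp add: \<Phi>_def)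
  next
    case (combo_add U V b y y')
    have y: "y \<in> \<G>" "normz y (iv y)" and b: "b \<in> ON"
      using combo_add.hyps by (auto simp: real_norm_def frob_fixed_def G1_G)
    have "normz (h * y) (iv (h * y))" using normz_mult[OF h(2) y(2)] h y by (simp add: iv_mult)
    then have "\<Phi> g y \<in> PN" unfolding \<Phi>_def
      using sandwich_trace[of "x * g * iv h * iv x" "h * y" e] g x h y e
      by (simp add: G_mult mult.assoc)
    then have "\<Phi> g U + b * \<Phi> g y \<in> PN"
      using combo_add.IH b by (intro big.zideal_closed(2) big.zideal_closed(6))
    moreover have "\<Phi> g (U + sc b y) = \<Phi> g U + b * \<Phi> g y"
      by (simp add: \<Phi>_def distrib_left distrib_right algebra_simps)
    ultimately show ?case by simp
  qed
  show ?thesis using U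
  proof (induction rule: combo.induct)
    case combo_0
    then show ?case using big.zideal_closed(1) by (simp add: \<Phi>_def)
  next
    case (combo_add U V b y y')
    have y: "y \<in> \<G>" and b: "b \<in> ON"
      using combo_add.hyps by (auto simp: real_norm_def frob_fixed_def G1_G)
    then have "\<Phi> U U' + b * \<Phi> y U' \<in> PN"
      using combo_add.IH 1 by (intro big.zideal_closed(2) big.zideal_closed(6))
    moreover have "\<Phi> (U + sc b y) U' = \<Phi> U U' + b * \<Phi> y U'"
      by (simp add: \<Phi>_def distrib_left distrib_right algebra_simps)
    ultimately show ?case by simp
  qed
qed

text \<open>\<open>z'\<close> is the Frobenius image of \<open>z\<close>, taken against the
  conjugate of \<epsilon> by \<open>h\<close>. Cycling \<open>h\<close> around makes \<epsilon>
  occur twice in \<open>z' * z\<close>, and rank one fuses the two traces into one covered by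
  \<open>combo_sandwich\<close>.\<close>

lemma good_trace:
  assumes g: "good d \<epsilon>" and x: "x \<in> G1" and e: "e \<in> E"
  shows "of_nat d * (tr (\<epsilon> * e * x) - tr (\<epsilon> * x)) \<in> PN"
proof -
  have xG: "x \<in> \<G>" using x by (rule G1_G)
  obtain h where h: "h \<in> \<G>" "normz h (iv h)"
    and U: "combo frob_fixed real_norm (sc (of_nat d) \<epsilon>) (sc (of_nat d) (h * \<epsilon> * iv h))"
    using g by (auto simp: good_def)
  have \<epsilon>: "supp n \<epsilon>" "rank1 \<epsilon>" using g by (auto simp: good_def)
  define z where "z = of_nat d * (tr (\<epsilon> * e * x) - tr (\<epsilon> * x))"
  define z' where "z' = of_nat d * (tr (iv x * adj e * (h * \<epsilon> * iv h)) - tr (iv x * (h * \<epsilon> * iv h)))"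
  have z: "z \<in> ON" "z ^ p - z' \<in> PN"
    using combo_frob[OF U x e] by (auto simp: z_def z'_def right_diff_distrib)
  have prod: "tr (\<epsilon> * A) * tr (\<epsilon> * B) = tr (\<epsilon> * A * \<epsilon> * B)" for A B
    by (simp add: rank1_sandwich[OF \<epsilon>(2)])
  have z'1: "z' = of_nat d * (tr (\<epsilon> * (iv h * iv x * adj e * h)) - tr (\<epsilon> * (iv h * iv x * h)))"
    unfolding z'_def using tr_comm[of "iv x * adj e * h" "\<epsilon> * iv h"] tr_comm[of "iv x * h" "\<epsilon> * iv h"]
    by (simp add: mult.assoc)
  have "z' * z = of_nat d * of_nat d * (
      tr (\<epsilon> * (iv h * iv x * adj e * h)) * tr (\<epsilon> * (e * x)) - tr (\<epsilon> * (iv h * iv x * adj e * h)) * tr (\<epsilon> * x)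
     - tr (\<epsilon> * (iv h * iv x * h)) * tr (\<epsilon> * (e * x)) + tr (\<epsilon> * (iv h * iv x * h)) * tr (\<epsilon> * x))"
    unfolding z'1 z_def by (simp add: algebra_simps)
  also have "\<dots> = tr (x * sc (of_nat d) \<epsilon> * iv h * iv x * adj e * h * sc (of_nat d) \<epsilon> * e)
    - tr (x * sc (of_nat d) \<epsilon> * iv h * iv x * adj e * h * sc (of_nat d) \<epsilon>)
    - tr (x * sc (of_nat d) \<epsilon> * iv h * iv x * h * sc (of_nat d) \<epsilon> * e)
    + tr (x * sc (of_nat d) \<epsilon> * iv h * iv x * h * sc (of_nat d) \<epsilon>)"
  proof -
    have c: "tr (x * W) = tr (W * x)" for W by (rule tr_comm)
    show ?thesis unfolding prod by (simp add: c mult.assoc algebra_simps)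
  qed
  also have "\<dots> \<in> PN" by (rule combo_sandwich[OF U U xG h e])
  finally have "z' * z \<in> PN" .
  moreover have "(z ^ p - z') * z \<in> PN" using z by (intro big.zideal_closed(5))
  ultimately have "(z ^ p - z') * z + z' * z \<in> PN" by (intro big.zideal_closed(2))
  then have "z ^ (Suc p) \<in> PN" by (simp add: algebra_simps)
  then have "z \<in> PN" by (rule big.pi_radical[OF z(1)])
  then show ?thesis by (simp add: z_def)
qed

end

section \<open>Nilpotency\<close>

locale heis_group_resolution = heis_group +
  fixes F :: "nat set" and \<epsilon> :: "nat \<Rightarrow> cmat" and d :: nat
  assumes F_fin: "finite F" and F_sum: "(\<Sum>j\<in>F. \<epsilon> j) = un n" and d: "coprime d p"
    and F_good: "j \<in> F \<Longrightarrow> good d (\<epsilon> j)" and m_pos: "m > 0"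
begin

lemma F_supp: "j \<in> F \<Longrightarrow> supp n (\<epsilon> j)" using F_good by (auto simp: good_def)

lemma F_rank1: "j \<in> F \<Longrightarrow> rank1 (\<epsilon> j)" using F_good by (auto simp: good_def)

text \<open>Summing \<open>good_trace\<close> over the resolution replaces the idempotent by the
  identity.\<close>

lemma E_trivial:
  assumes x: "x \<in> G1" and e: "e \<in> E"
  shows "tr (x * e) - tr x \<in> PN"
proof -
  have xG: "x \<in> \<G>" using x by (rule G1_G)
  have s: "tr y = (\<Sum>j\<in>F. tr (\<epsilon> j * y))" if "supp n y" for y
  proof -
    have "tr y = tr ((\<Sum>j\<in>F. \<epsilon> j) * y)" using that by (simp add: F_sum)
    then show ?thesis by (simp add: sum_distrib_right)
  qed
  have "(\<Sum>j\<in>F. of_nat d * (tr (\<epsilon> j * e * x) - tr (\<epsilon> j * x))) \<in> PN"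
    using good_trace[OF F_good x e] by (intro big.zideal_sum)
  also have "(\<Sum>j\<in>F. of_nat d * (tr (\<epsilon> j * e * x) - tr (\<epsilon> j * x))) = of_nat d * (tr (e * x) - tr x)"
    using xG e by (simp add: s[of "e * x"] s[of x] supp_times sum_subtractf sum_distrib_left[symmetric] mult.assoc)
  finally have "of_nat d * (tr (x * e) - tr x) \<in> PN" by (simp add: tr_comm)
  moreover have "tr (x * e) - tr x \<in> ON"
    by (intro big.zint_closed(4) tr_in) (use xG e in simp_all)
  ultimately show ?thesis using big.cancel_coprime[OF d] by blast
qed

section \<open>The span of \<open>G1\<close> over the cyclotomic integers and the radical of its
  trace form\<close>

inductive RS :: "cmat \<Rightarrow> bool" where
  RS_0: "RS 0"
| RS_add: "RS U \<Longrightarrow> c \<in> ON \<Longrightarrow> g \<in> G1 \<Longrightarrow> RS (U + sc c g)"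

lemma RS_supp: "RS U \<Longrightarrow> supp n U"
  by (induction rule: RS.induct) (auto simp: G1_G)

lemma RS_plus: "RS V \<Longrightarrow> RS U \<Longrightarrow> RS (U + V)"
  by (induction rule: RS.induct) (auto simp: add.assoc[symmetric] intro: RS.intros)

lemma RS_G1: "g \<in> G1 \<Longrightarrow> RS g"
  using RS_add[OF RS_0, of 1 g] by simp

lemma RS_sc: "RS U \<Longrightarrow> c \<in> ON \<Longrightarrow> RS (sc c U)"
proof (induction rule: RS.induct)
  case (RS_add U c' g)
  then show ?case using RS.RS_add[of "sc c U" "c * c'" g] by (simp add: sc_add big.zint_closed)
qed (auto intro: RS_0)

lemma RS_minus: "RS U \<Longrightarrow> RS V \<Longrightarrow> RS (U - V)"
  using RS_plus[OF RS_sc[of V "- 1"], of U] by (simp add: big.zint_closed)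

lemma RS_mult: "RS V \<Longrightarrow> RS U \<Longrightarrow> RS (U * V)"
proof (induction rule: RS.induct)
  case RS_0
  show ?case by (simp add: RS.RS_0)
next
  case (RS_add V c g)
  have "RS (U * g)" using RS_add.prems
  proof (induction rule: RS.induct)
    case RS_0
    show ?case by (simp add: RS.RS_0)
  next
    case (RS_add U c' g')
    then show ?case using RS.RS_add[of "U * g" c' "g' * g"] G1_mult \<open>g \<in> G1\<close> by (simp add: distrib_right)
  qed
  then show ?case using RS_plus[OF RS_sc[of "U * g" c], of "U * V"] RS_add by (simp add: distrib_left)
qed

text \<open>The radical of the trace form modulo \<open>big.\<pi>\<close>, a two-sided ideal of the
  span. Its nilpotency, in the form of \<open>JP_trace\<close>, stands in for a reduction of the
  representation modulo a prime.\<close>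

definition JJ :: "cmat set" where "JJ = {W. RS W \<and> (\<forall>x\<in>G1. tr (x * W) \<in> PN)}"

lemma JJ_RS: "W \<in> JJ \<Longrightarrow> RS W" by (simp add: JJ_def)

lemma un_G1: "un n \<in> G1" by (rule G1_E) simp

lemma JJ_tr: "W \<in> JJ \<Longrightarrow> tr W \<in> PN"
  using un_G1 RS_supp unfolding JJ_def by (metis (no_types, lifting) mem_Collect_eq un_times(1))

lemma JJ_minus: "U \<in> JJ \<Longrightarrow> V \<in> JJ \<Longrightarrow> U - V \<in> JJ"
  using RS_minus big.zideal_closed(3) by (simp add: JJ_def right_diff_distrib)

lemma JJ_trace: assumes W: "W \<in> JJ" shows "RS X \<Longrightarrow> tr (X * W) \<in> PN"
proof (induction rule: RS.induct)
  case RS_0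
  show ?case using big.zideal_closed(1) by simp
next
  case (RS_add U c g)
  then show ?case using W big.zideal_closed(2) big.zideal_closed(6) by (simp add: JJ_def distrib_right)
qed

lemma JJ_mult: assumes W: "W \<in> JJ" and X: "RS X" shows "X * W \<in> JJ" "W * X \<in> JJ"
proof -
  have "tr (x * (X * W)) \<in> PN" if "x \<in> G1" for x
    using JJ_trace[OF W RS_mult[OF X RS_G1[OF that]]] by (simp add: mult.assoc)
  then show "X * W \<in> JJ" using W X by (auto simp: JJ_def intro: RS_mult)
  have "tr (x * (W * X)) \<in> PN" if "x \<in> G1" for x
    using JJ_trace[OF W RS_mult[OF RS_G1[OF that] X]] tr_comm[of "x * W" X] by (simp add: mult.assoc)
  then show "W * X \<in> JJ" using W X by (auto simp: JJ_def intro: RS_mult)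
qed

text \<open>The idempotents come from group elements, so they can be interleaved with elements of
  the ideal at the cost of a factor \<open>d\<close>.\<close>

lemma F_RS: assumes "j \<in> F" shows "RS (sc (of_nat d) (\<epsilon> j))"
proof -
  have "combo frob_fixed real_norm U V \<Longrightarrow> RS U" for U V
    by (induction rule: combo.induct) (auto simp: frob_fixed_def real_norm_def intro: RS.intros)
  then show ?thesis using F_good[OF assms] by (auto simp: good_def)
qed

section \<open>Words in the radical and paths through the rank one idempotents\<close>

primrec prodl :: "cmat list \<Rightarrow> cmat" where
  "prodl [] = un n"
| "prodl (X # Xs) = X * prodl Xs"

lemma prodl_supp: "(\<And>X. X \<in> set Xs \<Longrightarrow> supp n X) \<Longrightarrow> supp n (prodl Xs)"
  by (induction Xs) auto

lemma prodl_append: "(\<And>X. X \<in> set Xs \<union> set Ys \<Longrightarrow> supp n X) \<Longrightarrow> prodl (Xs @ Ys) = prodl Xs * prodl Ys"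
  by (induction Xs) (auto simp: mult.assoc prodl_supp)

text \<open>Idempotents alternate with elements of \<open>JJ\<close>, so that
  \<open>rank1_sandwich\<close> cuts out the stretch between two visits to the same index.\<close>

definition path :: "(nat \<times> cmat) list \<Rightarrow> cmat" where "path xs = prodl (map (\<lambda>(j, Y). \<epsilon> j * Y) xs)"

definition steps :: "(nat \<times> cmat) list \<Rightarrow> bool" where "steps xs \<longleftrightarrow> set xs \<subseteq> F \<times> JJ"

lemma path_supp: "steps xs \<Longrightarrow> X \<in> set (map (\<lambda>(j, Y). \<epsilon> j * Y) xs) \<Longrightarrow> supp n X"
  by (auto simp: steps_def F_supp RS_supp JJ_RS)

lemma path_supp': "steps xs \<Longrightarrow> supp n (path xs)"
  unfolding path_def by (rule prodl_supp) (rule path_supp)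

lemma path_append:
  assumes "steps xs" "steps ys"
  shows "path (xs @ ys) = path xs * path ys"
  unfolding path_def map_append
  by (rule prodl_append) (use path_supp[OF assms(1)] path_supp[OF assms(2)] in blast)

lemma path_Cons: "path ((j, Y) # xs) = \<epsilon> j * Y * path xs"
  by (simp add: path_def)

lemma path_JJ: "steps xs \<Longrightarrow> RS (sc (of_nat (d ^ length xs)) (path xs)) \<and> (xs \<noteq> [] \<longrightarrow> sc (of_nat (d ^ length xs)) (path xs) \<in> JJ)"
proof (induction xs)
  case Nil
  then show ?case using RS_G1[OF un_G1] by (simp add: path_def)
next
  case (Cons a xs)
  obtain j Y where a: "a = (j, Y)" by (cases a)
  have h: "j \<in> F" "Y \<in> JJ" "steps xs" using Cons.prems a by (auto simp: steps_def)
  have "sc (of_nat (d ^ length (a # xs))) (path (a # xs)) =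
      sc (of_nat d) (\<epsilon> j) * (Y * sc (of_nat (d ^ length xs)) (path xs))"
    by (simp add: a path_Cons mult.assoc mult.commute)
  also have "\<dots> \<in> JJ" using Cons.IH[OF h(3)] h F_RS by (intro JJ_mult) auto
  finally show ?case using JJ_RS by simp
qed

text \<open>A closed path through more than \<open>card F\<close> of the rank one idempotents revisits one of them,
  and its trace then factors into the traces of two shorter closed paths.\<close>

lemma path_trace:
  "steps xs \<Longrightarrow> xs \<noteq> [] \<Longrightarrow>
    \<exists>D. length xs \<le> card F * D \<and> of_nat (d ^ length xs) * tr (path xs) \<in> zideal N (big.\<pi> ^ D)"
proof (induction "length xs" arbitrary: xs rule: less_induct)
  case less
  show ?case
  proof (cases "distinct (map fst xs)")
    case True
    have "length xs = card (set (map fst xs))" using distinct_card[OF True] by simp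
    also have "\<dots> \<le> card F" using less.prems(1) F_fin by (intro card_mono) (auto simp: steps_def)
    finally have "length xs \<le> card F * 1" by simp
    moreover have "of_nat (d ^ length xs) * tr (path xs) \<in> zideal N (big.\<pi> ^ 1)"
      using JJ_tr[of "sc (of_nat (d ^ length xs)) (path xs)"] path_JJ[OF less.prems(1)] less.prems(2) by simp
    ultimately show ?thesis by blast
  next
    case False
    then obtain as bs cs j where dec: "map fst xs = as @ [j] @ bs @ [j] @ cs"
      using not_distinct_decomp by blast
    then obtain A B C Y Y' where xs: "xs = A @ (j, Y) # B @ (j, Y') # C"
      by (auto simp: map_eq_append_conv map_eq_Cons_conv append_eq_map_conv Cons_eq_map_conv)
    \<comment> \<open>The cyclic word is cut at its two visits to \<open>j\<close>; the second part
      runs through the end of the word back to its beginning.\<close>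
    define u v where "u = (j, Y) # B" and "v = (j, Y') # C @ A"
    have st: "steps A" "steps B" "steps C" "j \<in> F" "Y \<in> JJ" "Y' \<in> JJ" "steps u" "steps v"
      using less.prems(1) by (auto simp: xs steps_def u_def v_def)
    have len: "length xs = length u + length v" "length u > 0" "length v > 0"
      by (auto simp: xs u_def v_def)
    obtain D1 where D1: "length u \<le> card F * D1" "of_nat (d ^ length u) * tr (path u) \<in> zideal N (big.\<pi> ^ D1)"
      using less.hyps[of u] st len by (auto simp: u_def)
    obtain D2 where D2: "length v \<le> card F * D2" "of_nat (d ^ length v) * tr (path v) \<in> zideal N (big.\<pi> ^ D2)"
      using less.hyps[of v] st len by (auto simp: v_def)
    have "tr (path u) * tr (path v) = tr (path u * path v)"
    proof -
      have "path u * path v = \<epsilon> j * (Y * path B) * \<epsilon> j * (Y' * path (C @ A))"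
        by (simp add: u_def v_def path_Cons mult.assoc)
      also have "\<epsilon> j * (Y * path B) * \<epsilon> j = sc (tr (path u)) (\<epsilon> j)"
        unfolding rank1_sandwich[OF F_rank1[OF st(4)]] by (simp add: u_def path_Cons mult.assoc)
      finally show ?thesis by (simp add: v_def path_Cons mult.assoc)
    qed
    also have "\<dots> = tr (path A * (path u * path ((j, Y') # C)))"
      unfolding v_def using st
      by (subst tr_comm[of "path A"]) (simp add: path_Cons path_append mult.assoc)
    also have "path A * (path u * path ((j, Y') # C)) = path xs"
    proof -
      have "steps ((j, Y') # C)" using st by (auto simp: steps_def)
      then have "path u * path ((j, Y') # C) = path (u @ (j, Y') # C)" "steps (u @ (j, Y') # C)"
        using st by (auto simp: path_append[of u] steps_def)
      then show ?thesis using st by (simp add: path_append[of A, symmetric] xs u_def)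
    qed
    finally have t: "tr (path xs) = tr (path u) * tr (path v)" by simp
    have "of_nat (d ^ length u) * tr (path u) * (of_nat (d ^ length v) * tr (path v)) \<in> zideal N (big.\<pi> ^ D1 * big.\<pi> ^ D2)"
      using D1(2) D2(2) by (rule big.zideal_mult)
    then have "of_nat (d ^ length xs) * tr (path xs) \<in> zideal N (big.\<pi> ^ (D1 + D2))"
      by (simp add: t len power_add mult_ac)
    moreover have "length xs \<le> card F * (D1 + D2)" using D1(1) D2(1) by (simp add: len distrib_left)
    ultimately show ?thesis by blast
  qed
qed

lemma card_F: "card F > 0"
proof -
  have "F \<noteq> {}" using F_sum un_neq_0[OF n_pos] by auto
  then show ?thesis using F_fin by (simp add: card_gt_0_iff)
qed

text \<open>Inserting the resolution of the identity before each letter expands the word into paths,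
  and \<open>path_trace\<close> gives one factor \<open>big.\<pi>\<close> for every
  \<open>card F\<close> letters.\<close>

lemma word_trace:
  "steps xs \<Longrightarrow> set Ys \<subseteq> JJ \<Longrightarrow> length xs + length Ys = k \<Longrightarrow> k > 0 \<Longrightarrow>
    of_nat (d ^ k) * tr (path xs * prodl Ys) \<in> zideal N (big.\<pi> ^ (k div card F))"
proof (induction Ys arbitrary: xs)
  case Nil
  obtain D where D: "length xs \<le> card F * D" "of_nat (d ^ length xs) * tr (path xs) \<in> zideal N (big.\<pi> ^ D)"
    using path_trace[OF Nil.prems(1)] Nil.prems by auto
  have "k div card F \<le> D" using D(1) card_F Nil.prems(3)
    by (metis add.right_neutral div_le_mono list.size(3) nonzero_mult_div_cancel_left not_gr_zero)
  then have "big.\<pi> ^ D = big.\<pi> ^ (k div card F) * big.\<pi> ^ (D - k div card F)" by (simp flip: power_add)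
  then have "big.\<pi> ^ D \<in> zideal N (big.\<pi> ^ (k div card F))"
    using big.zideal_closed(7) by (simp add: big.zint_power)
  then show ?case using big.zideal_mono D(2) Nil.prems path_supp' by auto
next
  case (Cons Y Ys)
  have Y: "Y \<in> JJ" "supp n Y" using Cons.prems by (auto simp: RS_supp JJ_RS)
  have sY: "supp n (prodl Ys)" using Cons.prems by (intro prodl_supp) (auto simp: RS_supp JJ_RS)
  have st: "steps (xs @ [(j, Y)])" if "j \<in> F" for j using Cons.prems that by (auto simp: steps_def)
  have "path xs * prodl (Y # Ys) = path xs * ((\<Sum>j\<in>F. \<epsilon> j) * Y) * prodl Ys"
    using Y by (simp add: F_sum mult.assoc)
  also have "\<dots> = (\<Sum>j\<in>F. path (xs @ [(j, Y)]) * prodl Ys)"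
    unfolding sum_distrib_left sum_distrib_right
  proof (intro sum.cong refl)
    fix j assume e: "j \<in> F"
    have "steps [(j, Y)]" using e Y by (auto simp: steps_def)
    then show "path xs * (\<epsilon> j * Y) * prodl Ys = path (xs @ [(j, Y)]) * prodl Ys"
      using Cons.prems(1) e Y by (simp add: path_append path_Cons[of _ _ "[]"]) (simp add: path_def F_supp supp_times)
  qed
  finally have "of_nat (d ^ k) * tr (path xs * prodl (Y # Ys)) =
    (\<Sum>j\<in>F. of_nat (d ^ k) * tr (path (xs @ [(j, Y)]) * prodl Ys))"
    by (simp add: sum_distrib_left)
  also have "\<dots> \<in> zideal N (big.\<pi> ^ (k div card F))"
    using Cons.prems by (intro big.zideal_sum Cons.IH st) auto
  finally show ?case .
qed

text \<open>The \<open>k\<close>-th power of the ideal \<open>JJ\<close>; for \<open>k > 0\<close>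
  coefficients are absorbed into the letters.\<close>

inductive JP :: "nat \<Rightarrow> cmat \<Rightarrow> bool" for k where
  JP_0: "JP k 0"
| JP_add: "JP k U \<Longrightarrow> length Ys = k \<Longrightarrow> set Ys \<subseteq> JJ \<Longrightarrow> JP k (U + prodl Ys)"

lemma JP_plus: "JP k V \<Longrightarrow> JP k U \<Longrightarrow> JP k (U + V)"
  by (induction rule: JP.induct) (auto simp: add.assoc[symmetric] intro: JP.intros)

lemma JP_word: assumes "length Ys = k" "set Ys \<subseteq> JJ" shows "JP k (prodl Ys)"
  using JP_add[OF JP_0 assms] by simp

lemma JP_1: "Y \<in> JJ \<Longrightarrow> JP 1 Y"
  using JP_word[of "[Y]" 1] by (simp add: RS_supp JJ_RS)

lemma JP_right: assumes "JP k V" "k > 0" "RS X" shows "JP k (V * X)"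
  using assms(1)
proof (induction rule: JP.induct)
  case JP_0
  show ?case by (simp add: JP.JP_0)
next
  case (JP_add U Ys)
  then obtain Zs Z where Ys: "Ys = Zs @ [Z]" using assms(2) by (cases Ys rule: rev_cases) auto
  have Z: "Z \<in> JJ" "set Zs \<subseteq> JJ" using JP_add Ys by auto
  have sp: "supp n Y" if "Y \<in> JJ" for Y using that by (simp add: RS_supp JJ_RS)
  have "prodl Ys * X = prodl (Zs @ [Z * X])"
    using Z sp JJ_mult(2)[OF Z(1) assms(3)] RS_supp[OF assms(3)] unfolding Ys
    by (subst prodl_append, force, subst prodl_append, force) (simp add: mult.assoc)
  moreover have "JP k (prodl (Zs @ [Z * X]))"
    using Z JJ_mult(2)[OF Z(1) assms(3)] JP_add Ys by (intro JP_word) auto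
  ultimately show ?case using JP_plus JP_add.IH by (simp add: distrib_right)
qed

lemma JP_neg: assumes "JP k V" "k > 0" shows "JP k (- V)"
proof -
  have "supp n V" using assms(1)
    by (induction rule: JP.induct) (auto intro!: prodl_supp simp: RS_supp JJ_RS subset_iff)
  then have "V * (sc (- 1) (un n)) = - V" by simp
  moreover have "RS (sc (- 1) (un n))" using RS_sc[OF RS_G1[OF un_G1], of "- 1"] big.zint_closed(3)[of 1] by simp
  ultimately show ?thesis using JP_right[OF assms] by metis
qed

lemma JP_mult: "JP k V \<Longrightarrow> JP j U \<Longrightarrow> JP (j + k) (U * V)"
proof (induction rule: JP.induct)
  case JP_0
  show ?case by (simp add: JP.JP_0)
next
  case (JP_add V Ys)
  have "JP (j + k) (U * prodl Ys)" using JP_add.prems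
  proof (induction rule: JP.induct)
    case JP_0
    show ?case by (simp add: JP.JP_0)
  next
    case (JP_add U Zs)
    have "prodl Zs * prodl Ys = prodl (Zs @ Ys)"
      using JP_add \<open>set Ys \<subseteq> JJ\<close> by (intro prodl_append[symmetric]) (auto simp: RS_supp JJ_RS)
    moreover have "JP (j + k) (prodl (Zs @ Ys))"
      using JP_add \<open>set Ys \<subseteq> JJ\<close> \<open>length Ys = k\<close> by (intro JP_word) auto
    ultimately show ?case using JP_plus JP_add.IH by (simp add: distrib_right)
  qed
  then show ?case using JP_plus JP_add.IH[OF JP_add.prems] by (simp add: distrib_left)
qed

lemma JP_trace: "JP k V \<Longrightarrow> k > 0 \<Longrightarrow> of_nat (d ^ k) * tr V \<in> zideal N (big.\<pi> ^ (k div card F))"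
proof (induction rule: JP.induct)
  case JP_0
  show ?case using big.zideal_closed(1) by simp
next
  case (JP_add U Ys)
  have "supp n (prodl Ys)" using JP_add by (intro prodl_supp) (auto simp: RS_supp JJ_RS)
  then have "of_nat (d ^ k) * tr (prodl Ys) \<in> zideal N (big.\<pi> ^ (k div card F))"
    using word_trace[of "[]" Ys k] JP_add by (simp add: steps_def path_def)
  then show ?case using JP_add big.zideal_closed(2) by (simp add: distrib_left)
qed

end

section \<open>The filtration of a congruence subgroup by the powers of the radical, and its last
  layer\<close>

context heis_group_resolution
begin

text \<open>The elements that are the identity modulo the radical; they include \<open>E\<close> by
  \<open>E_trivial\<close> and are stable under conjugation by \<G>.\<close>

definition MM :: "cmat set" where "MM = {g \<in> G1. g - un n \<in> JJ}"

text \<open>The analogue of the dimension subgroups: a commutator with an element of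
  \<open>MM\<close> raises the index.\<close>

definition \<Gamma> :: "nat \<Rightarrow> cmat set" where "\<Gamma> k = {g \<in> MM. JP k (g - un n)}"

lemma MM_G: "g \<in> MM \<Longrightarrow> g \<in> \<G>" by (simp add: MM_def G1_G)

lemma MM_iff: "g \<in> MM \<longleftrightarrow> g \<in> G1 \<and> (\<forall>x\<in>G1. tr (x * g) - tr x \<in> PN)"
proof -
  have "tr (x * (g - un n)) = tr (x * g) - tr x" if "x \<in> G1" for x
    using that by (simp add: right_diff_distrib G1_G)
  moreover have "RS (g - un n)" if "g \<in> G1" using that by (intro RS_minus RS_G1 un_G1)
  ultimately show ?thesis by (auto simp: MM_def JJ_def)
qed

lemma MM_conj: assumes a: "a \<in> \<G>" and g: "g \<in> MM" shows "a * g * iv a \<in> MM"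
  unfolding MM_iff
proof (intro conjI ballI)
  have gG: "g \<in> \<G>" using g by (rule MM_G)
  show "a * g * iv a \<in> G1" using a g by (intro G1_conj) (auto simp: MM_def)
  fix x assume x: "x \<in> G1"
  define y where "y = iv a * x * a"
  have xG: "x \<in> \<G>" using x by (rule G1_G)
  have y: "y \<in> G1" using G1_conj[of "iv a" x] a x by (simp add: y_def iv_iv)
  have "tr (x * (a * g * iv a)) = tr (y * g)"
    unfolding y_def using tr_comm[of "x * a * g" "iv a"] by (simp add: mult.assoc)
  moreover have "tr y = tr x"
    unfolding y_def using tr_comm[of "iv a * x" a] a xG by (simp add: mult.assoc)
  moreover have "tr (y * g) - tr y \<in> PN" using g y unfolding MM_iff by blast
  ultimately show "tr (x * (a * g * iv a)) - tr x \<in> PN" by simp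
qed

lemma E_MM: "e \<in> E \<Longrightarrow> e \<in> MM"
  using E_trivial G1_E by (simp add: MM_iff)

lemma MM_\<Gamma>: "g \<in> MM \<Longrightarrow> g \<in> \<Gamma> 1"
  using JP_1 by (simp add: \<Gamma>_def MM_def)

lemma commutator_G1: "g \<in> G1 \<Longrightarrow> h \<in> G1 \<Longrightarrow> g * h * iv g * iv h \<in> G1"
  by (intro G1_mult G1_iv)

text \<open>With \<open>a = g - un n\<close> and \<open>b = h - un n\<close>, the commutator minus
  the identity is \<open>a * b - b * a\<close> times \<open>iv g * iv h\<close>, so the degrees
  add.\<close>

lemma commutator_\<Gamma>:
  assumes g: "g \<in> \<Gamma> k" and k: "k > 0" and h: "h \<in> MM"
  shows "g * h * iv g * iv h \<in> \<Gamma> (k + 1)"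
proof -
  have gh: "g \<in> G1" "h \<in> G1" "g \<in> \<G>" "h \<in> \<G>" "g - un n \<in> JJ" "h - un n \<in> JJ" "JP k (g - un n)"
    using g h by (auto simp: \<Gamma>_def MM_def G1_G)
  define W where "W = (g - un n) * (h - un n) - (h - un n) * (g - un n)"
  define X where "X = iv g * iv h"
  have "W = g * h - h * g"
    using gh by (simp add: W_def algebra_simps)
  moreover have "h * g * (iv g * iv h) = un n" using gh by (simp add: mult.assoc)
  ultimately have c: "g * h * iv g * iv h - un n = W * X"
    by (simp add: X_def left_diff_distrib mult.assoc)
  have X: "RS X" unfolding X_def using gh by (intro RS_G1 G1_mult G1_iv)
  have W1: "JP (k + 1) W"
  proof -
    have "JP (k + 1) ((g - un n) * (h - un n))" using JP_mult[OF JP_1[OF gh(6)] gh(7)] .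
    moreover have "JP (k + 1) (- ((h - un n) * (g - un n)))"
      using JP_neg[OF JP_mult[OF gh(7) JP_1[OF gh(6)]]] by simp
    ultimately show ?thesis unfolding W_def using JP_plus by (metis uminus_add_conv_diff add.commute)
  qed
  have WJ: "W \<in> JJ" unfolding W_def
    by (rule JJ_minus[OF JJ_mult(1)[OF gh(6) JJ_RS[OF gh(5)]] JJ_mult(1)[OF gh(5) JJ_RS[OF gh(6)]]])
  show ?thesis unfolding \<Gamma>_def MM_def
  proof (intro CollectI conjI)
    show "g * h * iv g * iv h \<in> G1" using gh by (intro commutator_G1)
    show "g * h * iv g * iv h - un n \<in> JJ" unfolding c using WJ X by (intro JJ_mult)
    show "JP (k + 1) (g * h * iv g * iv h - un n)" unfolding c using W1 X by (intro JP_right) auto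
  qed
qed

text \<open>Deep in the filtration the trace of \<open>(g - un n) * e\<close> is divisible by a
  power of \<open>p\<close> exceeding \<open>2 * n\<close>, while its conjugates are bounded by
  \<open>2 * n\<close>. So it vanishes for every \<open>e\<close>, and Fourier expansion gives the
  claim.\<close>

lemma \<Gamma>_trivial: obtains K where "\<And>k g. k \<ge> K \<Longrightarrow> g \<in> \<Gamma> k \<Longrightarrow> g = un n"
proof -
  obtain L where L: "2 * n < L" by blast
  have pL: "2 * n < p ^ L"
    using L less_exp[of L] power_mono[of 2 p L] p_gt_2 by linarith
  \<comment> \<open>\<open>big.\<pi> ^ (big.P + big.P)\<close> is divisible by \<open>p\<close>, and
    each factor \<open>big.\<pi>\<close> costs \<open>card F\<close> letters.\<close>
  define K where "K = card F * ((big.P + big.P) * L) + 1"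
  have "g = un n" if k: "k \<ge> K" and g: "g \<in> \<Gamma> k" for k g
  proof -
    have gG: "g \<in> G1" "g \<in> \<G>" and gJ: "JP k (g - un n)" using g by (auto simp: \<Gamma>_def MM_def G1_G)
    have k0: "k > 0" using k by (simp add: K_def)
    have kK: "(big.P + big.P) * L \<le> k div card F"
      using k card_F div_le_mono[of "card F * ((big.P + big.P) * L)" k "card F"] by (simp add: K_def)
    have piL: "big.\<pi> ^ (k div card F) \<in> zideal N (of_nat p ^ L)"
    proof -
      have "(big.\<pi> ^ (big.P + big.P)) ^ L \<in> zideal N (of_nat p ^ L)"
        by (rule big.zideal_power[OF big.pi_power_P])
      then have "big.\<pi> ^ ((big.P + big.P) * L) * big.\<pi> ^ (k div card F - (big.P + big.P) * L) \<in> zideal N (of_nat p ^ L)"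
        unfolding power_mult by (intro big.zideal_closed(5)) auto
      then show ?thesis using kK by (simp flip: power_add)
    qed
    have z0: "tr ((g - un n) * e) = 0" if e: "e \<in> E" for e
    proof -
      define z where "z = tr ((g - un n) * e)"
      have z: "z = tr (g * e) - tr e" using e gG by (simp add: z_def left_diff_distrib)
      have ge: "g * e \<in> \<G>" "e \<in> \<G>" using gG e by auto
      have z_in: "z \<in> ON" unfolding z using ge by (intro big.zint_closed tr_in)
      have "JP k ((g - un n) * e)" using gJ k0 e by (intro JP_right RS_G1 G1_E)
      then have "of_nat (d ^ k) * z \<in> zideal N (big.\<pi> ^ (k div card F))" unfolding z_def using k0 by (rule JP_trace)
      then have "of_nat (d ^ k) * z \<in> zideal N (of_nat p ^ L)" using big.zideal_mono[OF piL] by blast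
      moreover have "coprime (d ^ k) p" using d by simp
      ultimately have "z \<in> zideal N (of_nat p ^ L)" using big.cancel_coprime_power[OF _ z_in] by blast
      then obtain u where u: "u \<in> ON" "z = of_nat p ^ L * u" unfolding zideal_def by blast
      have "cmod (big.\<sigma> k u) < 1" if k: "coprime k N" for k
      proof -
        have "big.\<sigma> k z = big.\<sigma> k (of_nat (p ^ L) * u)" by (simp add: u)
        also have "\<dots> = big.\<sigma> k (of_nat (p ^ L)) * big.\<sigma> k u"
          by (rule big.sigma_mult[OF k big.zint_intros(4) u(1)])
        also have "\<dots> = of_nat (p ^ L) * big.\<sigma> k u" by (simp only: big.sigma_simps(3)[OF k])
        finally have "real (p ^ L) * cmod (big.\<sigma> k u) = cmod (big.\<sigma> k z)" by (simp add: norm_mult norm_power)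
        also have "big.\<sigma> k z = big.\<sigma> k (tr (g * e)) - big.\<sigma> k (tr e)"
          unfolding z using ge by (intro big.sigma_diff[OF k] tr_in)
        also have "cmod \<dots> \<le> of_nat n + of_nat n"
          using norm_triangle_ineq4 sigma_tr_bound[OF ge(1) k] sigma_tr_bound[OF ge(2) k] by (rule order_trans[OF _ add_mono])
        also have "\<dots> < real (p ^ L)" using pL by (metis of_nat_add of_nat_less_iff mult_2)
        finally have "real (p ^ L) * cmod (big.\<sigma> k u) < real (p ^ L) * 1" by simp
        then show ?thesis using p_pos by (simp add: mult_less_cancel_left)
      qed
      then have "u = 0" using u(1) by (intro big.zint_small_conjugates_zero)
      then show ?thesis using u z_def by simp
    qed
    have "sc (of_nat (card E) / of_nat n) (g - un n) = 0"
      using fourier[of "g - un n"] gG z0 by (simp add: E_adj)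
    then have "g - un n = 0" using card_pos n_pos by (simp add: sc_eq_0_iff)
    then show ?thesis by simp
  qed
  then show ?thesis using that by blast
qed

lemma nonscalar_E: obtains e where "e \<in> E" "\<not> scalar e"
proof (rule ccontr)
  assume "\<not> thesis"
  then have "E \<subseteq> (\<lambda>c. sc c (un n)) ` {c. c ^ p = 1}"
    using that scalar_E unfolding scalar_def by blast
  then have "card E \<le> card {c :: complex. c ^ p = 1}"
    using finite_roots_unity[of p] p_pos by (intro surj_card_le) auto
  then have "p * n ^ 2 \<le> p" using card_E card_roots_unity_eq[of p] p_pos by simp
  moreover have "n > 1" unfolding n_eq using p_gt_2 m_pos by (intro one_less_power) auto
  then have "n ^ 2 > 1" by (intro one_less_power) auto
  ultimately show False using p_pos by simp
qed

text \<open>Take a nonscalar element in the last layer that has one; its commutators with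
  \<open>MM\<close> lie one layer deeper.\<close>

lemma central_element:
  obtains z where "z \<in> MM" "\<not> scalar z" "\<And>y. y \<in> MM \<Longrightarrow> scalar (z * y * iv z * iv y)"
proof -
  obtain K where K: "\<And>k g. k \<ge> K \<Longrightarrow> g \<in> \<Gamma> k \<Longrightarrow> g = un n" using \<Gamma>_trivial by blast
  define S where "S = {k. k > 0 \<and> (\<exists>z\<in>\<Gamma> k. \<not> scalar z)}"
  have sun: "scalar (un n)" by (auto simp: scalar_def intro!: exI[of _ 1])
  have "k < K" if "k \<in> S" for k
  proof (rule ccontr)
    assume "\<not> k < K"
    moreover obtain z where "z \<in> \<Gamma> k" "\<not> scalar z" using \<open>k \<in> S\<close> unfolding S_def by blast
    ultimately show False using K[of k z] sun by simp
  qed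
  then have "finite S" by (meson finite_nat_iff_bounded lessThan_iff subsetI)
  moreover have "1 \<in> S"
  proof -
    obtain e where e: "e \<in> E" "\<not> scalar e" using nonscalar_E .
    then have "e \<in> \<Gamma> 1" by (intro MM_\<Gamma> E_MM)
    then show ?thesis using e(2) unfolding S_def by blast
  qed
  ultimately have Max: "Max S \<in> S" "\<And>k. k \<in> S \<Longrightarrow> k \<le> Max S" using Max_in by (blast, auto)
  then obtain z where z: "z \<in> \<Gamma> (Max S)" "\<not> scalar z" "Max S > 0" by (auto simp: S_def)
  have "scalar (z * y * iv z * iv y)" if "y \<in> MM" for y
  proof (rule ccontr)
    assume "\<not> ?thesis"
    then have "Max S + 1 \<in> S" using commutator_\<Gamma>[OF z(1,3) that] by (auto simp: S_def)
    then show False using Max(2) by force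
  qed
  then show ?thesis using that z by (auto simp: \<Gamma>_def)
qed

text \<open>Take \<open>e0\<close> with nonzero coefficient in the Fourier expansion of
  \<open>z\<close>. Then \<open>z * adj e0\<close> commutes with each \<open>e\<close> up to a
  factor, and its nonzero trace forces that factor to be 1.\<close>

lemma eigen_E:
  assumes z: "z \<in> \<G>" and h: "\<And>e. e \<in> E \<Longrightarrow> \<exists>c. z * e * iv z = sc c e"
  obtains \<mu> e0 where "e0 \<in> E" "z = sc \<mu> e0"
proof -
  have "\<exists>e\<in>E. tr (z * adj e) \<noteq> 0"
  proof (rule ccontr)
    assume "\<not> ?thesis"
    then have "sc (of_nat (card E) / of_nat n) z = 0" using fourier[of z] z by simp
    then have "z = 0" using card_pos n_pos by (simp add: sc_eq_0_iff)
    then show False using iv_simps(1)[OF z] un_neq_0[OF n_pos] by simp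
  qed
  then obtain e0 where e0: "e0 \<in> E" "tr (z * adj e0) \<noteq> 0" by blast
  define w where "w = z * adj e0"
  have sw: "supp n w" using z e0 by (auto simp: w_def)
  have "w * e = e * w" if e: "e \<in> E" for e
  proof -
    obtain c where c: "z * e * iv z = sc c e" using h[OF e] by blast
    have "z * e = z * e * iv z * z" using z e by (simp add: mult.assoc)
    then have ze: "z * e = sc c (e * z)" unfolding c by simp
    obtain c2 where c2: "adj e0 * e = sc c2 (e * adj e0)" using E_comm[OF E_adj[OF e0(1)] e] by blast
    have "w * e = z * (adj e0 * e)" by (simp add: w_def mult.assoc)
    also have "\<dots> = sc c2 (z * e * adj e0)" by (simp add: c2 mult.assoc)
    also have "\<dots> = sc (c2 * c) (e * w)" unfolding ze by (simp add: w_def mult.assoc)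
    finally have we: "w * e = sc (c2 * c) (e * w)" .
    have "tr (w * e * adj e) = c2 * c * tr (e * w * adj e)" unfolding we by simp
    moreover have "tr (e * w * adj e) = tr (w * (adj e * e))"
      using tr_comm[of e "w * adj e"] by (simp add: mult.assoc)
    ultimately have "tr w = c2 * c * tr w" using e sw by (simp add: mult.assoc)
    then have "c2 * c = 1" using e0(2) by (simp add: w_def)
    then show ?thesis using we by simp
  qed
  then obtain \<mu> where "w = sc \<mu> (un n)" using E_irr[OF sw] by blast
  moreover have "w * e0 = z" using z e0 by (simp add: w_def mult.assoc)
  ultimately have "z = sc \<mu> e0" using e0 by auto
  then show ?thesis using that e0 by blast
qed

text \<open>Matrices that conjugation by \<open>MM\<close> only rescales. The property is
  multiplicative and stable under conjugation by \<G>, so chirps can spread it over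
  \<open>E\<close>.\<close>

definition CC :: "cmat \<Rightarrow> bool" where "CC X \<longleftrightarrow> supp n X \<and> (\<forall>y\<in>MM. \<exists>c. y * X * iv y = sc c X)"

lemma CC_mult: assumes "CC X" "CC Y" shows "CC (X * Y)"
  unfolding CC_def
proof (intro conjI ballI)
  show "supp n (X * Y)" using assms by (auto simp: CC_def)
  fix y assume y: "y \<in> MM"
  then have yG: "y \<in> \<G>" by (rule MM_G)
  obtain c c' where "y * X * iv y = sc c X" "y * Y * iv y = sc c' Y" using assms y unfolding CC_def by blast
  moreover have "y * (X * Y) * iv y = (y * X * iv y) * (y * Y * iv y)"
    using assms yG by (simp add: CC_def mult.assoc supp_times)
  ultimately have "y * (X * Y) * iv y = sc (c * c') (X * Y)" by (simp add: mult.commute)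
  then show "\<exists>c. y * (X * Y) * iv y = sc c (X * Y)" by blast
qed

lemma CC_un: "CC (un n)"
  unfolding CC_def using MM_G by (auto intro!: exI[of _ 1])

lemma CC_mpow: "CC X \<Longrightarrow> CC (mpow n X k)"
  by (induction k) (auto intro: CC_mult CC_un)

lemma CC_sc: assumes "CC (sc c X)" "c \<noteq> 0" "supp n X" shows "CC X"
  unfolding CC_def
proof (intro conjI ballI)
  fix y assume "y \<in> MM"
  then obtain c' where "y * sc c X * iv y = sc c' (sc c X)" using assms unfolding CC_def by blast
  then have "sc c (y * X * iv y) = sc c (sc c' X)" by (simp add: mult.commute)
  then show "\<exists>c. y * X * iv y = sc c X" using sc_cancel[OF _ assms(2)] by blast
qed (rule assms)

lemma adj_power: "e \<in> E \<Longrightarrow> adj e = mpow n e (p - 1)"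
proof -
  assume e: "e \<in> E"
  have "e * mpow n e (p - 1) = un n" using E_pow[OF e] p_pos by (cases p) auto
  then have "adj e * (e * mpow n e (p - 1)) = adj e" using e by simp
  then show "adj e = mpow n e (p - 1)" using e by (simp flip: mult.assoc)
qed

lemma CC_conj: assumes a: "a \<in> \<G>" and X: "CC X" shows "CC (a * X * iv a)"
  unfolding CC_def
proof (intro conjI ballI)
  have sX: "supp n X" using X by (simp add: CC_def)
  show "supp n (a * X * iv a)" using a sX by (auto intro!: supp_times)
  fix y assume y: "y \<in> MM"
  then have yG: "y \<in> \<G>" by (rule MM_G)
  define y' where "y' = iv a * y * a"
  have y': "y' \<in> MM" using MM_conj[of "iv a" y] a y by (simp add: y'_def iv_iv)
  have iy': "iv y' = iv a * iv y * a"
    using a yG by (simp add: y'_def iv_mult iv_iv G_mult mult.assoc)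
  obtain c where c: "y' * X * iv y' = sc c X" using X y' unfolding CC_def by blast
  have "y * (a * X * iv a) * iv y = a * (y' * X * iv y') * iv a"
    unfolding iy' unfolding y'_def using a yG sX by (simp add: mult.assoc supp_times)
  then show "\<exists>c. y * (a * X * iv a) * iv y = sc c (a * X * iv a)" unfolding c by auto
qed

text \<open>Conjugating by the chirp of a non-commuting \<open>f\<close> multiplies \<open>e\<close> by a power
  of \<open>f\<close>.\<close>

lemma CC_noncommuting:
  assumes e: "e \<in> E" "CC e" and f: "f \<in> E" and ne: "e * f \<noteq> f * e"
  shows "CC f"
proof -
  obtain r where r: "r < p" "e * f = sc (zeta p ^ r) (f * e)" using commutator_power[OF f e(1)] .
  have "r > 0" using r ne by (cases r) auto
  define a where "a = fc f chi"
  have aG: "a \<in> \<G>" using chirp_G[OF f] by (simp add: a_def)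
  have iva: "iv a = fc f (\<lambda>i. cnj (chi i))"
    using normzD[OF normz_chirp[OF f]] aG by (intro iv_unique[symmetric]) (auto simp: a_def)
  define c where "c = cnj (chi r)"
  define k where "k = (p - 1) * r"
  have "a * e * iv a = sc c (mpow n f k * e)"
    unfolding iva unfolding a_def c_def k_def using chirp_conj[OF f e(1) r(2)] by simp
  then have "CC (sc c (mpow n f k * e))" using CC_conj[OF aG e(2)] by simp
  moreover have "c \<noteq> 0" using chi_pow(2)[of r] p_pos by (auto simp: c_def power_0_left)
  moreover have "supp n (mpow n f k * e)" using f e by simp
  ultimately have "CC (mpow n f k * e)" by (rule CC_sc)
  moreover have "CC (adj e)" unfolding adj_power[OF e(1)] using e by (intro CC_mpow)
  ultimately have "CC (mpow n f k * e * adj e)" by (rule CC_mult)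
  then have fk: "CC (mpow n f k)" using f e by (simp add: mult.assoc)
  \<comment> \<open>\<open>f\<close> is therefore a power of \<open>mpow n f k\<close>.\<close>
  have "coprime k p"
    unfolding k_def using coprime_less_p[of r] coprime_less_p[of "p - 1"] r(1) \<open>r > 0\<close> p_gt_2 by simp
  from cong_solve_coprime_nat[OF this] obtain j where "[k * j = Suc 0] (mod p)" by blast
  then have "(k * j) mod p = 1" using p_gt_2 by (simp add: cong_def)
  then have kj: "k * j = p * (k * j div p) + 1" by (metis mult_div_mod_eq)
  have "mpow n f (k * j) = mpow n f (p * (k * j div p)) * mpow n f 1"
    by (subst kj) (rule mpow_add[OF E_supp[OF f]])
  also have "\<dots> = f" using f by (simp add: mpow_mult E_pow)
  finally have "mpow n f (k * j) = f" .
  moreover have "mpow n f (k * j) = mpow n (mpow n f k) j" using f by (intro mpow_mult) auto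
  ultimately show ?thesis using CC_mpow[OF fk, of j] by simp
qed

text \<open>The element of \<open>central_element\<close> is a multiple of a nonscalar
  \<open>e0\<close> in \<open>E\<close>, which inherits its property. Elements not commuting with
  \<open>e0\<close> follow by \<open>CC_noncommuting\<close>; an \<open>f\<close> commuting with it
  is a quotient of two that do not, \<open>g * f\<close> and \<open>g\<close>.\<close>

lemma CC_E: assumes f: "f \<in> E" shows "CC f"
proof -
  obtain z where z: "z \<in> MM" "\<not> scalar z" "\<And>y. y \<in> MM \<Longrightarrow> scalar (z * y * iv z * iv y)"
    using central_element by blast
  have zG: "z \<in> \<G>" using z by (simp add: MM_G)
  have zy: "\<exists>c. z * y * iv z = sc c y" if y: "y \<in> MM" for y
  proof -
    obtain c where "z * y * iv z * iv y = sc c (un n)" using z(3)[OF y] by (auto simp: scalar_def)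
    then have "z * y * iv z * iv y * y = sc c y" using MM_G[OF y] by simp
    then show ?thesis using zG MM_G[OF y] by (auto simp: mult.assoc)
  qed
  obtain \<mu> e0 where e0: "e0 \<in> E" "z = sc \<mu> e0" using eigen_E[OF zG zy[OF E_MM]] by blast
  have \<mu>: "\<mu> \<noteq> 0"
  proof
    assume "\<mu> = 0"
    then have "z = sc 0 (un n)" using e0 by simp
    then show False using z(2) unfolding scalar_def by blast
  qed
  have Cz: "CC z" unfolding CC_def
  proof (intro conjI ballI)
    fix y assume y: "y \<in> MM"
    have yG: "y \<in> \<G>" using y by (rule MM_G)
    obtain c where c: "z * y * iv z = sc c y" using zy[OF y] by blast
    have c0: "c \<noteq> 0"
    proof
      assume "c = 0"
      then have "iv z * (z * y * iv z) * z = 0" using c by simp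
      moreover have "iv z * (z * y * iv z) * z = y" using zG yG by (simp add: mult.assoc)
      ultimately show False using iv_simps(1)[OF yG] un_neq_0[OF n_pos] by simp
    qed
    have "z * y = z * y * iv z * z" using zG yG by (simp add: mult.assoc)
    then have "z * y = sc c (y * z)" unfolding c by simp
    then have "y * z = sc (inverse c) (z * y)" using c0 by simp
    then have "y * z * iv y = sc (inverse c) z" using zG yG by (simp add: mult.assoc)
    then show "\<exists>c. y * z * iv y = sc c z" by blast
  qed (use zG in auto)
  have C0: "CC e0" using CC_sc[of \<mu> e0] Cz e0 \<mu> by auto
  have ns: "\<not> scalar e0" using z(2) e0(2) by (auto simp: scalar_def)
  show ?thesis
  proof (cases "e0 * f = f * e0")
    case False
    then show ?thesis by (rule CC_noncommuting[OF e0(1) C0 f])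
  next
    case True
    obtain g where g: "g \<in> E" "e0 * g \<noteq> g * e0"
      using E_irr[OF E_supp[OF e0(1)]] ns unfolding scalar_def by blast
    have "e0 * (g * f) \<noteq> g * f * e0"
    proof
      assume "e0 * (g * f) = g * f * e0"
      then have "e0 * g * f * adj f = g * e0 * f * adj f" by (simp add: mult.assoc True)
      then have "e0 * g = g * e0" using f g e0 by (simp add: mult.assoc)
      then show False using g by simp
    qed
    then have "CC (g * f)" using CC_noncommuting[OF e0(1) C0] g f by blast
    moreover have "CC (adj g)" unfolding adj_power[OF g(1)]
      by (intro CC_mpow CC_noncommuting[OF e0(1) C0 g])
    ultimately have "CC (adj g * (g * f))" by (metis CC_mult)
    then show ?thesis using f g by (simp flip: mult.assoc)
  qed
qed

text \<open>The conjugate \<open>y\<close> lies in \<open>MM\<close>, so by \<open>CC_E\<close> it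
  commutes with \<open>E\<close> up to scalars and is a multiple of an element of \<open>E\<close>.
  Since \<open>mpow n y p\<close> is the identity, the multiplier is a \<open>p\<close>-th root of
  unity, and \<open>E\<close> contains those scalars.\<close>

theorem G_normalizes_E:
  assumes x: "x \<in> \<G>" and e: "e \<in> E"
  shows "x * e * iv x \<in> E"
proof -
  define y where "y = x * e * iv x"
  have y: "y \<in> MM" "y \<in> \<G>" using MM_conj[OF x E_MM[OF e]] x e by (auto simp: y_def)
  have "\<exists>c. y * f * iv y = sc c f" if "f \<in> E" for f using CC_E[OF that] y unfolding CC_def by blast
  then obtain \<mu> e1 where e1: "e1 \<in> E" "y = sc \<mu> e1" using eigen_E[OF y(2)] by blast
  have "mpow n y p = un n"
    unfolding y_def using x e by (simp add: mpow_conj E_pow)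
  then have "sc (\<mu> ^ p) (un n) = sc 1 (un n)" unfolding e1(2) using e1(1) by (simp add: mpow_sc E_pow)
  then have "\<mu> ^ p = 1" using sc_un_eq_iff[OF n_pos] by blast
  then show ?thesis using e1 E_sc by (simp add: y_def)
qed

end

section \<open>Tensor products of irreducible groups\<close>

definition cm :: "nat \<Rightarrow> (nat \<Rightarrow> nat \<Rightarrow> complex) \<Rightarrow> cmat" where
  "cm n f = Cmat (\<lambda>i j. if i < n \<and> j < n then f i j else 0)"

lemma ent_cm [simp]: "ent (cm n f) i j = (if i < n \<and> j < n then f i j else 0)"
proof -
  have "(\<lambda>i j. if i < n \<and> j < n then f i j else 0) \<in> {A. \<exists>n. \<forall>i j. n \<le> i \<or> n \<le> j \<longrightarrow> A i j = (0 :: complex)}"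
    by (auto intro!: exI[of _ n])
  then show ?thesis by (simp add: cm_def Cmat_inverse)
qed

lemma supp_cm [simp, intro]: "supp n (cm n f)"
  by (simp add: supp_def)

lemma cm_eqI:
  assumes "supp n A" "supp n B" "\<And>i j. i < n \<Longrightarrow> j < n \<Longrightarrow> ent A i j = ent B i j"
  shows "A = B"
proof (rule cmat_eqI)
  fix i j
  show "ent A i j = ent B i j"
    using assms by (cases "i < n \<and> j < n") (auto simp: supp_def not_less)
qed

definition mu :: "nat \<Rightarrow> nat \<Rightarrow> nat \<Rightarrow> cmat" where
  "mu n a b = cm n (\<lambda>i j. if i = a \<and> j = b then 1 else 0)"

lemma supp_mu [simp, intro]: "supp n (mu n a b)" by (simp add: mu_def)

lemma commutes_units_scalar:
  assumes M: "supp n M" and n: "n > 0" and c: "\<And>a b. a < n \<Longrightarrow> b < n \<Longrightarrow> M * mu n a b = mu n a b * M"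
  shows "M = sc (ent M 0 0) (un n)"
proof -
  have *: "ent M i a = (if i = a then ent M b b else 0)" if "i < n" "a < n" "b < n" for i a b
  proof -
    have "ent (M * mu n a b) i b = (\<Sum>t<n. if t = a then ent M i a else 0)"
      unfolding ent_times[OF M] using that by (intro sum.cong) (auto simp: mu_def)
    moreover have "ent (mu n a b * M) i b = (\<Sum>t<n. if t = b then (if i = a then ent M b b else 0) else 0)"
      unfolding ent_times[OF supp_mu] using that by (intro sum.cong) (auto simp: mu_def)
    ultimately show ?thesis using c[OF that(2,3)] that by simp
  qed
  show ?thesis
  proof (rule cm_eqI[OF M])
    show "ent M i j = ent (sc (ent M 0 0) (un n)) i j" if "i < n" "j < n" for i j
      using *[OF that n] that by simp
  qed simp
qed

lemma kr_mu:
  assumes "k > 0" "a < n" "b < n" "i < k" "j < k"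
  shows "kr k (mu n a b) (mu k i j) = mu (n * k) (a * k + i) (b * k + j)"
proof (rule cm_eqI[of "n * k"])
  fix u v assume uv: "u < n * k" "v < n * k"
  have iff: "u = a * k + i \<longleftrightarrow> u div k = a \<and> u mod k = i" if "i < k" for u a i
    using that by (auto simp: mult.commute)
  have "u div k < n" "v div k < n" "u mod k < k" "v mod k < k"
    using uv assms(1) by (auto simp: less_mult_imp_div_less)
  then show "ent (kr k (mu n a b) (mu k i j)) u v = ent (mu (n * k) (a * k + i) (b * k + j)) u v"
    using uv assms by (simp add: ent_kr mu_def iff)
qed (use assms in \<open>auto intro: supp_kr\<close>)

lemma kr_one: "supp n A \<Longrightarrow> kr 1 A (un 1) = A"
  by (rule cmat_eqI) (simp add: ent_kr)

definition krs :: "nat \<Rightarrow> cmat set \<Rightarrow> cmat set \<Rightarrow> cmat set" where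
  "krs k E1 E2 = (\<lambda>(A, B). kr k A B) ` (E1 \<times> E2)"

lemma krsI: "A \<in> E1 \<Longrightarrow> B \<in> E2 \<Longrightarrow> kr k A B \<in> krs k E1 E2"
  by (auto simp: krs_def)

lemma krsE: assumes "x \<in> krs k E1 E2" obtains A B where "A \<in> E1" "B \<in> E2" "x = kr k A B"
  using assms by (auto simp: krs_def)

text \<open>The point is irreducibility: by \<open>fourier\<close> both factors span their full
  matrix algebras, so \<open>M\<close> commutes with all Kronecker products of matrices, in
  particular with the matrix units.\<close>

lemma heis_kr:
  assumes "heis p n1 m1 E1" "heis p k m E"
  shows "heis p (n1 * k) (m1 + m) (krs k E1 E)"
proof -
  interpret h1: heis p n1 m1 E1 by fact
  interpret h: heis p k m E by fact
  note k = h.n_pos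
  have kr_eq: "kr k A B * kr k C D = kr k (A * C) (B * D)" if "B \<in> E" for A B C D
    using k that by (intro kr_mult) auto
  show ?thesis
  proof unfold_locales
    show "n1 * k = p ^ (m1 + m)" by (simp add: h1.n_eq h.n_eq power_add)
    show "un (n1 * k) \<in> krs k E1 E" using krsI[OF h1.E_un h.E_un, of k] kr_un[OF k] by simp
    show "finite (krs k E1 E)" unfolding krs_def using h1.E_fin h.E_fin by simp
    fix e assume "e \<in> krs k E1 E"
    then obtain A B where e: "A \<in> E1" "B \<in> E" "e = kr k A B" by (rule krsE)
    show "supp (n1 * k) e" using e k by (auto intro: supp_kr)
    show "adj e \<in> krs k E1 E" using e k by (auto simp: kr_simps intro!: krsI)
    show "e * adj e = un (n1 * k)" "adj e * e = un (n1 * k)"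
      using e k by (auto simp: kr_simps kr_eq h.E_adj kr_un)
    show "mpow (n1 * k) e p = un (n1 * k)"
      using e k by (simp add: mpow_kr h1.E_pow h.E_pow kr_un)
    show "ent e i j \<in> zint p" for i j
      using e k h1.E_int h.E_int h1.zint_closed by (simp add: ent_kr)
    fix f assume "f \<in> krs k E1 E"
    then obtain C D where f: "C \<in> E1" "D \<in> E" "f = kr k C D" by (rule krsE)
    show "e * f \<in> krs k E1 E" using e f by (auto simp: kr_eq intro!: krsI)
    obtain c where c: "c ^ p = 1" "A * C = sc c (C * A)" using h1.E_comm[OF e(1) f(1)] by blast
    obtain c' where c': "c' ^ p = 1" "B * D = sc c' (D * B)" using h.E_comm[OF e(2) f(2)] by blast
    have "(c' * c) ^ p = 1" using c c' by (simp add: power_mult_distrib)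
    moreover have "e * f = sc (c' * c) (f * e)" using e f k by (simp add: kr_eq kr_simps c c')
    ultimately show "\<exists>c. c ^ p = 1 \<and> e * f = sc c (f * e)" by blast
  next
    fix c :: complex assume "c ^ p = 1"
    then show "sc c (un (n1 * k)) \<in> krs k E1 E"
      using krsI[OF h1.E_scal h.E_un, of c k] k by (simp add: kr_simps kr_un)
  next
    fix M assume M: "supp (n1 * k) M" and comm: "\<And>e. e \<in> krs k E1 E \<Longrightarrow> M * e = e * M"
    have X: "M * kr k X Y = kr k X Y * M" if s: "supp n1 X" "supp k Y" for X Y
    proof -
      define c1 c2 where "c1 = (of_nat (card E1) / of_nat n1 :: complex)" and "c2 = (of_nat (card E) / of_nat k :: complex)"
      have c: "c2 * c1 \<noteq> 0" using h1.card_pos h.card_pos h1.n_pos k by (simp add: c1_def c2_def)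
      have "sc (c2 * c1) (kr k X Y) = kr k (sc c1 X) (sc c2 Y)" using k by (simp add: kr_simps)
      also have "\<dots> = (\<Sum>A\<in>E1. kr k (sc (tr (X * adj A)) A) (\<Sum>B\<in>E. sc (tr (Y * adj B)) B))"
        unfolding c1_def c2_def h1.fourier[OF s(1), symmetric] h.fourier[OF s(2), symmetric]
        by (rule kr_sum(1)[OF k])
      also have "\<dots> = (\<Sum>A\<in>E1. \<Sum>B\<in>E. sc (tr (Y * adj B) * tr (X * adj A)) (kr k A B))"
        by (simp add: kr_sum(2)[OF k] kr_simps[OF k] mult.commute)
      finally have 1: "sc (c2 * c1) (kr k X Y) = (\<Sum>A\<in>E1. \<Sum>B\<in>E. sc (tr (Y * adj B) * tr (X * adj A)) (kr k A B))" .
      have "M * sc (c2 * c1) (kr k X Y) = sc (c2 * c1) (kr k X Y) * M"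
        unfolding 1 sum_distrib_left sum_distrib_right
        by (intro sum.cong refl) (simp add: comm krsI)
      then have "sc (c2 * c1) (M * kr k X Y) = sc (c2 * c1) (kr k X Y * M)" by simp
      then show ?thesis using c by (rule sc_cancel)
    qed
    have "M * mu (n1 * k) a b = mu (n1 * k) a b * M" if ab: "a < n1 * k" "b < n1 * k" for a b
    proof -
      have "mu (n1 * k) a b = kr k (mu n1 (a div k) (b div k)) (mu k (a mod k) (b mod k))"
        using ab k by (subst kr_mu) (auto simp: less_mult_imp_div_less)
      then show ?thesis using X by auto
    qed
    then have "M = sc (ent M 0 0) (un (n1 * k))"
      using h1.n_pos k by (intro commutes_units_scalar[OF M]) auto
    then show "\<exists>c. M = sc c (un (n1 * k))" by blast
  qed
qed

text \<open>The data from which the group-theoretic argument starts, in a form that passes to tensor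
  products: the parity involution, the admissible matrices, and the resolutions of the identity
  by rank one idempotents.\<close>

definition parity :: "nat \<Rightarrow> nat \<Rightarrow> cmat set \<Rightarrow> cmat \<Rightarrow> bool" where
  "parity p n E t \<longleftrightarrow> supp n t \<and> t * t = un n \<and> tr t = 1 \<and> (\<forall>e\<in>E. \<exists>c. c ^ p = 1 \<and> t * e * t = sc c (adj e))"

definition nrm :: "nat \<Rightarrow> cmat set \<Rightarrow> nat \<Rightarrow> cmat \<Rightarrow> cmat \<Rightarrow> bool" where
  "nrm n E M y y' \<longleftrightarrow> supp n y \<and> supp n y' \<and> y * y' = un n \<and> y' * y = un n \<and>
     (\<forall>e\<in>E. y * e * y' \<in> E) \<and> mpow n y M = un n"

text \<open>The ring \<open>R\<close>, the exponent \<open>M\<close> and, in \<open>idem\<close>,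
  the coefficient condition \<open>B\<close> are parameters: later \<open>R\<close> is
  \<open>RR\<close> and \<open>B\<close> is \<open>frob_fixed\<close>, which live with \<G>, while
  the passage to tensor products does not involve \<G>.\<close>

definition adm :: "nat \<Rightarrow> cmat set \<Rightarrow> complex set \<Rightarrow> nat \<Rightarrow> cmat \<Rightarrow> cmat \<Rightarrow> bool" where
  "adm n E R M y y' \<longleftrightarrow> nrm n E M y y' \<and> (\<exists>c>0. \<forall>i j. of_nat c * ent y i j \<in> R)"

definition idem :: "nat \<Rightarrow> cmat set \<Rightarrow> complex set \<Rightarrow> nat \<Rightarrow> (complex \<Rightarrow> bool) \<Rightarrow> nat \<Rightarrow> cmat \<Rightarrow> bool" where
  "idem n E R M B d \<epsilon> \<longleftrightarrow> supp n \<epsilon> \<and> rank1 \<epsilon> \<and> tr \<epsilon> = 1 \<and>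
     (\<exists>h h'. nrm n E M h h' \<and> combo B (adm n E R M) (sc (of_nat d) \<epsilon>) (sc (of_nat d) (h * \<epsilon> * h')))"

definition resolvable :: "nat \<Rightarrow> cmat set \<Rightarrow> complex set \<Rightarrow> nat \<Rightarrow> (complex \<Rightarrow> bool) \<Rightarrow> nat \<Rightarrow> bool" where
  "resolvable n E R M B d \<longleftrightarrow>
     (\<exists>(K :: nat) \<epsilon>. (\<Sum>j<K. \<epsilon> j) = un n \<and> (\<forall>j<K. idem n E R M B d (\<epsilon> j)))"

lemma parity_kr:
  assumes k: "k > 0" and E: "\<And>B. B \<in> E \<Longrightarrow> supp k B"
    and t1: "parity p n E1 t1" and t: "parity p k E t"
  shows "parity p (n * k) (krs k E1 E) (kr k t1 t)"
  unfolding parity_def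
proof (intro conjI ballI)
  have s: "supp n t1" "supp k t" using t1 t by (auto simp: parity_def)
  show "supp (n * k) (kr k t1 t)" using k s by (rule supp_kr)
  show "kr k t1 t * kr k t1 t = un (n * k)" using k s t1 t by (simp add: kr_mult parity_def kr_un)
  show "tr (kr k t1 t) = 1" using k s t1 t by (simp add: tr_kr parity_def)
  fix e assume "e \<in> krs k E1 E"
  then obtain A B where e: "A \<in> E1" "B \<in> E" "e = kr k A B" by (rule krsE)
  obtain c where c: "c ^ p = 1" "t1 * A * t1 = sc c (adj A)" using t1 e unfolding parity_def by blast
  obtain c' where c': "c' ^ p = 1" "t * B * t = sc c' (adj B)" using t e unfolding parity_def by blast
  have "(c' * c) ^ p = 1" using c c' by (simp add: power_mult_distrib)
  moreover have "kr k t1 t * e * kr k t1 t = sc (c' * c) (adj e)"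
    using e k s E by (simp add: kr_mult supp_times kr_simps c c')
  ultimately show "\<exists>c. c ^ p = 1 \<and> kr k t1 t * e * kr k t1 t = sc c (adj e)" by blast
qed

lemma nrm_kr:
  assumes k: "k > 0" and E: "\<And>B. B \<in> E \<Longrightarrow> supp k B" and y: "nrm n E1 M y y'" and z: "nrm k E M z z'"
  shows "nrm (n * k) (krs k E1 E) M (kr k y z) (kr k y' z')"
  unfolding nrm_def
proof (intro conjI ballI)
  have s: "supp n y" "supp n y'" "supp k z" "supp k z'" using y z by (auto simp: nrm_def)
  show "supp (n * k) (kr k y z)" "supp (n * k) (kr k y' z')" using k s by (auto intro: supp_kr)
  show "kr k y z * kr k y' z' = un (n * k)" "kr k y' z' * kr k y z = un (n * k)"
    using k s y z by (simp_all add: kr_mult nrm_def kr_un)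
  show "mpow (n * k) (kr k y z) M = un (n * k)" using k s y z by (simp add: mpow_kr nrm_def kr_un)
  fix e assume "e \<in> krs k E1 E"
  then obtain A B where e: "A \<in> E1" "B \<in> E" "e = kr k A B" by (rule krsE)
  then have "kr k y z * e * kr k y' z' = kr k (y * A * y') (z * B * z')"
    using k s E by (simp add: kr_mult supp_times)
  then show "kr k y z * e * kr k y' z' \<in> krs k E1 E" using y z e by (auto simp: nrm_def intro!: krsI)
qed

lemma adm_kr:
  assumes k: "k > 0" and E: "\<And>B. B \<in> E \<Longrightarrow> supp k B" and R: "\<And>a b. a \<in> R \<Longrightarrow> b \<in> R \<Longrightarrow> a * b \<in> R"
    and y: "adm n E1 R M y y'" and z: "adm k E R M z z'"
  shows "adm (n * k) (krs k E1 E) R M (kr k y z) (kr k y' z')"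
proof -
  obtain c where c: "c > 0" "\<And>i j. of_nat c * ent y i j \<in> R" using y by (auto simp: adm_def)
  obtain c' where c': "c' > 0" "\<And>i j. of_nat c' * ent z i j \<in> R" using z by (auto simp: adm_def)
  have "of_nat (c * c') * ent (kr k y z) i j \<in> R" for i j
    using R[OF c(2) c'(2), of "i div k" "j div k" "i mod k" "j mod k"] k by (simp add: ent_kr mult_ac)
  moreover have "c * c' > 0" using c c' by simp
  moreover have "nrm (n * k) (krs k E1 E) M (kr k y z) (kr k y' z')"
    by (rule nrm_kr[OF k E]) (use y z in \<open>simp_all add: adm_def\<close>)
  ultimately show ?thesis unfolding adm_def by blast
qed

lemma combo_plus: "combo B Y U' V' \<Longrightarrow> combo B Y U V \<Longrightarrow> combo B Y (U + U') (V + V')"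
  by (induction rule: combo.induct) (auto simp: add.assoc[symmetric] intro: combo.intros)

lemma combo_sum:
  "finite K \<Longrightarrow> (\<And>k. k \<in> K \<Longrightarrow> B (b k) \<and> Y (y k) (y' k)) \<Longrightarrow>
    combo B Y (\<Sum>k\<in>K. sc (b k) (y k)) (\<Sum>k\<in>K. sc (b k) (y' k))"
proof (induction K rule: finite_induct)
  case (insert x K)
  then show ?case using combo_add[of B Y "\<Sum>k\<in>K. sc (b k) (y k)" "\<Sum>k\<in>K. sc (b k) (y' k)" "b x" "y x" "y' x"]
    by (simp add: add.commute)
qed (simp add: combo_0)

lemma combo_kr:
  assumes k: "k > 0" and B: "\<And>a b. B a \<Longrightarrow> B b \<Longrightarrow> B (a * b)"
    and Y: "\<And>y y' z z'. Y1 y y' \<Longrightarrow> Y2 z z' \<Longrightarrow> Y (kr k y z) (kr k y' z')"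
    and U: "combo B Y1 U V" and U': "combo B Y2 U' V'"
  shows "combo B Y (kr k U U') (kr k V V')"
  using U
proof (induction rule: combo.induct)
  case combo_0
  then show ?case using k by (simp add: kr_simps combo.combo_0)
next
  case (combo_add U V b y y')
  have "combo B Y (sc b (kr k y U')) (sc b (kr k y' V'))" using U'
  proof (induction rule: combo.induct)
    case combo_0
    then show ?case using k by (simp add: kr_simps combo.combo_0)
  next
    case (combo_add U' V' b' z z')
    then show ?case
      using combo.combo_add[of B Y "sc b (kr k y U')" "sc b (kr k y' V')" "b * b'" "kr k y z" "kr k y' z'"]
        B[OF \<open>B b\<close>] Y[OF \<open>Y1 y y'\<close>] k by (simp add: kr_simps sc_add)
  qed
  then show ?case using combo_plus[of B Y _ _ "kr k U U'" "kr k V V'"] combo_add.IH k by (simp add: kr_simps)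
qed

lemma idem_kr:
  assumes k: "k > 0" and E: "\<And>B. B \<in> E \<Longrightarrow> supp k B" and R: "\<And>a b. a \<in> R \<Longrightarrow> b \<in> R \<Longrightarrow> a * b \<in> R"
    and B: "\<And>a b. B a \<Longrightarrow> B b \<Longrightarrow> B (a * b)"
    and x: "idem n E1 R M B d1 \<epsilon>" and y: "idem k E R M B d \<delta>"
  shows "idem (n * k) (krs k E1 E) R M B (d1 * d) (kr k \<epsilon> \<delta>)"
proof -
  obtain h h' where h: "nrm n E1 M h h'" "combo B (adm n E1 R M) (sc (of_nat d1) \<epsilon>) (sc (of_nat d1) (h * \<epsilon> * h'))"
    using x by (auto simp: idem_def)
  obtain g g' where g: "nrm k E M g g'" "combo B (adm k E R M) (sc (of_nat d) \<delta>) (sc (of_nat d) (g * \<delta> * g'))"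
    using y by (auto simp: idem_def)
  have s: "supp n \<epsilon>" "supp k \<delta>" "supp k g" using x y g by (auto simp: idem_def nrm_def)
  have "combo B (adm (n * k) (krs k E1 E) R M) (kr k (sc (of_nat d1) \<epsilon>) (sc (of_nat d) \<delta>))
      (kr k (sc (of_nat d1) (h * \<epsilon> * h')) (sc (of_nat d) (g * \<delta> * g')))"
  proof (rule combo_kr[OF k _ _ h(2) g(2)])
    show "B (a * b)" if "B a" "B b" for a b using B that .
    show "adm (n * k) (krs k E1 E) R M (kr k y z) (kr k y' z')"
      if "adm n E1 R M y y'" "adm k E R M z z'" for y y' z z'
      by (rule adm_kr[OF k _ _ that]) (use E R in auto)
  qed
  moreover have "kr k (h * \<epsilon> * h') (g * \<delta> * g') = kr k h g * kr k \<epsilon> \<delta> * kr k h' g'"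
    using k s by (simp add: kr_mult supp_times)
  ultimately have "combo B (adm (n * k) (krs k E1 E) R M) (sc (of_nat (d1 * d)) (kr k \<epsilon> \<delta>))
      (sc (of_nat (d1 * d)) (kr k h g * kr k \<epsilon> \<delta> * kr k h' g'))"
    using k by (simp add: kr_simps mult.commute)
  moreover have "nrm (n * k) (krs k E1 E) M (kr k h g) (kr k h' g')" using nrm_kr[OF k E h(1) g(1)] .
  moreover have "supp (n * k) (kr k \<epsilon> \<delta>)" "rank1 (kr k \<epsilon> \<delta>)" "tr (kr k \<epsilon> \<delta>) = 1"
    using k s x y by (auto simp: idem_def rank1_kr tr_kr intro: supp_kr)
  ultimately show ?thesis unfolding idem_def by blast
qed

lemma resolution_kr:
  fixes R :: "complex set" and B :: "complex \<Rightarrow> bool" and E1 E :: "cmat set" and n k M d1 d :: nat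
  assumes k: "k > 0" and E: "\<And>B. B \<in> E \<Longrightarrow> supp k B" and R: "\<And>a b. a \<in> R \<Longrightarrow> b \<in> R \<Longrightarrow> a * b \<in> R"
    and B: "\<And>a b. B a \<Longrightarrow> B b \<Longrightarrow> B (a * b)"
    and x: "resolvable n E1 R M B d1" and y: "resolvable k E R M B d"
  shows "resolvable (n * k) (krs k E1 E) R M B (d1 * d)"
proof -
  obtain K :: nat and \<epsilon> where K: "(\<Sum>j<K. \<epsilon> j) = un n" "\<And>j. j < K \<Longrightarrow> idem n E1 R M B d1 (\<epsilon> j)"
    using x unfolding resolvable_def by blast
  obtain L :: nat and \<delta> where L: "(\<Sum>j<L. \<delta> j) = un k" "\<And>j. j < L \<Longrightarrow> idem k E R M B d (\<delta> j)"
    using y unfolding resolvable_def by blast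
  have L0: "L > 0" using L(1) un_neq_0[OF k] by (cases L) auto
  have "(\<Sum>j<K * L. kr k (\<epsilon> (j div L)) (\<delta> (j mod L))) = un (n * k)"
  proof (rule cmat_eqI)
    fix i j
    have "ent (\<Sum>j<K * L. kr k (\<epsilon> (j div L)) (\<delta> (j mod L))) i j = (\<Sum>a<K. \<Sum>b<L. ent (kr k (\<epsilon> a) (\<delta> b)) i j)"
      unfolding ent_sum by (rule sum_div_mod[OF L0])
    also have "\<dots> = ent (kr k (\<Sum>j<K. \<epsilon> j) (\<Sum>j<L. \<delta> j)) i j"
      using k by (subst sum.swap) (simp add: kr_sum)
    finally show "ent (\<Sum>j<K * L. kr k (\<epsilon> (j div L)) (\<delta> (j mod L))) i j = ent (un (n * k)) i j"
      unfolding K L kr_un[OF k] .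
  qed
  moreover have "idem (n * k) (krs k E1 E) R M B (d1 * d) (kr k (\<epsilon> (j div L)) (\<delta> (j mod L)))" if "j < K * L" for j
    using that L0 by (intro idem_kr k E R B K L) (auto simp: less_mult_imp_div_less)
  ultimately show ?thesis unfolding resolvable_def
    by (intro exI[of _ "K * L"] exI[of _ "\<lambda>j. kr k (\<epsilon> (j div L)) (\<delta> (j mod L))"]) auto
qed

context heis_group
begin

lemma nrm_G: assumes "nrm n E (4 * p * (p - 1)) y y'" shows "y \<in> \<G>" "y' = iv y" "normz y y'"
proof -
  show nz: "normz y y'" using assms by (auto simp: nrm_def normz_def)
  show "y \<in> \<G>" using G_normz[OF nz] assms by (simp add: nrm_def)
  then show "y' = iv y" using assms by (intro iv_unique) (auto simp: nrm_def)
qed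

text \<open>Elements of \<open>E\<close> have entries in \<open>zint p\<close>, which is inside
  \<open>RR\<close>, so entries of \<open>y\<close> in \<open>RR\<close> up to a positive integer
  give Fourier coefficients in \<open>RR\<close>.\<close>

lemma adm_real: assumes a: "adm n E RR (4 * p * (p - 1)) y y'" shows "real_norm y y'"
proof -
  have nz: "nrm n E (4 * p * (p - 1)) y y'" using a by (simp add: adm_def)
  note y = nrm_G[OF nz]
  obtain c where c: "c > 0" "\<And>i j. of_nat c * ent y i j \<in> RR" using a by (auto simp: adm_def)
  have "tr (y * e) \<in> RR" if e: "e \<in> E" for e
  proof -
    have sy: "supp n y" "supp n (y * e)" using y e by auto
    have "of_nat c * tr (y * e) = (\<Sum>i<n. \<Sum>j<n. (of_nat c * ent y i j) * ent e j i)"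
      unfolding tr_eq[OF sy(2)] ent_times[OF sy(1)] by (simp add: sum_distrib_left mult.assoc)
    also have "\<dots> \<in> RR" by (intro RR_sum RR_closed(4) c RR_zint E_int e)
    finally show ?thesis by (rule RR_cancel[OF _ c(1) tr_in]) (use y e in simp)
  qed
  then show ?thesis using y by (auto simp: real_norm_def G1_def)
qed

lemma idem_good:
  assumes "idem n E RR (4 * p * (p - 1)) frob_fixed d \<epsilon>"
  shows "good d \<epsilon>"
proof -
  obtain h h' where h: "nrm n E (4 * p * (p - 1)) h h'"
    and c: "combo frob_fixed (adm n E RR (4 * p * (p - 1))) (sc (of_nat d) \<epsilon>) (sc (of_nat d) (h * \<epsilon> * h'))"
    using assms by (auto simp: idem_def)
  have "combo frob_fixed real_norm U V" if "combo frob_fixed (adm n E RR (4 * p * (p - 1))) U V" for U V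
    using that by (induction rule: combo.induct) (blast intro: combo.intros adm_real)+
  then show ?thesis using c nrm_G[OF h] assms by (auto simp: good_def idem_def)
qed

lemma normalizes_E:
  assumes res: "resolvable n E RR (4 * p * (p - 1)) frob_fixed d" and d: "coprime d p" and m: "m > 0"
    and x: "x \<in> \<G>"
  shows "normz x (iv x)"
proof -
  obtain K :: nat and \<epsilon> where K: "(\<Sum>j<K. \<epsilon> j) = un n" "\<And>j. j < K \<Longrightarrow> good d (\<epsilon> j)"
    using res idem_good unfolding resolvable_def by blast
  interpret heis_group_resolution p n m E N s n' \<G> t "{..<K}" \<epsilon> d
    by unfold_locales (use K d m in auto)
  show ?thesis using x G_normalizes_E[OF x] by (auto simp: normz_def)
qed

end

section \<open>The group generated by shift and clock matrices\<close>

lemma sum_single: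
  fixes f :: "nat \<Rightarrow> 'a::comm_monoid_add"
  assumes "k0 < p" "\<And>k. k < p \<Longrightarrow> k \<noteq> k0 \<Longrightarrow> f k = 0"
  shows "(\<Sum>k<p. f k) = f k0"
proof -
  have "(\<Sum>k<p. f k) = (\<Sum>k<p. if k = k0 then f k0 else 0)" using assms by (intro sum.cong) auto
  then show ?thesis using assms by simp
qed

lemma ent_mult_row:
  assumes "supp n A" "k0 < n" "\<And>k. k < n \<Longrightarrow> k \<noteq> k0 \<Longrightarrow> ent A i k = 0"
  shows "ent (A * B) i j = ent A i k0 * ent B k0 j"
  unfolding ent_times[OF assms(1)] using assms(2,3) by (intro sum_single) auto

lemma ent_mult_col:
  assumes "supp n A" "k0 < n" "\<And>k. k < n \<Longrightarrow> k \<noteq> k0 \<Longrightarrow> ent B k j = 0"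
  shows "ent (A * B) i j = ent A i k0 * ent B k0 j"
  unfolding ent_times[OF assms(1)] using assms(2,3) by (intro sum_single) auto

context odd_prime
begin

text \<open>\<open>zeta p ^ c\<close> times the \<open>a\<close>-th power of the shift times the
  \<open>b\<close>-th power of the clock matrix, in this order.\<close>

definition weyl :: "nat \<Rightarrow> nat \<Rightarrow> nat \<Rightarrow> cmat" where
  "weyl c a b = cm p (\<lambda>i j. if i = (j + a) mod p then zeta p ^ (c + b * j) else 0)"

text \<open>The dilation of the index by \<open>u\<close>; for \<open>u = p - 1\<close> it is the
  parity involution.\<close>

definition dm :: "nat \<Rightarrow> cmat" where
  "dm u = cm p (\<lambda>i j. if i = (u * j) mod p then 1 else 0)"

definition rp :: complex where "rp = of_real (sqrt (real p))"

definition dft :: cmat where "dft = cm p (\<lambda>i j. zeta p ^ (i * j) / rp)"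

definition dft' :: cmat where "dft' = cm p (\<lambda>i j. cnj (zeta p) ^ (i * j) / rp)"

lemma supp_weyl [simp, intro]: "supp p (weyl c a b)" by (simp add: weyl_def)
lemma supp_dm [simp, intro]: "supp p (dm u)" by (simp add: dm_def)
lemma supp_dft [simp, intro]: "supp p dft" "supp p dft'" by (simp_all add: dft_def dft'_def)

lemma mod_p [simp]: "a mod p < p" using p_pos by simp

lemma weyl_cong:
  assumes "[c = c'] (mod p)" "[a = a'] (mod p)" "[b = b'] (mod p)"
  shows "weyl c a b = weyl c' a' b'"
proof (rule cm_eqI)
  fix i j assume ij: "i < p" "j < p"
  have "zeta p ^ (c + b * j) = zeta p ^ (c' + b' * j)"
    by (intro zeta_power_cong cong_add cong_mult assms cong_refl)
  moreover have "(j + a) mod p = (j + a') mod p"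
    using cong_add[OF cong_refl assms(2), of j] by (simp add: cong_def)
  ultimately show "ent (weyl c a b) i j = ent (weyl c' a' b') i j" using ij by (simp add: weyl_def)
qed auto

lemma cong_mod_p: "[a mod p = a] (mod p)" by (simp add: cong_def)

lemma weyl_mult: "weyl c a b * weyl c' a' b' = weyl (c + c' + b * a') (a + a') (b + b')"
proof (rule cm_eqI)
  fix i j assume ij: "i < p" "j < p"
  define k where "k = (j + a') mod p"
  have k: "k < p" "[k = j + a'] (mod p)" using cong_mod_p by (auto simp: k_def)
  have "ent (weyl c a b * weyl c' a' b') i j = ent (weyl c a b) i k * ent (weyl c' a' b') k j"
    using ij k by (intro ent_mult_col[of p]) (auto simp: weyl_def k_def)
  also have "\<dots> = (if i = (k + a) mod p then zeta p ^ (c + b * k + (c' + b' * j)) else 0)"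
    using ij k by (simp add: weyl_def k_def[symmetric] power_add)
  also have "zeta p ^ (c + b * k + (c' + b' * j)) = zeta p ^ (c + b * (j + a') + (c' + b' * j))"
    by (intro zeta_power_cong cong_add cong_mult cong_refl k)
  also have "c + b * (j + a') + (c' + b' * j) = c + c' + b * a' + (b + b') * j"
    by (simp add: algebra_simps)
  also have "(k + a) mod p = (j + (a + a')) mod p" by (simp add: k_def mod_add_left_eq mod_add_right_eq add_ac)
  finally show "ent (weyl c a b * weyl c' a' b') i j = ent (weyl (c + c' + b * a') (a + a') (b + b')) i j"
    using ij by (simp add: weyl_def)
qed auto

lemma weyl_0: "weyl 0 0 0 = un p"
  by (rule cm_eqI) (auto simp: weyl_def)

lemma sc_weyl: "sc (zeta p ^ k) (weyl c a b) = weyl (k + c) a b"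
  by (rule cm_eqI) (auto simp: weyl_def power_add)

lemma mpow_weyl: "mpow p (weyl c a b) k = weyl (k * c + b * a * (k choose 2)) (k * a) (k * b)"
proof (induction k)
  case (Suc k)
  have "Suc k choose 2 = k + (k choose 2)" by (simp add: numeral_2_eq_2)
  then show ?case unfolding mpow.simps(2) Suc weyl_mult
    by (intro arg_cong3[where f = weyl]) (simp_all add: algebra_simps)
qed (simp add: weyl_0 numeral_2_eq_2)

text \<open>Here and below \<open>p - 1\<close> stands for -1 modulo \<open>p\<close>, which keeps
  all exponents natural numbers.\<close>

lemma pred_p: "[(p - 1) * a + a = 0] (mod p)"
proof -
  have "(p - 1) * a + a = p * a" using p_pos by (cases p) auto
  then show ?thesis by (simp add: cong_0_iff)
qed

lemma shift_iff:
  assumes "i < p" "k < p"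
  shows "i = (k + (p - 1) * a) mod p \<longleftrightarrow> k = (i + a) mod p"
proof
  assume i: "i = (k + (p - 1) * a) mod p"
  then have "[i + a = k + (p - 1) * a + a] (mod p)" by (intro cong_add cong_refl) (simp add: cong_def)
  also have "[k + (p - 1) * a + a = k + 0] (mod p)"
    using cong_add[OF cong_refl pred_p] by (simp add: add.assoc)
  finally show "k = (i + a) mod p" using assms by (simp add: cong_def)
next
  assume k: "k = (i + a) mod p"
  then have "[k + (p - 1) * a = i + a + (p - 1) * a] (mod p)" by (intro cong_add cong_refl) (simp add: cong_def)
  also have "[i + a + (p - 1) * a = i + 0] (mod p)"
    using cong_add[OF cong_refl pred_p, of i a] by (simp add: add_ac)
  finally show "i = (k + (p - 1) * a) mod p" using assms by (simp add: cong_def)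
qed

lemma adj_weyl: "adj (weyl c a b) = weyl ((p - 1) * c + a * b) ((p - 1) * a) ((p - 1) * b)"
proof (rule cm_eqI)
  fix i j assume ij: "i < p" "j < p"
  show "ent (adj (weyl c a b)) i j = ent (weyl ((p - 1) * c + a * b) ((p - 1) * a) ((p - 1) * b)) i j"
  proof (cases "j = (i + a) mod p")
    case False
    then show ?thesis using ij shift_iff[OF ij, of a] by (simp add: weyl_def)
  next
    case True
    have j: "[j = i + a] (mod p)" unfolding True by (rule cong_mod_p)
    have "[(p - 1) * c + a * b + (p - 1) * b * j = (p - 1) * c + a * b + (p - 1) * b * (i + a)] (mod p)"
      by (intro cong_add cong_mult cong_refl j)
    also have "(p - 1) * c + a * b + (p - 1) * b * (i + a) = (p - 1) * (c + b * i) + ((p - 1) * (a * b) + a * b)"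
      by (simp only: distrib_left mult_ac add_ac)
    also have "[\<dots> = (p - 1) * (c + b * i) + 0] (mod p)" by (intro cong_add cong_refl pred_p)
    finally have "zeta p ^ ((p - 1) * c + a * b + (p - 1) * b * j) = zeta p ^ ((p - 1) * (c + b * i))"
      using zeta_power_cong by simp
    also have "\<dots> = cnj (zeta p ^ (c + b * i))" by (simp only: complex_cnj_power cnj_zeta power_mult)
    finally show ?thesis using ij True shift_iff[OF ij, of a] by (simp add: weyl_def)
  qed
qed auto

definition WE :: "cmat set" where "WE = {weyl c a b |c a b. True}"

lemma weyl_WE [simp, intro]: "weyl c a b \<in> WE" by (auto simp: WE_def)

lemma cong_pred: "[(p - 1) * ((p - 1) * a) = a] (mod p)"
proof -
  have "[(p - 1) * ((p - 1) * a) + (p - 1) * a = 0 + 0] (mod p)" using pred_p[of "(p - 1) * a"] by simp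
  also have "[0 + 0 = a + (p - 1) * a] (mod p)" using cong_sym[OF pred_p[of a]] by (simp add: add.commute)
  finally show ?thesis unfolding cong_add_rcancel_nat .
qed

lemma cong_cancel_p: "[a + b + (p - 1) * b = a] (mod p)"
  using cong_add[OF cong_refl pred_p, of a b] by (simp add: add_ac)

lemma p_dvd_choose2: "p dvd (p choose 2)"
proof -
  have "2 * (p choose 2) = p * (p - 1)" unfolding choose_two
    by (rule dvd_mult_div_cancel) (cases p; auto)
  then have "p dvd 2 * (p choose 2)" by simp
  moreover have "coprime p 2" using coprime_less_p[of 2] p_gt_2 by (simp add: coprime_commute)
  ultimately show ?thesis by (simp add: coprime_dvd_mult_right_iff)
qed

lemma heis_weyl: "heis p p 1 WE"
proof unfold_locales
  show "p = p ^ 1" by simp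
  show "un p \<in> WE" unfolding weyl_0[symmetric] by simp
  have "WE \<subseteq> (\<lambda>(c, a, b). weyl c a b) ` ({..<p} \<times> {..<p} \<times> {..<p})"
  proof
    fix e assume "e \<in> WE"
    then obtain c a b where "e = weyl c a b" by (auto simp: WE_def)
    also have "\<dots> = weyl (c mod p) (a mod p) (b mod p)" by (intro weyl_cong cong_sym[OF cong_mod_p])
    finally show "e \<in> (\<lambda>(c, a, b). weyl c a b) ` ({..<p} \<times> {..<p} \<times> {..<p})"
      by (intro image_eqI[of _ _ "(c mod p, a mod p, b mod p)"]) auto
  qed
  then show "finite WE" by (rule finite_subset) simp
  fix e assume "e \<in> WE"
  then obtain c a b where e: "e = weyl c a b" by (auto simp: WE_def)
  show "supp p e" by (simp add: e)
  show "adj e \<in> WE" by (simp add: e adj_weyl)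
  have "weyl c a b * weyl ((p - 1) * c + a * b) ((p - 1) * a) ((p - 1) * b) = weyl 0 0 0"
    unfolding weyl_mult
  proof (rule weyl_cong)
    have eq: "c + ((p - 1) * c + a * b) + b * ((p - 1) * a) = ((p - 1) * c + c) + ((p - 1) * (a * b) + a * b)"
      by (simp add: algebra_simps)
    show "[c + ((p - 1) * c + a * b) + b * ((p - 1) * a) = 0] (mod p)" unfolding eq
      using cong_add[OF pred_p[of c] pred_p[of "a * b"]] by (simp only: add_0_left)
  qed (use pred_p in \<open>simp_all add: add.commute\<close>)
  then show ea: "e * adj e = un p" by (simp add: e adj_weyl weyl_0)
  have "weyl ((p - 1) * c + a * b) ((p - 1) * a) ((p - 1) * b) * weyl c a b = weyl 0 0 0"
    unfolding weyl_mult
  proof (rule weyl_cong)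
    have eq: "(p - 1) * c + a * b + c + (p - 1) * b * a = ((p - 1) * c + c) + ((p - 1) * (a * b) + a * b)"
      by (simp add: algebra_simps)
    show "[(p - 1) * c + a * b + c + (p - 1) * b * a = 0] (mod p)" unfolding eq
      using cong_add[OF pred_p[of c] pred_p[of "a * b"]] by (simp only: add_0_left)
  qed (use pred_p in simp_all)
  then show "adj e * e = un p" by (simp add: e adj_weyl weyl_0)
  show "mpow p e p = un p"
    unfolding e mpow_weyl weyl_0[symmetric]
    using p_dvd_choose2 by (intro weyl_cong) (auto simp: cong_0_iff)
  show "ent e i j \<in> zint p" for i j by (auto simp: e weyl_def)
  fix f assume "f \<in> WE"
  then obtain c' a' b' where f: "f = weyl c' a' b'" by (auto simp: WE_def)
  show "e * f \<in> WE" by (simp add: e f weyl_mult)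
  define k where "k = b * a' + (p - 1) * (b' * a)"
  have "e * f = sc (zeta p ^ k) (f * e)"
    unfolding e f weyl_mult sc_weyl
  proof (intro weyl_cong)
    have eq: "k + (c' + c + b' * a) = (c + c' + b * a') + b' * a + (p - 1) * (b' * a)" by (simp add: k_def)
    show "[c + c' + b * a' = k + (c' + c + b' * a)] (mod p)" unfolding eq by (rule cong_sym[OF cong_cancel_p])
  qed (simp_all add: add.commute)
  moreover have "(zeta p ^ k) ^ p = 1" by (metis mult.commute power_mult power_one zeta_N)
  ultimately show "\<exists>c. c ^ p = 1 \<and> e * f = sc c (f * e)" by blast
next
  fix c :: complex assume "c ^ p = 1"
  then obtain k where "c = zeta p ^ k" using root_of_unity_eq by blast
  then show "sc c (un p) \<in> WE" by (simp add: sc_weyl flip: weyl_0)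
next
  fix M assume M: "supp p M" and comm: "\<And>e. e \<in> WE \<Longrightarrow> M * e = e * M"
  \<comment> \<open>Commuting with the clock matrix, whose diagonal entries are distinct, makes
    \<open>M\<close> diagonal; commuting with the shift then equates neighbouring diagonal
    entries.\<close>
  have diag: "ent M i j = 0" if ij: "i < p" "j < p" "i \<noteq> j" for i j
  proof -
    have "ent (M * weyl 0 0 1) i j = ent M i j * zeta p ^ j"
      using ij by (subst ent_mult_col[OF M, of j]) (auto simp: weyl_def)
    moreover have "ent (weyl 0 0 1 * M) i j = zeta p ^ i * ent M i j"
      using ij by (subst ent_mult_row[OF supp_weyl, of i]) (auto simp: weyl_def)
    ultimately have "ent M i j * zeta p ^ j = zeta p ^ i * ent M i j" using comm by simp
    then have "ent M i j = 0 \<or> zeta p ^ i = zeta p ^ j" by (metis mult.commute mult_cancel_left)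
    then show ?thesis using zeta_power_inj ij by blast
  qed
  have step: "ent M (Suc j) (Suc j) = ent M j j" if j: "Suc j < p" for j
  proof -
    have "ent (M * weyl 0 1 0) (Suc j) j = ent M (Suc j) (Suc j)"
      using j by (subst ent_mult_col[OF M, of "Suc j"]) (auto simp: weyl_def)
    moreover have "ent (weyl 0 1 0 * M) (Suc j) j = ent M j j"
    proof -
      have "k = j" if "k < p" "Suc j = Suc k mod p" for k
        using that j by (cases "Suc k = p") auto
      then show ?thesis using j by (subst ent_mult_row[OF supp_weyl, of j]) (auto simp: weyl_def)
    qed
    ultimately show ?thesis using comm by simp
  qed
  have const: "j < p \<Longrightarrow> ent M j j = ent M 0 0" for j
    by (induction j) (auto simp: step)
  have "M = sc (ent M 0 0) (un p)"
  proof (rule cm_eqI[OF M])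
    fix i j assume "i < p" "j < p"
    then show "ent M i j = ent (sc (ent M 0 0) (un p)) i j"
      using diag[of i j] const[of j] by (cases "i = j") simp_all
  qed simp
  then show "\<exists>c. M = sc c (un p)" by blast
qed

subsection \<open>Dilations and the Fourier matrix\<close>

lemma dm_cong: "[u = v] (mod p) \<Longrightarrow> dm u = dm v"
  unfolding dm_def using cong_mult[OF _ cong_refl, of u v p] by (simp add: cong_def)

lemma dm_1: "dm 1 = un p"
  by (rule cm_eqI) (auto simp: dm_def)

lemma dm_mult: "dm u * dm v = dm (u * v)"
proof (rule cm_eqI)
  fix i j assume ij: "i < p" "j < p"
  have "ent (dm u * dm v) i j = ent (dm u) i ((v * j) mod p) * ent (dm v) ((v * j) mod p) j"
    using ij by (intro ent_mult_col[of p]) (auto simp: dm_def)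
  then show "ent (dm u * dm v) i j = ent (dm (u * v)) i j"
    using ij by (simp add: dm_def mod_mult_right_eq mult.assoc)
qed auto

lemma mpow_dm: "mpow p (dm u) k = dm (u ^ k)"
proof (induction k)
  case 0
  show ?case using dm_1 by simp
qed (simp add: dm_mult)

lemma dilate_iff:
  assumes u: "[u * u' = 1] (mod p)" and "i < p" "k < p"
  shows "i = (u' * k) mod p \<longleftrightarrow> k = (u * i) mod p"
proof
  assume i: "i = (u' * k) mod p"
  then have "[u * i = u * (u' * k)] (mod p)" by (intro cong_mult cong_refl) (simp add: cong_def)
  also have "[u * (u' * k) = 1 * k] (mod p)" using cong_mult[OF u cong_refl, of k] by (simp add: mult.assoc)
  finally show "k = (u * i) mod p" using assms by (simp add: cong_def)
next
  assume k: "k = (u * i) mod p"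
  then have "[u' * k = u' * (u * i)] (mod p)" by (intro cong_mult cong_refl) (simp add: cong_def)
  also have "[u' * (u * i) = 1 * i] (mod p)" using cong_mult[OF u cong_refl, of i] by (simp add: mult_ac)
  finally show "i = (u' * k) mod p" using assms by (simp add: cong_def)
qed

lemma dm_weyl:
  assumes u: "[u * u' = 1] (mod p)"
  shows "dm u * weyl c a b = weyl c (u * a) (u' * b) * dm u"
proof (rule cm_eqI)
  fix i j assume ij: "i < p" "j < p"
  define k l where "k = (j + a) mod p" and "l = (u * j) mod p"
  have "ent (dm u * weyl c a b) i j = ent (dm u) i k * ent (weyl c a b) k j"
    using ij by (intro ent_mult_col[of p]) (auto simp: weyl_def k_def)
  also have "\<dots> = (if i = (u * (j + a)) mod p then zeta p ^ (c + b * j) else 0)"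
    using ij by (simp add: weyl_def dm_def k_def mod_mult_right_eq)
  also have "\<dots> = (if i = (l + u * a) mod p then zeta p ^ (c + u' * b * l) else 0)"
  proof -
    have "[c + u' * b * l = c + u' * b * (u * j)] (mod p)"
      by (intro cong_add cong_mult cong_refl) (simp add: l_def cong_def)
    also have "u' * b * (u * j) = (u * u') * (b * j)" by (simp add: mult_ac)
    also have "[c + (u * u') * (b * j) = c + 1 * (b * j)] (mod p)"
      by (intro cong_add cong_mult cong_refl u)
    finally have "zeta p ^ (c + u' * b * l) = zeta p ^ (c + b * j)" using zeta_power_cong by simp
    then show ?thesis by (simp add: l_def mod_add_left_eq distrib_left)
  qed
  also have "\<dots> = ent (weyl c (u * a) (u' * b)) i l * ent (dm u) l j"
    using ij by (simp add: weyl_def dm_def l_def)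
  also have "\<dots> = ent (weyl c (u * a) (u' * b) * dm u) i j"
    using ij by (intro ent_mult_col[symmetric, of p]) (auto simp: dm_def l_def)
  finally show "ent (dm u * weyl c a b) i j = ent (weyl c (u * a) (u' * b) * dm u) i j" .
qed auto

lemma rp: "rp * rp = of_nat p" "rp \<noteq> 0" "cnj rp = rp"
proof -
  have "sqrt (real p) * sqrt (real p) = real p" by simp
  then show 1: "rp * rp = of_nat p" unfolding rp_def by (metis of_real_mult of_real_of_nat_eq)
  then show "rp \<noteq> 0" using p_pos by auto
  show "cnj rp = rp" by (simp add: rp_def)
qed

lemma sum_zeta_diff:
  assumes "i < p" "j < p"
  shows "(\<Sum>k<p. zeta p ^ (i * k) * cnj (zeta p) ^ (j * k)) = (if i = j then of_nat p else 0)"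
proof -
  have "zeta p ^ (i * k) * cnj (zeta p) ^ (j * k) = zeta p ^ ((i + (p - 1) * j) * k)" for k
    by (simp only: cnj_zeta power_mult[symmetric] power_add[symmetric] distrib_right mult.assoc)
  then have "(\<Sum>k<p. zeta p ^ (i * k) * cnj (zeta p) ^ (j * k)) = (if p dvd i + (p - 1) * j then of_nat p else 0)"
    by (simp only: sum_zeta_multiples)
  moreover have "p dvd i + (p - 1) * j \<longleftrightarrow> i = j"
    using shift_iff[of 0 i j] assms p_pos by (auto simp: dvd_eq_mod_eq_0)
  ultimately show ?thesis by simp
qed

lemma dft_inverse: "dft * dft' = un p" "dft' * dft = un p"
proof -
  have 1: "(\<Sum>k<p. zeta p ^ (i * k) / rp * (cnj (zeta p) ^ (k * j) / rp)) = (if i = j then 1 else 0)"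
    if "i < p" "j < p" for i j
  proof -
    have "(\<Sum>k<p. zeta p ^ (i * k) / rp * (cnj (zeta p) ^ (k * j) / rp)) =
      (\<Sum>k<p. zeta p ^ (i * k) * cnj (zeta p) ^ (j * k)) / (rp * rp)"
      by (simp add: sum_divide_distrib mult.commute)
    then show ?thesis using p_pos that by (simp add: sum_zeta_diff rp)
  qed
  show "dft * dft' = un p"
  proof (rule cm_eqI)
    fix i j assume ij: "i < p" "j < p"
    have "ent (dft * dft') i j = (\<Sum>k<p. zeta p ^ (i * k) / rp * (cnj (zeta p) ^ (k * j) / rp))"
      unfolding ent_times[OF supp_dft(1)] using ij by (intro sum.cong) (simp_all add: dft_def dft'_def)
    also have "\<dots> = (if i = j then 1 else 0)" by (rule 1[OF ij])
    finally show "ent (dft * dft') i j = ent (un p) i j" by (simp add: ij)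
  qed auto
  have 2: "(\<Sum>k<p. cnj (zeta p) ^ (i * k) / rp * (zeta p ^ (k * j) / rp)) = (if i = j then 1 else 0)"
    if "i < p" "j < p" for i j
  proof -
    have "cnj (\<Sum>k<p. zeta p ^ (i * k) / rp * (cnj (zeta p) ^ (k * j) / rp)) = (if i = j then 1 else 0)"
      unfolding 1[OF that] by simp
    then show ?thesis by (simp add: rp)
  qed
  show "dft' * dft = un p"
  proof (rule cm_eqI)
    fix i j assume ij: "i < p" "j < p"
    have "ent (dft' * dft) i j = (\<Sum>k<p. cnj (zeta p) ^ (i * k) / rp * (zeta p ^ (k * j) / rp))"
      unfolding ent_times[OF supp_dft(2)] using ij by (intro sum.cong) (simp_all add: dft_def dft'_def)
    also have "\<dots> = (if i = j then 1 else 0)" by (rule 2[OF ij])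
    finally show "ent (dft' * dft) i j = ent (un p) i j" by (simp add: ij)
  qed auto
qed

lemma dft_weyl: "dft * weyl c a b = weyl (c + (p - 1) * (a * b)) ((p - 1) * b) a * dft"
proof (rule cm_eqI)
  fix i j assume ij: "i < p" "j < p"
  define k l where "k = (j + a) mod p" and "l = (i + b) mod p"
  have kl: "[k = j + a] (mod p)" "[l = i + b] (mod p)" by (simp_all add: k_def l_def cong_mod_p)
  have "ent (dft * weyl c a b) i j = ent dft i k * ent (weyl c a b) k j"
    using ij by (intro ent_mult_col[of p]) (auto simp: weyl_def k_def)
  also have "\<dots> = zeta p ^ (i * k + (c + b * j)) / rp"
    using ij by (simp add: weyl_def dft_def k_def power_add)
  also have "zeta p ^ (i * k + (c + b * j)) = zeta p ^ (c + (p - 1) * (a * b) + a * l + l * j)"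
  proof (rule zeta_power_cong)
    have "[i * k + (c + b * j) = i * (j + a) + (c + b * j)] (mod p)"
      by (intro cong_add cong_mult cong_refl kl)
    also have "[i * (j + a) + (c + b * j) = i * (j + a) + (c + b * j) + a * b + (p - 1) * (a * b)] (mod p)"
      by (rule cong_sym[OF cong_cancel_p])
    also have "i * (j + a) + (c + b * j) + a * b + (p - 1) * (a * b) =
        c + (p - 1) * (a * b) + a * (i + b) + (i + b) * j" by (simp add: algebra_simps)
    also have "[\<dots> = c + (p - 1) * (a * b) + a * l + l * j] (mod p)"
      by (intro cong_add cong_mult cong_refl cong_sym[OF kl(2)])
    finally show "[i * k + (c + b * j) = c + (p - 1) * (a * b) + a * l + l * j] (mod p)" .
  qed
  also have "zeta p ^ (c + (p - 1) * (a * b) + a * l + l * j) / rp =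
      ent (weyl (c + (p - 1) * (a * b)) ((p - 1) * b) a) i l * ent dft l j"
    using ij shift_iff[of i l b] by (simp add: weyl_def dft_def l_def power_add)
  also have "\<dots> = ent (weyl (c + (p - 1) * (a * b)) ((p - 1) * b) a * dft) i j"
    using ij shift_iff[of i _ b] by (intro ent_mult_row[symmetric, of p]) (auto simp: weyl_def l_def)
  finally show "ent (dft * weyl c a b) i j = ent (weyl (c + (p - 1) * (a * b)) ((p - 1) * b) a * dft) i j" .
qed auto

lemma dft_dm:
  assumes u: "[u * u' = 1] (mod p)"
  shows "dft * dm u = dm u' * dft"
proof (rule cm_eqI)
  fix i j assume ij: "i < p" "j < p"
  define k l where "k = (u * j) mod p" and "l = (u * i) mod p"
  have "ent (dft * dm u) i j = ent dft i k * ent (dm u) k j"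
    using ij by (intro ent_mult_col[of p]) (auto simp: dm_def k_def)
  also have "\<dots> = zeta p ^ (i * k) / rp" using ij by (simp add: dft_def dm_def k_def)
  also have "zeta p ^ (i * k) = zeta p ^ (l * j)"
  proof (rule zeta_power_cong)
    have "[i * k = i * (u * j)] (mod p)" by (intro cong_mult cong_refl) (simp add: k_def cong_def)
    also have "i * (u * j) = u * i * j" by simp
    also have "[\<dots> = l * j] (mod p)" by (intro cong_mult cong_refl) (simp add: l_def cong_def)
    finally show "[i * k = l * j] (mod p)" .
  qed
  also have "zeta p ^ (l * j) / rp = ent (dm u') i l * ent dft l j"
    using ij dilate_iff[OF u, of i l] by (simp add: dft_def dm_def l_def)
  also have "\<dots> = ent (dm u' * dft) i j"
    using ij dilate_iff[OF u, of i] by (intro ent_mult_row[symmetric, of p]) (auto simp: dm_def l_def)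
  finally show "ent (dft * dm u) i j = ent (dm u' * dft) i j" .
qed auto

lemma dft_dft: "dft * dft = dm (p - 1)"
proof (rule cm_eqI)
  fix i j assume ij: "i < p" "j < p"
  have "ent (dft * dft) i j = (\<Sum>k<p. zeta p ^ ((i + j) * k)) / (rp * rp)"
    using ij unfolding ent_times[OF supp_dft(1)]
    by (simp add: dft_def sum_divide_distrib distrib_right power_add mult.commute[of _ j])
  also have "\<dots> = (if p dvd i + j then 1 else 0)" using p_pos by (simp add: sum_zeta_multiples rp)
  also have "p dvd i + j \<longleftrightarrow> i = ((p - 1) * j) mod p"
    using shift_iff[of i 0 j] ij p_pos by (auto simp: dvd_eq_mod_eq_0)
  finally show "ent (dft * dft) i j = ent (dm (p - 1)) i j" using ij by (simp add: dm_def)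
qed auto

lemma pred_square: "[(p - 1) * (p - 1) = 1] (mod p)"
  using cong_pred[of 1] by simp

text \<open>The index 0 is the only fixed point of negation modulo the odd prime \<open>p\<close>,
  which gives trace 1.\<close>

lemma parity_weyl: "parity p p WE (dm (p - 1))"
  unfolding parity_def
proof (intro conjI ballI)
  show "supp p (dm (p - 1))" by simp
  show tt: "dm (p - 1) * dm (p - 1) = un p"
    unfolding dm_mult dm_1[symmetric] by (rule dm_cong[OF pred_square])
  have "i = ((p - 1) * i) mod p \<longleftrightarrow> i = 0" if i: "i < p" for i
  proof
    assume "i = ((p - 1) * i) mod p"
    then have "p dvd i + i" using shift_iff[of i 0 i] i p_pos by (auto simp: dvd_eq_mod_eq_0)
    then have "p dvd 2 * i" by (simp add: mult_2)
    then have "p dvd i" using p_prime p_gt_2 by (auto simp: prime_dvd_mult_iff dest: dvd_imp_le)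
    then show "i = 0" using i by (auto dest: dvd_imp_le)
  qed simp
  then have "tr (dm (p - 1)) = (\<Sum>i<p. if i = 0 then 1 else 0)"
    unfolding tr_eq[OF supp_dm] by (intro sum.cong) (auto simp: dm_def)
  then show "tr (dm (p - 1)) = 1" using p_pos by simp
  fix e assume "e \<in> WE"
  then obtain c a b where e: "e = weyl c a b" by (auto simp: WE_def)
  \<comment> \<open>The difference of phases between the two Weyl matrices: \<open>c\<close> minus
    the phase of \<open>adj e\<close>.\<close>
  define k where "k = c + (p - 1) * ((p - 1) * c + a * b)"
  have "dm (p - 1) * e * dm (p - 1) = weyl c ((p - 1) * a) ((p - 1) * b) * (dm (p - 1) * dm (p - 1))"
    unfolding e dm_weyl[OF pred_square] by (simp only: mult.assoc)
  also have "\<dots> = weyl c ((p - 1) * a) ((p - 1) * b)" unfolding tt by simp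
  also have "\<dots> = sc (zeta p ^ k) (adj e)"
    unfolding e adj_weyl sc_weyl
  proof (intro weyl_cong cong_refl)
    have eq: "k + ((p - 1) * c + a * b) = c + ((p - 1) * c + a * b) + (p - 1) * ((p - 1) * c + a * b)"
      by (simp add: k_def)
    show "[c = k + ((p - 1) * c + a * b)] (mod p)" unfolding eq by (rule cong_sym[OF cong_cancel_p])
  qed
  finally have "dm (p - 1) * e * dm (p - 1) = sc (zeta p ^ k) (adj e)" .
  moreover have "(zeta p ^ k) ^ p = 1" by (metis mult.commute power_mult power_one zeta_N)
  ultimately show "\<exists>c. c ^ p = 1 \<and> dm (p - 1) * e * dm (p - 1) = sc c (adj e)" by blast
qed

lemma unit_inverse: assumes "coprime u p" shows "[u * u ^ (p - 2) = 1] (mod p)"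
proof -
  have "\<not> p dvd u" using assms p_prime by (metis coprime_absorb_right not_prime_unit)
  then have "[u ^ (p - 1) = 1] (mod p)" using p_prime by (intro fermat_theorem)
  moreover have "p - 1 = Suc (p - 2)" using p_gt_2 by simp
  ultimately show ?thesis by (simp only: power_Suc)
qed

lemma dm_inverse:
  assumes "coprime u p"
  shows "dm u * dm (u ^ (p - 2)) = un p" "dm (u ^ (p - 2)) * dm u = un p"
  using dm_cong[OF unit_inverse[OF assms]] by (simp_all only: dm_mult dm_1 mult.commute[of "u ^ (p - 2)" u])

lemma nrm_dm:
  assumes u: "coprime u p" and M: "p - 1 dvd M"
  shows "nrm p WE M (dm u) (dm (u ^ (p - 2)))"
  unfolding nrm_def
proof (intro conjI ballI)
  fix e assume "e \<in> WE"
  then obtain c a b where e: "e = weyl c a b" by (auto simp: WE_def)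
  have "dm u * e * dm (u ^ (p - 2)) = weyl c (u * a) (u ^ (p - 2) * b) * (dm u * dm (u ^ (p - 2)))"
    unfolding e dm_weyl[OF unit_inverse[OF u]] by (simp only: mult.assoc)
  then show "dm u * e * dm (u ^ (p - 2)) \<in> WE" using dm_inverse[OF u] by simp
next
  obtain k where k: "M = (p - 1) * k" using M by auto
  have "\<not> p dvd u" using u p_prime by (metis coprime_absorb_right not_prime_unit)
  then have "[u ^ (p - 1) = 1] (mod p)" using p_prime by (intro fermat_theorem)
  then have "mpow p (dm u) (p - 1) = un p" unfolding mpow_dm using dm_cong dm_1 by metis
  then show "mpow p (dm u) M = un p" unfolding k by (simp add: mpow_mult)
qed (use dm_inverse[OF u] in auto)

lemma square_parity: assumes "supp p y" "y * y = dm (p - 1)" "4 dvd M" shows "mpow p y M = un p"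
proof -
  obtain k where k: "M = 2 * (2 * k)" using assms(3) by auto
  have "mpow p y 2 = dm (p - 1)" using assms by (simp add: numeral_2_eq_2)
  moreover have "mpow p (dm (p - 1)) 2 = un p"
    using parity_weyl by (simp add: numeral_2_eq_2 parity_def)
  moreover have "mpow p y (2 * (2 * k)) = mpow p (mpow p y 2) (2 * k)" by (rule mpow_mult[OF assms(1)])
  moreover have "mpow p (dm (p - 1)) (2 * k) = mpow p (mpow p (dm (p - 1)) 2) k" by (rule mpow_mult[OF supp_dm])
  ultimately show ?thesis unfolding k by (simp only: mpow_un)
qed

lemma nrm_dft: assumes "4 dvd M" shows "nrm p WE M dft dft'"
  unfolding nrm_def
proof (intro conjI ballI)
  fix e assume "e \<in> WE"
  then obtain c a b where e: "e = weyl c a b" by (auto simp: WE_def)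
  have "dft * e * dft' = weyl (c + (p - 1) * (a * b)) ((p - 1) * b) a * (dft * dft')"
    unfolding e dft_weyl by (simp only: mult.assoc)
  then show "dft * e * dft' \<in> WE" using dft_inverse by simp
qed (use dft_inverse square_parity[OF _ dft_dft assms] in auto)

text \<open>Moving \<open>dm u\<close> past the Fourier matrix inverts \<open>u\<close>, so the
  square of the product is again the parity and its order divides 4.\<close>

lemma nrm_dm_dft:
  assumes u: "coprime u p" and M: "4 dvd M"
  shows "nrm p WE M (dm u * dft) (dft' * dm (u ^ (p - 2)))"
  unfolding nrm_def
proof (intro conjI ballI)
  have eq: "dm u * dft * X * (dft' * dm (u ^ (p - 2))) = dm u * (dft * X * dft') * dm (u ^ (p - 2))" for X
    by (simp only: mult.assoc)
  show "dm u * dft * (dft' * dm (u ^ (p - 2))) = un p"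
    using eq[of "un p"] dm_inverse[OF u] dft_inverse by (simp add: supp_times)
  have "dft' * dm (u ^ (p - 2)) * (dm u * dft) = dft' * (dm (u ^ (p - 2)) * dm u) * dft" by (simp only: mult.assoc)
  then show "dft' * dm (u ^ (p - 2)) * (dm u * dft) = un p"
    using dm_inverse[OF u] dft_inverse by simp
  show "dm u * dft * e * (dft' * dm (u ^ (p - 2))) \<in> WE" if "e \<in> WE" for e
    unfolding eq using that nrm_dft[of 4] nrm_dm[OF u, of 0] by (simp add: nrm_def)
  have "dm u * dft * (dm u * dft) = dm u * (dft * dm u) * dft" by (simp only: mult.assoc)
  also have "\<dots> = (dm u * dm (u ^ (p - 2))) * (dft * dft)"
    unfolding dft_dm[OF unit_inverse[OF u]] by (simp only: mult.assoc)
  also have "\<dots> = dm (p - 1)" unfolding dm_inverse[OF u] dft_dft by simp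
  finally show "mpow p (dm u * dft) M = un p" using M by (intro square_parity) auto
qed auto

end

section \<open>Rank one idempotents from a primitive root\<close>

locale odd_prime_root = odd_prime +
  fixes g :: nat
  assumes g: "bij_betw (\<lambda>k. g ^ k mod p) {..<p - 1} {1..<p}"
begin

lemma g_mod: "g ^ k mod p \<in> {1..<p}" if "k < p - 1" for k
  using g that unfolding bij_betw_def by auto

lemma g_coprime: "coprime (g ^ k) p"
proof -
  have "g ^ 1 mod p \<in> {1..<p}" using p_gt_2 by (intro g_mod) auto
  then have "\<not> p dvd g" by (auto simp: dvd_eq_mod_eq_0)
  then have "coprime g p" using p_prime by (metis coprime_commute prime_imp_coprime)
  then show ?thesis by simp
qed

lemma g_order: "[g ^ (p - 1) = 1] (mod p)"
proof -
  have "\<not> p dvd g" using g_coprime[of 1] p_prime by (metis coprime_absorb_right not_prime_unit power_one_right)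
  then show ?thesis using p_prime by (intro fermat_theorem)
qed

lemma g_surj: assumes "i \<in> {1..<p}" obtains k where "k < p - 1" "i = g ^ k mod p"
  using g assms unfolding bij_betw_def by (metis (no_types, lifting) imageE lessThan_iff)

lemma g_inj: "k < p - 1 \<Longrightarrow> l < p - 1 \<Longrightarrow> g ^ k mod p = g ^ l mod p \<Longrightarrow> k = l"
  using g unfolding bij_betw_def inj_on_def by auto

text \<open>For \<theta> a \<open>(p - 1)\<close>-th root of unity, the projection onto the
  \<theta>-eigenspace of the dilation by \<open>g\<close>. For \<theta> \<noteq> 1 this is a line
  spanned by a multiplicative character; for \<theta> = 1 it is the plane spanned by the basis
  vector 0 and the sum of the others.\<close>

definition proj :: "complex \<Rightarrow> cmat" where
  "proj \<theta> = sc (inverse (of_nat (p - 1))) (\<Sum>k<p - 1. sc (cnj \<theta> ^ k) (dm (g ^ k)))"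

lemma supp_proj [simp, intro]: "supp p (proj \<theta>)"
  unfolding proj_def by (intro supp_intros supp_sum supp_dm)

lemma p1: "of_nat (p - 1) \<noteq> (0 :: complex)" "p - 1 > 0" using p_gt_2 by auto

lemma root_norm: assumes "\<theta> ^ (p - 1) = 1" shows "\<theta> * cnj \<theta> = 1"
proof -
  have "cmod \<theta> = 1" using power_eq_1_iff[OF assms] p1 by auto
  then show ?thesis by (simp add: complex_norm_square[symmetric])
qed

lemma shift_sum:
  assumes "\<theta> ^ (p - 1) = 1"
  shows "(\<Sum>k<p - 1. sc (cnj \<theta> ^ Suc k) (dm (g ^ Suc k))) = (\<Sum>k<p - 1. sc (cnj \<theta> ^ k) (dm (g ^ k)))"
proof -
  define h where "h k = sc (cnj \<theta> ^ k) (dm (g ^ k))" for k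
  have "cnj \<theta> ^ (p - 1) = 1" using arg_cong[OF assms, of cnj] by simp
  then have "h (p - 1) = h 0" using dm_cong[OF g_order] by (simp add: h_def)
  then have "(\<Sum>k<p - 1. h (Suc k)) = (\<Sum>k<p - 1. h k)"
    using sum.lessThan_Suc_shift[of h "p - 1"] sum.lessThan_Suc[of h "p - 1"] by simp
  then show ?thesis by (simp add: h_def)
qed

lemma proj_eigen:
  assumes \<theta>: "\<theta> ^ (p - 1) = 1"
  shows "dm (g ^ k) * proj \<theta> = sc (\<theta> ^ k) (proj \<theta>)" "proj \<theta> * dm (g ^ k) = sc (\<theta> ^ k) (proj \<theta>)"
proof -
  have 0: "sc (cnj \<theta> ^ k) (dm (g ^ Suc k)) = sc \<theta> (sc (cnj \<theta> ^ Suc k) (dm (g ^ Suc k)))" for k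
    using root_norm[OF \<theta>] by (simp add: mult.assoc[symmetric])
  have 1: "dm g * proj \<theta> = sc \<theta> (proj \<theta>)"
  proof -
    have "dm g * proj \<theta> = sc (inverse (of_nat (p - 1))) (\<Sum>k<p - 1. sc (cnj \<theta> ^ k) (dm (g ^ Suc k)))"
      by (simp add: proj_def sum_distrib_left dm_mult)
    also have "\<dots> = sc (inverse (of_nat (p - 1))) (sc \<theta> (\<Sum>k<p - 1. sc (cnj \<theta> ^ Suc k) (dm (g ^ Suc k))))"
      unfolding 0 by (simp only: sc_sum)
    finally show ?thesis unfolding shift_sum[OF \<theta>] proj_def by (simp add: mult.commute)
  qed
  have 2: "proj \<theta> * dm g = sc \<theta> (proj \<theta>)"
  proof -
    have "dm g * proj \<theta> = proj \<theta> * dm g"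
      by (simp add: proj_def sum_distrib_left sum_distrib_right dm_mult mult.commute)
    then show ?thesis using 1 by simp
  qed
  show "dm (g ^ k) * proj \<theta> = sc (\<theta> ^ k) (proj \<theta>)"
  proof (induction k)
    case 0
    show ?case using dm_1 by simp
  next
    case (Suc k)
    have "dm (g ^ Suc k) * proj \<theta> = dm g * (dm (g ^ k) * proj \<theta>)" by (simp add: dm_mult flip: mult.assoc)
    then show ?case unfolding Suc using 1 by (simp add: mult.commute)
  qed
  show "proj \<theta> * dm (g ^ k) = sc (\<theta> ^ k) (proj \<theta>)"
  proof (induction k)
    case 0
    show ?case using dm_1 by simp
  next
    case (Suc k)
    have "proj \<theta> * dm (g ^ Suc k) = (proj \<theta> * dm (g ^ k)) * dm g" by (simp add: dm_mult mult.assoc mult.commute[of g])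
    then show ?case unfolding Suc using 2 by (simp add: mult.commute)
  qed
qed

definition lg :: "nat \<Rightarrow> nat" where "lg i = (SOME k. k < p - 1 \<and> i = g ^ k mod p)"

lemma lg: assumes "i \<in> {1..<p}" shows "lg i < p - 1" "g ^ lg i mod p = i"
proof -
  have "\<exists>k. k < p - 1 \<and> i = g ^ k mod p" using g_surj[OF assms] by blast
  from someI_ex[OF this] show "lg i < p - 1" "g ^ lg i mod p = i" by (auto simp: lg_def)
qed

lemma ent_proj_0:
  assumes ij: "i < p" "j < p" "i = 0 \<or> j = 0" and \<theta>: "\<theta> ^ (p - 1) = 1"
  shows "ent (proj \<theta>) i j = (if i = j \<and> \<theta> = 1 then 1 else 0)"
proof -
  have d: "ent (dm (g ^ k)) i j = (if i = j then 1 else 0)" for k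
  proof (cases "j = 0")
    case True
    then show ?thesis using ij by (simp add: dm_def)
  next
    case False
    then have "i = 0" using ij by simp
    have "\<not> p dvd g ^ k * j"
    proof
      assume "p dvd g ^ k * j"
      then have "p dvd j" using g_coprime[of k] by (simp add: coprime_commute coprime_dvd_mult_right_iff)
      then show False using False ij by (auto dest: dvd_imp_le)
    qed
    then show ?thesis using False ij \<open>i = 0\<close> by (simp add: dm_def dvd_eq_mod_eq_0)
  qed
  have c: "cnj \<theta> ^ (p - 1) = 1" using arg_cong[OF \<theta>, of cnj] by simp
  have "cnj \<theta> = 1 \<longleftrightarrow> \<theta> = 1" by (metis complex_cnj_cnj complex_cnj_one)
  then have s: "(\<Sum>k<p - 1. cnj \<theta> ^ k) = (if \<theta> = 1 then of_nat (p - 1) else 0)"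
    using sum_powers_root_of_unity[OF c] by auto
  show ?thesis
  proof (cases "i = j")
    case True
    have "ent (proj \<theta>) i j = inverse (of_nat (p - 1)) * (\<Sum>k<p - 1. cnj \<theta> ^ k)"
      unfolding proj_def by (simp only: ent_sc ent_sum d if_P[OF True] mult_1_right)
    then show ?thesis unfolding s using True p1 by simp
  next
    case False
    then show ?thesis by (simp add: proj_def d)
  qed
qed

text \<open>The eigenvector equations on both sides propagate the entry at \<open>(1, 1)\<close>, to
  which only \<open>k = 0\<close> contributes.\<close>

lemma ent_proj:
  assumes ij: "i \<in> {1..<p}" "j \<in> {1..<p}" and \<theta>: "\<theta> ^ (p - 1) = 1"
  shows "ent (proj \<theta>) i j = cnj \<theta> ^ lg i * \<theta> ^ lg j / of_nat (p - 1)"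
proof -
  have p1': "1 < p" using p_gt_2 by simp
  have d1: "ent (dm (g ^ k)) 1 1 = (if k = 0 then 1 else 0)" if k: "k < p - 1" for k
  proof -
    have "1 = g ^ k mod p \<longleftrightarrow> k = 0"
    proof
      assume "1 = g ^ k mod p"
      then have "g ^ k mod p = g ^ 0 mod p" using p1' by simp
      then show "k = 0" by (rule g_inj[OF k p1(2)])
    qed (use p1' in simp)
    then show ?thesis using p1' by (simp add: dm_def)
  qed
  have 1: "ent (proj \<theta>) 1 1 = inverse (of_nat (p - 1))"
  proof -
    have "(\<Sum>k<p - 1. cnj \<theta> ^ k * ent (dm (g ^ k)) 1 1) = (\<Sum>k<p - 1. if k = 0 then 1 else 0)"
      by (intro sum.cong refl) (simp only: d1 lessThan_iff, simp)
    then show ?thesis using p1 by (simp add: proj_def)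
  qed
  have row: "ent (proj \<theta>) 1 j = \<theta> ^ lg i * ent (proj \<theta>) i j"
  proof -
    have u: "[g ^ lg i * (g ^ lg i) ^ (p - 2) = 1] (mod p)" using unit_inverse[OF g_coprime] .
    have "[(g ^ lg i) ^ (p - 2) * g ^ lg i = 1] (mod p)" using u by (simp only: mult.commute)
    then have iff: "i = (g ^ lg i * k) mod p \<longleftrightarrow> k = ((g ^ lg i) ^ (p - 2) * i) mod p" if "k < p" for k
      using dilate_iff[of "(g ^ lg i) ^ (p - 2)" "g ^ lg i" i k] ij that by auto
    have "i = (g ^ lg i * 1) mod p" using lg[OF ij(1)] by simp
    then have one: "1 = ((g ^ lg i) ^ (p - 2) * i) mod p" using iff[OF p1'] by blast
    have z: "ent (dm (g ^ lg i)) i k = 0" if k: "k < p" "k \<noteq> 1" for k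
    proof -
      have "i \<noteq> (g ^ lg i * k) mod p" using iff[OF k(1)] one k(2) by metis
      then show ?thesis by (simp add: dm_def)
    qed
    have "ent (dm (g ^ lg i) * proj \<theta>) i j = ent (dm (g ^ lg i)) i 1 * ent (proj \<theta>) 1 j"
      by (rule ent_mult_row[OF supp_dm p1' z])
    also have "\<dots> = ent (proj \<theta>) 1 j" using ij p1' lg[OF ij(1)] by (simp add: dm_def)
    finally show ?thesis by (simp add: proj_eigen[OF \<theta>])
  qed
  have col: "ent (proj \<theta>) 1 j = \<theta> ^ lg j * ent (proj \<theta>) 1 1"
  proof -
    have jp: "j < p" using ij by simp
    have z: "ent (dm (g ^ lg j)) k 1 = 0" if "k \<noteq> j" for k
      using that lg(2)[OF ij(2)] by (simp add: dm_def)
    have "ent (proj \<theta> * dm (g ^ lg j)) 1 1 = ent (proj \<theta>) 1 j * ent (dm (g ^ lg j)) j 1"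
      by (rule ent_mult_col[OF supp_proj jp z])
    also have "\<dots> = ent (proj \<theta>) 1 j" using ij p1' lg[OF ij(2)] by (simp add: dm_def)
    finally show ?thesis by (simp add: proj_eigen[OF \<theta>])
  qed
  have "cnj \<theta> ^ lg i * \<theta> ^ lg i = 1"
    using root_norm[OF \<theta>] by (simp add: mult.commute flip: power_mult_distrib)
  then have "ent (proj \<theta>) i j = cnj \<theta> ^ lg i * (\<theta> ^ lg i * ent (proj \<theta>) i j)" by (simp flip: mult.assoc)
  also have "\<dots> = cnj \<theta> ^ lg i * (\<theta> ^ lg j * inverse (of_nat (p - 1)))" unfolding row[symmetric] col 1 ..
  finally show ?thesis by (simp add: divide_inverse mult.assoc)
qed

lemma sum_split: "(\<Sum>k<p. f k) = f 0 + (\<Sum>k\<in>{1..<p}. f k :: complex)"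
proof -
  have "{..<p} = insert 0 {1..<p}" using p_gt_2 by auto
  then show ?thesis by simp
qed

lemma proj_rank1:
  assumes \<theta>: "\<theta> ^ (p - 1) = 1" "\<theta> \<noteq> 1"
  shows "rank1 (proj \<theta>)" "tr (proj \<theta>) = 1"
proof -
  have E: "ent (proj \<theta>) i j =
      (if i \<in> {1..<p} then cnj \<theta> ^ lg i else 0) * (if j \<in> {1..<p} then \<theta> ^ lg j / of_nat (p - 1) else 0)" for i j
  proof (cases "i < p \<and> j < p")
    case True
    then show ?thesis using ent_proj[OF _ _ \<theta>(1), of i j] ent_proj_0[of i j, OF _ _ _ \<theta>(1)] \<theta>(2)
      by (cases "i = 0 \<or> j = 0") auto
  next
    case False
    then show ?thesis using supp_proj[of \<theta>] by (auto simp: supp_def)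
  qed
  show "rank1 (proj \<theta>)" unfolding rank1_def by (intro exI allI) (rule E)
  have "tr (proj \<theta>) = (\<Sum>k\<in>{1..<p}. ent (proj \<theta>) k k)"
    unfolding tr_eq[OF supp_proj] sum_split using ent_proj_0[of 0 0, OF _ _ _ \<theta>(1)] \<theta>(2) p_pos by simp
  also have "\<dots> = (\<Sum>k\<in>{1..<p}. inverse (of_nat (p - 1)))"
  proof (intro sum.cong refl)
    fix k assume k: "k \<in> {1..<p}"
    have "cnj \<theta> ^ lg k * \<theta> ^ lg k = 1"
      using root_norm[OF \<theta>(1)] by (simp add: mult.commute flip: power_mult_distrib)
    then show "ent (proj \<theta>) k k = inverse (of_nat (p - 1))" using ent_proj[OF k k \<theta>(1)] by (simp add: divide_inverse)
  qed
  also have "\<dots> = 1" using p1 by simp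
  finally show "tr (proj \<theta>) = 1" .
qed

text \<open>On the plane of \<open>proj 1\<close> the Fourier matrix is an involution, because its
  square is the parity, itself a dilation. For \<delta> = 1 and \<delta> = - 1 this is the
  projection onto its \<delta>-eigenline.\<close>

definition half :: "complex \<Rightarrow> cmat" where
  "half \<delta> = sc (inverse 2) (proj 1 + sc \<delta> (proj 1 * dft))"

lemma ent_proj_dft:
  assumes ij: "i < p" "j < p"
  shows "ent (proj 1 * dft) i j =
    (if i = 0 \<or> j = 0 then 1 / rp else - 1 / (of_nat (p - 1) * rp))"
proof (cases "i = 0")
  case True
  have "ent (proj 1 * dft) i j = ent (proj 1) i 0 * ent dft 0 j"
    using ij True ent_proj_0[of 0 _ 1] by (intro ent_mult_row[of p]) (auto simp: p_pos)
  then show ?thesis using True ij p_pos ent_proj_0[of 0 0 1] by (simp add: dft_def)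
next
  case False
  then have i: "i \<in> {1..<p}" using ij by simp
  have "ent (proj 1 * dft) i j = (\<Sum>k\<in>{1..<p}. ent (proj 1) i k * ent dft k j)"
    unfolding ent_times[OF supp_proj] sum_split using ent_proj_0[of i 0 1] False ij p_pos by simp
  also have "\<dots> = (\<Sum>k\<in>{1..<p}. zeta p ^ (j * k) / (of_nat (p - 1) * rp))"
    using ij ent_proj[OF i, of _ 1] by (intro sum.cong refl) (simp add: dft_def mult.commute)
  also have "\<dots> = ((\<Sum>k<p. zeta p ^ (j * k)) - 1) / (of_nat (p - 1) * rp)"
    unfolding sum_split by (simp add: sum_divide_distrib)
  also have "(\<Sum>k<p. zeta p ^ (j * k)) = (if j = 0 then of_nat p else 0)"
    using ij by (auto simp: sum_zeta_multiples dest: dvd_imp_le)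
  finally show ?thesis using False p1 p_pos by (auto simp: of_nat_diff)
qed

lemma half_rank1:
  assumes \<delta>: "\<delta> = 1 \<or> \<delta> = - 1"
  shows "rank1 (half \<delta>)" "tr (half \<delta>) = 1"
proof -
  have \<delta>2: "\<delta> * \<delta> = 1" using \<delta> by auto
  have r0: "rp \<noteq> 0" by (rule rp)
  \<comment> \<open>This factorization of \<open>rp * rp - \<delta> * \<delta>\<close> turns the
    denominators \<open>p - 1\<close> into those of an outer product.\<close>
  have pm: "of_nat (p - 1) = (rp - \<delta>) * (rp + \<delta>)"
    using p_pos \<delta>2 rp(1) by (simp add: of_nat_diff algebra_simps)
  then have rd: "rp + \<delta> \<noteq> 0" "rp - \<delta> \<noteq> 0" using p1 by auto
  have h00: "ent (half \<delta>) 0 0 = (rp + \<delta>) / (2 * rp)"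
    using r0 p_pos ent_proj_0[of 0 0 1] ent_proj_dft[of 0 0] by (simp add: half_def field_simps)
  have h0: "ent (half \<delta>) i j = \<delta> / (2 * rp)" if "i < p" "j < p" "i = 0 \<or> j = 0" "i \<noteq> j" for i j
    using that r0 ent_proj_0[of i j 1] ent_proj_dft[of i j] by (auto simp: half_def field_simps)
  have h1: "ent (half \<delta>) i j = 1 / (2 * rp * (rp + \<delta>))" if "i \<in> {1..<p}" "j \<in> {1..<p}" for i j
  proof -
    have e1: "ent (proj 1) i j = 1 / of_nat (p - 1)" using ent_proj[OF that, of 1] by simp
    have e2: "ent (proj 1 * dft) i j = - 1 / (of_nat (p - 1) * rp)" using ent_proj_dft[of i j] that by simp
    have alg: "inverse 2 * (1 / M + \<delta> * (- 1 / (M * rp))) = (rp - \<delta>) / (2 * rp * M)" if "M \<noteq> 0" for M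
      using that r0 by (simp add: field_simps)
    have "ent (half \<delta>) i j = (rp - \<delta>) / (2 * rp * of_nat (p - 1))"
      unfolding half_def ent_sc ent_simps(2) e1 e2 by (rule alg[OF p1(1)])
    then show ?thesis unfolding pm using rd r0 by simp
  qed
  \<comment> \<open>\<open>a\<close> is twice the zeroth column of \<open>half \<delta>\<close>, and
    \<open>b\<close> is its zeroth row divided by \<open>a 0\<close>.\<close>
  define a where "a i = (if i < p then if i = 0 then (rp + \<delta>) / rp else \<delta> / rp else 0)" for i
  define b where "b j = (if j < p then if j = 0 then 1 / 2 else \<delta> / (2 * (rp + \<delta>)) else 0)" for j
  have "ent (half \<delta>) i j = a i * b j" for i j
  proof (cases "i < p \<and> j < p")
    case False
    then have "ent (proj 1) i j = 0" "ent (proj 1 * dft) i j = 0"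
      using supp_proj[of 1] supp_times[OF supp_proj supp_dft(1), of 1] by (auto simp: supp_def not_less)
    then show ?thesis using False by (auto simp: half_def a_def b_def)
  next
    case True
    consider "i = 0" "j = 0" | "i = 0" "j \<noteq> 0" | "i \<noteq> 0" "j = 0" | "i \<in> {1..<p}" "j \<in> {1..<p}" using True by fastforce
    then show ?thesis
    proof cases
      case 1
      then show ?thesis using h00 p_pos by (simp add: a_def b_def)
    next
      case 2
      have "a i * b j = (rp + \<delta>) / rp * (\<delta> / (2 * (rp + \<delta>)))" using 2 True by (simp add: a_def b_def)
      also have "\<dots> = \<delta> / (2 * rp)"
      proof -
        have "x / rp * (\<delta> / (2 * x)) = \<delta> / (2 * rp)" if "x \<noteq> 0" for x
          using that r0 by (simp add: field_simps)
        then show ?thesis using rd(1) by blast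
      qed
      finally show ?thesis using h0[of i j] True 2 by simp
    next
      case 3
      then show ?thesis using h0[of i j] True rd r0 by (simp add: a_def b_def)
    next
      case 4
      have "a i * b j = (\<delta> * \<delta>) / (rp * (2 * (rp + \<delta>)))" using 4 by (simp add: a_def b_def)
      then show ?thesis using h1[OF 4] by (simp add: \<delta>2 mult_ac)
    qed
  qed
  then show "rank1 (half \<delta>)" unfolding rank1_def by blast
  have s: "supp p (half \<delta>)" unfolding half_def by (intro supp_intros supp_times supp_proj supp_dft)
  have "tr (half \<delta>) = (rp + \<delta>) / (2 * rp) + of_nat (p - 1) * (1 / (2 * rp * (rp + \<delta>)))"
    unfolding tr_eq[OF s] sum_split h00 using h1 by simp
  also have "\<dots> = (rp + \<delta>) / (2 * rp) + (rp - \<delta>) / (2 * rp)"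
    unfolding pm using rd r0 by simp
  also have "\<dots> = 1" using r0 by (simp flip: add_divide_distrib)
  finally show "tr (half \<delta>) = 1" .
qed

lemma supp_half [simp, intro]: "supp p (half \<delta>)"
  unfolding half_def by (intro supp_intros supp_times supp_proj supp_dft)

lemma proj_sum: "(\<Sum>j<p - 1. proj (zeta (p - 1) ^ j)) = un p"
proof -
  interpret c: cyclotomic_integers "p - 1" by unfold_locales (use p1 in simp)
  have *: "(\<Sum>j<p - 1. cnj (zeta (p - 1) ^ j) ^ k) = (if k = 0 then of_nat (p - 1) else 0)" if k: "k < p - 1" for k
  proof (cases "k = 0")
    case False
    define x where "x = cnj (zeta (p - 1)) ^ k"
    have 1: "cnj (zeta (p - 1) ^ j) ^ k = x ^ j" for j
      by (simp add: x_def mult.commute flip: power_mult)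
    have "x ^ (p - 1) = cnj ((zeta (p - 1) ^ (p - 1)) ^ k)"
      by (simp add: x_def mult.commute flip: power_mult)
    then have 2: "x ^ (p - 1) = 1" unfolding c.zeta_N by simp
    have "x \<noteq> 1"
    proof
      assume "x = 1"
      then have "cnj (zeta (p - 1) ^ k) = cnj 1" by (simp add: x_def)
      then have "zeta (p - 1) ^ k = 1" by (simp only: complex_cnj_cancel_iff)
      then have "p - 1 dvd k" by (simp only: c.zeta_power_eq_1_iff)
      then show False using False k by (auto dest: dvd_imp_le)
    qed
    then show ?thesis unfolding 1 using sum_powers_root_of_unity[OF 2] False by simp
  qed simp
  have "(\<Sum>j<p - 1. proj (zeta (p - 1) ^ j)) =
    sc (inverse (of_nat (p - 1))) (\<Sum>j<p - 1. \<Sum>k<p - 1. sc (cnj (zeta (p - 1) ^ j) ^ k) (dm (g ^ k)))"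
    unfolding proj_def sc_sum ..
  also have "\<dots> = sc (inverse (of_nat (p - 1))) (\<Sum>k<p - 1. sc (\<Sum>j<p - 1. cnj (zeta (p - 1) ^ j) ^ k) (dm (g ^ k)))"
    by (subst sum.swap) (simp only: sc_sum(2))
  also have "(\<Sum>k<p - 1. sc (\<Sum>j<p - 1. cnj (zeta (p - 1) ^ j) ^ k) (dm (g ^ k))) =
    (\<Sum>k<p - 1. if k = 0 then sc (of_nat (p - 1)) (dm 1) else 0)"
    by (intro sum.cong refl) (simp only: * lessThan_iff, simp)
  also have "\<dots> = sc (of_nat (p - 1)) (un p)" using p1 dm_1 by simp
  finally show ?thesis using p1 by simp
qed

lemma half_sum: "half 1 + half (- 1) = proj 1"
proof -
  have "half 1 + half (- 1) = sc (inverse 2) (proj 1) + sc (inverse 2) (proj 1)"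
    by (simp add: half_def sc_add)
  also have "\<dots> = proj 1" by (simp add: sc_add(2)[symmetric])
  finally show ?thesis .
qed

definition Dsum :: cmat where "Dsum = (\<Sum>k<p - 1. dm (g ^ k))"

lemma Dsum_proj: "Dsum = sc (of_nat (p - 1)) (proj 1)"
  using p1 by (simp add: Dsum_def proj_def)

lemma supp_Dsum [simp, intro]: "supp p Dsum" by (simp add: Dsum_proj)

lemma Dsum_dm: assumes "u \<in> {1..<p}" shows "Dsum * dm u = Dsum"
proof -
  obtain k where "u = g ^ k mod p" using g_surj[OF assms] by blast
  then have "dm u = dm (g ^ k)" using dm_cong[OF cong_mod_p] by simp
  then show ?thesis using proj_eigen(2)[of 1 k] by (simp add: Dsum_proj)
qed

text \<open>Inversion permutes the dilations. Both sums absorb every dilation, so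
  \<open>I * Dsum\<close> can be computed in two ways.\<close>

lemma Dsum_inverse: "(\<Sum>k<p - 1. dm ((g ^ k) ^ (p - 2))) = Dsum"
proof -
  define I where "I = (\<Sum>k<p - 1. dm ((g ^ k) ^ (p - 2)))"
  have iD: "dm ((g ^ k) ^ (p - 2)) * Dsum = Dsum" for k
  proof -
    have "dm (g ^ k) * Dsum = Dsum" using proj_eigen(1)[of 1 k] by (simp add: Dsum_proj)
    then have "dm ((g ^ k) ^ (p - 2)) * Dsum = dm ((g ^ k) ^ (p - 2)) * dm (g ^ k) * Dsum" by (simp add: mult.assoc)
    then show ?thesis unfolding dm_inverse(2)[OF g_coprime] by simp
  qed
  have "I * Dsum = sc (of_nat (p - 1)) Dsum"
    unfolding I_def sum_distrib_right by (simp only: iD) (rule cmat_eqI, simp)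
  moreover have "I * Dsum = sc (of_nat (p - 1)) I"
  proof -
    have "dm (v ^ (p - 2)) * Dsum = Dsum * dm (v ^ (p - 2))" for v
      by (simp add: Dsum_def sum_distrib_left sum_distrib_right dm_mult mult.commute)
    have "I * dm (g ^ l) = I" for l
    proof -
      have "dm (g ^ k) = dm (((g ^ k) ^ (p - 2)) ^ (p - 2))" for k
      proof (rule dm_cong)
        have u: "[g ^ k * (g ^ k) ^ (p - 2) = 1] (mod p)" by (rule unit_inverse[OF g_coprime])
        have v: "[(g ^ k) ^ (p - 2) * ((g ^ k) ^ (p - 2)) ^ (p - 2) = 1] (mod p)"
          using g_coprime by (intro unit_inverse) simp
        have "[g ^ k * ((g ^ k) ^ (p - 2) * ((g ^ k) ^ (p - 2)) ^ (p - 2)) = g ^ k * 1] (mod p)"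
          by (intro cong_mult cong_refl v)
        moreover have "[g ^ k * (g ^ k) ^ (p - 2) * ((g ^ k) ^ (p - 2)) ^ (p - 2) = 1 * ((g ^ k) ^ (p - 2)) ^ (p - 2)] (mod p)"
          by (intro cong_mult cong_refl u)
        ultimately show "[g ^ k = ((g ^ k) ^ (p - 2)) ^ (p - 2)] (mod p)"
          by (metis (no_types, lifting) cong_sym cong_trans mult.assoc mult_1 mult_1_right)
      qed
      define h where "h = g ^ (p - 2)"
      have hk: "(g ^ k) ^ (p - 2) = h ^ k" for k by (simp add: h_def mult.commute flip: power_mult)
      have ho: "[h ^ (p - 1) = 1] (mod p)"
        using cong_pow[OF g_order, of "p - 2"] by (simp add: h_def mult.commute flip: power_mult)
      have Ih: "I * dm h = I"
      proof -
        have "I * dm h = (\<Sum>k<p - 1. dm (h ^ Suc k))"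
          by (simp add: I_def hk sum_distrib_right dm_mult mult.commute)
        also have "\<dots> = (\<Sum>k<p - 1. dm (h ^ k))"
          using sum.lessThan_Suc_shift[of "\<lambda>k. dm (h ^ k)" "p - 1"] sum.lessThan_Suc[of "\<lambda>k. dm (h ^ k)" "p - 1"]
            dm_cong[OF ho] by simp
        finally show ?thesis by (simp add: I_def hk)
      qed
      have Ihk: "I * dm (h ^ j) = I" for j
      proof (induction j)
        case 0
        have "supp p I" unfolding I_def by auto
        then show ?case using dm_1 by simp
      next
        case (Suc j)
        have "I * dm (h ^ Suc j) = I * dm h * dm (h ^ j)" by (simp add: dm_mult mult.assoc)
        then show ?case using Ih Suc by simp
      qed
      have "dm (g ^ l) = dm (h ^ (l * (p - 2)))"
        using \<open>\<And>k. dm (g ^ k) = dm (((g ^ k) ^ (p - 2)) ^ (p - 2))\<close>[of l] by (simp add: hk power_mult)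
      then show ?thesis using Ihk by simp
    qed
    then have "I * Dsum = (\<Sum>l<p - 1. I)" unfolding Dsum_def by (simp add: sum_distrib_left)
    then show ?thesis by (simp only:) (rule cmat_eqI, simp)
  qed
  ultimately have "sc (of_nat (p - 1)) I = sc (of_nat (p - 1)) Dsum" by simp
  then show ?thesis using sc_cancel[OF _ p1(1)] by (simp add: I_def)
qed

lemma dft_dm_g: "dft * dm (g ^ k) = dm ((g ^ k) ^ (p - 2)) * dft"
  by (rule dft_dm[OF unit_inverse[OF g_coprime]])

lemma dft_Dsum: "dft * Dsum = Dsum * dft"
proof -
  have "dft * Dsum = (\<Sum>k<p - 1. dm ((g ^ k) ^ (p - 2))) * dft"
    by (simp add: Dsum_def sum_distrib_left sum_distrib_right dft_dm_g)
  then show ?thesis by (simp only: Dsum_inverse)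
qed

lemma dft'_eq: "dft' = dm (p - 1) * dft"
proof -
  have "dm (p - 1) * dft * dft = un p" using parity_weyl by (simp add: mult.assoc dft_dft parity_def)
  then have "dm (p - 1) * dft * (dft * dft') = un p * dft'" by (metis mult.assoc)
  then show ?thesis by (simp add: dft_inverse supp_times)
qed

text \<open>The conjugating element is \<open>dft\<close>. It inverts dilations, so it carries the
  combination giving \<open>proj \<theta>\<close> to the combination of the inverses. It commutes
  with \<open>Dsum\<close>, hence with \<open>half \<delta>\<close>, and the inverses of the
  matrices \<open>dm (g ^ k) * dft\<close> again sum to \<open>Dsum * dft\<close>. The factor
  \<open>2 * (p - 1)\<close> clears the denominators of both kinds of projection.\<close>

lemma resolution_weyl:
  assumes R: "0 \<in> R" "1 \<in> R" "\<And>k. rp * zeta p ^ k \<in> R" and M: "4 dvd M" "p - 1 dvd M"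
    and B: "\<And>\<theta>. \<theta> ^ (p - 1) = 1 \<Longrightarrow> B (2 * \<theta>)" "B 1" "B (- 1)"
  shows "resolvable p WE R M B (2 * (p - 1))"
proof -
  let ?d = "of_nat (2 * (p - 1)) :: complex"
  have adm_dm: "adm p WE R M (dm (g ^ k)) (dm ((g ^ k) ^ (p - 2)))" for k
    unfolding adm_def using nrm_dm[OF g_coprime M(2)] R by (auto simp: dm_def intro!: exI[of _ 1])
  have ent_dd: "ent (dm (g ^ k) * dft) i j = zeta p ^ (((g ^ k) ^ (p - 2) * i) mod p * j) / rp" if ij: "i < p" "j < p" for i j k
  proof -
    define u where "u = (g ^ k) ^ (p - 2)"
    have u: "[u * g ^ k = 1] (mod p)" using unit_inverse[OF g_coprime, of k] by (simp only: u_def mult.commute)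
    define l where "l = (u * i) mod p"
    have "ent (dm (g ^ k) * dft) i j = ent (dm (g ^ k)) i l * ent dft l j"
      using ij dilate_iff[OF u, of i] by (intro ent_mult_row[of p]) (auto simp: dm_def l_def)
    also have "\<dots> = zeta p ^ (l * j) / rp"
      using ij dilate_iff[OF u, of i l] by (simp add: dm_def dft_def l_def)
    finally show ?thesis by (simp add: l_def u_def)
  qed
  have adm_dd: "adm p WE R M (dm (g ^ k) * dft) (dft' * dm ((g ^ k) ^ (p - 2)))" for k
  proof -
    have "of_nat p * ent (dm (g ^ k) * dft) i j \<in> R" for i j
    proof (cases "i < p \<and> j < p")
      case True
      have "of_nat p / rp = rp" using rp by (simp add: field_simps)
      then have "of_nat p * (x / rp) = rp * x" for x by (metis times_divide_eq_left times_divide_eq_right)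
      then show ?thesis using True R(3) by (simp add: ent_dd)
    next
      case False
      have "supp p (dm (g ^ k) * dft)" by (intro supp_times supp_dm supp_dft)
      then show ?thesis using False R(1) by (auto simp: supp_def not_less)
    qed
    then show ?thesis unfolding adm_def using nrm_dm_dft[OF g_coprime M(1)] p_pos by blast
  qed
  have idem_proj: "idem p WE R M B (2 * (p - 1)) (proj \<theta>)" if \<theta>: "\<theta> ^ (p - 1) = 1" "\<theta> \<noteq> 1" for \<theta>
  proof -
    have c: "(cnj \<theta> ^ k) ^ (p - 1) = 1" for k
    proof -
      have c0: "cnj \<theta> ^ (p - 1) = 1" using arg_cong[OF \<theta>(1), of cnj] by simp
      have "(cnj \<theta> ^ k) ^ (p - 1) = (cnj \<theta> ^ (p - 1)) ^ k" by (simp only: power_mult[symmetric] mult.commute)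
      then show ?thesis by (simp only: c0 power_one)
    qed
    have d: "?d * inverse (of_nat (p - 1)) = 2"
    proof -
      have *: "of_nat (2 * k) * inverse (of_nat k) = (2 :: complex)" if "k > 0" for k :: nat
        using that by (simp add: field_simps)
      show ?thesis by (rule *) (use p_gt_2 in simp)
    qed
    have U: "sc ?d (proj \<theta>) = (\<Sum>k<p - 1. sc (2 * cnj \<theta> ^ k) (dm (g ^ k)))"
      unfolding proj_def sc_simps(3) d by (simp add: sc_sum)
    have "dft * dm (g ^ k) * dft' = dm ((g ^ k) ^ (p - 2))" for k
      unfolding dft_dm_g by (simp add: mult.assoc dft_inverse)
    then have V: "sc ?d (dft * proj \<theta> * dft') = (\<Sum>k<p - 1. sc (2 * cnj \<theta> ^ k) (dm ((g ^ k) ^ (p - 2))))"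
    proof -
      have "sc ?d (dft * proj \<theta> * dft') = dft * sc ?d (proj \<theta>) * dft'" by simp
      also have "\<dots> = (\<Sum>k<p - 1. sc (2 * cnj \<theta> ^ k) (dft * dm (g ^ k) * dft'))"
        unfolding U by (simp add: sum_distrib_left sum_distrib_right)
      finally show ?thesis by (simp only: \<open>\<And>k. dft * dm (g ^ k) * dft' = dm ((g ^ k) ^ (p - 2))\<close>)
    qed
    have "combo B (adm p WE R M) (sc ?d (proj \<theta>)) (sc ?d (dft * proj \<theta> * dft'))"
      unfolding U V by (rule combo_sum) (use B(1)[OF c] adm_dm in auto)
    then show ?thesis unfolding idem_def using proj_rank1[OF \<theta>] nrm_dft[OF M(1)] by blast
  qed
  have idem_half: "idem p WE R M B (2 * (p - 1)) (half \<delta>)" if \<delta>: "\<delta> = 1 \<or> \<delta> = - 1" for \<delta>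
  proof -
    have d: "?d * inverse 2 = of_nat (p - 1)" by simp
    have U0: "sc ?d (half \<delta>) = Dsum + sc \<delta> (Dsum * dft)"
      unfolding half_def sc_simps(3) d Dsum_proj by (simp add: sc_add mult.commute)
    then have U: "sc ?d (half \<delta>) = (\<Sum>k<p - 1. sc 1 (dm (g ^ k))) + (\<Sum>k<p - 1. sc \<delta> (dm (g ^ k) * dft))"
      by (simp add: Dsum_def sum_distrib_right sc_sum)
    have sD: "supp p (Dsum * dft)" by (intro supp_times supp_Dsum supp_dft)
    have "sc ?d (dft * half \<delta> * dft') = dft * sc ?d (half \<delta>) * dft'" by simp
    also have "\<dots> = dft * Dsum * dft' + sc \<delta> (dft * Dsum * (dft * dft'))"
      unfolding U0 by (simp add: distrib_left distrib_right mult.assoc)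
    also have "dft * Dsum * dft' = Dsum" unfolding dft_Dsum by (simp add: mult.assoc dft_inverse)
    also have "dft * Dsum * (dft * dft') = Dsum * dft" unfolding dft_Dsum dft_inverse using sD by simp
    finally have V0: "sc ?d (dft * half \<delta> * dft') = Dsum + sc \<delta> (Dsum * dft)" .
    have "(\<Sum>k<p - 1. dft' * dm ((g ^ k) ^ (p - 2))) = dft' * Dsum"
      unfolding Dsum_inverse[symmetric] sum_distrib_left ..
    also have "\<dots> = dm (p - 1) * (Dsum * dft)" unfolding dft'_eq mult.assoc dft_Dsum ..
    also have "\<dots> = Dsum * dm (p - 1) * dft"
      by (simp add: Dsum_def sum_distrib_left sum_distrib_right dm_mult mult.commute flip: mult.assoc)
    also have "\<dots> = Dsum * dft" using p_gt_2 by (subst Dsum_dm) auto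
    finally have W: "(\<Sum>k<p - 1. dft' * dm ((g ^ k) ^ (p - 2))) = Dsum * dft" .
    have V: "sc ?d (dft * half \<delta> * dft') =
        (\<Sum>k<p - 1. sc 1 (dm ((g ^ k) ^ (p - 2)))) + (\<Sum>k<p - 1. sc \<delta> (dft' * dm ((g ^ k) ^ (p - 2))))"
      unfolding V0 W[symmetric] by (simp only: sc_simps(4) Dsum_inverse sc_sum(1))
    have "combo B (adm p WE R M) (sc ?d (half \<delta>)) (sc ?d (dft * half \<delta> * dft'))"
      unfolding U V by (intro combo_plus combo_sum) (use B \<delta> adm_dm adm_dd in auto)
    then show ?thesis unfolding idem_def using half_rank1[OF \<delta>] nrm_dft[OF M(1)] by blast
  qed
  interpret c: cyclotomic_integers "p - 1" by unfold_locales (use p1 in simp)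
  \<comment> \<open>The plane of the trivial character is split into its two halves, placed at the
    indices 0 and \<open>p - 1\<close>, which makes \<open>p\<close> idempotents in all.\<close>
  define \<epsilon> where "\<epsilon> j = (if j = 0 then half 1 else if j = p - 1 then half (- 1) else proj (zeta (p - 1) ^ j))" for j
  have "(\<Sum>j<p. \<epsilon> j) = un p"
  proof -
    have e1: "{..<p} = insert 0 (insert (p - 1) {1..<p - 1})" and e2: "{..<p - 1} = insert 0 {1..<p - 1}"
      using p_gt_2 by auto
    have "(\<Sum>j<p. \<epsilon> j) = half 1 + (half (- 1) + (\<Sum>j\<in>{1..<p - 1}. \<epsilon> j))"
      unfolding e1 using p_gt_2 by (simp add: \<epsilon>_def)
    also have "(\<Sum>j\<in>{1..<p - 1}. \<epsilon> j) = (\<Sum>j\<in>{1..<p - 1}. proj (zeta (p - 1) ^ j))"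
      by (intro sum.cong) (auto simp: \<epsilon>_def)
    also have "half 1 + (half (- 1) + (\<Sum>j\<in>{1..<p - 1}. proj (zeta (p - 1) ^ j))) = (\<Sum>j<p - 1. proj (zeta (p - 1) ^ j))"
      unfolding e2 by (simp add: half_sum flip: add.assoc)
    finally show ?thesis unfolding proj_sum .
  qed
  moreover have "idem p WE R M B (2 * (p - 1)) (\<epsilon> j)" if j: "j < p" for j
  proof -
    consider "j = 0" | "j = p - 1" | "0 < j" "j < p - 1" using j by linarith
    then show ?thesis
    proof cases
      case 3
      have "(zeta (p - 1) ^ j) ^ (p - 1) = (zeta (p - 1) ^ (p - 1)) ^ j" by (simp add: mult.commute flip: power_mult)
      then have "(zeta (p - 1) ^ j) ^ (p - 1) = 1" by (simp only: c.zeta_N power_one)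
      moreover have "zeta (p - 1) ^ j \<noteq> 1"
      proof
        assume "zeta (p - 1) ^ j = 1"
        then have "p - 1 dvd j" by (simp only: c.zeta_power_eq_1_iff)
        then show False using 3 by (auto dest: dvd_imp_le)
      qed
      ultimately show ?thesis using 3 idem_proj by (simp add: \<epsilon>_def)
    qed (use idem_half p_gt_2 in \<open>auto simp: \<epsilon>_def\<close>)
  qed
  ultimately show ?thesis unfolding resolvable_def by blast
qed

subsection \<open>The sign of the conjugate Gauss sum\<close>

lemma sum_over_root: "(\<Sum>x<p. f x) = f 0 + (\<Sum>k<p - 1. f (g ^ k mod p) :: complex)"
  unfolding sum_split sum.reindex_bij_betw[OF g, symmetric] ..

text \<open>\<open>g ^ u\<close> squares to 1 and is not 1, because \<open>u\<close> is positive and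
  below the order of \<open>g\<close>.\<close>

lemma g_half: assumes "p - 1 = 2 * u" shows "[g ^ u + 1 = 0] (mod p)"
proof -
  have u: "u < p - 1" "u > 0" using assms p_gt_2 by auto
  have e: "(g ^ u) ^ 2 = g ^ (p - 1)" unfolding assms power_mult[symmetric] by (simp only: mult.commute)
  have "[(g ^ u) ^ 2 = 1] (mod p)" unfolding e by (rule g_order)
  then have "[int ((g ^ u) ^ 2) = int 1] (mod int p)" by (simp only: cong_int_iff)
  then have "int p dvd int ((g ^ u) ^ 2) - int 1" by (simp only: cong_iff_dvd_diff)
  moreover have "int ((g ^ u) ^ 2) - int 1 = (int (g ^ u) + 1) * (int (g ^ u) - 1)"
    by (simp add: power2_eq_square algebra_simps)
  ultimately have "int p dvd int (g ^ u) + 1 \<or> int p dvd int (g ^ u) - 1"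
    using p_prime by (metis prime_dvd_mult_iff prime_nat_int_transfer)
  moreover have "\<not> int p dvd int (g ^ u) - 1"
  proof
    assume "int p dvd int (g ^ u) - 1"
    then have "[int (g ^ u) = int 1] (mod int p)" by (simp only: cong_iff_dvd_diff of_nat_1)
    then have "[g ^ u = 1] (mod p)" by (simp only: cong_int_iff)
    then have "g ^ u mod p = g ^ 0 mod p" by (simp add: cong_def)
    then have "u = 0" by (rule g_inj[OF u(1) p1(2)])
    then show False using u(2) by simp
  qed
  ultimately have "int p dvd int (g ^ u + 1)" by (metis of_nat_1 of_nat_add)
  then have "p dvd g ^ u + 1" by (simp only: of_nat_dvd_iff)
  then show ?thesis by (simp only: cong_0_iff)
qed

lemma zeta_neg: assumes "p - 1 = 2 * u" shows "cnj (zeta p ^ a) = zeta p ^ (g ^ u * a)"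
proof -
  have "[g ^ u * a + a = 0 * a] (mod p)" using cong_mult[OF g_half[OF assms] cong_refl, of a] by (simp add: distrib_right add.commute)
  then have "zeta p ^ (g ^ u * a) * zeta p ^ a = 1"
    using zeta_power_cong by (metis mult_zero_left power_0 power_add)
  moreover have "zeta p ^ a * cnj (zeta p ^ a) = 1" using zeta_cnj by (simp flip: power_mult_distrib)
  ultimately show ?thesis by (metis mult.commute mult.left_commute mult_1_right)
qed

text \<open>In terms of the primitive root the sum runs over even powers of \<open>g\<close>, and
  conjugation multiplies the exponent by \<open>g ^ u\<close>. For even \<open>u\<close> this
  permutes the even powers; for odd \<open>u\<close> it exchanges them with the odd ones, and the
  sum over all nonzero residues is -1.\<close>

lemma gauss_conj:
  assumes u: "p - 1 = 2 * u"
  shows "even u \<Longrightarrow> cnj gauss = gauss" "odd u \<Longrightarrow> cnj gauss = - gauss"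
proof -
  define h where "h k = zeta p ^ (g ^ k)" for k
  have per: "h (k + 2 * u) = h k" for k
  proof -
    have "[g ^ k * g ^ (2 * u) = g ^ k * 1] (mod p)" using g_order unfolding u by (intro cong_mult cong_refl)
    then show ?thesis unfolding h_def power_add by (intro zeta_power_cong) simp
  qed
  have per': "h (k + 2 * u * j) = h k" for k j
  proof (induction j)
    case (Suc j)
    have "h (k + 2 * u * Suc j) = h ((k + 2 * u * j) + 2 * u)" by (simp add: algebra_simps)
    then show ?case using per Suc by simp
  qed simp
  have hmod: "h (k mod (2 * u)) = h k" for k
    using per'[of "k mod (2 * u)" "k div (2 * u)"] by simp
  have u0: "u > 0" using u p_gt_2 by simp
  have sq: "(\<Sum>x<p. zeta p ^ (x ^ 2 * g ^ c)) = 1 + (\<Sum>k<2 * u. h (2 * k + c))" for c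
  proof -
    have "zeta p ^ ((g ^ k mod p) ^ 2 * g ^ c) = h (2 * k + c)" for k
    proof -
      have "[(g ^ k mod p) ^ 2 * g ^ c = (g ^ k) ^ 2 * g ^ c] (mod p)"
        by (intro cong_mult cong_pow cong_mod_p cong_refl)
      moreover have "(g ^ k) ^ 2 * g ^ c = g ^ (2 * k + c)" by (simp add: power_add mult.commute flip: power_mult)
      ultimately show ?thesis unfolding h_def using zeta_power_cong by simp
    qed
    then show ?thesis unfolding sum_over_root u by simp
  qed
  have G: "gauss = 1 + (\<Sum>k<2 * u. h (2 * k))" using sq[of 0] by (simp add: gauss_def)
  have cG: "cnj gauss = 1 + (\<Sum>k<2 * u. h (2 * k + u))"
    unfolding sq[symmetric] gauss_def cnj_sum by (intro sum.cong refl) (simp only: zeta_neg[OF u] mult.commute)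
  {
    assume "even u"
    then obtain v where v: "u = 2 * v" by auto
    have "(\<Sum>k<2 * u. h (2 * k)) = (\<Sum>k<2 * u. h (2 * ((k + v) mod (2 * u))))"
      using sum.reindex_bij_betw[OF bij_betw_add_mod[of "2 * u" v], of "\<lambda>k. h (2 * k)"] u0 by simp
    also have "\<dots> = (\<Sum>k<2 * u. h (2 * k + u))"
    proof (intro sum.cong refl)
      fix k
      have "h (2 * ((k + v) mod (2 * u))) = h ((2 * ((k + v) mod (2 * u))) mod (2 * u))" by (simp only: hmod)
      also have "(2 * ((k + v) mod (2 * u))) mod (2 * u) = (2 * (k + v)) mod (2 * u)" by (rule mod_mult_right_eq)
      also have "h \<dots> = h (2 * (k + v))" by (rule hmod)
      finally show "h (2 * ((k + v) mod (2 * u))) = h (2 * k + u)" by (simp add: v)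
    qed
    finally show "cnj gauss = gauss" using G cG by simp
  }
  {
    assume "odd u"
    then obtain v where v: "u = 2 * v + 1" by (auto elim: oddE)
    have "(\<Sum>k<2 * u. h (2 * k + 1)) = (\<Sum>k<2 * u. h (2 * ((k + v) mod (2 * u)) + 1))"
      using sum.reindex_bij_betw[OF bij_betw_add_mod[of "2 * u" v], of "\<lambda>k. h (2 * k + 1)"] u0 by simp
    also have "\<dots> = (\<Sum>k<2 * u. h (2 * k + u))"
    proof (intro sum.cong refl)
      fix k
      have "[2 * ((k + v) mod (2 * u)) + 1 = 2 * (k + v) + 1] (mod (2 * u))"
        by (intro cong_add cong_mult cong_refl) (simp add: cong_def)
      then have "h (2 * ((k + v) mod (2 * u)) + 1) = h (2 * (k + v) + 1)"
        using hmod unfolding cong_def by metis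
      then show "h (2 * ((k + v) mod (2 * u)) + 1) = h (2 * k + u)" by (simp add: v)
    qed
    finally have odd_sum: "(\<Sum>k<2 * u. h (2 * k + u)) = (\<Sum>k<2 * u. h (2 * k + 1))" by simp
    have "(\<Sum>k<2 * (2 * u). h k) = (\<Sum>k<2 * u. h (2 * k)) + (\<Sum>k<2 * u. h (2 * k + 1))"
    proof -
      have "(\<Sum>k<2 * n. h k) = (\<Sum>k<n. h (2 * k)) + (\<Sum>k<n. h (2 * k + 1))" for n
        by (induction n) (simp_all add: algebra_simps)
      then show ?thesis .
    qed
    moreover have "(\<Sum>k<2 * (2 * u). h k) = 2 * (\<Sum>k<2 * u. h k)"
    proof -
      have "(\<Sum>k<j + n. h k) = (\<Sum>k<j. h k) + (\<Sum>k<n. h (k + j))" for j n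
        by (induction n) (simp_all add: add.assoc add.commute[of j])
      from this[of "2 * u" "2 * u"] have "(\<Sum>k<2 * u + 2 * u. h k) = (\<Sum>k<2 * u. h k) + (\<Sum>k<2 * u. h k)"
        by (simp only: per)
      then show ?thesis by (simp only: mult_2)
    qed
    moreover have "(\<Sum>k<2 * u. h k) = - 1"
    proof -
      have "(\<Sum>x<p. zeta p ^ (1 * x)) = 0" unfolding sum_zeta_multiples using p_gt_2 by simp
      moreover have "(\<Sum>x<p. zeta p ^ (1 * x)) = 1 + (\<Sum>k<2 * u. h k)"
        unfolding sum_over_root u h_def by (simp add: zeta_power_cong[OF cong_mod_p])
      ultimately show ?thesis by (simp add: eq_neg_iff_add_eq_0 add.commute)
    qed
    ultimately have sum2: "(\<Sum>k<2 * u. h (2 * k)) + (\<Sum>k<2 * u. h (2 * k + 1)) = - 2"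
      by (metis mult_minus1_right)
    have "gauss + cnj gauss = (1 + (\<Sum>k<2 * u. h (2 * k))) + (1 + (\<Sum>k<2 * u. h (2 * k + 1)))"
      by (subst cG, subst G) (simp only: odd_sum)
    also have "\<dots> = 2 + ((\<Sum>k<2 * u. h (2 * k)) + (\<Sum>k<2 * u. h (2 * k + 1)))" by simp
    also have "\<dots> = 0" unfolding sum2 by simp
    finally have "gauss + cnj gauss = 0" .
    then show "cnj gauss = - gauss" by (simp add: add_eq_0_iff)
  }
qed

text \<open>\<open>rp\<close> and the Gauss sum have the same square up to sign, so they differ by a
  fourth root of unity; which one is left open.\<close>

lemma rp_gauss:
  obtains c where "rp = c * gauss" "c = 1 \<or> c = - 1 \<or> odd ((p - 1) div 2) \<and> (c = \<i> \<or> c = - \<i>)"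
proof -
  have "odd p" using p_prime p_gt_2 prime_odd_nat by blast
  then have u: "p - 1 = 2 * ((p - 1) div 2)" by simp
  have g0: "gauss \<noteq> 0" using gauss_norm p_pos by auto
  show ?thesis
  proof (cases "even ((p - 1) div 2)")
    case True
    then have "rp * rp = gauss * gauss" using gauss_norm gauss_conj(1)[OF u] rp by simp
    then have "rp = gauss \<or> rp = - gauss" by (simp only: square_eq_iff)
    then have "rp = 1 * gauss \<or> rp = - 1 * gauss" by simp
    then show ?thesis using that by blast
  next
    case False
    then have "- (gauss * gauss) = rp * rp" using gauss_norm gauss_conj(2)[OF u] rp by simp
    moreover have "(\<i> * gauss) * (\<i> * gauss) = (\<i> * \<i>) * (gauss * gauss)" by (simp only: mult_ac)
    ultimately have "rp * rp = (\<i> * gauss) * (\<i> * gauss)" by simp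
    then have "rp = \<i> * gauss \<or> rp = - (\<i> * gauss)" by (simp only: square_eq_iff)
    then have "rp = \<i> * gauss \<or> rp = - \<i> * gauss" by simp
    then show ?thesis using that False by blast
  qed
qed

end

lemma (in odd_prime) primitive_root: obtains g where "odd_prime_root p g"
proof -
  have "odd p" using p_prime p_gt_2 prime_odd_nat by blast
  then obtain g where all: "\<forall>k>0. residue_primroot (p ^ k) g"
    using residue_primroot_odd_prime_power_exists[OF p_prime] by blast
  have "residue_primroot (p ^ 1) g" by (rule all[rule_format]) simp
  then have g: "residue_primroot p g" by simp
  have "bij_betw (\<lambda>i. g ^ i mod p) {..<totient p} (totatives p)"
    using residue_primroot_is_generator[OF _ g] p_gt_2 by simp
  moreover have "totatives p = {1..<p}"
    unfolding totatives_prime[OF p_prime] by (simp add: set_eq_iff Suc_le_eq)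
  ultimately have "bij_betw (\<lambda>i. g ^ i mod p) {..<p - 1} {1..<p}" using totient_prime[OF p_prime] by simp
  then have "odd_prime_root p g" by unfold_locales
  then show ?thesis using that by blast
qed

section \<open>The extraspecial group and its Clifford group\<close>

context odd_prime
begin

text \<open>\<open>EE 0\<close> lacks the scalars demanded by \<open>heis\<close>, so the inductions
  start from \<open>EE 1 = WE\<close>.\<close>

fun EE :: "nat \<Rightarrow> cmat set" where
  "EE 0 = {un 1}"
| "EE (Suc m) = krs (p ^ m) WE (EE m)"

lemma WE_supp: "e \<in> WE \<Longrightarrow> supp p e" by (auto simp: WE_def)

lemma EE_1: "EE 1 = WE"
proof -
  have "kr 1 e (un 1) = e" if "e \<in> WE" for e by (rule kr_one[OF WE_supp[OF that]])
  then have "(\<lambda>(A, B). kr 1 A B) ` (WE \<times> {un 1}) = WE" by force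
  then show ?thesis by (simp add: krs_def)
qed

lemma heis_EE: "m \<ge> 1 \<Longrightarrow> heis p (p ^ m) m (EE m)"
proof (induction m rule: nat_induct_at_least)
  case base
  show ?case using heis_weyl by (simp only: EE_1 power_one_right)
next
  case (Suc m)
  show ?case using heis_kr[OF heis_weyl Suc.IH] by simp
qed

lemma EE_supp:
  assumes "m \<ge> 1" "e \<in> EE m"
  shows "supp (p ^ m) e"
proof -
  interpret h: heis p "p ^ m" m "EE m" by (rule heis_EE[OF assms(1)])
  show ?thesis using assms(2) by (rule h.E_supp)
qed

lemma parity_EE: "m \<ge> 1 \<Longrightarrow> \<exists>t. parity p (p ^ m) (EE m) t"
proof (induction m rule: nat_induct_at_least)
  case base
  show ?case using parity_weyl by (simp only: EE_1 power_one_right) blast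
next
  case (Suc m)
  then obtain t where "parity p (p ^ m) (EE m) t" by blast
  from parity_kr[OF _ EE_supp[OF Suc.hyps] parity_weyl this] show ?case using p_pos by auto
qed

lemma resolution_EE:
  assumes R: "0 \<in> R" "1 \<in> R" "\<And>k. rp * zeta p ^ k \<in> R" "\<And>a b. a \<in> R \<Longrightarrow> b \<in> R \<Longrightarrow> a * b \<in> R"
    and M: "4 dvd M" "p - 1 dvd M"
    and B: "\<And>\<theta>. \<theta> ^ (p - 1) = 1 \<Longrightarrow> B (2 * \<theta>)" "B 1" "B (- 1)" "\<And>a b. B a \<Longrightarrow> B b \<Longrightarrow> B (a * b)"
  shows "m \<ge> 1 \<Longrightarrow> \<exists>d. coprime d p \<and> resolvable (p ^ m) (EE m) R M B d"
proof (induction m rule: nat_induct_at_least)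
  case base
  obtain g where "odd_prime_root p g" using primitive_root .
  then interpret odd_prime_root p g .
  have "coprime (2 * (p - 1)) p" using coprime_less_p[of 2] coprime_less_p[of "p - 1"] p_gt_2 by simp
  then show ?case using resolution_weyl[OF R(1-3) M B(1-3)] by (simp only: EE_1 power_one_right) blast
next
  case (Suc m)
  then obtain d where d: "coprime d p" "resolvable (p ^ m) (EE m) R M B d" by blast
  obtain g where "odd_prime_root p g" using primitive_root .
  then interpret odd_prime_root p g .
  have "coprime (2 * (p - 1)) p" using coprime_less_p[of 2] coprime_less_p[of "p - 1"] p_gt_2 by simp
  then have "coprime (2 * (p - 1) * d) p" using d by simp
  moreover have "resolvable (p * p ^ m) (krs (p ^ m) WE (EE m)) R M B (2 * (p - 1) * d)"
    using p_pos by (intro resolution_kr[OF _ EE_supp[OF Suc.hyps] R(4) B(4) resolution_weyl[OF R(1-3) M B(1-3)] d(2)]) auto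
  ultimately show ?case by (intro exI[of _ "2 * (p - 1) * d"]) simp
qed

lemma emb_XZ: "emb (X_mat p) = weyl 0 1 0" "emb (Z_mat p) = weyl 0 0 1"
proof -
  show "emb (X_mat p) = weyl 0 1 0"
    by (rule cm_eqI[of p]) (auto simp: ent_emb X_mat_def weyl_def supp_def)
  have "zeta p ^ j = cis (2 * pi * real j / real p)" for j
    by (simp add: zeta_def DeMoivre mult_ac)
  then show "emb (Z_mat p) = weyl 0 0 1"
    by (intro cm_eqI[of p]) (auto simp: ent_emb Z_mat_def weyl_def supp_def)
qed

lemma E1_carrier: "A \<in> E1_group p \<Longrightarrow> A \<in> carrier (GL p)"
  unfolding E1_group_def
  by (rule group.generate_in_carrier[OF group_GL]) (use p_pos X_mat_GL Z_mat_GL in auto)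

lemma GL_carrier_mat: "A \<in> carrier (GL n) \<Longrightarrow> A \<in> carrier_mat n n" by (simp add: GL_iff)

lemma GL_inv:
  assumes A: "A \<in> carrier (GL n)"
  shows "emb A * emb (inv\<^bsub>GL n\<^esub> A) = un n" "emb (inv\<^bsub>GL n\<^esub> A) * emb A = un n"
    "inv\<^bsub>GL n\<^esub> A \<in> carrier_mat n n"
proof -
  interpret group "GL n" by (rule group_GL)
  have c: "inv\<^bsub>GL n\<^esub> A \<in> carrier (GL n)" using A by simp
  then show i: "inv\<^bsub>GL n\<^esub> A \<in> carrier_mat n n" by (rule GL_carrier_mat)
  have "A * inv\<^bsub>GL n\<^esub> A = 1\<^sub>m n" "inv\<^bsub>GL n\<^esub> A * A = 1\<^sub>m n"
    using r_inv[OF A] l_inv[OF A] by (simp_all add: GL_simps)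
  then show "emb A * emb (inv\<^bsub>GL n\<^esub> A) = un n" "emb (inv\<^bsub>GL n\<^esub> A) * emb A = un n"
    using i GL_carrier_mat[OF A] by (simp_all add: emb_one flip: emb_mult)
qed

lemma emb_E1: "emb ` E1_group p = WE"
proof
  interpret h: heis p p 1 WE by (rule heis_weyl)
  have sub: "{X_mat p, Z_mat p} \<subseteq> carrier (GL p)" using p_pos X_mat_GL Z_mat_GL by auto
  have "emb A \<in> WE" if "A \<in> generate (GL p) {X_mat p, Z_mat p}" for A
    using that
  proof (induction rule: generate.induct)
    case one
    show ?case by (simp add: GL_simps emb_one h.E_un)
  next
    case (incl h)
    then show ?case by (auto simp: emb_XZ)
  next
    case (inv A)
    then have A: "A \<in> carrier (GL p)" "emb A \<in> WE" using sub by (auto simp: emb_XZ)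
    have "emb (inv\<^bsub>GL p\<^esub> A) = adj (emb A) * emb A * emb (inv\<^bsub>GL p\<^esub> A)"
      using A supp_emb[OF GL_inv(3)[OF A(1)]] by simp
    also have "\<dots> = adj (emb A)" by (simp only: mult.assoc GL_inv(1)[OF A(1)] un_times(2)[OF h.E_supp[OF h.E_adj[OF A(2)]]])
    finally show ?case using A by auto
  next
    case (eng A B)
    then have "A \<in> carrier_mat p p" "B \<in> carrier_mat p p"
      using E1_carrier GL_carrier_mat unfolding E1_group_def by blast+
    then show ?case using eng.IH by (auto simp: GL_simps emb_mult)
  qed
  then show "emb ` E1_group p \<subseteq> WE" unfolding E1_group_def by blast
  have mult: "x * y \<in> emb ` E1_group p" if xy: "x \<in> emb ` E1_group p" "y \<in> emb ` E1_group p" for x y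
  proof -
    obtain A B where AB: "A \<in> E1_group p" "B \<in> E1_group p" "x = emb A" "y = emb B" using xy by blast
    then have "A * B \<in> E1_group p" unfolding E1_group_def using generate.eng[of A "GL p" _ B] by (simp add: GL_simps)
    moreover have "emb (A * B) = x * y" 
      using AB emb_mult[OF GL_carrier_mat[OF E1_carrier[OF AB(1)]] GL_carrier_mat[OF E1_carrier[OF AB(2)]]] by simp
    ultimately show ?thesis by (metis imageI)
  qed
  have un: "un p \<in> emb ` E1_group p"
    using generate.one[of "GL p" "{X_mat p, Z_mat p}"] unfolding E1_group_def
    by (metis GL_simps(2) emb_one imageI)
  have X: "weyl 0 1 0 \<in> emb ` E1_group p" and Z: "weyl 0 0 1 \<in> emb ` E1_group p"
    unfolding E1_group_def emb_XZ[symmetric] by (auto intro: generate.incl)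
  have pow: "mpow p x k \<in> emb ` E1_group p" if "x \<in> emb ` E1_group p" for x k
    by (induction k) (use that mult un in auto)
  \<comment> \<open>The commutator of clock and shift, with inverses written as
    \<open>(p - 1)\<close>-th powers, is the scalar \<open>zeta p\<close>.\<close>
  have "weyl 0 0 1 * weyl 0 1 0 * mpow p (weyl 0 0 1) (p - 1) * mpow p (weyl 0 1 0) (p - 1) = weyl 1 0 0"
    unfolding mpow_weyl weyl_mult
  proof (rule weyl_cong)
    have p1: "Suc (p - 1) = p" using p_pos by simp
    show "[0 + 0 + 1 * 1 + ((p - 1) * 0 + 1 * 0 * (p - 1 choose 2)) + (1 + 0) * ((p - 1) * 0) +
        ((p - 1) * 0 + 0 * 1 * (p - 1 choose 2)) + (1 + 0 + (p - 1) * 1) * ((p - 1) * 1) = 1] (mod p)"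
      using p1 p_gt_2 by (simp add: cong_def mod_Suc)
  qed (use p_pos in \<open>auto simp: cong_0_iff\<close>)
  then have C: "weyl 1 0 0 \<in> emb ` E1_group p" using mult[OF mult[OF mult[OF Z X] pow[OF Z]] pow[OF X]] by metis
  show "WE \<subseteq> emb ` E1_group p"
  proof
    fix e assume "e \<in> WE"
    then obtain c a b where e: "e = weyl c a b" by (auto simp: WE_def)
    have "mpow p (weyl 1 0 0) c * mpow p (weyl 0 1 0) a * mpow p (weyl 0 0 1) b = weyl c a b"
      by (simp add: mpow_weyl weyl_mult)
    then show "e \<in> emb ` E1_group p" unfolding e using mult[OF mult[OF pow[OF C] pow[OF X]] pow[OF Z]] by metis
  qed
qed

lemma E_group_carrier: "A \<in> E_group p m \<Longrightarrow> A \<in> carrier_mat (p ^ m) (p ^ m)"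
  using E_group_GL[OF p_pos] GL_carrier_mat by blast

lemma E_group_Suc: "E_group p (Suc m) = (\<lambda>(A, B). kronecker A B) ` (E1_group p \<times> E_group p m)"
proof (intro equalityI subsetI)
  fix x assume "x \<in> E_group p (Suc m)"
  then obtain As where As: "x = foldr kronecker As (1\<^sub>m 1)" "length As = Suc m" "set As \<subseteq> E1_group p"
    unfolding E_group_def by blast
  then obtain A Bs where "As = A # Bs" by (cases As) auto
  then show "x \<in> (\<lambda>(A, B). kronecker A B) ` (E1_group p \<times> E_group p m)"
    using As unfolding E_group_def by (intro image_eqI[of _ _ "(A, foldr kronecker Bs (1\<^sub>m 1))"]) auto
next
  fix x assume "x \<in> (\<lambda>(A, B). kronecker A B) ` (E1_group p \<times> E_group p m)"
  then obtain A Bs where "A \<in> E1_group p" "length Bs = m" "set Bs \<subseteq> E1_group p"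
    "x = kronecker A (foldr kronecker Bs (1\<^sub>m 1))" unfolding E_group_def by auto
  then show "x \<in> E_group p (Suc m)" unfolding E_group_def by (intro CollectI exI[of _ "A # Bs"]) auto
qed

lemma emb_E_group: "emb ` E_group p m = EE m"
proof (induction m)
  case 0
  have "E_group p 0 = {1\<^sub>m 1}" by (auto simp: E_group_def)
  then show ?case by (simp add: emb_one)
next
  case (Suc m)
  have k: "emb (kronecker A B) = kr (p ^ m) (emb A) (emb B)" if "A \<in> E1_group p" "B \<in> E_group p m" for A B
    using that p_pos by (intro emb_kronecker[of _ p]) (auto intro: GL_carrier_mat E1_carrier E_group_carrier)
  have "emb ` E_group p (Suc m) = (\<lambda>(A, B). kr (p ^ m) (emb A) (emb B)) ` (E1_group p \<times> E_group p m)"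
    unfolding E_group_Suc image_image by (intro image_cong refl) (auto simp: k)
  also have "\<dots> = krs (p ^ m) (emb ` E1_group p) (emb ` E_group p m)"
    unfolding krs_def by force
  finally show ?case by (simp add: emb_E1 Suc)
qed

lemma zint_cyclotomic: assumes "z \<in> zint p" "a > 0" shows "z \<in> cyclotomic_field (a * p)"
proof -
  let ?F = "cyclotomic_field (a * p)"
  have pw: "x ^ k \<in> ?F" if "x \<in> ?F" for x k
    by (induction k) (use that cyclotomic_field_closed(2) cyclotomic_field_closed(3)[of 1] in auto)
  have "zeta p = cis (2 * pi / real (a * p)) ^ a"
    using assms(2) by (simp add: zeta_def DeMoivre)
  then have z: "zeta p \<in> ?F" using pw[OF cyclotomic_field_closed(4)[of "a * p"], of a] by simp
  obtain c :: "nat \<Rightarrow> int" where c: "z = (\<Sum>i<p. of_int (c i) * zeta p ^ i)" using zint_coeffs[OF assms(1)] .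
  have "(\<Sum>i\<in>S. of_int (c i) * zeta p ^ i) \<in> ?F" if "finite S" for S
    using that
  proof (induction S)
    case empty
    show ?case using cyclotomic_field_closed(3)[of 0] by simp
  next
    case (insert x S)
    have "of_int (c x) \<in> ?F" using cyclotomic_field_closed(3)[of "of_int (c x)"] by simp
    then show ?case using insert cyclotomic_field_closed(1,2) pw[OF z] by simp
  qed
  then show ?thesis unfolding c by simp
qed

end

text \<open>The last hypothesis places the entries in the field of \<open>p\<close>-th roots of
  unity, inside the field that defines the Clifford group. \<open>normz_rescale\<close> can provide
  it because it divides by a Gauss sum instead of the square root of \<open>p\<close>.\<close>

lemma (in odd_prime) clifford_memI:
  assumes m: "m \<ge> 1" and nz: "heis.normz (p ^ m) (EE m) a a'"
    and u: "a * adj a = un (p ^ m)" and r: "r > 0" "mpow (p ^ m) a r = un (p ^ m)"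
    and d: "d > 0" "\<And>i j. of_nat d * ent a i j \<in> zint p"
  obtains A where "A \<in> clifford_group p m" "emb A = a"
proof -
  interpret h: heis p "p ^ m" m "EE m" by (rule heis_EE[OF m])
  let ?n = "p ^ m" and ?E = "E_group p m"
  interpret G: group "GL ?n" by (rule group_GL)
  note nd = h.normzD[OF nz]
  obtain A where A: "A \<in> carrier_mat ?n ?n" "emb A = a" using emb_surj[OF nd(1)] .
  obtain A' where A': "A' \<in> carrier_mat ?n ?n" "emb A' = a'" using emb_surj[OF nd(2)] .
  have AA: "A * A' = 1\<^sub>m ?n" "A' * A = 1\<^sub>m ?n"
    by (rule emb_inj[of _ ?n]; use A A' nd in \<open>simp add: emb_mult[of _ ?n] emb_one\<close>)+
  have AGL: "A \<in> carrier (GL ?n)" "A' \<in> carrier (GL ?n)" using A A' AA by (auto simp: GL_iff)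
  have inv: "inv\<^bsub>GL ?n\<^esub> A = A'" using AGL AA by (intro G.inv_equality) (auto simp: GL_simps)
  have E: "?E \<subseteq> carrier (GL ?n)" by (rule E_group_GL[OF p_pos])
  have memE: "X \<in> ?E" if X: "X \<in> carrier_mat ?n ?n" "emb X \<in> EE m" for X
  proof -
    obtain Y where "Y \<in> ?E" "emb Y = emb X" using X(2) unfolding emb_E_group[symmetric] by (metis imageE)
    then show ?thesis using emb_inj[OF E_group_carrier X(1)] by metis
  qed
  have conj1: "A * H * A' \<in> ?E" if H: "H \<in> ?E" for H
  proof (rule memE)
    show "A * H * A' \<in> carrier_mat ?n ?n" using A A' E_group_carrier[OF H] by simp
    have "emb (A * H * A') = a * emb H * a'" using A A' E_group_carrier[OF H] by (simp add: emb_mult[of _ ?n] mult.assoc)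
    then show "emb (A * H * A') \<in> EE m" using nd(5)[of "emb H"] H emb_E_group[of m] by auto
  qed
  have conj2: "A' * H * A \<in> ?E" if H: "H \<in> ?E" for H
  proof (rule memE)
    show "A' * H * A \<in> carrier_mat ?n ?n" using A A' E_group_carrier[OF H] by simp
    have "emb (A' * H * A) = a' * emb H * a" using A A' E_group_carrier[OF H] by (simp add: emb_mult[of _ ?n] mult.assoc)
    then show "emb (A' * H * A) \<in> EE m"
      using h.normzD(5)[OF h.normz_sym[OF nz], of "emb H"] H emb_E_group[of m] by auto
  qed
  have "A <#\<^bsub>GL ?n\<^esub> ?E #>\<^bsub>GL ?n\<^esub> inv\<^bsub>GL ?n\<^esub> A = (\<lambda>H. A * H * A') ` ?E"
    unfolding l_coset_def r_coset_def inv by (auto simp: GL_simps)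
  also have "\<dots> = ?E"
  proof
    show "(\<lambda>H. A * H * A') ` ?E \<subseteq> ?E" using conj1 by blast
    show "?E \<subseteq> (\<lambda>H. A * H * A') ` ?E"
    proof
      fix H assume H: "H \<in> ?E"
      have "emb (A * (A' * H * A) * A') = a * (a' * emb H * a) * a'"
        using A A' E_group_carrier[OF H] by (simp add: emb_mult[of _ ?n] mult.assoc)
      also have "\<dots> = emb H" using h.conj_cancel[OF nd(3) supp_emb[OF E_group_carrier[OF H]]] .
      finally have "A * (A' * H * A) * A' = H"
        using A A' E_group_carrier[OF H] by (intro emb_inj[of _ ?n]) auto
      then show "H \<in> (\<lambda>H. A * H * A') ` ?E" using conj2[OF H] by (metis imageI)
    qed
  qed
  finally have "A \<in> normalizer (GL ?n) ?E" using E AGL by (simp add: normalizer_def stabilizer_def)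
  moreover have "A * mat_adjoint A = 1\<^sub>m ?n"
  proof (rule emb_inj[of _ ?n])
    have ad: "mat_adjoint A \<in> carrier_mat ?n ?n" using A by (auto simp: mat_adjoint_def mat_of_rows_def)
    then show "A * mat_adjoint A \<in> carrier_mat ?n ?n" using A by simp
    show "emb (A * mat_adjoint A) = emb (1\<^sub>m ?n)"
      using A ad u by (simp add: emb_mult[of _ ?n] emb_adjoint[of _ ?n] emb_one)
  qed simp
  moreover have "elements_mat A \<subseteq> cyclotomic_field (gcd (p + 1) 4 * p)"
  proof
    fix x assume "x \<in> elements_mat A"
    then obtain i j where ij: "i < ?n" "j < ?n" "x = A $$ (i, j)" using A(1) by (auto simp: elements_mat_def)
    have "x = ent a i j" using ij A by (auto simp: ent_emb)
    then have "of_nat d * x \<in> cyclotomic_field (gcd (p + 1) 4 * p)" using d by (intro zint_cyclotomic) auto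
    moreover have "of_rat (inverse (of_nat d)) \<in> cyclotomic_field (gcd (p + 1) 4 * p)" by (rule cyclotomic_field_closed)
    ultimately have "of_nat d * x * of_rat (inverse (of_nat d)) \<in> cyclotomic_field (gcd (p + 1) 4 * p)"
      by (rule cyclotomic_field_closed)
    moreover have "of_nat d * x * of_rat (inverse (of_nat d)) = x"
      unfolding of_rat_inverse of_rat_of_nat_eq using d(1) by (simp add: field_simps)
    ultimately show "x \<in> cyclotomic_field (gcd (p + 1) 4 * p)" by simp
  qed
  ultimately have "A \<in> clifford_normalizer p m" using A(1) by (simp add: clifford_normalizer_def unitary_group_def)
  moreover have "A ^\<^sub>m r = 1\<^sub>m ?n"
  proof (rule emb_inj[of _ ?n])
    show "emb (A ^\<^sub>m r) = emb (1\<^sub>m ?n)" using A r by (simp add: emb_pow[of _ ?n] emb_one)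
  qed (use A in simp_all)
  ultimately have "A \<in> clifford_group p m" using r(1) unfolding clifford_group_def by blast
  then show ?thesis using that A by blast
qed

section \<open>The conditions of the resolution for \<open>RR\<close> and
  \<open>frob_fixed\<close>\<close>

context heis_group
begin

text \<open>These are the coefficients occurring in \<open>resolution_weyl\<close>: a
  \<open>(p - 1)\<close>-th root of unity is its own \<open>p\<close>-th power, and 2 is fixed
  modulo \<open>p\<close> by Fermat.\<close>

lemma frob_fixed_intros:
  "\<theta> ^ (p - 1) = 1 \<Longrightarrow> frob_fixed (2 * \<theta>)" "frob_fixed 1" "frob_fixed (- 1)"
  "frob_fixed a \<Longrightarrow> frob_fixed b \<Longrightarrow> frob_fixed (a * b)"
proof -
  show "frob_fixed 1" using big.zideal_closed(1) by (simp add: frob_fixed_def)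
  have "odd p" using p_prime p_gt_2 prime_odd_nat by blast
  then show "frob_fixed (- 1)" using big.zideal_closed(1) by (simp add: frob_fixed_def big.zint_closed(3))
  {
    assume \<theta>: "\<theta> ^ (p - 1) = 1"
    have "p - 1 dvd N" using N_dvd by (metis dvd_mult_right)
    then obtain k where "N = (p - 1) * k" by (elim dvdE)
    then have "\<theta> ^ N = 1" using \<theta> by (simp add: power_mult)
    then have t: "\<theta> \<in> ON" by (rule big.zint_root_of_unity)
    have tp: "\<theta> ^ p = \<theta>" using \<theta> p_pos by (cases p) auto
    have "(2::complex) ^ p - 2 \<in> PN"
      using big.p_ideal_in_pi[OF big.fermat_int[OF p_prime, of 2]] by simp
    then have "((2::complex) ^ p - 2) * \<theta> \<in> PN" using t by (rule big.zideal_closed(5))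
    then have "(2 * \<theta>) ^ p - 2 * \<theta> \<in> PN" by (simp add: power_mult_distrib tp left_diff_distrib)
    moreover have "2 * \<theta> \<in> ON" using t by (intro big.zint_closed(2) big.zint_intros)
    ultimately show "frob_fixed (2 * \<theta>)" by (simp add: frob_fixed_def)
  }
  {
    assume ab: "frob_fixed a" "frob_fixed b"
    then have h: "a \<in> ON" "b \<in> ON" "a ^ p - a \<in> PN" "b ^ p - b \<in> PN" by (auto simp: frob_fixed_def)
    have "a ^ p * (b ^ p - b) + (a ^ p - a) * b \<in> PN"
      by (rule big.zideal_closed(2)[OF big.zideal_closed(6)[OF h(4) big.zint_power[OF h(1)]] big.zideal_closed(5)[OF h(3,2)]])
    moreover have "a ^ p * (b ^ p - b) + (a ^ p - a) * b = (a * b) ^ p - a * b"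
      by (simp add: power_mult_distrib algebra_simps)
    moreover have "a * b \<in> ON" using h by (intro big.zint_closed(2))
    ultimately show "frob_fixed (a * b)" by (simp add: frob_fixed_def)
  }
qed

text \<open>\<i> enters only if \<open>p\<close> is 3 modulo 4. Then \<open>tw\<close>, which is
  congruent to \<open>p\<close> modulo \<open>n'\<close> and so modulo 4, sends \<i> to its inverse,
  that is, to its conjugate.\<close>

lemma RR_rp: "rp * zeta p ^ k \<in> RR"
proof -
  obtain g where "odd_prime_root p g" using primitive_root .
  then interpret r: odd_prime_root p g .
  obtain c where c: "rp = c * gauss" "c = 1 \<or> c = - 1 \<or> odd ((p - 1) div 2) \<and> (c = \<i> \<or> c = - \<i>)"
    using r.rp_gauss .
  have neg: "- x \<in> RR" if "x \<in> RR" for x using RR_closed(5)[OF RR_closed(1) that] by simp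
  have one: "1 \<in> RR" using RR_closed(2)[of 1] by simp
  have i: "\<i> \<in> RR" if o: "odd ((p - 1) div 2)"
  proof -
    have "coprime p 2" using coprime_less_p[of 2] p_gt_2 by (simp add: coprime_commute)
    then have "coprime 4 big.P" using coprime_power_left_iff[of 2 2 "p ^ s"] by (simp add: coprime_commute)
    moreover have "4 dvd big.P * n'" using N_dvd unfolding big.N_eq[symmetric] by (metis dvd_mult_left mult.assoc)
    ultimately have "4 dvd n'" by (simp add: coprime_dvd_mult_right_iff)
    then have "[tw = p] (mod 4)" using tw(2) cong_dvd_modulus_nat by blast
    moreover have "p mod 4 = 3" using o prime_odd_nat[OF p_prime p_gt_2] by presburger
    ultimately have tw4: "tw mod 4 = 3" by (simp add: cong_def)
    have i4: "\<i> ^ 4 = 1" by (simp add: numeral_eq_Suc)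
    have "\<i> ^ tw = \<i> ^ (4 * (tw div 4) + tw mod 4)" by simp
    also have "\<dots> = \<i> ^ 3" unfolding power_add power_mult i4 tw4 by simp
    also have "\<dots> = cnj \<i>" by (simp add: numeral_eq_Suc)
    finally have itw: "\<i> ^ tw = cnj \<i>" .
    have "4 dvd N" using N_dvd by (metis dvd_mult_left mult.assoc)
    then obtain k where "N = 4 * k" by (elim dvdE)
    then have iN: "\<i> ^ N = 1" using i4 by (simp add: power_mult)
    show ?thesis using itw iN tw_coprime by (simp add: RR_def big.zint_root_of_unity big.sigma_root_of_unity)
  qed
  have "c \<in> RR" using c(2) neg one i by auto
  then show ?thesis
    unfolding c(1) by (intro RR_closed(4) RR_power RR_zint[OF gauss_in] RR_root[OF zeta_p_P])
qed

end

text \<open>Multiplication by an element permutes \<open>S\<close> and so fixes the product over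
  \<open>S\<close>; hence every element is a root of unity of order dividing \<open>card S\<close>,
  and there are only \<open>card S\<close> of those.\<close>

lemma finite_unit_set:
  fixes S :: "complex set"
  assumes fin: "finite S" and one: "1 \<in> S" and mult: "\<And>a b. a \<in> S \<Longrightarrow> b \<in> S \<Longrightarrow> a * b \<in> S"
    and nz: "0 \<notin> S"
  shows "card S > 0" "S = {c. c ^ card S = 1}"
proof -
  show c: "card S > 0" using fin one by (auto simp: card_gt_0_iff)
  have "a ^ card S = 1" if a: "a \<in> S" for a
  proof -
    have a0: "a \<noteq> 0" using a nz by auto
    have inj: "inj_on ((*) a) S" using a0 by (auto simp: inj_on_def)
    have im: "(*) a ` S = S" using inj mult[OF a] fin by (intro endo_inj_surj) auto
    have "(\<Prod>x\<in>S. x) = (\<Prod>x\<in>S. a * x)"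
      using prod.reindex[OF inj, of "\<lambda>x. x"] im by simp
    also have "\<dots> = a ^ card S * (\<Prod>x\<in>S. x)" by (simp add: prod.distrib)
    finally have "(\<Prod>x\<in>S. x) = a ^ card S * (\<Prod>x\<in>S. x)" .
    moreover have "(\<Prod>x\<in>S. x) \<noteq> 0" using fin nz by auto
    ultimately show ?thesis by simp
  qed
  then have "S \<subseteq> {c. c ^ card S = 1}" by blast
  moreover have "card {c :: complex. c ^ card S = 1} = card S" using c by (rule card_roots_unity_eq)
  moreover have "finite {c :: complex. c ^ card S = 1}" using c by (intro finite_roots_unity) simp
  ultimately show "S = {c. c ^ card S = 1}" by (intro card_subset_eq) auto
qed

theorem theorem7p3:
  fixes p m :: nat and G :: "complex mat set"
  assumes "prime p" and "p > 2" and "m \<ge> 1"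
    and "subgroup G (GL (p ^ m))" and "finite G" and "clifford_group p m \<subseteq> G"
  shows "\<exists>\<zeta> :: complex. (\<exists>k>0. \<zeta> ^ k = 1) \<and>
           G = generate (GL (p ^ m)) (clifford_group p m \<union> {\<zeta> \<cdot>\<^sub>m 1\<^sub>m (p ^ m)})"
proof -
  interpret odd_prime p using assms by unfold_locales
  let ?n = "p ^ m"
  interpret h: heis p ?n m "EE m" by (rule heis_EE[OF assms(3)])
  interpret GLn: group "GL ?n" by (rule group_GL)
  interpret S: subgroup G "GL ?n" by fact
  have carr: "A \<in> carrier_mat ?n ?n" if "A \<in> G" for A using S.subset that GL_carrier_mat by blast
  have G_mult: "A * B \<in> G" if "A \<in> G" "B \<in> G" for A B using S.m_closed[OF that] by (simp add: GL_simps)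
  have G_one: "1\<^sub>m ?n \<in> G" using S.one_closed by (simp add: GL_simps)
  have cardG: "card G > 0" using assms(5) G_one by (auto simp: card_gt_0_iff)
  have G_order: "mpow ?n (emb A) (card G) = un ?n" if A: "A \<in> G" for A
  proof -
    interpret H: group "GL ?n\<lparr>carrier := G\<rparr>" by (rule S.subgroup_is_group[OF GLn.group_axioms])
    have pw: "A [^]\<^bsub>GL ?n\<lparr>carrier := G\<rparr>\<^esub> k = A ^\<^sub>m k" for k :: nat
      by (induction k) (use carr[OF A] in \<open>auto simp: H.nat_pow_Suc GL_simps\<close>)
    have "A [^]\<^bsub>GL ?n\<lparr>carrier := G\<rparr>\<^esub> Coset.order (GL ?n\<lparr>carrier := G\<rparr>) = 1\<^sub>m ?n"
      using H.pow_order_eq_1[of A] A by (simp add: GL_simps)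
    then have "A ^\<^sub>m card G = 1\<^sub>m ?n" unfolding pw by (simp add: Coset.order_def)
    then show ?thesis using emb_pow[OF carr[OF A], of "card G"] by (simp add: emb_one)
  qed
  have cliff: "\<exists>\<mu> A. \<mu> \<noteq> 0 \<and> A \<in> clifford_group p m \<and> emb A = sc \<mu> a" if a: "h.normz a a'" for a a'
  proof -
    obtain \<mu> r d where \<mu>: "\<mu> \<noteq> 0" "sc \<mu> a * adj (sc \<mu> a) = un ?n" "r > 0" "mpow ?n (sc \<mu> a) r = un ?n"
      "d > 0" "\<And>i j. of_nat d * ent (sc \<mu> a) i j \<in> zint p" using h.normz_rescale[OF a] by blast
    obtain A where "A \<in> clifford_group p m" "emb A = sc \<mu> a"
      by (rule clifford_memI[OF assms(3) h.normz_sc[OF \<mu>(1) a] \<mu>(2-6)])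
    then show ?thesis using \<mu> by blast
  qed
  have EG: "\<exists>A\<in>G. emb A = e" if e: "e \<in> EE m" for e
  proof -
    obtain A where "A \<in> clifford_group p m" "emb A = e"
      by (rule clifford_memI[OF assms(3) h.normz_E[OF e] h.E_unitary[OF e] p_pos h.E_pow[OF e], of 1])
        (use h.E_int[OF e] in auto)
    then show ?thesis using assms(6) by blast
  qed
  obtain t where t: "parity p ?n (EE m) t" using parity_EE[OF assms(3)] by blast
  \<comment> \<open>A common exponent: \<open>card G\<close> for the matrices in \<open>G\<close>,
    and \<open>4 * p * (p - 1)\<close> for the elements required by
    \<open>heis_group\<close>.\<close>
  define N where "N = 4 * p * (p - 1) * card G"
  have N0: "N > 0" using p_gt_2 cardG by (simp add: N_def)
  define s where "s = multiplicity p N"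
  obtain n' where n': "N = p ^ s * n'" "\<not> p dvd n'"
    using multiplicity_decompose'[of N p] N0 p_prime not_prime_unit unfolding s_def by blast
  have "p dvd N" by (simp add: N_def)
  then have s1: "s \<ge> 1" unfolding s_def using N0 p_prime
    by (metis One_nat_def Suc_leI multiplicity_gt_zero_iff not_gr_zero not_prime_unit)
  have cp: "coprime p n'" using n'(2) p_prime by (simp add: prime_imp_coprime)
  \<comment> \<open>\<open>G\<close> contains normalizing elements such as chirps only up to
    scalars, so all multiples by \<open>N\<close>-th roots of unity are added.\<close>
  define \<G> where "\<G> = {sc \<xi> (emb A) |\<xi> A. \<xi> ^ N = 1 \<and> A \<in> G}"
  have GI: "emb A \<in> \<G>" if "A \<in> G" for A
    unfolding \<G>_def using that by (intro CollectI exI[of _ 1] exI[of _ A]) auto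
  have G_N: "mpow ?n (emb A) N = un ?n" if A: "A \<in> G" for A
  proof -
    have e: "N = card G * (4 * p * (p - 1))" by (simp add: N_def)
    show ?thesis unfolding e by (simp add: mpow_mult supp_emb[OF carr[OF A]] G_order[OF A])
  qed
  have GN: "a \<in> \<G>" if a: "h.normz a a'" "mpow ?n a (4 * p * (p - 1)) = un ?n" for a a'
  proof -
    obtain \<mu> A where \<mu>: "\<mu> \<noteq> 0" "A \<in> clifford_group p m" "emb A = sc \<mu> a" using cliff[OF a(1)] by blast
    have AG: "A \<in> G" using \<mu> assms(6) by blast
    have sa: "supp ?n a" using h.normzD(1)[OF a(1)] .
    \<comment> \<open>The \<open>N\<close>-th powers of \<open>a\<close> and of its multiple
      \<open>sc \<mu> a\<close>, which comes from \<open>G\<close>, are both the identity, so \<mu>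
      is an \<open>N\<close>-th root of unity.\<close>
    have "un ?n = mpow ?n (sc \<mu> a) N" using G_N[OF AG] by (simp add: \<mu>)
    also have "\<dots> = sc (\<mu> ^ N) (mpow ?n a N)" by (rule mpow_sc[OF sa])
    also have "mpow ?n a N = un ?n" unfolding N_def using mpow_mult[OF sa, of "4 * p * (p - 1)" "card G"] a(2) by simp
    finally have "sc (\<mu> ^ N) (un ?n) = sc 1 (un ?n)" by simp
    then have "\<mu> ^ N = 1" using sc_un_eq_iff[OF h.n_pos] by blast
    then have "inverse \<mu> ^ N = 1" by (simp add: power_inverse)
    moreover have "a = sc (inverse \<mu>) (emb A)" using \<mu> by simp
    ultimately show ?thesis unfolding \<G>_def using AG by blast
  qed
  have tG: "t \<in> \<G>"
  proof (rule GN)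
    have tt: "supp ?n t" "t * t = un ?n" using t by (auto simp: parity_def)
    have "t * e * t \<in> EE m" if e: "e \<in> EE m" for e
    proof -
      obtain c where "c ^ p = 1" "t * e * t = sc c (adj e)" using t e unfolding parity_def by blast
      then show ?thesis using h.E_sc h.E_adj[OF e] by simp
    qed
    then show "h.normz t t" using tt by (simp add: h.normz_def)
    have "mpow ?n t 2 = un ?n" using tt by (simp add: numeral_2_eq_2)
    moreover have "4 * p * (p - 1) = 2 * (2 * p * (p - 1))" by simp
    ultimately show "mpow ?n t (4 * p * (p - 1)) = un ?n" by (simp only: mpow_mult[OF tt(1)] mpow_un)
  qed
  interpret hg: heis_group p ?n m "EE m" N s n' \<G> t
  proof unfold_locales
    show "N > 0" "prime p" "1 \<le> s" "N = p ^ s * n'" "coprime p n'" by fact+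
    show "4 * p * (p - 1) dvd N" by (simp add: N_def)
    show "supp ?n x" if "x \<in> \<G>" for x
      using that supp_emb[OF carr] by (auto simp: \<G>_def)
    show "x * y \<in> \<G>" if xy: "x \<in> \<G>" "y \<in> \<G>" for x y
    proof -
      obtain \<xi> A where x: "x = sc \<xi> (emb A)" "\<xi> ^ N = 1" "A \<in> G" using xy(1) by (auto simp: \<G>_def)
      obtain \<eta> B where y: "y = sc \<eta> (emb B)" "\<eta> ^ N = 1" "B \<in> G" using xy(2) by (auto simp: \<G>_def)
      have "x * y = sc (\<eta> * \<xi>) (emb (A * B))" using x y emb_mult[OF carr carr] by simp
      moreover have "(\<eta> * \<xi>) ^ N = 1" using x y by (simp add: power_mult_distrib)
      ultimately show ?thesis unfolding \<G>_def using G_mult x y by blast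
    qed
    show "e \<in> \<G>" if "e \<in> EE m" for e using EG[OF that] GI by blast
    show "mpow ?n x N = un ?n" if x: "x \<in> \<G>" for x
    proof -
      obtain \<xi> A where x: "x = sc \<xi> (emb A)" "\<xi> ^ N = 1" "A \<in> G" using x by (auto simp: \<G>_def)
      then show ?thesis using G_N[OF x(3)] supp_emb[OF carr[OF x(3)]] by (simp add: mpow_sc)
    qed
    show "a \<in> \<G>" if "h.normz a a'" "mpow ?n a (4 * p * (p - 1)) = un ?n" for a a' using GN that by blast
    show "t \<in> \<G>" by (rule tG)
  qed (use t in \<open>auto simp: parity_def\<close>)
  have "\<exists>d. coprime d p \<and> resolvable ?n (EE m) hg.RR (4 * p * (p - 1)) hg.frob_fixed d"
    by (rule resolution_EE[OF _ _ _ _ _ _ _ _ _ _ assms(3)])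
      (use hg.RR_closed(1) hg.RR_closed(2)[of 1] hg.RR_closed(4) hg.RR_rp hg.frob_fixed_intros in auto)
  then obtain d where d: "coprime d p" "resolvable ?n (EE m) hg.RR (4 * p * (p - 1)) hg.frob_fixed d" by blast
  have m0: "m > 0" using assms(3) by simp
  have nz: "h.normz (emb A) (hg.iv (emb A))" if "A \<in> G" for A
    using hg.normalizes_E[OF d(2,1) m0 GI[OF that]] .
  \<comment> \<open>The scalars in \<open>G\<close> form a finite multiplicative set, hence a full
    group of roots of unity, whose generator is the required \<zeta>.\<close>
  define S where "S = {c. c \<cdot>\<^sub>m 1\<^sub>m ?n \<in> G}"
  have smult: "(a * b) \<cdot>\<^sub>m 1\<^sub>m ?n = (a \<cdot>\<^sub>m 1\<^sub>m ?n) * (b \<cdot>\<^sub>m (1\<^sub>m ?n :: complex mat))" for a b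
    by (rule emb_inj[of _ ?n]) (auto simp: emb_mult[of _ ?n] emb_smult emb_one mult.commute)
  have inj: "inj_on (\<lambda>c. c \<cdot>\<^sub>m (1\<^sub>m ?n :: complex mat)) S"
  proof (rule inj_onI)
    fix a b :: complex assume "a \<cdot>\<^sub>m (1\<^sub>m ?n :: complex mat) = b \<cdot>\<^sub>m 1\<^sub>m ?n"
    then have "sc a (un ?n) = sc b (un ?n)" by (metis emb_one emb_smult)
    then show "a = b" using sc_un_eq_iff[OF h.n_pos] by blast
  qed
  have finS: "finite S" by (rule inj_on_finite[OF inj _ assms(5)]) (auto simp: S_def)
  have one: "1 \<cdot>\<^sub>m (1\<^sub>m ?n :: complex mat) = 1\<^sub>m ?n"
    by (rule emb_inj[of _ ?n]) (auto simp: emb_smult emb_one)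
  have S1: "1 \<in> S" using G_one by (simp add: S_def one)
  have Sm: "a * b \<in> S" if "a \<in> S" "b \<in> S" for a b using that G_mult by (simp add: S_def smult)
  have S0: "0 \<notin> S"
  proof
    assume "0 \<in> S"
    then have g: "(0 :: complex) \<cdot>\<^sub>m 1\<^sub>m ?n \<in> G" by (simp add: S_def)
    have "emb (0 \<cdot>\<^sub>m 1\<^sub>m ?n) = 0" by (simp add: emb_smult)
    then show False using GL_inv(1)[of "0 \<cdot>\<^sub>m 1\<^sub>m ?n" ?n] g S.subset un_neq_0[OF h.n_pos] by auto
  qed
  define r where "r = card S"
  have r: "r > 0" "S = {c. c ^ r = 1}" using finite_unit_set[OF finS S1 Sm S0] by (simp_all add: r_def)
  interpret c: cyclotomic_integers r by unfold_locales (rule r)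
  define Z where "Z = zeta r \<cdot>\<^sub>m (1\<^sub>m ?n :: complex mat)"
  let ?H = "generate (GL ?n) (clifford_group p m \<union> {Z})"
  have ZG: "Z \<in> G" using r(2) c.zeta_N by (auto simp: Z_def S_def)
  have "?H \<subseteq> G" using assms(4,6) ZG by (intro GLn.generate_subgroup_incl) auto
  moreover have "A \<in> ?H" if A: "A \<in> G" for A
  proof -
    \<comment> \<open>\<open>A\<close> normalizes \<open>EE m\<close>, so a multiple of it is a
      Clifford element; both lie in \<open>G\<close>, so the multiplier is a scalar of
      \<open>G\<close>.\<close>
    obtain \<mu> B where \<mu>: "\<mu> \<noteq> 0" "B \<in> clifford_group p m" "emb B = sc \<mu> (emb A)" using cliff[OF nz[OF A]] by blast
    have BG: "B \<in> G" using \<mu> assms(6) by blast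
    have iA: "inv\<^bsub>GL ?n\<^esub> A \<in> G" using A by (rule S.m_inv_closed)
    have "B * inv\<^bsub>GL ?n\<^esub> A = \<mu> \<cdot>\<^sub>m 1\<^sub>m ?n"
      using carr[OF BG] carr[OF iA] GL_inv(1)[of A ?n] A S.subset
      by (intro emb_inj[of _ ?n]) (auto simp: emb_mult[of _ ?n] emb_smult emb_one \<mu>)
    then have "\<mu> \<in> S" using G_mult[OF BG iA] by (simp add: S_def)
    then have "inverse \<mu> ^ r = 1" using r(2) by (simp add: power_inverse)
    then obtain k where k: "inverse \<mu> = zeta r ^ k" using c.root_of_unity_eq by metis
    have Zk: "zeta r ^ j \<cdot>\<^sub>m 1\<^sub>m ?n \<in> ?H" for j
    proof (induction j)
      case 0
      show ?case using generate.one[of "GL ?n" "clifford_group p m \<union> {Z}"] by (simp add: GL_simps one)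
    next
      case (Suc j)
      have "Z \<otimes>\<^bsub>GL ?n\<^esub> (zeta r ^ j \<cdot>\<^sub>m 1\<^sub>m ?n) \<in> ?H"
        by (rule generate.eng[OF generate.incl Suc]) simp
      then show ?case by (simp add: GL_simps Z_def smult)
    qed
    have "(zeta r ^ k \<cdot>\<^sub>m 1\<^sub>m ?n) \<otimes>\<^bsub>GL ?n\<^esub> B \<in> ?H"
      by (rule generate.eng[OF Zk generate.incl]) (use \<mu> in simp)
    moreover have "(zeta r ^ k \<cdot>\<^sub>m 1\<^sub>m ?n) * B = A"
      using carr[OF BG] carr[OF A] \<mu> supp_emb[OF carr[OF A]]
      by (intro emb_inj[of _ ?n]) (auto simp: emb_mult[of _ ?n] emb_smult emb_one k[symmetric])
    ultimately show ?thesis by (simp add: GL_simps)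
  qed
  ultimately have "G = ?H" by blast
  then show ?thesis using r(1) c.zeta_N unfolding Z_def by blast
qed

end
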